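(* Let $F:M^n\to\mathbb R^{n+1}_1$ be an admissible null $C^r$-wave front (if $F$ is real analytic, i.e. $r=\omega$, it is admissible). Then there exist (a) a $C^r$-differentiable $(n-1)$-manifold $\check\Sigma^{n-1}$, (b) a $C^r$-immersion $\mathcal I:M^n\to\mathbb R\times\check\Sigma^{n-1}$, (c) an $L$-complete null wave front $\check F:\mathbb R\times\check\Sigma^{n-1}\to\mathbb R^{n+1}_1$ written in the normal form, with canonical lift $\check{\mathcal L}:\mathbb R\times\check\Sigma^{n-1}\to\mathbb R^{n+1}_1\times\mathbb R^{n+1}_1$, such that $$\check F\circ\mathcal I(q)=F(q),\qquad \check{\mathcal L}\circ\mathcal I(q)=\mathcal L_F(q)\qquad(q\in M^n).$$ If the canonical lift $\mathcal L_F$ of $F$ is an embedding, then $\mathcal I$ gives a diffeomorphism between $M^n$ and $\mathcal I(M^n)$. Moreover, if $F$ is $L$-complete, then $\mathcal I$ is a surjection.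
   Context: Here $n\ge 2$, $r=\infty$ or $r=\omega$ ($C^\omega$ means real analytic), and $M^n$ is a $C^r$-differentiable $n$-manifold. $\mathbb R^{n+1}_1$ is $\mathbb R^{n+1}$ with coordinates $(t,x_1,\dots,x_n)$ and Lorentzian inner product $\langle v,w\rangle=-v_0w_0+\sum_{i=1}^n v_iw_i$; $|\cdot|_E$ is the standard Euclidean norm on the same space. A non-zero vector $v$ is light-like if $\langle v,v\rangle=0$, and points in the future direction if $v_0>0$. $\mathbb R^n_0$ is Euclidean $n$-space, identified with $\{0\}\times\mathbb R^n\subset\mathbb R^{n+1}_1$. Null wave fronts. A $C^r$-map $F:M^n\to\mathbb R^{n+1}$ is a (co-orientable) $C^r$-wave front if there is a $C^r$-map $\tilde\alpha:M^n\to(\mathbb R^{n+1})^*\setminus\{0\}$ with $\tilde\alpha_p(dF_p(v))=0$ for all $p\in M^n$, $v\in T_pM^n$, such that $(F,\pi\circ\tilde\alpha):M^n\to\mathbb R^{n+1}\times P^*(\mathbb R^{n+1})$ is an immersion, $\pi$ being the projection onto the projective space of $(\mathbb R^{n+1})^*$. It is null if the vector field $\hat\xi$ along $F$ given by $\langle\hat\xi_p,x\rangle=\tilde\alpha_p(x)$ is light-like at every $p$. The $E$-normalized normal vector field $\hat\xi_E$ is the rescaling of $\hat\xi$ pointing in the future direction with $|\hat\xi_E|_E=\sqrt2$. The canonical lift of $F$ is $\mathcal L_F:=(F,\hat\xi_E):M^n\to\mathbb R^{n+1}_1\times\mathbb R^{n+1}_1$. The $E$-normalized null vector field $\xi_E$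 is the unique $C^r$ vector field on $M^n$ with $dF(\xi_E)=\hat\xi_E$ whose integral curves are mapped by $F$ into light-like lines (it exists for every null wave front). $F$ is $L$-complete if for each $p\in M^n$ there is an integral curve $\gamma:\mathbb R\to M^n$ of $\xi_E$ through $p$ such that $F\circ\gamma(\mathbb R)$ is an entire light-like line. Normal form. A $C^r$-map $f:\Sigma^{n-1}\to\mathbb R^n_0$ is a co-orientable wave front if there is a unit normal vector field $\nu$ along $f$ such that $(f,\nu):\Sigma^{n-1}\to\mathbb R^n_0\times S^{n-1}$ is an immersion. A null wave front on $\mathbb R\times\Sigma^{n-1}$ is written in the normal form if it equals $\mathcal F^f_+(t,x):=(0,f(x))+t(1,\nu(x))$ for such an $f$; its $E$-normalized normal vector field is $(1,\nu)$. Fundamental $F$-data. Let $\tau:M^n\to\mathbb R$ be the time coordinate (first component) of $F$. Fundamental $F$-data at $p\in M^n$ is a tuple $(U,\Sigma_U,\tau_U,\rho_U,\tilde g_U,\hat\xi_U,I_U)$ where $U$ is a neighborhood of $p$; $\Sigma_U$ is a connected $C^r$ $(n-1)$-submanifold of $U$; $\tau_U=\tau|_U$; $\rho_U:U\to\Sigma_U$ is a surjective $C^r$-submersion; $\tilde g_U:\Sigma_U\to\{0\}\times\mathbb R^n_0$ is a $C^r$-wave front; $\hat\xi_U=\hat\xi_E|_{\Sigma_U}=(1,\nu_U)$ with $\nu_U$ a unit normal vector field of $\tilde g_U$ in $\mathbb R^n_0$; $I_U=(t_U-\epsilon_U,t_U+\epsilon_U)$ for some $t_U\in\mathbb R$,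 $\epsilon_U\in(0,\infty)$, or $I_U=\mathbb R$; and, putting $G_U(t,x):=\tilde g_U(x)+t\hat\xi_U(x)$ on $\mathbb R\times\Sigma_U$: (i) $\Phi_U:=(\tau_U,\rho_U):U\to I_U\times\Sigma_U$ is a diffeomorphism with $F=G_U\circ\Phi_U$ on $U$; (ii) $\mathcal L_U:\mathbb R\times\Sigma_U\ni(t,x)\mapsto(G_U(t,x),\hat\xi_U(x))\in\mathbb R^{n+1}_1\times\mathbb R^{n+1}_1$ is an embedding with $\mathcal L_F=\mathcal L_U\circ\Phi_U$ on $U$; (iii) $\tilde l_U:\Sigma_U\ni x\mapsto(\tilde g_U(x),\hat\xi_U(x))\in\mathbb R^{n+1}_1\times\mathbb R^{n+1}_1$ is an embedding. Such data exist at every $p\in M^n$, and $M^n$ is covered by the sets $U_\lambda$ of an at most countable family $\{(U_\lambda,\Sigma_\lambda,\tau_\lambda,\rho_\lambda,\tilde g_\lambda,\hat\xi_\lambda,I_\lambda)\}_{\lambda\in\mathcal A}$ of fundamental $F$-data, with associated embeddings $\tilde l_\lambda=(\tilde g_\lambda,\hat\xi_\lambda):\Sigma_\lambda\to\mathbb R^{n+1}_1\times\mathbb R^{n+1}_1$. Admissibility. For $C^r$-embeddings $f:U\to\mathbb R^m$, $g:V\to\mathbb R^m$ of connected manifolds $U,V$ of the same dimension (less than $m$), $x\in U$ is $(f,g)$-related to $y\in V$ if $f(x)=g(y)$ and there are open neighborhoods $O_x\subset U$ of $x$ and $O_y\subset V$ of $y$ with $f(O_x)=g(O_y)$; $O\subset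 U$ is not $(f,g)$-related to $O'\subset V$ if no point of $O$ is $(f,g)$-related to a point of $O'$. The pair $(U,V)$ is $(f,g)$-admissible if for each $(x,y)\in U\times V$ either $x$ is $(f,g)$-related to $y$, or there are neighborhoods $O_x\subset U$ of $x$ and $O_y\subset V$ of $y$ such that $O_x$ is not $(f,g)$-related to $O_y$. An at most countable family $\{(U_\lambda,f_\lambda)\}_{\lambda\in\mathcal A}$ of embeddings of connected manifolds of the same dimension into $\mathbb R^m$ is admissible if $(U_\lambda,U_\mu)$ is $(f_\lambda,f_\mu)$-admissible for all $(\lambda,\mu)\in\mathcal A\times\mathcal A$. The null wave front $F$ is admissible if, for an at most countable family of fundamental $F$-data with $M^n=\bigcup_\lambda U_\lambda$, the family $\{(\Sigma_\lambda,\tilde l_\lambda)\}_{\lambda\in\mathcal A}$ is admissible. *)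

theory Defs
  imports "HOL-Analysis.Analysis"
begin

section \<open>Regularity classes\<close>

datatype regularity = Smooth | Analytic

text \<open>For open \<open>S\<close> in a finite-dimensional space this is the class $C^k$: existence and
  continuity of all iterated directional derivatives up to order \<open>k\<close>.\<close>

primrec Ck_on :: "nat \<Rightarrow> 'a::real_normed_vector set \<Rightarrow> ('a \<Rightarrow> 'b::real_normed_vector) \<Rightarrow> bool" where
  "Ck_on 0 S f \<longleftrightarrow> continuous_on S f"
| "Ck_on (Suc k) S f \<longleftrightarrow>
     (\<forall>x\<in>S. f differentiable (at x)) \<and> (\<forall>v. Ck_on k S (\<lambda>x. frechet_derivative f (at x) v))"

text \<open>Around every point, \<open>f\<close> is the sum of an unconditionally convergent power series in the
  coordinates; a multi-index is a function \<open>Basis \<rightarrow> nat\<close>.\<close>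

definition real_analytic_on :: "'a::euclidean_space set \<Rightarrow> ('a \<Rightarrow> 'b::real_normed_vector) \<Rightarrow> bool" where
  "real_analytic_on S f \<longleftrightarrow>
     (\<forall>a\<in>S. \<exists>e>0. \<exists>c :: ('a \<Rightarrow> nat) \<Rightarrow> 'b. \<forall>x\<in>ball a e.
        ((\<lambda>m. (\<Prod>i\<in>Basis. ((x - a) \<bullet> i) ^ m i) *\<^sub>R c m) has_sum f x) (Basis \<rightarrow>\<^sub>E UNIV))"

definition Cr_on :: "regularity \<Rightarrow> 'a::euclidean_space set \<Rightarrow> ('a \<Rightarrow> 'b::real_normed_vector) \<Rightarrow> bool" where
  "Cr_on r S f \<longleftrightarrow> (case r of Smooth \<Rightarrow> \<forall>k. Ck_on k S f | Analytic \<Rightarrow> real_analytic_on S f)"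


section \<open>Manifolds\<close>

text \<open>A manifold is given by an atlas, i.e. a set of charts \<open>(U, \<phi>)\<close>; the dimension is that of the
  model space \<open>'e\<close>. The point set and the topology are those determined by the atlas.\<close>

type_synonym ('a, 'e) chart = "'a set \<times> ('a \<Rightarrow> 'e)"
type_synonym ('a, 'e) atlas = "('a, 'e) chart set"

definition carrier :: "('a, 'e) atlas \<Rightarrow> 'a set" where
  "carrier M = (\<Union>c\<in>M. fst c)"

definition mopen :: "('a, 'e::real_normed_vector) atlas \<Rightarrow> 'a set \<Rightarrow> bool" where
  "mopen M W \<longleftrightarrow> W \<subseteq> carrier M \<and> (\<forall>c\<in>M. open (snd c ` (W \<inter> fst c)))"

definition mtop :: "('a, 'e::real_normed_vector) atlas \<Rightarrow> 'a topology" where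
  "mtop M = topology (mopen M)"

definition second_countable :: "'a topology \<Rightarrow> bool" where
  "second_countable X \<longleftrightarrow>
     (\<exists>B. countable B \<and> (\<forall>V\<in>B. openin X V) \<and>
          (\<forall>W x. openin X W \<and> x \<in> W \<longrightarrow> (\<exists>V\<in>B. x \<in> V \<and> V \<subseteq> W)))"

definition local_rep :: "('a, 'e) chart \<Rightarrow> ('b, 'f) chart \<Rightarrow> ('a \<Rightarrow> 'b) \<Rightarrow> 'e \<Rightarrow> 'f" where
  "local_rep c d f = snd d \<circ> f \<circ> inv_into (fst c) (snd c)"

definition Cr_manifold :: "regularity \<Rightarrow> ('a, 'e::euclidean_space) atlas \<Rightarrow> bool" where
  "Cr_manifold r M \<longleftrightarrow>
     (\<forall>c\<in>M. inj_on (snd c) (fst c)) \<and>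
     (\<forall>c\<in>M. \<forall>d\<in>M. open (snd c ` (fst c \<inter> fst d)) \<and>
                     Cr_on r (snd c ` (fst c \<inter> fst d)) (local_rep c d (\<lambda>x. x))) \<and>
     Hausdorff_space (mtop M) \<and> second_countable (mtop M)"

lemma openin_mtop:
  assumes "\<And>c. c \<in> M \<Longrightarrow> inj_on (snd c) (fst c)"
  shows "openin (mtop M) W \<longleftrightarrow> mopen M W"
proof -
  have "istopology (mopen M)"
    unfolding istopology_def
  proof (intro conjI allI impI)
    fix S T assume S: "mopen M S" and T: "mopen M T"
    have "snd c ` (S \<inter> T \<inter> fst c) = snd c ` (S \<inter> fst c) \<inter> snd c ` (T \<inter> fst c)" if "c \<in> M" for c
      using inj_on_image_Int[OF assms[OF that], of "S \<inter> fst c" "T \<inter> fst c"]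
      by (simp add: Int_ac)
    then show "mopen M (S \<inter> T)"
      using S T by (auto simp: mopen_def)
  next
    fix K assume K: "\<forall>S\<in>K. mopen M S"
    have eq: "snd c ` (\<Union>K \<inter> fst c) = (\<Union>S\<in>K. snd c ` (S \<inter> fst c))" for c
      by auto
    have "open (snd c ` (\<Union>K \<inter> fst c))" if "c \<in> M" for c
      unfolding eq using K that by (intro open_UN) (simp add: mopen_def)
    then show "mopen M (\<Union>K)"
      using K by (auto simp: mopen_def)
  qed
  then show ?thesis
    by (simp add: mtop_def)
qed

definition euclid :: "('e, 'e) atlas" where
  "euclid = {(UNIV, \<lambda>x. x)}"

definition restr :: "('a, 'e) atlas \<Rightarrow> 'a set \<Rightarrow> ('a, 'e) atlas" where
  "restr M W = (\<lambda>c. (W \<inter> fst c, snd c)) ` M"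

definition prod_atlas :: "('a, 'e) atlas \<Rightarrow> ('b, 'f) atlas \<Rightarrow> ('a \<times> 'b, 'e \<times> 'f) atlas" where
  "prod_atlas M N = (\<lambda>(c, d). (fst c \<times> fst d, map_prod (snd c) (snd d))) ` (M \<times> N)"

definition Cr_map ::
  "regularity \<Rightarrow> ('a, 'e::euclidean_space) atlas \<Rightarrow> ('b, 'f::real_normed_vector) atlas \<Rightarrow> ('a \<Rightarrow> 'b) \<Rightarrow> bool" where
  "Cr_map r M N f \<longleftrightarrow>
     f ` carrier M \<subseteq> carrier N \<and> continuous_map (mtop M) (mtop N) f \<and>
     (\<forall>c\<in>M. \<forall>d\<in>N. Cr_on r (snd c ` (fst c \<inter> f -` fst d)) (local_rep c d f))"

text \<open>The differential of \<open>f\<close> at \<open>p\<close>, expressed in the charts \<open>c\<close> around \<open>p\<close> and \<open>d\<close> around \<open>f p\<close>.\<close>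

definition mderiv ::
  "('a, 'e::real_normed_vector) chart \<Rightarrow> ('b, 'f::real_normed_vector) chart \<Rightarrow> ('a \<Rightarrow> 'b) \<Rightarrow> 'a \<Rightarrow> 'e \<Rightarrow> 'f" where
  "mderiv c d f p = frechet_derivative (local_rep c d f) (at (snd c p))"

abbreviation vderiv ::
  "('a, 'e::real_normed_vector) chart \<Rightarrow> ('a \<Rightarrow> 'v::real_normed_vector) \<Rightarrow> 'a \<Rightarrow> 'e \<Rightarrow> 'v" where
  "vderiv c f p \<equiv> mderiv c (UNIV, \<lambda>x. x) f p"

definition Cr_immersion ::
  "regularity \<Rightarrow> ('a, 'e::euclidean_space) atlas \<Rightarrow> ('b, 'f::real_normed_vector) atlas \<Rightarrow> ('a \<Rightarrow> 'b) \<Rightarrow> bool" where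
  "Cr_immersion r M N f \<longleftrightarrow> Cr_map r M N f \<and>
     (\<forall>p\<in>carrier M. \<forall>c\<in>M. \<forall>d\<in>N. p \<in> fst c \<and> f p \<in> fst d \<longrightarrow> inj (mderiv c d f p))"

definition Cr_submersion ::
  "regularity \<Rightarrow> ('a, 'e::euclidean_space) atlas \<Rightarrow> ('b, 'f::real_normed_vector) atlas \<Rightarrow> ('a \<Rightarrow> 'b) \<Rightarrow> bool" where
  "Cr_submersion r M N f \<longleftrightarrow> Cr_map r M N f \<and>
     (\<forall>p\<in>carrier M. \<forall>c\<in>M. \<forall>d\<in>N. p \<in> fst c \<and> f p \<in> fst d \<longrightarrow> surj (mderiv c d f p))"

definition Cr_embedding ::
  "regularity \<Rightarrow> ('a, 'e::euclidean_space) atlas \<Rightarrow> ('b, 'f::real_normed_vector) atlas \<Rightarrow> ('a \<Rightarrow> 'b) \<Rightarrow> bool" where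
  "Cr_embedding r M N f \<longleftrightarrow> Cr_immersion r M N f \<and> embedding_map (mtop M) (mtop N) f"

definition Cr_diffeo ::
  "regularity \<Rightarrow> ('a, 'e::euclidean_space) atlas \<Rightarrow> ('b, 'f::euclidean_space) atlas \<Rightarrow> ('a \<Rightarrow> 'b) \<Rightarrow> bool" where
  "Cr_diffeo r M N f \<longleftrightarrow> bij_betw f (carrier M) (carrier N) \<and>
     Cr_map r M N f \<and> Cr_map r N M (inv_into (carrier M) f)"

text \<open>A vector field is given by its components in every chart, subject to the transformation law
  of tangent vectors.\<close>

definition Cr_vector_field ::
  "regularity \<Rightarrow> ('a, 'e::euclidean_space) atlas \<Rightarrow> (('a, 'e) chart \<Rightarrow> 'a \<Rightarrow> 'e) \<Rightarrow> bool" where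
  "Cr_vector_field r M X \<longleftrightarrow>
     (\<forall>c\<in>M. Cr_on r (snd c ` fst c) (X c \<circ> inv_into (fst c) (snd c))) \<and>
     (\<forall>c\<in>M. \<forall>d\<in>M. \<forall>p\<in>fst c \<inter> fst d. X d p = mderiv c d (\<lambda>x. x) p (X c p))"

definition integral_curve ::
  "('a, 'e::euclidean_space) atlas \<Rightarrow> (('a, 'e) chart \<Rightarrow> 'a \<Rightarrow> 'e) \<Rightarrow> real set \<Rightarrow> (real \<Rightarrow> 'a) \<Rightarrow> bool" where
  "integral_curve M X J \<gamma> \<longleftrightarrow>
     is_interval J \<and> continuous_map (top_of_set J) (mtop M) \<gamma> \<and>
     (\<forall>t\<in>J. \<forall>c\<in>M. \<gamma> t \<in> fst c \<longrightarrow>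
        ((\<lambda>s. snd c (\<gamma> s)) has_vector_derivative X c (\<gamma> t)) (at t within J))"


section \<open>Sphere and projective space\<close>

text \<open>Charts of the unit sphere: open hemispheres \<open>s x_i > 0\<close> with \<open>s = 1\<close> or \<open>s = -1\<close>, projected
  along the \<open>i\<close>-th axis; \<open>h\<close> numbers the remaining coordinates.\<close>

definition sphere_atlas :: "(real^'n, real^'k) atlas" where
  "sphere_atlas =
     {({x \<in> sphere 0 1. s * x $ i > 0}, \<lambda>x. \<chi> j. x $ h j) | s i h.
        s \<in> {1, -1} \<and> bij_betw h UNIV (UNIV - {i})}"

text \<open>In the ambient space \<open>'n mink\<close> the first component is the time coordinate. A point of the
  projective space of its dual is a class of non-zero functionals up to scaling. The charts are
  the affine ones \<open>a(e) \<noteq> 0\<close>, \<open>e\<close> a coordinate vector; in the chart of the \<open>i\<close>-th spatial coordinate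
  vector the slot \<open>i\<close>, which would be constantly 1, is taken by the time coordinate.\<close>

type_synonym 'n mink = "real \<times> (real^'n)"
type_synonym 'n dual = "'n mink \<Rightarrow>\<^sub>L real"

abbreviation dcoord0 :: "('n::finite) dual \<Rightarrow> real" where
  "dcoord0 a \<equiv> blinfun_apply a (1, 0)"

abbreviation dcoord :: "('n::finite) dual \<Rightarrow> 'n \<Rightarrow> real" where
  "dcoord a j \<equiv> blinfun_apply a (0, axis j 1)"

definition proj_class :: "('n::finite) dual \<Rightarrow> 'n dual set" where
  "proj_class a = {c *\<^sub>R a | c. c \<noteq> 0}"

definition proj_atlas :: "(('n::finite) dual set, real^'n) atlas" where
  "proj_atlas =
     insert (proj_class ` {a. dcoord0 a \<noteq> 0},
             \<lambda>P. let a = (SOME a. a \<in> P) in \<chi> j. dcoord a j / dcoord0 a)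
       (range (\<lambda>i. (proj_class ` {a. dcoord a i \<noteq> 0},
             \<lambda>P. let a = (SOME a. a \<in> P) in
                 \<chi> j. (if j = i then dcoord0 a else dcoord a j) / dcoord a i)))"


section \<open>Null wave fronts\<close>

definition lorentz :: "('n::finite) mink \<Rightarrow> 'n mink \<Rightarrow> real" where
  "lorentz v w = - (fst v * fst w) + snd v \<bullet> snd w"

definition lightlike :: "('n::finite) mink \<Rightarrow> bool" where
  "lightlike v \<longleftrightarrow> v \<noteq> 0 \<and> lorentz v v = 0"

definition lightlike_line :: "('n::finite) mink set \<Rightarrow> bool" where
  "lightlike_line L \<longleftrightarrow> (\<exists>a v. lightlike v \<and> L = range (\<lambda>s. a + s *\<^sub>R v))"

definition sharp :: "('n::finite) dual \<Rightarrow> 'n mink" where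
  "sharp a = (THE v. \<forall>x. lorentz v x = blinfun_apply a x)"

text \<open>\<open>\<alpha>\<close> is the conormal field that exhibits \<open>F\<close> as a wave front.\<close>

definition wave_front ::
  "regularity \<Rightarrow> ('a, 'e::euclidean_space) atlas \<Rightarrow> ('a \<Rightarrow> ('n::finite) mink) \<Rightarrow> ('a \<Rightarrow> 'n dual) \<Rightarrow> bool" where
  "wave_front r M F \<alpha> \<longleftrightarrow>
     Cr_map r M euclid F \<and> Cr_map r M (restr euclid (- {0})) \<alpha> \<and>
     (\<forall>p\<in>carrier M. \<forall>c\<in>M. p \<in> fst c \<longrightarrow> (\<forall>v. blinfun_apply (\<alpha> p) (vderiv c F p v) = 0)) \<and>
     Cr_immersion r M (prod_atlas euclid proj_atlas) (\<lambda>p. (F p, proj_class (\<alpha> p)))"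

definition null_wave_front ::
  "regularity \<Rightarrow> ('a, 'e::euclidean_space) atlas \<Rightarrow> ('a \<Rightarrow> ('n::finite) mink) \<Rightarrow> ('a \<Rightarrow> 'n dual) \<Rightarrow> bool" where
  "null_wave_front r M F \<alpha> \<longleftrightarrow> wave_front r M F \<alpha> \<and> (\<forall>p\<in>carrier M. lightlike (sharp (\<alpha> p)))"

text \<open>The rescaling of a light-like vector to Euclidean length $\sqrt 2$ and future direction.\<close>

definition E_normalize :: "('n::finite) mink \<Rightarrow> 'n mink" where
  "E_normalize v = (sgn (fst v) * sqrt 2 / norm v) *\<^sub>R v"

definition xihat_E :: "('a \<Rightarrow> ('n::finite) dual) \<Rightarrow> 'a \<Rightarrow> 'n mink" where
  "xihat_E \<alpha> p = E_normalize (sharp (\<alpha> p))"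

definition canonical_lift ::
  "('a \<Rightarrow> ('n::finite) mink) \<Rightarrow> ('a \<Rightarrow> 'n dual) \<Rightarrow> 'a \<Rightarrow> 'n mink \<times> 'n mink" where
  "canonical_lift F \<alpha> p = (F p, xihat_E \<alpha> p)"

text \<open>This predicate determines the vector field \<open>X\<close> uniquely when \<open>(F, \<alpha>)\<close> is a null wave front.\<close>

definition null_vector_field_E ::
  "regularity \<Rightarrow> ('a, 'e::euclidean_space) atlas \<Rightarrow> ('a \<Rightarrow> ('n::finite) mink) \<Rightarrow> ('a \<Rightarrow> 'n dual) \<Rightarrow>
    (('a, 'e) chart \<Rightarrow> 'a \<Rightarrow> 'e) \<Rightarrow> bool" where
  "null_vector_field_E r M F \<alpha> X \<longleftrightarrow>
     Cr_vector_field r M X \<and>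
     (\<forall>c\<in>M. \<forall>p\<in>fst c. vderiv c F p (X c p) = xihat_E \<alpha> p) \<and>
     (\<forall>J \<gamma>. integral_curve M X J \<gamma> \<longrightarrow> (\<exists>L. lightlike_line L \<and> F ` \<gamma> ` J \<subseteq> L))"

definition L_complete ::
  "regularity \<Rightarrow> ('a, 'e::euclidean_space) atlas \<Rightarrow> ('a \<Rightarrow> ('n::finite) mink) \<Rightarrow> ('a \<Rightarrow> 'n dual) \<Rightarrow> bool" where
  "L_complete r M F \<alpha> \<longleftrightarrow>
     (\<exists>X. null_vector_field_E r M F \<alpha> X \<and>
       (\<forall>p\<in>carrier M. \<exists>\<gamma>. integral_curve M X UNIV \<gamma> \<and> p \<in> range \<gamma> \<and> lightlike_line (range (F \<circ> \<gamma>))))"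


section \<open>Wave fronts in Euclidean space and the normal form\<close>

definition unit_normal_field ::
  "regularity \<Rightarrow> ('a, real^'k) atlas \<Rightarrow> ('a \<Rightarrow> real^'n) \<Rightarrow> ('a \<Rightarrow> real^'n) \<Rightarrow> bool" where
  "unit_normal_field r S f \<nu> \<longleftrightarrow>
     Cr_map r S (sphere_atlas :: (real^'n, real^'k) atlas) \<nu> \<and>
     (\<forall>p\<in>carrier S. \<forall>c\<in>S. p \<in> fst c \<longrightarrow> (\<forall>v. \<nu> p \<bullet> vderiv c f p v = 0))"

definition euclidean_front_with ::
  "regularity \<Rightarrow> ('a, real^'k) atlas \<Rightarrow> ('a \<Rightarrow> real^'n) \<Rightarrow> ('a \<Rightarrow> real^'n) \<Rightarrow> bool" where
  "euclidean_front_with r S f \<nu> \<longleftrightarrow>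
     Cr_map r S euclid f \<and> unit_normal_field r S f \<nu> \<and>
     Cr_immersion r S (prod_atlas euclid (sphere_atlas :: (real^'n, real^'k) atlas)) (\<lambda>p. (f p, \<nu> p))"

definition normal_form ::
  "regularity \<Rightarrow> ('a, real^'k) atlas \<Rightarrow> (real \<times> 'a \<Rightarrow> ('n::finite) mink) \<Rightarrow>
    (real \<times> 'a \<Rightarrow> 'n dual) \<Rightarrow> bool" where
  "normal_form r S F \<alpha> \<longleftrightarrow>
     (\<exists>f \<nu>. euclidean_front_with r S f \<nu> \<and>
        (\<forall>t. \<forall>x\<in>carrier S. F (t, x) = (0, f x) + t *\<^sub>R (1, \<nu> x) \<and> xihat_E \<alpha> (t, x) = (1, \<nu> x)))"


section \<open>Fundamental data\<close>

record ('a, 'n::finite, 'k::finite) fdata =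
  U_of :: "'a set"
  Sigma_of :: "('a, real^'k) atlas"
  tau_of :: "'a \<Rightarrow> real"
  rho_of :: "'a \<Rightarrow> 'a"
  g_of :: "'a \<Rightarrow> 'n mink"
  xi_of :: "'a \<Rightarrow> 'n mink"
  I_of :: "real set"

definition G_of :: "('a, 'n::finite, 'k::finite) fdata \<Rightarrow> real \<times> 'a \<Rightarrow> 'n mink" where
  "G_of D = (\<lambda>(t, x). g_of D x + t *\<^sub>R xi_of D x)"

definition Phi_of :: "('a, 'n::finite, 'k::finite) fdata \<Rightarrow> 'a \<Rightarrow> real \<times> 'a" where
  "Phi_of D q = (tau_of D q, rho_of D q)"

definition L_of :: "('a, 'n::finite, 'k::finite) fdata \<Rightarrow> real \<times> 'a \<Rightarrow> 'n mink \<times> 'n mink" where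
  "L_of D = (\<lambda>(t, x). (G_of D (t, x), xi_of D x))"

definition l_of :: "('a, 'n::finite, 'k::finite) fdata \<Rightarrow> 'a \<Rightarrow> 'n mink \<times> 'n mink" where
  "l_of D x = (g_of D x, xi_of D x)"

text \<open>Submanifold means embedded submanifold; its structure is recorded as an atlas \<open>Sigma_of D\<close>
  for which the inclusion into \<open>U_of D\<close> is an embedding.\<close>

definition fundamental_data ::
  "regularity \<Rightarrow> ('a, 'e::euclidean_space) atlas \<Rightarrow> ('a \<Rightarrow> ('n::finite) mink) \<Rightarrow> ('a \<Rightarrow> 'n dual) \<Rightarrow>
    'a \<Rightarrow> ('a, 'n, 'k::finite) fdata \<Rightarrow> bool" where
  "fundamental_data r M F \<alpha> p D \<longleftrightarrow>
     openin (mtop M) (U_of D) \<and> p \<in> U_of D \<and>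
     Cr_manifold r (Sigma_of D) \<and> connected_space (mtop (Sigma_of D)) \<and>
     carrier (Sigma_of D) \<subseteq> U_of D \<and>
     Cr_embedding r (Sigma_of D) (restr M (U_of D)) (\<lambda>x. x) \<and>
     (\<forall>q\<in>U_of D. tau_of D q = fst (F q)) \<and>
     Cr_submersion r (restr M (U_of D)) (Sigma_of D) (rho_of D) \<and>
     rho_of D ` U_of D = carrier (Sigma_of D) \<and>
     (\<forall>x\<in>carrier (Sigma_of D). fst (g_of D x) = 0) \<and>
     (\<exists>\<nu>. euclidean_front_with r (Sigma_of D) (snd \<circ> g_of D) \<nu>) \<and>
     (\<forall>x\<in>carrier (Sigma_of D). xi_of D x = xihat_E \<alpha> x \<and> fst (xi_of D x) = 1) \<and>
     unit_normal_field r (Sigma_of D) (snd \<circ> g_of D) (snd \<circ> xi_of D) \<and>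
     ((\<exists>t e. e > 0 \<and> I_of D = {t - e <..< t + e}) \<or> I_of D = UNIV) \<and>
     Cr_diffeo r (restr M (U_of D)) (prod_atlas (restr euclid (I_of D)) (Sigma_of D)) (Phi_of D) \<and>
     (\<forall>q\<in>U_of D. F q = G_of D (Phi_of D q)) \<and>
     Cr_embedding r (prod_atlas euclid (Sigma_of D)) euclid (L_of D) \<and>
     (\<forall>q\<in>U_of D. canonical_lift F \<alpha> q = L_of D (Phi_of D q)) \<and>
     Cr_embedding r (Sigma_of D) euclid (l_of D)"


section \<open>Admissibility\<close>

definition related ::
  "('a, 'e::euclidean_space) atlas \<Rightarrow> ('b, 'e) atlas \<Rightarrow> ('a \<Rightarrow> 'v) \<Rightarrow> ('b \<Rightarrow> 'v) \<Rightarrow> 'a \<Rightarrow> 'b \<Rightarrow> bool" where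
  "related U V f g x y \<longleftrightarrow> f x = g y \<and>
     (\<exists>Ox Oy. openin (mtop U) Ox \<and> x \<in> Ox \<and> openin (mtop V) Oy \<and> y \<in> Oy \<and> f ` Ox = g ` Oy)"

definition admissible_pair ::
  "('a, 'e::euclidean_space) atlas \<Rightarrow> ('b, 'e) atlas \<Rightarrow> ('a \<Rightarrow> 'v) \<Rightarrow> ('b \<Rightarrow> 'v) \<Rightarrow> bool" where
  "admissible_pair U V f g \<longleftrightarrow>
     (\<forall>x\<in>carrier U. \<forall>y\<in>carrier V. related U V f g x y \<or>
        (\<exists>Ox Oy. openin (mtop U) Ox \<and> x \<in> Ox \<and> openin (mtop V) Oy \<and> y \<in> Oy \<and>
           (\<forall>x'\<in>Ox. \<forall>y'\<in>Oy. \<not> related U V f g x' y')))"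

definition admissible_family ::
  "regularity \<Rightarrow> 'i set \<Rightarrow> ('i \<Rightarrow> ('a, 'e::euclidean_space) atlas) \<Rightarrow> ('i \<Rightarrow> 'a \<Rightarrow> 'v::euclidean_space) \<Rightarrow> bool" where
  "admissible_family r A U f \<longleftrightarrow>
     countable A \<and> DIM('e) < DIM('v) \<and>
     (\<forall>i\<in>A. Cr_manifold r (U i) \<and> connected_space (mtop (U i)) \<and> Cr_embedding r (U i) euclid (f i)) \<and>
     (\<forall>i\<in>A. \<forall>j\<in>A. admissible_pair (U i) (U j) (f i) (f j))"

text \<open>The type argument fixes the model space \<open>real^'k\<close> of the slices.\<close>

definition admissible_front ::
  "'k::finite itself \<Rightarrow> regularity \<Rightarrow> ('a, 'e::euclidean_space) atlas \<Rightarrow> ('a \<Rightarrow> ('n::finite) mink) \<Rightarrow>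
    ('a \<Rightarrow> 'n dual) \<Rightarrow> bool" where
  "admissible_front k r M F \<alpha> \<longleftrightarrow>
     (\<exists>\<Lambda> :: ('a, 'n, 'k) fdata set.
        (\<forall>D\<in>\<Lambda>. \<exists>p\<in>carrier M. fundamental_data r M F \<alpha> p D) \<and>
        (\<Union>D\<in>\<Lambda>. U_of D) = carrier M \<and>
        admissible_family r \<Lambda> Sigma_of l_of)"

end

theory Submission
  imports Defs
begin

text \<open>Write the front as \<open>F = (0, f) + t (1, \<nu>)\<close> with \<open>t\<close> its time coordinate. Both \<open>f\<close> and \<open>\<nu>\<close> are constant
  along the light-like lines, so \<open>(f, \<nu>)\<close> parametrizes the local space of lines, that is, the slices
  of the fundamental data. Admissibility makes being related an equivalence relation with Hausdorff
  quotient on the disjoint union of the slices: this quotient is the manifold of all lines, \<open>(f, \<nu>)\<close>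
  descends to a Euclidean front on it, and \<open>q\<close> is sent to its time and its line. If \<open>F\<close> is L-complete,
  then each line of the quotient is covered by a single integral curve, whose time takes every value.

  Locally, the lines are the kernel of \<open>d(f, \<nu>)\<close>. The image of this differential is isotropic for the
  symplectic form on \<open>\<nu>\<^sup>\<bottom> \<times> \<nu>\<^sup>\<bottom>\<close>, so it has dimension at most \<open>n - 1\<close> and the kernel is non-trivial; the
  inverse function theorem then straightens the lines. For analytic fronts, the identity theorem
  together with invariance of domain yields admissibility.\<close>

section \<open>Power series in several variables\<close>

text \<open>\<open>Smooth\<close> and \<open>Analytic\<close> fronts go through one proof, while
  analyticity is given only as unconditional convergence of real power series. What is needed of it
  is drawn from the weighted sum of |c_m| \<rho>^|m|, a submultiplicative norm: composition,
  differentiation, inversion and the identity theorem become estimates of such sums.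

  Distinct points of the space of lines may have the same value \<open>(f, \<nu>)\<close>, because
  different sheets of a front can share a light-like line. Lines are therefore not identified by
  their values: being related asks for equal germs of the images. Equality of germs is an open
  condition, but a limit of related pairs may be unrelated. Such a pair would be inseparable in the
  quotient, and it is this that admissibility excludes.

  Normal vectors are scaled to time component 1. Time is thus a local coordinate on the front, the
  parameter of its lines and, up to a shift, the parameter of the integral curves, and passing to
  the quotient forgets nothing but time.\<close>

definition multi_idx :: "('a::euclidean_space \<Rightarrow> nat) set" where
  "multi_idx = Basis \<rightarrow>\<^sub>E UNIV"

definition mpow :: "'a::euclidean_space \<Rightarrow> ('a \<Rightarrow> nat) \<Rightarrow> real" where
  "mpow x m = (\<Prod>i\<in>Basis. (x \<bullet> i) ^ m i)"

definition mdeg :: "('a::euclidean_space \<Rightarrow> nat) \<Rightarrow> nat" where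
  "mdeg m = (\<Sum>i\<in>Basis. m i)"

text \<open>Cubes rather than balls: on them |x^m| is at most \<open>\<rho> ^ mdeg m\<close>, and a
  map takes values in a cube as soon as its coordinates are bounded one by one.\<close>

definition box_ball :: "real \<Rightarrow> 'a::euclidean_space set" where
  "box_ball \<rho> = {x. \<forall>i\<in>Basis. \<bar>x \<bullet> i\<bar> \<le> \<rho>}"

definition ps_coeffs :: "real \<Rightarrow> (('a::euclidean_space \<Rightarrow> nat) \<Rightarrow> 'b::banach) \<Rightarrow> ('a \<Rightarrow> 'b) \<Rightarrow> bool" where
  "ps_coeffs \<rho> c f \<longleftrightarrow> (\<lambda>m. norm (c m) * \<rho> ^ mdeg m) summable_on multi_idx \<and>
     (\<forall>x\<in>box_ball \<rho>. ((\<lambda>m. mpow x m *\<^sub>R c m) has_sum f x) multi_idx)"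

text \<open>\<open>C\<close> bounds the weighted l^1 norm of the coefficients and not merely the
  values of \<open>f\<close>. This norm is submultiplicative, so products, substitutions and
  infinite sums are controlled by arithmetic with the bounds. Outside the cube \<open>f\<close> is
  unconstrained.\<close>

definition ps :: "real \<Rightarrow> real \<Rightarrow> ('a::euclidean_space \<Rightarrow> 'b::banach) \<Rightarrow> bool" where
  "ps \<rho> C f \<longleftrightarrow> (\<exists>c. ps_coeffs \<rho> c f \<and> (\<Sum>\<^sub>\<infinity>m\<in>multi_idx. norm (c m) * \<rho> ^ mdeg m) \<le> C)"

lemma abs_mpow_le:
  assumes "x \<in> box_ball \<rho>"
  shows "\<bar>mpow x m\<bar> \<le> \<rho> ^ mdeg m"
proof -
  have "\<bar>mpow x m\<bar> = (\<Prod>i\<in>Basis. \<bar>x \<bullet> i\<bar> ^ m i)"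
    by (simp add: mpow_def abs_prod power_abs)
  also have "\<dots> \<le> (\<Prod>i\<in>Basis. \<rho> ^ m i)"
    using assms by (intro prod_mono) (auto simp: box_ball_def intro!: power_mono)
  finally show ?thesis by (simp add: mdeg_def power_sum)
qed

lemma norm_mpow_scaleR_le:
  assumes "x \<in> box_ball \<rho>"
  shows "norm (mpow x m *\<^sub>R c) \<le> norm c * \<rho> ^ mdeg m"
  using abs_mpow_le[OF assms, of m] by (simp add: mult.commute mult_left_mono)

lemma box_ball_nonneg: "0 \<le> \<rho> \<Longrightarrow> 0 \<in> box_ball \<rho>"
  by (simp add: box_ball_def)

lemma box_ball_norm: "norm x \<le> \<rho> \<Longrightarrow> x \<in> box_ball \<rho>"
  unfolding box_ball_def using Basis_le_norm order_trans by fastforce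

lemma ps_coeffsI:
  assumes "(\<lambda>m. norm (c m) * \<rho> ^ mdeg m) summable_on multi_idx"
    and "\<And>x. x \<in> box_ball \<rho> \<Longrightarrow> f x = (\<Sum>\<^sub>\<infinity>m\<in>multi_idx. mpow x m *\<^sub>R c m)"
  shows "ps_coeffs \<rho> c f"
  unfolding ps_coeffs_def
proof (intro conjI ballI)
  fix x :: 'a assume x: "x \<in> box_ball \<rho>"
  have "(\<lambda>m. mpow x m *\<^sub>R c m) summable_on multi_idx"
    by (rule abs_summable_summable, rule Infinite_Sum.abs_summable_on_comparison_test'[OF assms(1)])
       (rule norm_mpow_scaleR_le[OF x])
  then show "((\<lambda>m. mpow x m *\<^sub>R c m) has_sum f x) multi_idx"
    unfolding assms(2)[OF x] by simp
qed (rule assms)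

lemma ps_coeffs_bound:
  assumes "ps_coeffs \<rho> c f" "x \<in> box_ball \<rho>"
  shows "norm (f x) \<le> (\<Sum>\<^sub>\<infinity>m\<in>multi_idx. norm (c m) * \<rho> ^ mdeg m)"
  by (rule norm_infsum_le[where X=multi_idx and f="\<lambda>m. mpow x m *\<^sub>R c m" and g="\<lambda>m. norm (c m) * \<rho> ^ mdeg m"])
     (use assms in \<open>auto simp: ps_coeffs_def norm_mpow_scaleR_le simp del: norm_scaleR\<close>)

lemma ps_bound: "ps \<rho> C f \<Longrightarrow> x \<in> box_ball \<rho> \<Longrightarrow> norm (f x) \<le> C"
  unfolding ps_def using ps_coeffs_bound order_trans by blast

lemma ps_nonneg: "ps \<rho> C f \<Longrightarrow> 0 \<le> \<rho> \<Longrightarrow> 0 \<le> C"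
  using ps_bound[OF _ box_ball_nonneg, of \<rho> C f] norm_ge_zero order_trans by blast

lemma ps_mono: "ps \<rho> C f \<Longrightarrow> C \<le> D \<Longrightarrow> ps \<rho> D f"
  unfolding ps_def using order_trans by blast

lemma ps_cong: "ps \<rho> C f \<Longrightarrow> (\<And>x. x \<in> box_ball \<rho> \<Longrightarrow> f x = g x) \<Longrightarrow> ps \<rho> C g"
  unfolding ps_def ps_coeffs_def by auto

lemma ps_coeffs_shrink:
  assumes "ps_coeffs \<rho> c f" "0 \<le> \<sigma>" "\<sigma> \<le> \<rho>"
  shows "ps_coeffs \<sigma> c f"
    "(\<Sum>\<^sub>\<infinity>m\<in>multi_idx. norm (c m) * \<sigma> ^ mdeg m) \<le> (\<Sum>\<^sub>\<infinity>m\<in>multi_idx. norm (c m) * \<rho> ^ mdeg m)"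
proof -
  have le: "norm (c m) * \<sigma> ^ mdeg m \<le> norm (c m) * \<rho> ^ mdeg m" for m
    using assms by (intro mult_left_mono power_mono) auto
  have s: "(\<lambda>m. norm (c m) * \<sigma> ^ mdeg m) summable_on multi_idx"
    by (rule summable_on_comparison_test[where f="\<lambda>m. norm (c m) * \<rho> ^ mdeg m"])
       (use assms le in \<open>auto simp: ps_coeffs_def\<close>)
  show "ps_coeffs \<sigma> c f"
    using assms s unfolding ps_coeffs_def box_ball_def by fastforce
  show "(\<Sum>\<^sub>\<infinity>m\<in>multi_idx. norm (c m) * \<sigma> ^ mdeg m) \<le> (\<Sum>\<^sub>\<infinity>m\<in>multi_idx. norm (c m) * \<rho> ^ mdeg m)"
    by (rule infsum_mono) (use s assms le in \<open>auto simp: ps_coeffs_def\<close>)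
qed

lemma ps_shrink:
  assumes "ps \<rho> C f" "0 \<le> \<sigma>" "\<sigma> \<le> \<rho>"
  shows "ps \<sigma> C f"
proof -
  from assms(1) obtain c where c: "ps_coeffs \<rho> c f" "(\<Sum>\<^sub>\<infinity>m\<in>multi_idx. norm (c m) * \<rho> ^ mdeg m) \<le> C"
    unfolding ps_def by blast
  show ?thesis
    unfolding ps_def using ps_coeffs_shrink[OF c(1) assms(2,3)] c(2) by (intro exI[of _ c]) linarith
qed

text \<open>Monomials with the same exponent may be repeated: this is what makes products and infinite
  sums of power series easy.\<close>

lemma ps_collapse:
  fixes e :: "'i \<Rightarrow> ('a::euclidean_space \<Rightarrow> nat)" and c :: "'i \<Rightarrow> 'b::banach"
  assumes \<rho>: "0 < \<rho>" and e: "\<And>i. i \<in> A \<Longrightarrow> e i \<in> multi_idx"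
    and s: "(\<lambda>i. norm (c i) * \<rho> ^ mdeg (e i)) summable_on A"
    and C: "(\<Sum>\<^sub>\<infinity>i\<in>A. norm (c i) * \<rho> ^ mdeg (e i)) \<le> C"
    and f: "\<And>x. x \<in> box_ball \<rho> \<Longrightarrow> f x = (\<Sum>\<^sub>\<infinity>i\<in>A. mpow x (e i) *\<^sub>R c i)"
  shows "ps \<rho> C f"
proof -
  define B where "B m = {i\<in>A. e i = m}" for m
  define d where "d m = infsum c (B m)" for m
  have inj: "inj_on (\<lambda>i. (e i, i)) A" by (auto simp: inj_on_def)
  have im: "(\<lambda>i. (e i, i)) ` A = Sigma multi_idx B"
    using e by (auto simp: B_def)
  have re: "(g has_sum y) (Sigma multi_idx B) \<longleftrightarrow> ((\<lambda>i. g (e i, i)) has_sum y) A"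
    for g :: "_ \<Rightarrow> 'c::{comm_monoid_add,topological_space}" and y
    unfolding im[symmetric] has_sum_reindex[OF inj] by (simp add: o_def)
  have sB: "(\<lambda>i. norm (c i)) summable_on B m" for m
  proof -
    have "(\<lambda>i. norm (c i) * \<rho> ^ mdeg (e i)) summable_on B m"
      by (rule summable_on_subset_banach[OF s]) (auto simp: B_def)
    then have "(\<lambda>i. norm (c i) * \<rho> ^ mdeg m) summable_on B m"
      by (rule summable_on_cong[THEN iffD1, rotated]) (auto simp: B_def)
    then show ?thesis
      using \<rho> by (simp add: summable_on_cmult_left')
  qed
  have cB: "(c has_sum d m) (B m)" for m
    unfolding d_def using abs_summable_summable[OF sB] by simp
  let ?n = "\<lambda>m. \<Sum>\<^sub>\<infinity>i\<in>B m. norm (c i)"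
  have n: "((\<lambda>m. ?n m * \<rho> ^ mdeg m) has_sum (\<Sum>\<^sub>\<infinity>i\<in>A. norm (c i) * \<rho> ^ mdeg (e i))) multi_idx"
  proof (rule has_sum_SigmaD)
    show "((\<lambda>(m,i). norm (c i) * \<rho> ^ mdeg m) has_sum (\<Sum>\<^sub>\<infinity>i\<in>A. norm (c i) * \<rho> ^ mdeg (e i))) (Sigma multi_idx B)"
      unfolding re using s by simp
    show "((\<lambda>i. case (m, i) of (m, i) \<Rightarrow> norm (c i) * \<rho> ^ mdeg m) has_sum ?n m * \<rho> ^ mdeg m) (B m)" for m
      using sB by (auto intro: has_sum_cmult_left)
  qed
  have le: "norm (d m) * \<rho> ^ mdeg m \<le> ?n m * \<rho> ^ mdeg m" for m
    unfolding d_def using \<rho> norm_infsum_bound[OF sB, of m] by (intro mult_right_mono) auto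
  have sd: "(\<lambda>m. norm (d m) * \<rho> ^ mdeg m) summable_on multi_idx"
    by (rule summable_on_comparison_test[OF has_sum_imp_summable[OF n]]) (use le \<rho> in auto)
  have "ps_coeffs \<rho> d f"
  proof (rule ps_coeffsI[OF sd])
    fix x :: 'a assume x: "x \<in> box_ball \<rho>"
    have "((\<lambda>m. mpow x m *\<^sub>R d m) has_sum f x) multi_idx"
    proof (rule has_sum_SigmaD)
      have "(\<lambda>i. mpow x (e i) *\<^sub>R c i) summable_on A"
        by (rule abs_summable_summable, rule Infinite_Sum.abs_summable_on_comparison_test'[OF s])
           (rule norm_mpow_scaleR_le[OF x])
      then show "((\<lambda>(m,i). mpow x m *\<^sub>R c i) has_sum f x) (Sigma multi_idx B)"
        unfolding re f[OF x] by simp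
      show "((\<lambda>i. case (m, i) of (m, i) \<Rightarrow> mpow x m *\<^sub>R c i) has_sum mpow x m *\<^sub>R d m) (B m)" for m
        using has_sum_scaleR[OF cB] by simp
    qed
    then show "f x = (\<Sum>\<^sub>\<infinity>m\<in>multi_idx. mpow x m *\<^sub>R d m)"
      by (simp add: infsumI)
  qed
  moreover have "(\<Sum>\<^sub>\<infinity>m\<in>multi_idx. norm (d m) * \<rho> ^ mdeg m) \<le> C"
    using infsum_mono[OF sd has_sum_imp_summable[OF n] le] infsumI[OF n] C by linarith
  ultimately show ?thesis unfolding ps_def by blast
qed

section \<open>Elementary functions and closure properties of power series\<close>

lemma mpow_0 [simp]: "mpow x (restrict (\<lambda>_. 0) Basis) = 1"
  by (simp add: mpow_def)

lemma mdeg_0 [simp]: "mdeg (restrict (\<lambda>_. 0) Basis) = 0"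
  by (simp add: mdeg_def)

lemma ps_const:
  assumes "0 < \<rho>" shows "ps \<rho> (norm a) (\<lambda>_. a)"
  by (rule ps_collapse[where A="{()}" and e="\<lambda>_. restrict (\<lambda>_. 0) Basis" and c="\<lambda>_. a"])
     (use assms in \<open>auto simp: multi_idx_def\<close>)

definition unit_idx :: "'a::euclidean_space \<Rightarrow> ('a \<Rightarrow> nat)" where
  "unit_idx i = restrict (\<lambda>j. if j = i then 1 else 0) Basis"

lemma unit_idx_simps [simp]:
  assumes "i \<in> Basis"
  shows "mpow x (unit_idx i) = x \<bullet> i" "mdeg (unit_idx i) = 1"
proof -
  have "(\<Prod>j\<in>Basis. (x \<bullet> j) ^ unit_idx i j) = (\<Prod>j\<in>Basis. if j = i then x \<bullet> i else 1)"
    by (intro prod.cong) (auto simp: unit_idx_def)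
  then show "mpow x (unit_idx i) = x \<bullet> i"
    using assms by (simp add: mpow_def)
  have "(\<Sum>j\<in>Basis. unit_idx i j) = (\<Sum>j\<in>Basis. if j = i then 1 else 0)"
    by (intro sum.cong) (auto simp: unit_idx_def)
  then show "mdeg (unit_idx i) = 1"
    using assms by (simp add: mdeg_def)
qed

lemma unit_idx_in [simp]: "unit_idx i \<in> multi_idx"
  by (auto simp: unit_idx_def multi_idx_def)

lemma ps_coord:
  assumes "0 < \<rho>" "i \<in> Basis" shows "ps \<rho> \<rho> (\<lambda>x. x \<bullet> i)"
  by (rule ps_collapse[where A="{()}" and e="\<lambda>_. unit_idx i" and c="\<lambda>_. 1"])
     (use assms in auto)

lemma ps_add:
  assumes "ps \<rho> C f" "ps \<rho> D g" "0 < \<rho>" shows "ps \<rho> (C + D) (\<lambda>x. f x + g x)"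
proof -
  from assms obtain c d where c: "ps_coeffs \<rho> c f" "(\<Sum>\<^sub>\<infinity>m\<in>multi_idx. norm (c m) * \<rho> ^ mdeg m) \<le> C"
    and d: "ps_coeffs \<rho> d g" "(\<Sum>\<^sub>\<infinity>m\<in>multi_idx. norm (d m) * \<rho> ^ mdeg m) \<le> D"
    unfolding ps_def by blast
  let ?N = "\<lambda>c m. norm (c m) * \<rho> ^ mdeg m"
  have s: "(\<lambda>m. ?N c m + ?N d m) summable_on multi_idx"
    using c d by (intro summable_on_add) (auto simp: ps_coeffs_def)
  have le: "?N (\<lambda>m. c m + d m) m \<le> ?N c m + ?N d m" for m
    unfolding distrib_right[symmetric] using assms by (intro mult_right_mono norm_triangle_ineq) auto
  have s': "?N (\<lambda>m. c m + d m) summable_on multi_idx"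
    by (rule summable_on_comparison_test[OF s]) (use le assms in auto)
  have "ps_coeffs \<rho> (\<lambda>m. c m + d m) (\<lambda>x. f x + g x)"
    using c(1) d(1) s' unfolding ps_coeffs_def by (auto simp: scaleR_add_right intro!: has_sum_add)
  moreover have "infsum (?N (\<lambda>m. c m + d m)) multi_idx \<le> infsum (?N c) multi_idx + infsum (?N d) multi_idx"
    using infsum_mono[OF s' s le] c(1) d(1) by (subst (asm) infsum_add) (auto simp: ps_coeffs_def)
  ultimately show ?thesis
    unfolding ps_def using c(2) d(2) by (intro exI[of _ "\<lambda>m. c m + d m"]) linarith
qed

lemma ps_bounded_linear:
  assumes "ps \<rho> C f" "bounded_linear T" "0 \<le> K" "\<And>y. norm (T y) \<le> K * norm y" "0 \<le> \<rho>"
  shows "ps \<rho> (K * C) (\<lambda>x. T (f x))"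
proof -
  from assms obtain c where c: "ps_coeffs \<rho> c f" "(\<Sum>\<^sub>\<infinity>m\<in>multi_idx. norm (c m) * \<rho> ^ mdeg m) \<le> C"
    unfolding ps_def by blast
  interpret bounded_linear T by fact
  let ?N = "\<lambda>c m. norm (c m) * \<rho> ^ mdeg m"
  have s: "(\<lambda>m. K * ?N c m) summable_on multi_idx"
    using c by (intro summable_on_cmult_right) (auto simp: ps_coeffs_def)
  have le: "norm (T (c m)) * \<rho> ^ mdeg m \<le> K * ?N c m" for m
    unfolding mult.assoc[symmetric] using assms by (intro mult_right_mono) auto
  have s': "(\<lambda>m. norm (T (c m)) * \<rho> ^ mdeg m) summable_on multi_idx"
    by (rule summable_on_comparison_test[OF s]) (use le assms in auto)
  have "ps_coeffs \<rho> (\<lambda>m. T (c m)) (\<lambda>x. T (f x))"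
    using c(1) s' has_sum_bounded_linear[OF assms(2)] unfolding ps_coeffs_def
    by (auto simp: scale[symmetric])
  moreover have "(\<Sum>\<^sub>\<infinity>m\<in>multi_idx. norm (T (c m)) * \<rho> ^ mdeg m) \<le> K * infsum (?N c) multi_idx"
    using infsum_mono[OF s' s le] by (simp add: infsum_cmult_right')
  ultimately show ?thesis
    unfolding ps_def using c(2) assms(3) by (intro exI[of _ "\<lambda>m. T (c m)"]) (meson mult_left_mono order_trans)
qed

lemma ps_minus: "ps \<rho> C f \<Longrightarrow> 0 \<le> \<rho> \<Longrightarrow> ps \<rho> C (\<lambda>x. - f x)"
  using ps_bounded_linear[of \<rho> C f uminus 1] by (simp add: bounded_linear_minus[OF bounded_linear_ident])

lemma ps_inner_Basis:
  assumes "ps \<rho> C f" "i \<in> Basis" "0 \<le> \<rho>"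
  shows "ps \<rho> C (\<lambda>x. f x \<bullet> i)"
  using ps_bounded_linear[of \<rho> C f "\<lambda>y. y \<bullet> i" 1] assms
  by (simp add: bounded_linear_inner_left Basis_le_norm)

text \<open>The coefficients of all \<open>f j\<close> form one absolutely summable family over
  \<open>J \<times> multi_idx\<close>; its joint sum equals the iterated one, and collapsing equal
  exponents gives the series of \<open>F\<close>.\<close>

lemma ps_infsum:
  fixes f :: "'j \<Rightarrow> 'a::euclidean_space \<Rightarrow> 'b::banach"
  assumes \<rho>: "0 < \<rho>" and f: "\<And>j. j \<in> J \<Longrightarrow> ps \<rho> (C j) (f j)" and C: "C summable_on J"
    and F: "\<And>x. x \<in> box_ball \<rho> \<Longrightarrow> F x = (\<Sum>\<^sub>\<infinity>j\<in>J. f j x)"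
  shows "ps \<rho> (infsum C J) F"
proof -
  from f have "\<exists>c. \<forall>j\<in>J. ps_coeffs \<rho> (c j) (f j) \<and> (\<Sum>\<^sub>\<infinity>m\<in>multi_idx. norm (c j m) * \<rho> ^ mdeg m) \<le> C j"
    unfolding ps_def by (intro bchoice) auto
  then obtain c where c: "\<And>j. j \<in> J \<Longrightarrow> ps_coeffs \<rho> (c j) (f j)"
    and cC: "\<And>j. j \<in> J \<Longrightarrow> (\<Sum>\<^sub>\<infinity>m\<in>multi_idx. norm (c j m) * \<rho> ^ mdeg m) \<le> C j" by blast
  let ?N = "\<lambda>(j,m). norm (c j m) * \<rho> ^ mdeg m"
  let ?S = "\<lambda>j. \<Sum>\<^sub>\<infinity>m\<in>multi_idx. norm (c j m) * \<rho> ^ mdeg m"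
  have S: "?S summable_on J"
    by (rule summable_on_comparison_test[OF C]) (use cC \<rho> in \<open>auto intro!: infsum_nonneg\<close>)
  have hs: "((\<lambda>m. ?N (j, m)) has_sum ?S j) multi_idx" if "j \<in> J" for j
    using c[OF that] by (auto simp: ps_coeffs_def)
  have sN: "?N summable_on (J \<times> multi_idx)"
    by (rule summable_on_SigmaI[OF hs S]) (use \<rho> in auto)
  have "(?S has_sum infsum ?N (J \<times> multi_idx)) J"
    by (rule has_sum_SigmaD[OF _ hs]) (use sN in auto)
  then have eq: "infsum ?N (J \<times> multi_idx) = infsum ?S J"
    by (simp add: infsumI)
  show ?thesis
  proof (rule ps_collapse[where A="J \<times> multi_idx" and e=snd and c="\<lambda>(j,m). c j m"])
    have eqN: "(\<lambda>i. norm (case i of (j, m) \<Rightarrow> c j m) * \<rho> ^ mdeg (snd i)) = ?N"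
      by (auto simp: fun_eq_iff)
    show "(\<lambda>i. norm (case i of (j, m) \<Rightarrow> c j m) * \<rho> ^ mdeg (snd i)) summable_on (J \<times> multi_idx)"
      unfolding eqN by (rule sN)
    show "(\<Sum>\<^sub>\<infinity>i\<in>J \<times> multi_idx. norm (case i of (j, m) \<Rightarrow> c j m) * \<rho> ^ mdeg (snd i)) \<le> infsum C J"
      unfolding eqN eq using cC by (intro infsum_mono S C) auto
    fix x :: 'a assume x: "x \<in> box_ball \<rho>"
    have "(\<lambda>i. mpow x (snd i) *\<^sub>R (case i of (j, m) \<Rightarrow> c j m)) summable_on J \<times> multi_idx"
      by (rule abs_summable_summable, rule Infinite_Sum.abs_summable_on_comparison_test'[OF sN])
         (use norm_mpow_scaleR_le[OF x] in auto)
    then have "((\<lambda>j. f j x) has_sum (\<Sum>\<^sub>\<infinity>i\<in>J \<times> multi_idx. mpow x (snd i) *\<^sub>R (case i of (j, m) \<Rightarrow> c j m))) J"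
      by (intro has_sum_SigmaD[where B="\<lambda>_. multi_idx" and f="\<lambda>i. mpow x (snd i) *\<^sub>R (case i of (j, m) \<Rightarrow> c j m)"])
         (use c x in \<open>auto simp: ps_coeffs_def\<close>)
    then show "F x = (\<Sum>\<^sub>\<infinity>i\<in>J \<times> multi_idx. mpow x (snd i) *\<^sub>R (case i of (j, m) \<Rightarrow> c j m))"
      using F[OF x] by (simp add: infsumI)
  qed (use \<rho> in auto)
qed

text \<open>A product is the infinite sum of the monomials of the first factor times the second factor, so
  only the product with a monomial is computed by hand.\<close>

lemma ps_mpow_mult:
  fixes g :: "'a::euclidean_space \<Rightarrow> 'b::banach"
  assumes "0 < \<rho>" "ps \<rho> D g" "m \<in> multi_idx"
  shows "ps \<rho> (\<rho> ^ mdeg m * D) (\<lambda>x. mpow x m *\<^sub>R g x)"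
proof -
  from assms obtain d where d: "ps_coeffs \<rho> d g" "(\<Sum>\<^sub>\<infinity>m\<in>multi_idx. norm (d m) * \<rho> ^ mdeg m) \<le> D"
    unfolding ps_def by blast
  define e where "e m' = restrict (\<lambda>i. m i + m' i) Basis" for m'
  have e: "mdeg (e m') = mdeg m + mdeg m'" "mpow x (e m') = mpow x m * mpow x m'" for m' and x :: 'a
    by (simp_all add: e_def mdeg_def mpow_def sum.distrib power_add prod.distrib)
  have eq: "(\<lambda>i. norm (d i) * \<rho> ^ mdeg (e i)) = (\<lambda>i. \<rho> ^ mdeg m * (norm (d i) * \<rho> ^ mdeg i))"
    by (auto simp: e power_add)
  show ?thesis
  proof (rule ps_collapse[where A=multi_idx and e=e and c=d])
    show "(\<lambda>i. norm (d i) * \<rho> ^ mdeg (e i)) summable_on multi_idx"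
      unfolding eq using d by (intro summable_on_cmult_right) (auto simp: ps_coeffs_def)
    show "(\<Sum>\<^sub>\<infinity>i\<in>multi_idx. norm (d i) * \<rho> ^ mdeg (e i)) \<le> \<rho> ^ mdeg m * D"
      unfolding eq using d assms by (simp add: infsum_cmult_right')
    fix x :: 'a assume x: "x \<in> box_ball \<rho>"
    show "mpow x m *\<^sub>R g x = (\<Sum>\<^sub>\<infinity>i\<in>multi_idx. mpow x (e i) *\<^sub>R d i)"
      using has_sum_scaleR[of "\<lambda>m'. mpow x m' *\<^sub>R d m'" multi_idx "g x" "mpow x m"] d x
      by (intro infsumI[symmetric]) (auto simp: ps_coeffs_def e)
  qed (use assms in \<open>auto simp: e_def multi_idx_def\<close>)
qed

lemma ps_scaleR:
  fixes f :: "'a::euclidean_space \<Rightarrow> real" and g :: "'a \<Rightarrow> 'b::banach"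
  assumes \<rho>: "0 < \<rho>" and f: "ps \<rho> C f" and g: "ps \<rho> D g"
  shows "ps \<rho> (C * D) (\<lambda>x. f x *\<^sub>R g x)"
proof -
  from f obtain c where c: "ps_coeffs \<rho> c f" "(\<Sum>\<^sub>\<infinity>m\<in>multi_idx. norm (c m) * \<rho> ^ mdeg m) \<le> C"
    unfolding ps_def by blast
  let ?D = "\<lambda>m. norm (c m) * \<rho> ^ mdeg m * D"
  have "ps \<rho> (infsum ?D multi_idx) (\<lambda>x. f x *\<^sub>R g x)"
  proof (rule ps_infsum[OF \<rho>, where f="\<lambda>m x. c m *\<^sub>R mpow x m *\<^sub>R g x"])
    show "ps \<rho> (?D m) (\<lambda>x. c m *\<^sub>R mpow x m *\<^sub>R g x)" if "m \<in> multi_idx" for m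
      using ps_bounded_linear[OF ps_mpow_mult[OF \<rho> g that], of "\<lambda>y. c m *\<^sub>R y" "norm (c m)"] \<rho>
      by (simp add: bounded_linear_scaleR_right mult_ac)
    show "?D summable_on multi_idx"
      using c by (intro summable_on_cmult_left) (auto simp: ps_coeffs_def)
    fix x :: 'a assume x: "x \<in> box_ball \<rho>"
    show "f x *\<^sub>R g x = (\<Sum>\<^sub>\<infinity>m\<in>multi_idx. c m *\<^sub>R mpow x m *\<^sub>R g x)"
      using has_sum_bounded_linear[OF bounded_linear_scaleR_left[of "g x"], where S="f x" and A=multi_idx] c x
      by (intro infsumI[symmetric]) (auto simp: ps_coeffs_def mult_ac)
  qed
  moreover have "infsum ?D multi_idx \<le> C * D"
    using c(2) ps_nonneg[OF g] \<rho> by (simp add: infsum_cmult_left' mult_right_mono)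
  ultimately show ?thesis by (rule ps_mono)
qed

lemma ps_mult:
  fixes f :: "'a::euclidean_space \<Rightarrow> real"
  assumes "0 < \<rho>" "ps \<rho> C f" "ps \<rho> D g" shows "ps \<rho> (C * D) (\<lambda>x. f x * g x)"
  using ps_scaleR[OF assms] by simp

lemma ps_power:
  fixes f :: "'a::euclidean_space \<Rightarrow> real"
  assumes "0 < \<rho>" "ps \<rho> C f" shows "ps \<rho> (C ^ n) (\<lambda>x. f x ^ n)"
proof (induction n)
  case 0 then show ?case using ps_const[OF assms(1), of "1::real"] by simp
next
  case (Suc n) then show ?case using ps_mult[OF assms(1,2) Suc] by simp
qed

lemma ps_prod:
  fixes f :: "'i \<Rightarrow> 'a::euclidean_space \<Rightarrow> real"
  assumes "0 < \<rho>" "finite I" "\<And>i. i \<in> I \<Longrightarrow> ps \<rho> (C i) (f i)"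
  shows "ps \<rho> (\<Prod>i\<in>I. C i) (\<lambda>x. \<Prod>i\<in>I. f i x)"
  using assms(2,3)
proof (induction I)
  case empty then show ?case using ps_const[OF assms(1), of "1::real"] by simp
next
  case (insert i I) then show ?case using ps_mult[OF assms(1), of "C i" "f i"] by simp
qed

lemma ps_mpow:
  assumes "0 < \<rho>" "\<And>i. i \<in> Basis \<Longrightarrow> ps \<rho> R (\<lambda>x. g x \<bullet> i)"
  shows "ps \<rho> (R ^ mdeg m) (\<lambda>x. mpow (g x) m)"
  using ps_prod[OF assms(1) finite_Basis ps_power[OF assms(1) assms(2)], of "\<lambda>i. i" m]
  by (simp add: mpow_def mdeg_def power_sum)

lemma ps_range:
  assumes "\<And>i. i \<in> Basis \<Longrightarrow> ps \<rho> R (\<lambda>x. g x \<bullet> i)" "x \<in> box_ball \<rho>"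
  shows "g x \<in> box_ball R"
  using ps_bound[OF assms] by (auto simp: box_ball_def)

text \<open>Each monomial of \<open>f\<close> turns into a product of coordinates of
  \<open>g\<close>, of norm at most \<open>R ^ mdeg m\<close>, and these products are summed by
  \<open>ps_infsum\<close>. The constant term of a coordinate of \<open>g\<close> counts towards
  \<open>R\<close>.\<close>

lemma ps_compose:
  fixes g :: "'a::euclidean_space \<Rightarrow> 'c::euclidean_space" and f :: "'c \<Rightarrow> 'b::banach"
  assumes \<rho>: "0 < \<rho>" and f: "ps R C f" and g: "\<And>i. i \<in> Basis \<Longrightarrow> ps \<rho> R (\<lambda>x. g x \<bullet> i)"
  shows "ps \<rho> C (\<lambda>x. f (g x))"
proof -
  from f obtain c where c: "ps_coeffs R c f" "(\<Sum>\<^sub>\<infinity>m\<in>multi_idx. norm (c m) * R ^ mdeg m) \<le> C"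
    unfolding ps_def by blast
  have "ps \<rho> (\<Sum>\<^sub>\<infinity>m\<in>multi_idx. norm (c m) * R ^ mdeg m) (\<lambda>x. f (g x))"
  proof (rule ps_infsum[OF \<rho>, where f="\<lambda>m x. mpow (g x) m *\<^sub>R c m"])
    show "ps \<rho> (norm (c m) * R ^ mdeg m) (\<lambda>x. mpow (g x) m *\<^sub>R c m)" for m
      using ps_scaleR[OF \<rho> ps_mpow[OF \<rho> g, of m] ps_const[OF \<rho>, of "c m"]]
      by (simp add: mult_ac)
    show "(\<lambda>m. norm (c m) * R ^ mdeg m) summable_on multi_idx"
      using c by (auto simp: ps_coeffs_def)
    fix x :: 'a assume x: "x \<in> box_ball \<rho>"
    show "f (g x) = (\<Sum>\<^sub>\<infinity>m\<in>multi_idx. mpow (g x) m *\<^sub>R c m)"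
      using c ps_range[OF g x] by (intro infsumI[symmetric]) (auto simp: ps_coeffs_def)
  qed
  then show ?thesis by (rule ps_mono) (rule c)
qed

section \<open>Lipschitz estimates, Taylor expansion and local inversion of power series\<close>

lemma has_sum_minus:
  fixes f g :: "'i \<Rightarrow> 'b::real_normed_vector"
  assumes "(f has_sum a) A" "(g has_sum b) A"
  shows "((\<lambda>x. f x - g x) has_sum (a - b)) A"
  using has_sum_add[OF assms(1) has_sum_bounded_linear[OF bounded_linear_minus[OF bounded_linear_ident] assms(2)]] by simp

lemma ps_ident:
  assumes "0 < \<rho>" shows "ps \<rho> (real DIM('a) * \<rho>) (\<lambda>x::'a::euclidean_space. x)"
  by (rule ps_collapse[where A=Basis and e=unit_idx and c="\<lambda>i. i"])
     (use assms in \<open>auto simp: euclidean_representation\<close>)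

text \<open>Telescoping: u^(n+1) - v^(n+1) = u (u^n - v^n) + (u - v) v^n. The constant is the
  derivative of s^n at s = \<open>R\<close>, times \<delta>; for n = 0 the truncated exponent is
  harmless because of the factor n.\<close>

lemma ps_power_diff:
  fixes u v :: "'a::euclidean_space \<Rightarrow> real"
  assumes "0 < \<rho>" "ps \<rho> R u" "ps \<rho> R v" "ps \<rho> \<delta> (\<lambda>x. u x - v x)"
  shows "ps \<rho> (real n * R ^ (n - 1) * \<delta>) (\<lambda>x. u x ^ n - v x ^ n)"
proof (induction n)
  case 0 then show ?case using ps_const[OF assms(1), of "0::real"] by simp
next
  case (Suc n)
  have "ps \<rho> (R * (real n * R ^ (n - 1) * \<delta>) + \<delta> * R ^ n)
    (\<lambda>x. u x * (u x ^ n - v x ^ n) + (u x - v x) * v x ^ n)"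
    by (intro ps_add ps_mult ps_power assms Suc)
  also have "R * (real n * R ^ (n - 1) * \<delta>) + \<delta> * R ^ n = real (Suc n) * R ^ (Suc n - 1) * \<delta>"
    by (cases n) (auto simp: algebra_simps)
  finally show ?case by (simp add: algebra_simps)
qed

text \<open>One factor is exchanged at a time, as in the product rule; the resulting constants add
  up to that of a single power whose exponent is the total degree.\<close>

lemma ps_prod_diff:
  fixes u v :: "'i \<Rightarrow> 'a::euclidean_space \<Rightarrow> real"
  assumes "0 < \<rho>" "finite I" "\<And>i. i \<in> I \<Longrightarrow> ps \<rho> R (u i)" "\<And>i. i \<in> I \<Longrightarrow> ps \<rho> R (v i)"
    "\<And>i. i \<in> I \<Longrightarrow> ps \<rho> \<delta> (\<lambda>x. u i x - v i x)"
  shows "ps \<rho> (real (sum n I) * R ^ (sum n I - 1) * \<delta>) (\<lambda>x. (\<Prod>i\<in>I. u i x ^ n i) - (\<Prod>i\<in>I. v i x ^ n i))"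
  using assms(2-5)
proof (induction I)
  case empty then show ?case using ps_const[OF assms(1), of "0::real"] by simp
next
  case (insert i I)
  let ?N = "sum n I"
  have P: "ps \<rho> (\<Prod>i\<in>I. R ^ n i) (\<lambda>x. \<Prod>i\<in>I. v i x ^ n i)"
    by (intro ps_prod assms(1) insert ps_power) auto
  have "ps \<rho> (R ^ n i * (real ?N * R ^ (?N - 1) * \<delta>) + (real (n i) * R ^ (n i - 1) * \<delta>) * (\<Prod>i\<in>I. R ^ n i))
    (\<lambda>x. u i x ^ n i * ((\<Prod>i\<in>I. u i x ^ n i) - (\<Prod>i\<in>I. v i x ^ n i)) + (u i x ^ n i - v i x ^ n i) * (\<Prod>i\<in>I. v i x ^ n i))"
    by (intro ps_add ps_mult ps_power ps_power_diff P assms(1) insert) auto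
  also have "(\<Prod>i\<in>I. R ^ n i) = R ^ ?N" by (simp add: power_sum)
  also have "R ^ n i * (real ?N * R ^ (?N - 1) * \<delta>) + (real (n i) * R ^ (n i - 1) * \<delta>) * R ^ ?N
      = real (n i + ?N) * R ^ (n i + ?N - 1) * \<delta>"
    by (cases "n i"; cases "?N") (auto simp: algebra_simps power_add)
  finally show ?case using insert(1,2) by (simp add: algebra_simps)
qed

text \<open>\<open>K\<close> bounds the derivative at \<open>R\<close> of the majorant of
  \<open>h\<close>, the one-variable series that collects the numbers \<open>norm (c m)\<close> by
  degree. It serves as a Lipschitz constant, in the coefficient norm, of the substitution u
  \<mapsto> h \<circ> u.\<close>

lemma ps_compose_diff:
  fixes u v :: "'a::euclidean_space \<Rightarrow> 'c::euclidean_space" and h :: "'c \<Rightarrow> 'b::banach"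
  assumes \<rho>: "0 < \<rho>" and h: "ps_coeffs R c h"
    and s: "(\<lambda>m. norm (c m) * (real (mdeg m) * R ^ (mdeg m - 1))) summable_on multi_idx"
    and K: "(\<Sum>\<^sub>\<infinity>m\<in>multi_idx. norm (c m) * (real (mdeg m) * R ^ (mdeg m - 1))) \<le> K"
    and u: "\<And>i. i \<in> Basis \<Longrightarrow> ps \<rho> R (\<lambda>x. u x \<bullet> i)"
    and v: "\<And>i. i \<in> Basis \<Longrightarrow> ps \<rho> R (\<lambda>x. v x \<bullet> i)"
    and uv: "\<And>i. i \<in> Basis \<Longrightarrow> ps \<rho> \<delta> (\<lambda>x. u x \<bullet> i - v x \<bullet> i)" and \<delta>: "0 \<le> \<delta>"
  shows "ps \<rho> (K * \<delta>) (\<lambda>x. h (u x) - h (v x))"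
proof -
  let ?K = "\<lambda>m. norm (c m) * (real (mdeg m) * R ^ (mdeg m - 1))"
  have "ps \<rho> (\<Sum>\<^sub>\<infinity>m\<in>multi_idx. ?K m * \<delta>) (\<lambda>x. h (u x) - h (v x))"
  proof (rule ps_infsum[OF \<rho>, where f="\<lambda>m x. (mpow (u x) m - mpow (v x) m) *\<^sub>R c m"])
    show "ps \<rho> (?K m * \<delta>) (\<lambda>x. (mpow (u x) m - mpow (v x) m) *\<^sub>R c m)" for m
      using ps_scaleR[OF \<rho> ps_prod_diff[OF \<rho> finite_Basis, where u="\<lambda>i x. u x \<bullet> i" and v="\<lambda>i x. v x \<bullet> i" and n=m, OF u v uv] ps_const[OF \<rho>, of "c m"]]
      by (simp add: mult_ac mpow_def mdeg_def)
    show "(\<lambda>m. ?K m * \<delta>) summable_on multi_idx"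
      by (intro summable_on_cmult_left s)
    fix x :: 'a assume x: "x \<in> box_ball \<rho>"
    show "h (u x) - h (v x) = (\<Sum>\<^sub>\<infinity>m\<in>multi_idx. (mpow (u x) m - mpow (v x) m) *\<^sub>R c m)"
      using h ps_range[OF u x] ps_range[OF v x]
      by (intro infsumI[symmetric])
         (auto simp: ps_coeffs_def scaleR_diff_left intro!: has_sum_minus)
  qed
  also have "(\<Sum>\<^sub>\<infinity>m\<in>multi_idx. ?K m * \<delta>) = infsum ?K multi_idx * \<delta>"
    by (rule infsum_cmult_left')
  finally show ?thesis by (rule ps_mono) (use K \<delta> in \<open>simp add: mult_right_mono\<close>)
qed

lemma mdeg_eq_0: "m \<in> multi_idx \<Longrightarrow> mdeg m = 0 \<Longrightarrow> m = restrict (\<lambda>_. 0) Basis"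
  unfolding mdeg_def multi_idx_def by (auto simp: fun_eq_iff PiE_def extensional_def)

lemma mdeg_eq_1:
  assumes "m \<in> multi_idx" "mdeg m = 1" shows "m \<in> unit_idx ` Basis"
proof -
  obtain i where i: "i \<in> Basis" "m i = 1" "\<And>j. j \<in> Basis \<Longrightarrow> j \<noteq> i \<Longrightarrow> m j = 0"
    using assms(2) sum_eq_1_iff[of Basis m] unfolding mdeg_def by auto
  then have "m = unit_idx i"
    using assms(1) by (auto simp: fun_eq_iff unit_idx_def multi_idx_def PiE_def extensional_def restrict_def)
  then show ?thesis using i by blast
qed

lemma unit_idx_inj: "inj_on unit_idx Basis"
proof (rule inj_onI)
  fix i j :: 'a assume ij: "i \<in> Basis" "j \<in> Basis" "unit_idx i = unit_idx j"
  then have "unit_idx i i = unit_idx j i" by simp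
  then show "i = j" using ij by (auto simp: unit_idx_def split: if_splits)
qed

text \<open>On the cube of radius \<open>norm x\<close> every surviving term is smaller than on the
  cube of radius \<rho> by at least the factor \<open>(norm x / \<rho>) ^ N\<close>.\<close>

lemma ps_coeffs_deg_bound:
  assumes "ps_coeffs \<rho> c h" "0 < \<rho>" "\<And>m. m \<in> multi_idx \<Longrightarrow> mdeg m < N \<Longrightarrow> c m = 0" "norm x \<le> \<rho>"
  shows "norm (h x) \<le> (\<Sum>\<^sub>\<infinity>m\<in>multi_idx. norm (c m) * \<rho> ^ mdeg m) * (norm x / \<rho>) ^ N"
proof -
  let ?N = "\<lambda>m. norm (c m) * \<rho> ^ mdeg m"
  have 1: "ps_coeffs (norm x) c h"
    using ps_coeffs_shrink(1)[OF assms(1)] assms by simp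
  have le: "norm (c m) * norm x ^ mdeg m \<le> ?N m * (norm x / \<rho>) ^ N" if "m \<in> multi_idx" for m
  proof (cases "mdeg m < N")
    case False
    have "norm x ^ mdeg m = \<rho> ^ mdeg m * (norm x / \<rho>) ^ mdeg m"
      using assms by (simp add: power_divide)
    also have "\<dots> \<le> \<rho> ^ mdeg m * (norm x / \<rho>) ^ N"
      using assms False by (intro mult_left_mono power_decreasing) auto
    finally show ?thesis by (simp add: mult_left_mono mult.assoc)
  qed (use that assms in simp)
  have "norm (h x) \<le> (\<Sum>\<^sub>\<infinity>m\<in>multi_idx. norm (c m) * norm x ^ mdeg m)"
    by (rule ps_coeffs_bound[OF 1 box_ball_norm]) simp
  also have "\<dots> \<le> (\<Sum>\<^sub>\<infinity>m\<in>multi_idx. ?N m * (norm x / \<rho>) ^ N)"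
    using 1 assms(1) by (intro infsum_mono le summable_on_cmult_left) (auto simp: ps_coeffs_def)
  finally show ?thesis by (simp only: infsum_cmult_left')
qed

text \<open>Removing the monomials of degree 0 and 1 leaves a series that starts in degree 2 and is
  O(|x|^2); hence the linear part is the derivative. The remainder is returned with its
  coefficients, because the inversion has to estimate them.\<close>

lemma ps_taylor:
  fixes f :: "'a::euclidean_space \<Rightarrow> 'b::banach"
  assumes f: "ps \<rho> C f" and \<rho>: "0 < \<rho>"
  obtains L c h where "(f has_derivative L) (at 0)" "ps_coeffs \<rho> c h" "\<And>m. m \<in> multi_idx \<Longrightarrow> mdeg m < 2 \<Longrightarrow> c m = 0"
    "\<And>x. x \<in> box_ball \<rho> \<Longrightarrow> f x = f 0 + L x + h x"
proof -
  from f obtain d where d: "ps_coeffs \<rho> d f" unfolding ps_def by blast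
  define A where "A = insert (restrict (\<lambda>_. 0) Basis) (unit_idx ` (Basis::'a set))"
  define c where "c m = (if mdeg m < 2 then 0 else d m)" for m
  define L where "L x = (\<Sum>i\<in>Basis. (x \<bullet> i) *\<^sub>R d (unit_idx i))" for x
  define a where "a = d (restrict (\<lambda>_. 0) Basis)"
  define h where "h x = f x - (a + L x)" for x
  have A: "finite A" "A \<subseteq> multi_idx" by (auto simp: A_def multi_idx_def unit_idx_def)
  have notin: "restrict (\<lambda>_. 0) Basis \<notin> unit_idx ` (Basis::'a set)"
    by (metis image_iff mdeg_0 unit_idx_simps(2) zero_neq_one)
  have degA: "m \<in> multi_idx \<Longrightarrow> mdeg m < 2 \<longleftrightarrow> m \<in> A" for m :: "'a \<Rightarrow> nat"
    using mdeg_eq_0[of m] mdeg_eq_1[of m] by (auto simp: A_def less_2_cases_iff)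
  have sumA: "(\<Sum>m\<in>A. mpow x m *\<^sub>R d m) = a + L x" for x
    using notin by (simp add: A_def a_def L_def sum.reindex[OF unit_idx_inj])
  have c: "ps_coeffs \<rho> c h"
    unfolding ps_coeffs_def
  proof (intro conjI ballI)
    show "(\<lambda>m. norm (c m) * \<rho> ^ mdeg m) summable_on multi_idx"
      by (rule summable_on_comparison_test[where f="\<lambda>m. norm (d m) * \<rho> ^ mdeg m"])
         (use d \<rho> in \<open>auto simp: c_def ps_coeffs_def\<close>)
    fix x :: 'a assume x: "x \<in> box_ball \<rho>"
    have "((\<lambda>m. if mdeg m < 2 then mpow x m *\<^sub>R d m else 0) has_sum (a + L x)) multi_idx"
      by (rule has_sum_finite_neutralI[OF A]) (auto simp: degA sumA[symmetric] subsetD[OF A(2)] intro!: sum.cong)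
    then have "((\<lambda>m. mpow x m *\<^sub>R d m - (if mdeg m < 2 then mpow x m *\<^sub>R d m else 0)) has_sum (f x - (a + L x))) multi_idx"
      using d x by (intro has_sum_minus) (auto simp: ps_coeffs_def)
    then show "((\<lambda>m. mpow x m *\<^sub>R c m) has_sum h x) multi_idx"
      unfolding h_def c_def by (rule has_sum_cong[THEN iffD1, rotated, OF _]) auto
  qed
  have c0: "c m = 0" if "m \<in> multi_idx" "mdeg m < 2" for m using that by (simp add: c_def)
  have L: "bounded_linear L"
    unfolding L_def by (intro bounded_linear_sum bounded_linear_scaleR_const bounded_linear_inner_left)
  have "norm (h 0) \<le> 0"
    using ps_coeffs_deg_bound[where N=2 and x=0, OF c \<rho> c0] \<rho> by simp
  then have fa: "f 0 = a"
    using L by (simp add: h_def linear_simps)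
  let ?D = "\<Sum>\<^sub>\<infinity>m\<in>multi_idx. norm (c m) * \<rho> ^ mdeg m"
  have "(f has_derivative L) (at 0)"
  proof (rule has_derivativeI_sandwich[OF \<rho> L])
    fix y :: 'a assume y: "y \<noteq> 0" "dist y 0 < \<rho>"
    have "norm (h y) / norm y \<le> ?D * (norm y / \<rho>)\<^sup>2 / norm y"
      using ps_coeffs_deg_bound[where N=2 and x=y, OF c \<rho> c0] y by (intro divide_right_mono) auto
    also have "?D * (norm y / \<rho>)\<^sup>2 / norm y = ?D / \<rho>\<^sup>2 * norm y"
      using y(1) by (simp add: power_divide power2_eq_square)
    finally show "norm (f y - f 0 - L (y - 0)) / norm (y - 0) \<le> ?D / \<rho>\<^sup>2 * norm y"
      by (simp add: h_def fa algebra_simps)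
  next
    show "((\<lambda>y. ?D / \<rho>\<^sup>2 * norm y) \<longlongrightarrow> 0) (at 0)"
      by (intro tendsto_mult_right_zero tendsto_norm_zero tendsto_ident_at)
  qed
  then show thesis
    by (rule that[OF _ c c0]) (simp_all add: h_def fa)
qed

text \<open>For a series starting in degree 2 the derivative of the majorant vanishes at 0, so the
  Lipschitz constant of \<open>ps_compose_diff\<close> can be made as small as desired by shrinking
  the cube.\<close>

lemma ps_coeffs_small_lipschitz:
  assumes c: "ps_coeffs \<rho> c h" and \<rho>: "0 < \<rho>" and c0: "\<And>m. m \<in> multi_idx \<Longrightarrow> mdeg m < 2 \<Longrightarrow> c m = 0" and "0 < (\<kappa>::real)" "0 < \<epsilon>"
  obtains R where "0 < R" "R \<le> \<epsilon>" "R \<le> \<rho>"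
    "(\<lambda>m. norm (c m) * (real (mdeg m) * R ^ (mdeg m - 1))) summable_on multi_idx"
    "(\<Sum>\<^sub>\<infinity>m\<in>multi_idx. norm (c m) * (real (mdeg m) * R ^ (mdeg m - 1))) \<le> \<kappa>"
proof -
  let ?N = "\<lambda>m. norm (c m) * \<rho> ^ mdeg m"
  define D where "D = infsum ?N multi_idx"
  have D: "0 \<le> D" unfolding D_def using \<rho> by (intro infsum_nonneg) auto
  \<comment> \<open>The new radius is \<open>s * \<rho>\<close>. The bound 1/4 gives (n + 2) s^n
    \<le> 2, the second bound keeps the radius below \<epsilon>, and the third makes
    \<open>(2 * s / \<rho>) * (D + 1)\<close> at most \<kappa>; \<open>D + 1\<close> avoids a
    division by zero.\<close>
  define s where "s = min (1/4) (min (\<epsilon> / \<rho>) (\<kappa> * \<rho> / (2 * (D + 1))))"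
  have "0 < \<kappa> * \<rho> / (2 * (D + 1))"
    using assms D by (intro divide_pos_pos) auto
  then have s: "0 < s" "s \<le> 1/4" "s \<le> \<epsilon> / \<rho>" "s \<le> \<kappa> * \<rho> / (2 * (D + 1))"
    using assms D unfolding s_def by (simp, linarith, linarith, linarith)
  let ?K = "\<lambda>m. norm (c m) * (real (mdeg m) * (s * \<rho>) ^ (mdeg m - 1))"
  have le: "?K m \<le> (2 * s / \<rho>) * ?N m" if "m \<in> multi_idx" for m
  proof (cases "mdeg m < 2")
    case False
    then obtain n where n: "mdeg m = Suc (Suc n)" by (metis add_2_eq_Suc le_Suc_ex not_le)
    have "real (Suc (Suc n)) \<le> 2 * 4 ^ n"
    proof (induction n)
      case (Suc n)
      have "real (Suc (Suc (Suc n))) \<le> 4 * real (Suc (Suc n))" by simp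
      also have "\<dots> \<le> 2 * 4 ^ Suc n" using Suc by simp
      finally show ?case .
    qed simp
    then have "real (Suc (Suc n)) * s ^ n \<le> 2 * 4 ^ n * (1/4) ^ n"
      using s by (intro mult_mono power_mono) auto
    then have "real (Suc (Suc n)) * s ^ n \<le> 2" by (simp add: power_divide)
    then have "s * \<rho> ^ Suc n * (real (Suc (Suc n)) * s ^ n) \<le> s * \<rho> ^ Suc n * 2"
      using s \<rho> by (intro mult_left_mono) auto
    then have "real (mdeg m) * (s * \<rho>) ^ (mdeg m - 1) \<le> (2 * s / \<rho>) * \<rho> ^ mdeg m"
      using \<rho> n by (simp add: power_mult_distrib mult_ac)
    then show ?thesis
      using mult_left_mono[of _ _ "norm (c m)"] by (fastforce simp: mult_ac)
  qed (use that c0 in simp)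
  have sN: "(\<lambda>m. (2 * s / \<rho>) * ?N m) summable_on multi_idx"
    using c by (intro summable_on_cmult_right) (auto simp: ps_coeffs_def)
  have sK: "?K summable_on multi_idx"
    by (rule summable_on_comparison_test[OF sN le]) (use s \<rho> in auto)
  have "infsum ?K multi_idx \<le> (2 * s / \<rho>) * D"
    using infsum_mono[OF sK sN le] unfolding infsum_cmult_right' D_def by blast
  also have "\<dots> \<le> (2 * s / \<rho>) * (D + 1)"
    using s \<rho> by (intro mult_left_mono) auto
  also have "\<dots> \<le> \<kappa>"
    using s(4) \<rho> D by (simp add: field_simps)
  finally have "infsum ?K multi_idx \<le> \<kappa>" .
  with sK show thesis
    using s \<rho> by (intro that[of "s * \<rho>"]) (auto simp: field_simps)
qed

text \<open>The equation \<open>L u + h u = y\<close> is solved by the iteration \<open>u \<mapsto> L\<inverse> (y - h u)\<close>, which contracts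
  the coefficient norm.\<close>

lemma ps_right_inverse:
  fixes f :: "'a::euclidean_space \<Rightarrow> 'b::euclidean_space"
  assumes f: "ps \<rho>\<^sub>0 C f" and \<rho>\<^sub>0: "0 < \<rho>\<^sub>0" and der: "(f has_derivative L) (at 0)"
    and T: "bounded_linear T" "\<And>y. L (T y) = y" and \<epsilon>: "0 < \<epsilon>"
  obtains \<rho> u where "0 < \<rho>" "\<And>i. i \<in> Basis \<Longrightarrow> ps \<rho> \<epsilon> (\<lambda>y. u y \<bullet> i)"
    "\<And>y. y \<in> box_ball \<rho> \<Longrightarrow> f (u y) = f 0 + y"
proof -
  interpret T: bounded_linear T by fact
  obtain L' c h where L': "(f has_derivative L') (at 0)" and c: "ps_coeffs \<rho>\<^sub>0 c h"
    and c0: "\<And>m. m \<in> multi_idx \<Longrightarrow> mdeg m < 2 \<Longrightarrow> c m = 0"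
    and fx: "\<And>x. x \<in> box_ball \<rho>\<^sub>0 \<Longrightarrow> f x = f 0 + L' x + h x"
    using ps_taylor[OF f \<rho>\<^sub>0] by metis
  have LL: "L' = L" using L' der by (rule has_derivative_unique)
  obtain B where B: "0 < B" "\<And>y. norm (T y) \<le> B * norm y"
    using T.pos_bounded by (metis mult.commute)
  \<comment> \<open>The Lipschitz constant 1 / (2 B) of \<open>h\<close> becomes 1/2 after applying
    \<open>T\<close>, which enlarges norms at most by the factor \<open>B\<close>.\<close>
  obtain R where R: "0 < R" "R \<le> \<epsilon>" "R \<le> \<rho>\<^sub>0"
    and sR: "(\<lambda>m. norm (c m) * (real (mdeg m) * R ^ (mdeg m - 1))) summable_on multi_idx"
    and KR: "(\<Sum>\<^sub>\<infinity>m\<in>multi_idx. norm (c m) * (real (mdeg m) * R ^ (mdeg m - 1))) \<le> 1 / (2 * B)"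
    using ps_coeffs_small_lipschitz[OF c \<rho>\<^sub>0 c0, of "1 / (2 * B)" \<epsilon>] B \<epsilon> by auto
  have cR: "ps_coeffs R c h" using ps_coeffs_shrink(1)[OF c] R by simp
  have h0: "h 0 = 0"
    using ps_coeffs_deg_bound[where N=2 and x=0, OF c \<rho>\<^sub>0 c0] \<rho>\<^sub>0 by simp
  \<comment> \<open>Chosen so that the linear term \<open>T\<close> has coefficient norm
    \<open>R / 2\<close>, half of the room available to the iteration.\<close>
  define \<rho> where "\<rho> = R / (2 * B * real DIM('b))"
  have \<rho>: "0 < \<rho>" using R B by (simp add: \<rho>_def)
  have lip: "ps \<rho> (\<delta> / 2) (\<lambda>y. T (h (u y)) - T (h (v y)))"
    if "\<And>i. i \<in> Basis \<Longrightarrow> ps \<rho> R (\<lambda>x. u x \<bullet> i)" "\<And>i. i \<in> Basis \<Longrightarrow> ps \<rho> R (\<lambda>x. v x \<bullet> i)"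
       "\<And>i. i \<in> Basis \<Longrightarrow> ps \<rho> \<delta> (\<lambda>x. u x \<bullet> i - v x \<bullet> i)" "0 \<le> \<delta>" for u v :: "'b \<Rightarrow> 'a" and \<delta>
  proof -
    have "ps \<rho> (B * (1 / (2 * B) * \<delta>)) (\<lambda>y. T (h (u y) - h (v y)))"
      by (rule ps_bounded_linear[OF ps_compose_diff[OF \<rho> cR sR KR that] T(1) _ B(2)]) (use B \<rho> in auto)
    then show ?thesis using B by (simp add: T.diff)
  qed
  have Ty: "ps \<rho> (R / 2) T"
    using ps_bounded_linear[OF ps_ident[OF \<rho>] T(1) _ B(2)] B \<rho> by (simp add: \<rho>_def)
  define U where "U k = ((\<lambda>v y. T y - T (h (v y))) ^^ k) (\<lambda>_. 0)" for k
  have U0: "U 0 = (\<lambda>_. 0)" and US: "U (Suc k) = (\<lambda>y. T y - T (h (U k y)))" for k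
    by (simp_all add: U_def)
  \<comment> \<open>The increments halve at each step, starting with R/2, so the iterate number
    \<open>k\<close> is bounded by R (1 - 2^-k) and never leaves the cube on which the contraction
    estimate holds.\<close>
  have main: "(\<forall>i\<in>Basis. ps \<rho> (R * (1 - (1/2) ^ k)) (\<lambda>y. U k y \<bullet> i)) \<and>
      (\<forall>i\<in>Basis. ps \<rho> (R / 2 * (1/2) ^ k) (\<lambda>y. U (Suc k) y \<bullet> i - U k y \<bullet> i))" for k
  proof (induction k)
    case 0
    show ?case
      using ps_inner_Basis[OF Ty] ps_const[OF \<rho>, where 'a='b, of "0::real"] \<rho> by (simp add: U0 US h0)
  next
    case (Suc k)
    have le: "R * (1 - (1/2) ^ j) \<le> R" for j using R by simp
    have 1: "ps \<rho> (R * (1 - (1/2) ^ Suc k)) (\<lambda>y. U (Suc k) y \<bullet> i)" if "i \<in> Basis" for i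
      using ps_add[OF bspec[OF conjunct1[OF Suc] that] bspec[OF conjunct2[OF Suc] that] \<rho>]
      by (simp add: algebra_simps)
    have "ps \<rho> (R / 2 * (1/2) ^ k / 2) (\<lambda>y. T (h (U (Suc k) y)) - T (h (U k y)))"
      by (rule lip) (use 1 Suc le R in \<open>auto intro: ps_mono[OF _ le] ps_mono[OF 1 le]\<close>)
    from ps_minus[OF this] have "ps \<rho> (R / 2 * (1/2) ^ Suc k) (\<lambda>y. U (Suc (Suc k)) y - U (Suc k) y)"
      using \<rho> by (simp add: US[of "Suc k"] US[of k])
    then have "\<forall>i\<in>Basis. ps \<rho> (R / 2 * (1/2) ^ Suc k) (\<lambda>y. U (Suc (Suc k)) y \<bullet> i - U (Suc k) y \<bullet> i)"
      using ps_inner_Basis[where f="\<lambda>y. U (Suc (Suc k)) y - U (Suc k) y"] \<rho> by (simp add: inner_diff_left)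
    with 1 show ?case by blast
  qed
  define u where "u y = (\<Sum>i\<in>Basis. (\<Sum>\<^sub>\<infinity>k. U (Suc k) y \<bullet> i - U k y \<bullet> i) *\<^sub>R i)" for y
  have ui: "u y \<bullet> i = (\<Sum>\<^sub>\<infinity>k. U (Suc k) y \<bullet> i - U k y \<bullet> i)" if "i \<in> Basis" for y i
    using that by (simp add: u_def inner_sum_left inner_Basis if_distrib cong: if_cong)
  have geo: "((\<lambda>k. R / 2 * (1/2) ^ k) has_sum R) UNIV"
  proof -
    have "(\<lambda>k. R / 2 * (1/2) ^ k) sums (R / 2 * (1 / (1 - 1/2)))"
      by (intro sums_mult geometric_sums) auto
    then show ?thesis using R by (intro sums_nonneg_imp_has_sum) (auto simp: )
  qed
  have ups: "ps \<rho> R (\<lambda>y. u y \<bullet> i)" if "i \<in> Basis" for i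
    using ps_infsum[OF \<rho>, where C="\<lambda>k. R / 2 * (1/2) ^ k" and f="\<lambda>k y. U (Suc k) y \<bullet> i - U k y \<bullet> i" and F="\<lambda>y. u y \<bullet> i" and J=UNIV]
      main that has_sum_imp_summable[OF geo] infsumI[OF geo] by (simp add: ui)
  have lim: "(\<lambda>k. U k y) \<longlonglongrightarrow> u y" if y: "y \<in> box_ball \<rho>" for y
  proof (rule tendsto_componentwise_iff[THEN iffD2], rule ballI)
    fix i :: 'a assume i: "i \<in> Basis"
    have "norm (U (Suc k) y \<bullet> i - U k y \<bullet> i) \<le> R / 2 * (1/2) ^ k" for k
      using ps_bound[OF bspec[OF conjunct2[OF main] i] y] by blast
    then have "(\<lambda>k. U (Suc k) y \<bullet> i - U k y \<bullet> i) summable_on UNIV"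
      by (rule abs_summable_summable[OF Infinite_Sum.abs_summable_on_comparison_test'[OF has_sum_imp_summable[OF geo]]])
    then have "(\<lambda>k. U (Suc k) y \<bullet> i - U k y \<bullet> i) sums (u y \<bullet> i)"
      unfolding ui[OF i] by (intro has_sum_imp_sums) simp
    then have "(\<lambda>n. \<Sum>k<n. U (Suc k) y \<bullet> i - U k y \<bullet> i) \<longlonglongrightarrow> u y \<bullet> i"
      by (simp add: sums_def)
    moreover have "(\<Sum>k<n. U (Suc k) y \<bullet> i - U k y \<bullet> i) = U n y \<bullet> i" for n
      by (subst sum_lessThan_telescope) (simp add: U0)
    ultimately show "(\<lambda>k. U k y \<bullet> i) \<longlonglongrightarrow> u y \<bullet> i" by simp
  qed
  have pc: "ps \<rho> r (\<lambda>_::'b. s)" if "\<bar>s\<bar> \<le> r" for s r :: real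
    using ps_mono[OF ps_const[OF \<rho>, of s]] that by simp
  have lip': "norm (T (h a) - T (h b)) \<le> norm (a - b) / 2" if "a \<in> box_ball R" "b \<in> box_ball R" for a b
  proof -
    have "ps \<rho> (norm (a - b) / 2) (\<lambda>y::'b. T (h a) - T (h b))"
      by (rule lip[where u="\<lambda>_. a" and v="\<lambda>_. b"])
         (use that Basis_le_norm[of _ "a - b"] in \<open>auto simp: box_ball_def inner_diff_left intro!: pc\<close>)
    then show ?thesis using ps_bound[OF _ box_ball_nonneg] \<rho> by fastforce
  qed
  have "f (u y) = f 0 + y" if y: "y \<in> box_ball \<rho>" for y
  proof -
    have uR: "u y \<in> box_ball R" by (rule ps_range[OF ups y])
    have UR: "U k y \<in> box_ball R" for k
      by (rule ps_range[OF _ y], rule ps_mono) (use main R in auto)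
    have "(\<lambda>k. norm (U k y - u y) / 2) \<longlonglongrightarrow> 0"
      using tendsto_norm_zero[OF LIM_zero[OF lim[OF y]]] by (intro tendsto_divide_zero)
    then have "(\<lambda>k. T (h (U k y)) - T (h (u y))) \<longlonglongrightarrow> 0"
      by (rule Lim_null_comparison[rotated]) (intro always_eventually allI lip' UR uR)
    then have "(\<lambda>k. U (Suc k) y) \<longlonglongrightarrow> T y - T (h (u y))"
      unfolding US by (intro tendsto_diff tendsto_const) (simp add: LIM_zero_iff)
    with LIMSEQ_Suc[OF lim[OF y]] have "u y = T y - T (h (u y))"
      using LIMSEQ_unique by blast
    also have "\<dots> = T (y - h (u y))"
      by (simp add: T.diff)
    finally have "L (u y) = y - h (u y)"
      using T(2) by metis
    then show ?thesis
      using fx[of "u y"] uR R LL by (fastforce simp: box_ball_def)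
  qed
  then show thesis
    using \<rho> ups R by (intro that[of \<rho> u] ps_mono[OF ups]) auto
qed

section \<open>Real analytic functions\<close>

lemma prod_Basis_real_prod:
  fixes h :: "'a::euclidean_space \<times> real \<Rightarrow> 'c::comm_monoid_mult"
  shows "(\<Prod>i\<in>Basis. h i) = (\<Prod>i\<in>Basis. h (i, 0)) * h (0, 1)"
proof -
  have "(\<Prod>i\<in>Basis. h i) = (\<Prod>i\<in>(\<lambda>u. (u, 0)) ` Basis. h i) * (\<Prod>i\<in>{(0, 1)}. h i)"
    unfolding Basis_prod_def by (subst prod.union_disjoint[symmetric]) (auto intro!: prod.cong)
  then show ?thesis by (simp add: prod.reindex inj_on_def)
qed

lemma sum_Basis_real_prod:
  fixes h :: "'a::euclidean_space \<times> real \<Rightarrow> 'c::comm_monoid_add"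
  shows "(\<Sum>i\<in>Basis. h i) = (\<Sum>i\<in>Basis. h (i, 0)) + h (0, 1)"
proof -
  have "(\<Sum>i\<in>Basis. h i) = (\<Sum>i\<in>(\<lambda>u. (u, 0)) ` Basis. h i) + (\<Sum>i\<in>{(0, 1)}. h i)"
    unfolding Basis_prod_def by (subst sum.union_disjoint[symmetric]) (auto intro!: sum.cong)
  then show ?thesis by (simp add: sum.reindex inj_on_def)
qed

text \<open>The directional derivative is the coefficient of \<open>t\<close> in the power series of \<open>f (x + t v)\<close> in
  the variables \<open>(x, t)\<close>.\<close>

lemma ps_directional:
  fixes f :: "'a::euclidean_space \<Rightarrow> 'b::banach"
  assumes f: "ps R C f" and R: "0 < R"
  obtains \<rho> D d where "0 < \<rho>" "\<rho> \<le> R" "ps \<rho> D d"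
    "\<And>x. x \<in> box_ball \<rho> \<Longrightarrow> ((\<lambda>t. f (x + t *\<^sub>R v)) has_vector_derivative d x) (at 0)"
proof -
  \<comment> \<open>If |t| and the coordinates of x are at most \<rho>, then those of x + t v are at
    most \<rho> (1 + |v|) = R.\<close>
  define \<rho> where "\<rho> = R / (1 + norm v)"
  have nv: "0 < 1 + norm v" by (smt (verit) norm_ge_zero)
  have \<rho>: "0 < \<rho>" "\<rho> \<le> R" using R nv by (auto simp: \<rho>_def field_simps)
  define g where "g = (\<lambda>(x, t). f (x + t *\<^sub>R v))"
  have "ps \<rho> C (\<lambda>z. f (fst z + snd z *\<^sub>R v))"
  proof (rule ps_compose[OF \<rho>(1) f])
    fix i :: 'a assume i: "i \<in> Basis"
    have 1: "ps \<rho> \<rho> (\<lambda>z::'a\<times>real. fst z \<bullet> i)"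
      using ps_coord[OF \<rho>(1), of "(i, 0::real)"] i by (simp add: Basis_prod_def inner_prod_def)
    have 2: "ps \<rho> \<rho> (\<lambda>z::'a\<times>real. snd z)"
      using ps_coord[OF \<rho>(1), of "(0::'a, 1::real)"] by (simp add: Basis_prod_def inner_prod_def)
    have "ps \<rho> (\<rho> + \<rho> * norm (v \<bullet> i)) (\<lambda>z. fst z \<bullet> i + snd z * (v \<bullet> i))"
      by (intro ps_add ps_mult 1 2 ps_const \<rho>)
    moreover have "\<rho> + \<rho> * norm (v \<bullet> i) \<le> R"
    proof -
      have "\<rho> + \<rho> * norm (v \<bullet> i) \<le> \<rho> * (1 + norm v)"
        using Basis_le_norm[OF i, of v] \<rho> by (simp add: distrib_left mult_left_mono)
      then show ?thesis using nv by (simp add: \<rho>_def)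
    qed
    ultimately show "ps \<rho> R (\<lambda>z. (fst z + snd z *\<^sub>R v) \<bullet> i)"
      by (auto simp: inner_add_left intro: ps_mono)
  qed
  then obtain c where c: "ps_coeffs \<rho> c (\<lambda>z. f (fst z + snd z *\<^sub>R v))" unfolding ps_def by blast
  define e where "e m = restrict (\<lambda>i. m (i, 0)) Basis" for m :: "'a \<times> real \<Rightarrow> nat"
  define k where "k m = m (0, 1)" for m :: "'a \<times> real \<Rightarrow> nat"
  have mp: "mpow (x, t) m = mpow x (e m) * t ^ k m" for x t m
    by (simp add: mpow_def prod_Basis_real_prod inner_prod_def e_def k_def)
  have md: "mdeg m = mdeg (e m) + k m" for m
    by (simp add: mdeg_def sum_Basis_real_prod e_def k_def)
  \<comment> \<open>The terms are sorted by the power of t: \<open>A 0\<close> sums to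
    \<open>f x\<close>, \<open>A 1\<close> to t times the derivative, and \<open>A2\<close> is a
    remainder of size O(t^2).\<close>
  define A where "A j = {m\<in>multi_idx. k m = j}" for j
  define A2 where "A2 = {m\<in>multi_idx. 2 \<le> k m}"
  have un: "multi_idx = A 0 \<union> A 1 \<union> A2" "A 0 \<inter> A 1 = {}" "(A 0 \<union> A 1) \<inter> A2 = {}"
    by (auto simp: A_def A2_def)
  have sub: "A j \<subseteq> multi_idx" "A2 \<subseteq> multi_idx" for j by (auto simp: A_def A2_def)
  let ?N = "\<lambda>m. norm (c m) * \<rho> ^ mdeg m"
  have sN: "?N summable_on multi_idx" using c by (simp add: ps_coeffs_def)
  define a where "a j x = (\<Sum>\<^sub>\<infinity>m\<in>A j. mpow x (e m) *\<^sub>R c m)" for j x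
  have s1: "(\<lambda>m. ?N m / \<rho>) summable_on A 1"
    using summable_on_subset_banach[OF sN sub(1)] by (simp add: divide_inverse summable_on_cmult_left)
  have eqN: "norm (c m) * \<rho> ^ mdeg (e m) = ?N m / \<rho>" if "m \<in> A 1" for m
    using that \<rho> by (simp add: md A_def)
  have pd: "ps \<rho> (\<Sum>\<^sub>\<infinity>m\<in>A 1. ?N m / \<rho>) (a 1)"
  proof (rule ps_collapse[OF \<rho>(1), where A="A 1" and e=e and c=c])
    show "(\<lambda>m. norm (c m) * \<rho> ^ mdeg (e m)) summable_on A 1"
      using s1 by (rule summable_on_cong[THEN iffD1, rotated]) (simp add: eqN)
    show "(\<Sum>\<^sub>\<infinity>m\<in>A 1. norm (c m) * \<rho> ^ mdeg (e m)) \<le> (\<Sum>\<^sub>\<infinity>m\<in>A 1. ?N m / \<rho>)"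
      by (rule eq_refl, rule infsum_cong) (rule eqN)
  qed (auto simp: a_def e_def multi_idx_def)
  let ?D = "infsum ?N multi_idx"
  have ex: "norm (f (x + t *\<^sub>R v) - a 0 x - t *\<^sub>R a 1 x) \<le> ?D * (\<bar>t\<bar> / \<rho>)\<^sup>2"
    if x: "x \<in> box_ball \<rho>" and t: "\<bar>t\<bar> \<le> \<rho>" for x t
  proof -
    let ?T = "\<lambda>m. mpow (x, t) m *\<^sub>R c m"
    have xt: "(x, t) \<in> box_ball \<rho>"
      using x t by (auto simp: box_ball_def Basis_prod_def)
    then have hs: "(?T has_sum f (x + t *\<^sub>R v)) multi_idx"
      using c by (fastforce simp: ps_coeffs_def)
    have sT: "?T summable_on B" if "B \<subseteq> multi_idx" for B
      by (rule summable_on_subset_banach[OF has_sum_imp_summable[OF hs] that])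
    have "f (x + t *\<^sub>R v) = infsum ?T (A 0 \<union> A 1 \<union> A2)"
      unfolding un(1)[symmetric] by (rule infsumI[OF hs, symmetric])
    also have "\<dots> = infsum ?T (A 0) + infsum ?T (A 1) + infsum ?T A2"
      using sub un(2,3) by (subst infsum_Un_disjoint; (intro sT)?; (subst infsum_Un_disjoint)?; (intro sT)?; auto)
    also have "infsum ?T (A 0) = a 0 x"
      unfolding a_def by (intro infsum_cong) (auto simp: A_def mp)
    also have "infsum ?T (A 1) = (\<Sum>\<^sub>\<infinity>m\<in>A 1. t *\<^sub>R mpow x (e m) *\<^sub>R c m)"
      by (intro infsum_cong) (auto simp: A_def mp mult.commute)
    also have "\<dots> = t *\<^sub>R a 1 x"
      unfolding a_def by (rule infsum_scaleR_right)
    finally have eq: "f (x + t *\<^sub>R v) - a 0 x - t *\<^sub>R a 1 x = infsum ?T A2" by simp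
    have le: "norm (?T m) \<le> ?N m * (\<bar>t\<bar> / \<rho>)\<^sup>2" if m: "m \<in> A2" for m
    proof -
      have "\<bar>t\<bar> ^ k m = \<rho> ^ k m * (\<bar>t\<bar> / \<rho>) ^ k m"
        using \<rho> by (simp add: power_divide)
      also have "\<dots> \<le> \<rho> ^ k m * (\<bar>t\<bar> / \<rho>)\<^sup>2"
        using \<rho> t m by (intro mult_left_mono power_decreasing) (auto simp: A2_def)
      finally have "\<bar>mpow x (e m)\<bar> * \<bar>t\<bar> ^ k m \<le> \<rho> ^ mdeg (e m) * (\<rho> ^ k m * (\<bar>t\<bar> / \<rho>)\<^sup>2)"
        using abs_mpow_le[OF x] \<rho> by (intro mult_mono) auto
      then have "norm (c m) * (\<bar>mpow x (e m)\<bar> * \<bar>t\<bar> ^ k m) \<le> norm (c m) * (\<rho> ^ mdeg (e m) * (\<rho> ^ k m * (\<bar>t\<bar> / \<rho>)\<^sup>2))"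
        by (intro mult_left_mono) auto
      then show ?thesis
        by (simp add: mp md power_add abs_mult power_abs mult_ac)
    qed
    have "norm (infsum ?T A2) \<le> (\<Sum>\<^sub>\<infinity>m\<in>A2. ?N m * (\<bar>t\<bar> / \<rho>)\<^sup>2)"
      by (rule norm_infsum_le[OF has_sum_infsum has_sum_infsum le])
         (auto intro!: sT sub summable_on_cmult_left summable_on_subset_banach[OF sN])
    also have "\<dots> = infsum ?N A2 * (\<bar>t\<bar> / \<rho>)\<^sup>2" by (rule infsum_cmult_left')
    also have "\<dots> \<le> ?D * (\<bar>t\<bar> / \<rho>)\<^sup>2"
      using \<rho> by (intro mult_right_mono infsum_mono2 sN summable_on_subset_banach[OF sN] sub) auto
    finally show ?thesis unfolding eq .
  qed
  have "((\<lambda>t. f (x + t *\<^sub>R v)) has_vector_derivative a 1 x) (at 0)" if x: "x \<in> box_ball \<rho>" for x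
    unfolding has_vector_derivative_def
  proof (rule has_derivativeI_sandwich[OF \<rho>(1)])
    show "bounded_linear (\<lambda>t. t *\<^sub>R a 1 x)" by (rule bounded_linear_scaleR_left)
    have a0: "f x = a 0 x" using ex[OF x, of 0] \<rho> by simp
    fix t :: real assume t: "t \<noteq> 0" "dist t 0 < \<rho>"
    have "norm (f (x + t *\<^sub>R v) - a 0 x - t *\<^sub>R a 1 x) / norm t \<le> ?D * (\<bar>t\<bar> / \<rho>)\<^sup>2 / norm t"
      using ex[OF x, of t] t by (intro divide_right_mono) auto
    also have "\<dots> = ?D / \<rho>\<^sup>2 * \<bar>t\<bar>"
      using t(1) by (cases "t > 0") (simp_all add: power_divide power2_eq_square)
    finally show "norm (f (x + t *\<^sub>R v) - f (x + 0 *\<^sub>R v) - (t - 0) *\<^sub>R a 1 x) / norm (t - 0) \<le> ?D / \<rho>\<^sup>2 * \<bar>t\<bar>"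
      by (simp add: a0)
  next
    show "((\<lambda>t::real. ?D / \<rho>\<^sup>2 * \<bar>t\<bar>) \<longlongrightarrow> 0) (at 0)"
      by (intro tendsto_mult_right_zero tendsto_rabs_zero tendsto_ident_at)
  qed
  then show thesis using that \<rho> pd by blast
qed

text \<open>Beyond some finite \<open>X\<close> all finite partial sums lie within 1 of the limit. A
  term outside \<open>X\<close> is a difference of two of them and has norm at most 2; the terms in
  \<open>X\<close> are bounded by the sum of their norms.\<close>

lemma has_sum_bounded_terms:
  fixes f :: "'i \<Rightarrow> 'b::real_normed_vector"
  assumes "(f has_sum s) A"
  obtains K where "\<And>m. m \<in> A \<Longrightarrow> norm (f m) \<le> K"
proof -
  have "\<forall>\<^sub>F X in finite_subsets_at_top A. dist (sum f X) s < 1"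
    using assms unfolding has_sum_def by (rule tendstoD) simp
  then obtain X where X: "finite X" "X \<subseteq> A"
    and XY: "\<And>Y. finite Y \<Longrightarrow> X \<subseteq> Y \<Longrightarrow> Y \<subseteq> A \<Longrightarrow> dist (sum f Y) s < 1"
    unfolding eventually_finite_subsets_at_top by metis
  have "norm (f m) \<le> 2 + (\<Sum>x\<in>X. norm (f x))" if m: "m \<in> A" for m
  proof (cases "m \<in> X")
    case True
    then have "norm (f m) \<le> (\<Sum>x\<in>X. norm (f x))"
      using X by (intro member_le_sum) auto
    then show ?thesis by simp
  next
    case False
    have "dist (sum f (insert m X)) (sum f X) \<le> dist (sum f (insert m X)) s + dist (sum f X) s"
      by (rule dist_triangle2)
    also have "\<dots> < 1 + 1"
      using XY[of X] XY[of "insert m X"] X m by (intro add_strict_mono) auto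
    finally have "norm (f m) \<le> 2"
      using False X by (simp add: dist_norm)
    then show ?thesis by (simp add: add_increasing2 sum_nonneg)
  qed
  then show thesis using that by blast
qed

text \<open>The sum factors into one geometric series per coordinate. The proof is by contradiction:
  \<open>infsum\<close> of a non-summable family is 0 by convention, whereas the product formula
  gives a power of 2.\<close>

lemma summable_on_half_power_mdeg:
  "(\<lambda>m::'a::euclidean_space \<Rightarrow> nat. (1/2::real) ^ mdeg m) summable_on multi_idx"
proof (rule ccontr)
  assume "\<not> ?thesis"
  then have "(\<Sum>\<^sub>\<infinity>m\<in>(Basis::'a set) \<rightarrow>\<^sub>E UNIV. \<Prod>i\<in>Basis. (1/2::real) ^ m i) = 0"
    by (subst infsum_not_exists) (auto simp: multi_idx_def mdeg_def power_sum)
  moreover have g: "((\<lambda>n. (1/2::real) ^ n) has_sum 2) UNIV"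
    using geometric_sums[of "1/2::real"] by (intro sums_nonneg_imp_has_sum) auto
  have "(\<Sum>\<^sub>\<infinity>m\<in>(Basis::'a set) \<rightarrow>\<^sub>E UNIV. \<Prod>i\<in>Basis. (1/2::real) ^ m i)
      = (\<Prod>i\<in>(Basis::'a set). \<Sum>\<^sub>\<infinity>n. (1/2::real) ^ n)"
    by (rule infsum_prod_PiE_abs) (use has_sum_imp_summable[OF g] in \<open>auto simp: norm_power power_divide\<close>)
  ultimately show False using infsumI[OF g] by simp
qed

lemma norm_box_ball_le: "x \<in> box_ball \<rho> \<Longrightarrow> norm (x::'a::euclidean_space) \<le> real DIM('a) * \<rho>"
proof -
  assume "x \<in> box_ball \<rho>"
  then have "(\<Sum>i\<in>Basis. \<bar>x \<bullet> i\<bar>) \<le> (\<Sum>i\<in>(Basis::'a set). \<rho>)"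
    by (intro sum_mono) (auto simp: box_ball_def)
  then show ?thesis using norm_le_l1[of x] by simp
qed

text \<open>Abel's argument: convergence at the single corner (r, ..., r) of a cube bounds r^|m|
  |c_m|, so on the cube of half the size the terms are dominated by the summable family of the
  numbers 2^-|m|. Conversely a ball lies in the cube of the same radius.\<close>

lemma real_analytic_on_iff_ps:
  fixes f :: "'a::euclidean_space \<Rightarrow> 'b::banach"
  shows "real_analytic_on S f \<longleftrightarrow> (\<forall>a\<in>S. \<exists>\<rho>>0. \<exists>C. ps \<rho> C (\<lambda>x. f (a + x)))"
proof (intro iffI ballI)
  fix a assume "real_analytic_on S f" "a \<in> S"
  then obtain e c where e: "e > 0"
    and c: "\<And>x. x \<in> ball a e \<Longrightarrow> ((\<lambda>m. mpow (x - a) m *\<^sub>R c m) has_sum f x) multi_idx"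
    unfolding real_analytic_on_def mpow_def multi_idx_def by meson
  have c': "((\<lambda>m. mpow x m *\<^sub>R c m) has_sum f (a + x)) multi_idx" if "norm x < e" for x
    using c[of "a + x"] that by (simp add: dist_norm)
  \<comment> \<open>The norm is at most the sum of the absolute coordinates, so the cube of this
    radius lies in the ball of radius \<open>e\<close>.\<close>
  define r where "r = e / (2 * real DIM('a))"
  have r: "0 < r" using e by (simp add: r_def)
  have bb: "norm x < e" if "x \<in> box_ball r" for x :: 'a
    using norm_box_ball_le[OF that] e by (simp add: r_def)
  have One: "r *\<^sub>R One \<in> box_ball r"
    using r by (auto simp: box_ball_def)
  have mr: "mpow (r *\<^sub>R One) m = r ^ mdeg m" for m :: "'a \<Rightarrow> nat"
    by (simp add: mpow_def mdeg_def power_sum)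
  obtain K where K: "\<And>m. m \<in> multi_idx \<Longrightarrow> norm (r ^ mdeg m *\<^sub>R c m) \<le> K"
    using has_sum_bounded_terms[OF c'[OF bb[OF One], unfolded mr]] by metis
  define \<rho> where "\<rho> = r / 2"
  have \<rho>: "0 < \<rho>" using r by (simp add: \<rho>_def)
  have "(\<lambda>m. norm (c m) * \<rho> ^ mdeg m) summable_on multi_idx"
  proof (rule summable_on_comparison_test[OF summable_on_cmult_right[OF summable_on_half_power_mdeg, where c=K]])
    fix m :: "'a \<Rightarrow> nat" assume "m \<in> multi_idx"
    from mult_right_mono[OF K[OF this], of "(1/2) ^ mdeg m"]
    show "norm (c m) * \<rho> ^ mdeg m \<le> K * (1/2) ^ mdeg m"
      using r by (simp add: \<rho>_def power_divide mult_ac)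
  qed (use \<rho> in auto)
  moreover have "box_ball \<rho> \<subseteq> (box_ball r :: 'a set)"
    using r by (auto simp: box_ball_def \<rho>_def)
  ultimately have "ps_coeffs \<rho> c (\<lambda>x. f (a + x))"
    unfolding ps_coeffs_def using c'[OF bb] by blast
  then show "\<exists>\<rho>>0. \<exists>C. ps \<rho> C (\<lambda>x. f (a + x))"
    unfolding ps_def using \<rho> by blast
next
  assume *: "\<forall>a\<in>S. \<exists>\<rho>>0. \<exists>C. ps \<rho> C (\<lambda>x. f (a + x))"
  show "real_analytic_on S f"
    unfolding real_analytic_on_def
  proof
    fix a assume "a \<in> S"
    with * obtain \<rho> c where \<rho>: "0 < \<rho>" and c: "ps_coeffs \<rho> c (\<lambda>x. f (a + x))"
      unfolding ps_def by blast
    have "((\<lambda>m. (\<Prod>i\<in>Basis. ((x - a) \<bullet> i) ^ m i) *\<^sub>R c m) has_sum f x) (Basis \<rightarrow>\<^sub>E UNIV)" if x: "x \<in> ball a \<rho>" for x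
    proof -
      have "x - a \<in> box_ball \<rho>"
        using x by (intro box_ball_norm) (simp add: dist_norm norm_minus_commute)
      then show ?thesis using c unfolding ps_coeffs_def mpow_def multi_idx_def by fastforce
    qed
    then show "\<exists>e>0. \<exists>c. \<forall>x\<in>ball a e. ((\<lambda>m. (\<Prod>i\<in>Basis. ((x - a) \<bullet> i) ^ m i) *\<^sub>R c m) has_sum f x) (Basis \<rightarrow>\<^sub>E UNIV)"
      using \<rho> by blast
  qed
qed

lemma real_analytic_on_cong:
  fixes f :: "'a::euclidean_space \<Rightarrow> 'b::banach"
  assumes "real_analytic_on {a} f" "open U" "a \<in> U" "\<And>x. x \<in> U \<Longrightarrow> f x = g x"
  shows "real_analytic_on {a} g"
proof -
  obtain \<rho> C where \<rho>: "0 < \<rho>" "ps \<rho> C (\<lambda>x. f (a + x))"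
    using assms(1) unfolding real_analytic_on_iff_ps by auto
  obtain e where e: "0 < e" "ball a e \<subseteq> U" by (rule openE[OF assms(2,3)])
  define \<sigma> where "\<sigma> = min \<rho> (e / (2 * real DIM('a)))"
  have \<sigma>: "0 < \<sigma>" "\<sigma> \<le> \<rho>" using \<rho> e by (auto simp: \<sigma>_def)
  have "a + x \<in> U" if x: "x \<in> box_ball \<sigma>" for x
  proof -
    have "norm x \<le> real DIM('a) * \<sigma>" by (rule norm_box_ball_le[OF x])
    also have "\<dots> \<le> real DIM('a) * (e / (2 * real DIM('a)))" by (intro mult_left_mono) (auto simp: \<sigma>_def)
    also have "\<dots> < e" using e by simp
    finally show ?thesis using e by (auto simp: dist_norm)
  qed
  then have "ps \<sigma> C (\<lambda>x. g (a + x))"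
    using ps_cong[OF ps_shrink[OF \<rho>(2), of \<sigma>], of "\<lambda>x. g (a + x)"] \<sigma> assms(4) by simp
  then show ?thesis unfolding real_analytic_on_iff_ps using \<sigma> by blast
qed

lemma real_analytic_on_pointwise: "real_analytic_on S f \<longleftrightarrow> (\<forall>a\<in>S. real_analytic_on {a} f)"
  by (simp add: real_analytic_on_def)

lemma real_analytic_on_differentiable:
  fixes f :: "'a::euclidean_space \<Rightarrow> 'b::banach"
  assumes "real_analytic_on S f" "a \<in> S"
  shows "f differentiable (at a)"
proof -
  obtain \<rho> C where \<rho>: "0 < \<rho>" "ps \<rho> C (\<lambda>x. f (a + x))"
    using assms unfolding real_analytic_on_iff_ps by blast
  obtain L where L: "((\<lambda>x. f (a + x)) has_derivative L) (at 0)"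
    by (rule ps_taylor[OF \<rho>(2,1)])
  have "((\<lambda>x. f (a + (x - a))) has_derivative (\<lambda>x. L x)) (at a)"
    by (rule has_derivative_compose[where f="\<lambda>x. x - a" and g="\<lambda>x. f (a + x)" and f'="\<lambda>x. x"])
       (auto intro!: derivative_eq_intros L)
  then show ?thesis unfolding differentiable_def by auto
qed

text \<open>The Frechet derivative in the direction \<open>v\<close> is the derivative along the
  line x + t v, and the power series of the latter is supplied by
  \<open>ps_directional\<close>.\<close>

lemma real_analytic_on_directional:
  fixes f :: "'a::euclidean_space \<Rightarrow> 'b::banach"
  assumes f: "real_analytic_on S f" and "open S"
  shows "real_analytic_on S (\<lambda>x. frechet_derivative f (at x) v)"
  unfolding real_analytic_on_pointwise[of S]
proof
  fix a assume a: "a \<in> S"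
  obtain R C where R: "0 < R" "ps R C (\<lambda>x. f (a + x))"
    using f a unfolding real_analytic_on_iff_ps by blast
  obtain \<rho> D d where \<rho>: "0 < \<rho>" "ps \<rho> D d"
    and d: "\<And>x. x \<in> box_ball \<rho> \<Longrightarrow> ((\<lambda>t. f (a + (x + t *\<^sub>R v))) has_vector_derivative d x) (at 0)"
    using ps_directional[OF R(2,1), of v] by metis
  have "real_analytic_on {a} (\<lambda>x. d (x - a))"
    unfolding real_analytic_on_iff_ps using \<rho> by auto
  then show "real_analytic_on {a} (\<lambda>x. frechet_derivative f (at x) v)"
  proof (rule real_analytic_on_cong)
    show "open (S \<inter> ball a \<rho>)" "a \<in> S \<inter> ball a \<rho>" using assms a \<rho> by auto
    fix x assume x: "x \<in> S \<inter> ball a \<rho>"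
    then have "x - a \<in> box_ball \<rho>" by (intro box_ball_norm) (simp add: dist_norm norm_minus_commute)
    from d[OF this] have 1: "((\<lambda>t. f (x + t *\<^sub>R v)) has_vector_derivative d (x - a)) (at 0)"
      by (simp add: add.assoc[symmetric])
    have "(f has_derivative frechet_derivative f (at x)) (at x)"
      using real_analytic_on_differentiable[OF f] x by (simp add: frechet_derivative_works)
    then have "((\<lambda>t. f (x + t *\<^sub>R v)) has_derivative (\<lambda>t. frechet_derivative f (at x) (t *\<^sub>R v))) (at 0)"
      by (intro has_derivative_compose[where f="\<lambda>t. x + t *\<^sub>R v" and g=f]) (auto intro!: derivative_eq_intros)
    then have "((\<lambda>t. f (x + t *\<^sub>R v)) has_vector_derivative frechet_derivative f (at x) v) (at 0)"
      using linear_frechet_derivative[of f "at x"] real_analytic_on_differentiable[OF f] x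
      unfolding has_vector_derivative_def by (simp add: linear_cmul)
    with 1 show "d (x - a) = frechet_derivative f (at x) v"
      by (rule vector_derivative_unique_at)
  qed
qed

text \<open>Without a constant term every monomial shrinks at least by the factor \<open>s\<close>
  when the cube is scaled by \<open>s \<le> 1\<close>. This provides the small inner function that
  \<open>ps_compose\<close> asks for.\<close>

lemma ps_small:
  fixes k :: "'a::euclidean_space \<Rightarrow> 'b::banach"
  assumes k: "ps \<rho> C k" and \<rho>: "0 < \<rho>" and k0: "k 0 = 0" and \<epsilon>: "0 < \<epsilon>"
  obtains \<sigma> where "0 < \<sigma>" "\<sigma> \<le> \<rho>" "ps \<sigma> \<epsilon> k"
proof -
  obtain c where c: "ps_coeffs \<rho> c k" using k unfolding ps_def by blast
  let ?z = "restrict (\<lambda>_. 0::nat) (Basis::'a set)"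
  have "((\<lambda>m. mpow 0 m *\<^sub>R c m) has_sum c ?z) multi_idx"
  proof (rule has_sum_finite_neutralI[where B="{?z}"])
    fix m :: "'a \<Rightarrow> nat" assume m: "m \<in> multi_idx - {?z}"
    then have "mdeg m \<noteq> 0" using mdeg_eq_0 by blast
    then obtain i where "i \<in> Basis" "m i \<noteq> 0" unfolding mdeg_def by (meson sum.neutral)
    then show "mpow 0 m *\<^sub>R c m = 0" by (auto simp: mpow_def prod_zero_iff)
  qed (auto simp: multi_idx_def)
  moreover have "((\<lambda>m. mpow 0 m *\<^sub>R c m) has_sum k 0) multi_idx"
    using c box_ball_nonneg[of \<rho>] \<rho> by (auto simp: ps_coeffs_def)
  ultimately have c0: "c ?z = 0" using k0 has_sum_unique by metis
  let ?N = "\<lambda>m. norm (c m) * \<rho> ^ mdeg m"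
  let ?D = "infsum ?N multi_idx"
  have D: "0 \<le> ?D" using \<rho> by (intro infsum_nonneg) auto
  define s where "s = min 1 (\<epsilon> / (?D + 1))"
  have "0 < \<epsilon> / (?D + 1)" using D \<epsilon> by (intro divide_pos_pos) auto
  then have s: "0 < s" "s \<le> 1" "s \<le> \<epsilon> / (?D + 1)" by (auto simp: s_def)
  have sN: "(\<lambda>m. s * ?N m) summable_on multi_idx"
    using c by (intro summable_on_cmult_right) (auto simp: ps_coeffs_def)
  have le: "norm (c m) * (s * \<rho>) ^ mdeg m \<le> s * ?N m" if m: "m \<in> multi_idx" for m
  proof (cases "mdeg m")
    case 0
    then show ?thesis using mdeg_eq_0[OF m] c0 by simp
  next
    case (Suc n)
    then have "(s * \<rho>) ^ mdeg m \<le> s * \<rho> ^ mdeg m"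
      using s \<rho> power_decreasing[of 1 "Suc n" s] by (simp add: power_mult_distrib mult_right_mono)
    then show ?thesis using mult_left_mono[of _ _ "norm (c m)"] by (fastforce simp: mult_ac)
  qed
  have c': "ps_coeffs (s * \<rho>) c k"
    using ps_coeffs_shrink(1)[OF c] s \<rho> by (simp add: mult_left_le_one_le)
  then have "(\<Sum>\<^sub>\<infinity>m\<in>multi_idx. norm (c m) * (s * \<rho>) ^ mdeg m) \<le> s * ?D"
    unfolding infsum_cmult_right'[symmetric] by (intro infsum_mono le sN) (auto simp: ps_coeffs_def)
  also have "\<dots> \<le> s * (?D + 1)" using s by simp
  also have "\<dots> \<le> \<epsilon>" using s D by (simp add: field_simps)
  finally have "ps (s * \<rho>) \<epsilon> k" unfolding ps_def using c' by blast
  then show thesis using s \<rho> by (intro that) (auto simp: mult_left_le_one_le)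
qed

lemma real_analytic_on_compose:
  fixes f :: "'c::euclidean_space \<Rightarrow> 'b::banach" and g :: "'a::euclidean_space \<Rightarrow> 'c"
  assumes g: "real_analytic_on S g" and f: "real_analytic_on T f" and "g ` S \<subseteq> T"
  shows "real_analytic_on S (\<lambda>x. f (g x))"
  unfolding real_analytic_on_iff_ps
proof
  fix a assume a: "a \<in> S"
  then obtain R C where R: "0 < R" "ps R C (\<lambda>y. f (g a + y))"
    using f assms(3) unfolding real_analytic_on_iff_ps by blast
  obtain \<rho> D where \<rho>: "0 < \<rho>" "ps \<rho> D (\<lambda>x. g (a + x))"
    using g a unfolding real_analytic_on_iff_ps by blast
  have "ps \<rho> (D + norm (- g a)) (\<lambda>x. g (a + x) + - g a)"
    by (intro ps_add \<rho> ps_const)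
  from ps_small[OF this \<rho>(1) _ R(1)]
  obtain \<sigma> where \<sigma>: "0 < \<sigma>" "ps \<sigma> R (\<lambda>x. g (a + x) + - g a)" by auto
  have "ps \<sigma> C (\<lambda>x. f (g a + (g (a + x) + - g a)))"
    by (rule ps_compose[OF \<sigma>(1) R(2)]) (use ps_inner_Basis[OF \<sigma>(2)] \<sigma> in auto)
  then show "\<exists>\<rho>>0. \<exists>C. ps \<rho> C (\<lambda>x. f (g (a + x)))" using \<sigma> by auto
qed

lemma real_analytic_on_bounded_linear:
  assumes "bounded_linear (T :: 'a::euclidean_space \<Rightarrow> 'b::banach)"
  shows "real_analytic_on S T"
  unfolding real_analytic_on_iff_ps
proof
  fix a assume "a \<in> S"
  interpret bounded_linear T by fact
  obtain B where B: "0 < B" "\<And>y. norm (T y) \<le> B * norm y"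
    using pos_bounded by (metis mult.commute)
  have "ps 1 (norm (T a) + B * (real DIM('a) * 1)) (\<lambda>x. T a + T x)"
    by (intro ps_add ps_const ps_bounded_linear[OF ps_ident] assms B) (use B in auto)
  then have "ps 1 (norm (T a) + B * (real DIM('a) * 1)) (\<lambda>x. T (a + x))"
    by (simp add: add)
  then show "\<exists>\<rho>>0. \<exists>C. ps \<rho> C (\<lambda>x. T (a + x))"
    using zero_less_one by blast
qed

lemma real_analytic_on_bounded_linear_compose:
  fixes f :: "'a::euclidean_space \<Rightarrow> 'c::banach" and T :: "'c \<Rightarrow> 'b::banach"
  assumes T: "bounded_linear T" and f: "real_analytic_on S f"
  shows "real_analytic_on S (\<lambda>x. T (f x))"
  unfolding real_analytic_on_iff_ps
proof
  fix a assume "a \<in> S"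
  with f obtain \<rho> C where \<rho>: "0 < \<rho>" "ps \<rho> C (\<lambda>x. f (a + x))"
    unfolding real_analytic_on_iff_ps by meson
  obtain B where B: "0 < B" "\<And>y. norm (T y) \<le> B * norm y"
    using bounded_linear.pos_bounded[OF T] by (metis mult.commute)
  have "ps \<rho> (B * C) (\<lambda>x. T (f (a + x)))"
    by (rule ps_bounded_linear[OF \<rho>(2) T _ B(2)]) (use B \<rho> in auto)
  then show "\<exists>\<rho>>0. \<exists>C. ps \<rho> C (\<lambda>x. T (f (a + x)))" using \<rho> by blast
qed

lemma real_analytic_on_add:
  fixes f g :: "'a::euclidean_space \<Rightarrow> 'b::banach"
  assumes "real_analytic_on S f" "real_analytic_on S g"
  shows "real_analytic_on S (\<lambda>x. f x + g x)"
  unfolding real_analytic_on_iff_ps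
proof
  fix a assume "a \<in> S"
  with assms obtain \<rho> C \<sigma> D where "0 < \<rho>" "ps \<rho> C (\<lambda>x. f (a + x))" "0 < \<sigma>" "ps \<sigma> D (\<lambda>x. g (a + x))"
    unfolding real_analytic_on_iff_ps by meson
  then have "ps (min \<rho> \<sigma>) (C + D) (\<lambda>x. f (a + x) + g (a + x))" "0 < min \<rho> \<sigma>"
    by (auto intro!: ps_add intro: ps_shrink)
  then show "\<exists>\<rho>>0. \<exists>C. ps \<rho> C (\<lambda>x. f (a + x) + g (a + x))" by blast
qed

lemma real_analytic_on_scaleR:
  fixes g :: "'a::euclidean_space \<Rightarrow> 'b::banach"
  assumes "real_analytic_on S f" "real_analytic_on S g"
  shows "real_analytic_on S (\<lambda>x. f x *\<^sub>R g x)"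
  unfolding real_analytic_on_iff_ps
proof
  fix a assume "a \<in> S"
  with assms obtain \<rho> C \<sigma> D where "0 < \<rho>" "ps \<rho> C (\<lambda>x. f (a + x))" "0 < \<sigma>" "ps \<sigma> D (\<lambda>x. g (a + x))"
    unfolding real_analytic_on_iff_ps by meson
  then have "ps (min \<rho> \<sigma>) (C * D) (\<lambda>x. f (a + x) *\<^sub>R g (a + x))" "0 < min \<rho> \<sigma>"
    by (auto intro!: ps_scaleR intro: ps_shrink)
  then show "\<exists>\<rho>>0. \<exists>C. ps \<rho> C (\<lambda>x. f (a + x) *\<^sub>R g (a + x))" by blast
qed

lemma real_analytic_on_const:
  "real_analytic_on S (\<lambda>_::'a::euclidean_space. c::'b::banach)"
  unfolding real_analytic_on_iff_ps
  by (intro ballI exI[of _ "1::real"] conjI exI[of _ "norm c"] ps_const) auto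

text \<open>The geometric series 1/(a + x) = (1/a) \<Sum> (-x/a)^n; with \<rho> equal to half of |a|
  the bounds form a geometric series of ratio 1/2.\<close>

lemma real_analytic_on_inverse: "real_analytic_on {x::real. x \<noteq> 0} inverse"
  unfolding real_analytic_on_iff_ps
proof
  fix a :: real assume "a \<in> {x. x \<noteq> 0}"
  then have a: "a \<noteq> 0" by simp
  define \<rho> where "\<rho> = \<bar>a\<bar> / 2"
  have \<rho>: "0 < \<rho>" using a by (simp add: \<rho>_def)
  let ?C = "\<lambda>n. (1 / \<bar>a\<bar>) * (\<rho> / \<bar>a\<bar>) ^ n"
  have "ps \<rho> (infsum ?C UNIV) (\<lambda>x. inverse (a + x))"
  proof (rule ps_infsum[OF \<rho>, where f="\<lambda>n x. inverse a * (- inverse a * x) ^ n"])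
    have 1: "ps \<rho> \<rho> (\<lambda>x::real. x)" using ps_coord[OF \<rho>, of "1::real"] by simp
    show "ps \<rho> (?C n) (\<lambda>x. inverse a * (- inverse a * x) ^ n)" for n
      using ps_mult[OF \<rho> ps_const[OF \<rho>, of "inverse a"] ps_power[OF \<rho> ps_mult[OF \<rho> ps_const[OF \<rho>, of "- inverse a"] 1], of n]]
      by (simp add: field_simps)
    show "?C summable_on UNIV"
      using a by (intro summable_nonneg_imp_summable_on summable_mult summable_geometric) (auto simp: \<rho>_def)
    fix x :: real assume x: "x \<in> box_ball \<rho>"
    have nx: "norm (- inverse a * x) < 1"
    proof -
      have "\<bar>x\<bar> \<le> \<bar>a\<bar> / 2" using x by (simp add: box_ball_def \<rho>_def)
      then have lt: "\<bar>x\<bar> < \<bar>a\<bar>" using a by linarith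
      have eq: "norm (- inverse a * x) = \<bar>x\<bar> / \<bar>a\<bar>"
        by (simp add: abs_mult divide_inverse)
      show ?thesis unfolding eq using a lt by simp
    qed
    have s: "(\<lambda>n. inverse a * (- inverse a * x) ^ n) sums (inverse a * (1 / (1 - - inverse a * x)))"
      by (intro sums_mult geometric_sums nx)
    have ne: "a + x \<noteq> 0"
      using x a by (auto simp: box_ball_def \<rho>_def)
    have "summable (\<lambda>n. norm (inverse a * (- inverse a * x) ^ n))"
      unfolding norm_mult norm_power
      by (intro summable_mult summable_geometric) (use nx in \<open>simp only: norm_mult[symmetric] real_norm_def abs_norm_cancel abs_idempotent\<close>)
    from norm_summable_imp_has_sum[OF this s]
    show "inverse (a + x) = (\<Sum>\<^sub>\<infinity>n. inverse a * (- inverse a * x) ^ n)"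
      using a ne by (simp add: infsumI field_simps)
  qed
  then show "\<exists>\<rho>>0. \<exists>C. ps \<rho> C (\<lambda>x. inverse (a + x))" using \<rho> by blast
qed

section \<open>Calculus of the regularity classes\<close>

lemma frechet_derivativeI: "f differentiable (at x) \<Longrightarrow> (f has_derivative frechet_derivative f (at x)) (at x)"
  by (simp add: frechet_derivative_works)

text \<open>The congruence rule for the class \<open>k\<close> is a hypothesis here because the
  induction step of \<open>Ck_on_cong\<close>, which establishes that rule, itself relies on this
  lemma.\<close>

lemma Ck_on_SucI:
  fixes f :: "'a::real_normed_vector \<Rightarrow> 'b::real_normed_vector"
  assumes "\<And>x. x \<in> S \<Longrightarrow> (f has_derivative f' x) (at x)"
    and "\<And>v. Ck_on k S (\<lambda>x. f' x v)" and cong: "\<And>g h :: 'a \<Rightarrow> 'b. Ck_on k S g \<Longrightarrow> (\<And>x. x \<in> S \<Longrightarrow> g x = h x) \<Longrightarrow> Ck_on k S h"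
  shows "Ck_on (Suc k) S f"
proof -
  have "f' x = frechet_derivative f (at x)" if "x \<in> S" for x
    by (rule frechet_derivative_at[OF assms(1)[OF that]])
  then show ?thesis
    using assms(1) cong[OF assms(2)] by (auto simp: differentiable_def)
qed

lemma Ck_on_cong:
  assumes "open S" "Ck_on k S f" "\<And>x. x \<in> S \<Longrightarrow> f x = g x"
  shows "Ck_on k S g"
  using assms(2,3)
proof (induction k arbitrary: f g)
  case 0
  then show ?case by (auto intro: continuous_on_eq)
next
  case (Suc k)
  have "(g has_derivative frechet_derivative f (at x)) (at x)" if "x \<in> S" for x
    using Suc.prems that by (auto intro!: has_derivative_transform_within_open[OF frechet_derivativeI assms(1)])
  then show ?case
    by (rule Ck_on_SucI) (use Suc in auto)
qed

lemma Ck_on_SucI':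
  assumes "open S" "\<And>x. x \<in> S \<Longrightarrow> (f has_derivative f' x) (at x)" "\<And>v. Ck_on k S (\<lambda>x. f' x v)"
  shows "Ck_on (Suc k) S f"
  using assms by (blast intro: Ck_on_SucI Ck_on_cong)

lemma Ck_on_SucD: "Ck_on (Suc k) S f \<Longrightarrow> Ck_on k S f"
proof (induction k arbitrary: f)
  case 0
  then show ?case
    by (auto intro!: continuous_at_imp_continuous_on differentiable_imp_continuous_within)
qed auto

lemma Ck_on_subset: "Ck_on k S f \<Longrightarrow> T \<subseteq> S \<Longrightarrow> Ck_on k T f"
  by (induction k arbitrary: f) (auto intro: continuous_on_subset)

lemma Ck_on_local:
  assumes "\<And>a. a \<in> S \<Longrightarrow> \<exists>U. open U \<and> a \<in> U \<and> Ck_on k U f"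
  shows "Ck_on k S f"
  using assms
proof (induction k arbitrary: f)
  case 0
  have "isCont f a" if "a \<in> S" for a
    using 0[OF that] continuous_on_eq_continuous_at by auto
  then show ?case
    by (simp add: continuous_at_imp_continuous_on)
next
  case (Suc k)
  show ?case
    unfolding Ck_on.simps
  proof (intro conjI allI ballI)
    show "f differentiable at x" if "x \<in> S" for x
      using Suc.prems[OF that] by auto
    show "Ck_on k S (\<lambda>x. frechet_derivative f (at x) v)" for v
      by (rule Suc.IH) (use Suc.prems in fastforce)
  qed
qed

lemma Ck_on_const: "Ck_on k S (\<lambda>_. c)"
  by (induction k arbitrary: c) (auto simp: frechet_derivative_const)

lemma Ck_on_bounded_linear:
  assumes "bounded_linear T" shows "Ck_on k S T"
proof (cases k)
  case (Suc n)
  have "(T has_derivative T) (at x)" for x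
    by (rule bounded_linear_imp_has_derivative[OF assms])
  then have "frechet_derivative T (at x) = T" for x
    by (metis frechet_derivative_at)
  then show ?thesis
    using Suc bounded_linear_imp_differentiable[OF assms] by (auto intro: Ck_on_const)
qed (simp add: linear_continuous_on[OF assms])

lemma Ck_on_bounded_linear_compose:
  assumes "open S" "bounded_linear T" "Ck_on k S f" shows "Ck_on k S (\<lambda>x. T (f x))"
  using assms(3)
proof (induction k arbitrary: f)
  case (Suc k)
  show ?case
    by (rule Ck_on_SucI'[OF assms(1), where f'="\<lambda>x v. T (frechet_derivative f (at x) v)"])
       (use Suc in \<open>auto intro!: bounded_linear.has_derivative[OF assms(2)] frechet_derivativeI\<close>)
qed (auto intro: continuous_on_compose2[OF linear_continuous_on[OF assms(2), of UNIV]])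

lemma Ck_on_add:
  assumes "open S" "Ck_on k S f" "Ck_on k S g" shows "Ck_on k S (\<lambda>x. f x + g x)"
  using assms(2,3)
proof (induction k arbitrary: f g)
  case (Suc k)
  show ?case
    by (rule Ck_on_SucI'[OF assms(1), where f'="\<lambda>x v. frechet_derivative f (at x) v + frechet_derivative g (at x) v"])
       (use Suc in \<open>auto intro!: has_derivative_add frechet_derivativeI\<close>)
qed (auto intro!: continuous_intros)

lemma Ck_on_scaleR:
  assumes "open S" "Ck_on k S f" "Ck_on k S g" shows "Ck_on k S (\<lambda>x. f x *\<^sub>R g x)"
  using assms(2,3)
proof (induction k arbitrary: f g)
  case (Suc k)
  show ?case
  proof (rule Ck_on_SucI'[OF assms(1), where f'="\<lambda>x v. f x *\<^sub>R frechet_derivative g (at x) v + frechet_derivative f (at x) v *\<^sub>R g x"])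
    show "((\<lambda>x. f x *\<^sub>R g x) has_derivative (\<lambda>v. f x *\<^sub>R frechet_derivative g (at x) v + frechet_derivative f (at x) v *\<^sub>R g x)) (at x)"
      if "x \<in> S" for x
      using Suc.prems that by (auto intro!: has_derivative_scaleR frechet_derivativeI)
    show "Ck_on k S (\<lambda>x. f x *\<^sub>R frechet_derivative g (at x) v + frechet_derivative f (at x) v *\<^sub>R g x)" for v
      using Ck_on_SucD[OF Suc.prems(1)] Ck_on_SucD[OF Suc.prems(2)] Suc
      by (intro Ck_on_add[OF assms(1)] Suc.IH) auto
  qed
qed (auto intro!: continuous_intros)

lemma Ck_on_sum:
  assumes "open S" "\<And>i. i \<in> I \<Longrightarrow> Ck_on k S (f i)"
  shows "Ck_on k S (\<lambda>x. \<Sum>i\<in>I. f i x)"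
  using assms(2) by (induction I rule: infinite_finite_induct) (auto intro: Ck_on_const Ck_on_add[OF assms(1)])

text \<open>The chain rule is expanded over the basis: the derivative becomes a sum of products of
  coordinates of g' with partial derivatives of \<open>f\<close> at \<open>g x\<close>. The latter
  are again composites with \<open>g\<close>, so the induction runs over all
  \<open>f\<close>.\<close>

lemma Ck_on_compose:
  fixes g :: "'a::real_normed_vector \<Rightarrow> 'c::euclidean_space"
  assumes "open S" "open T" "g ` S \<subseteq> T" "Ck_on k S g" "Ck_on k T f"
  shows "Ck_on k S (\<lambda>x. f (g x))"
  using assms(4,5)
proof (induction k arbitrary: f)
  case 0
  then show ?case using assms(3) by (auto intro: continuous_on_compose2)
next
  case (Suc k)
  let ?f' = "\<lambda>x v. \<Sum>i\<in>Basis. (frechet_derivative g (at x) v \<bullet> i) *\<^sub>R frechet_derivative f (at (g x)) i"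
  show ?case
  proof (rule Ck_on_SucI'[OF assms(1), where f'="?f'"])
    fix x assume x: "x \<in> S"
    have f: "(f has_derivative frechet_derivative f (at (g x))) (at (g x))"
      using Suc.prems x assms(3) by (auto intro!: frechet_derivativeI)
    have A: "((\<lambda>x. f (g x)) has_derivative (\<lambda>v. frechet_derivative f (at (g x)) (frechet_derivative g (at x) v))) (at x)"
      using Suc.prems x by (intro has_derivative_compose[where g=f and f=g] f frechet_derivativeI) auto
    have eq: "frechet_derivative f (at (g x)) w = (\<Sum>i\<in>Basis. (w \<bullet> i) *\<^sub>R frechet_derivative f (at (g x)) i)" for w
      using linear_sum[OF has_derivative_linear[OF f], of "\<lambda>i. (w \<bullet> i) *\<^sub>R i" Basis]
      by (simp add: euclidean_representation linear_cmul[OF has_derivative_linear[OF f]])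
    show "((\<lambda>x. f (g x)) has_derivative ?f' x) (at x)"
      by (rule has_derivative_eq_rhs[OF A]) (rule ext, rule eq)
  next
    fix v
    show "Ck_on k S (\<lambda>x. ?f' x v)"
      using Ck_on_SucD[OF Suc.prems(1)] Suc
      by (intro Ck_on_sum Ck_on_scaleR Suc.IH Ck_on_bounded_linear_compose[OF assms(1) bounded_linear_inner_left] assms) auto
  qed
qed

text \<open>The derivative of 1/x contains only the factor 1/x itself, twice, so the induction
  hypothesis covers it.\<close>

lemma Ck_on_inverse: "Ck_on k {x::real. x \<noteq> 0} inverse"
proof (induction k)
  case 0 then show ?case by (auto intro!: continuous_intros)
next
  case (Suc k)
  have op: "open {x::real. x \<noteq> 0}" using open_Compl[of "{0::real}"] by (simp add: Compl_eq)
  show ?case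
  proof (rule Ck_on_SucI'[OF op, where f'="\<lambda>x v. inverse x *\<^sub>R inverse x *\<^sub>R (- v)"])
    show "(inverse has_derivative (\<lambda>v. inverse x *\<^sub>R inverse x *\<^sub>R (- v))) (at x)" if "x \<in> {x. x \<noteq> 0}" for x :: real
      using has_derivative_inverse'[of x UNIV] that by (simp add: fun_eq_iff mult_ac)
  qed (intro Ck_on_scaleR op Suc Ck_on_const)
qed

text \<open>\<open>Some k\<close> stands for \<open>C\<close>-\<open>k\<close>, \<open>None\<close> for real analytic, so that smoothness and
  analyticity are treated uniformly.\<close>

definition reg_on :: "nat option \<Rightarrow> 'a::euclidean_space set \<Rightarrow> ('a \<Rightarrow> 'b::real_normed_vector) \<Rightarrow> bool" where
  "reg_on q S f \<longleftrightarrow> (case q of None \<Rightarrow> real_analytic_on S f | Some k \<Rightarrow> Ck_on k S f)"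

definition reg_set :: "regularity \<Rightarrow> nat option set" where
  "reg_set r = (case r of Smooth \<Rightarrow> range Some | Analytic \<Rightarrow> {None})"

lemma Cr_on_iff_reg: "Cr_on r S f \<longleftrightarrow> (\<forall>q\<in>reg_set r. reg_on q S f)"
  by (cases r) (auto simp: Cr_on_def reg_set_def reg_on_def)

lemma reg_on_cong:
  fixes f :: "'a::euclidean_space \<Rightarrow> 'b::banach"
  assumes "open S" "reg_on q S f" "\<And>x. x \<in> S \<Longrightarrow> f x = g x"
  shows "reg_on q S g"
proof (cases q)
  case None
  then have "\<forall>a\<in>S. real_analytic_on {a} f"
    using assms(2) real_analytic_on_pointwise by (auto simp: reg_on_def)
  then have "\<forall>a\<in>S. real_analytic_on {a} g"
    using real_analytic_on_cong[OF _ assms(1)] assms(3) by blast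
  then show ?thesis
    unfolding reg_on_def None using real_analytic_on_pointwise by fastforce
qed (use assms in \<open>auto simp: reg_on_def intro: Ck_on_cong\<close>)

lemma reg_on_subset: "reg_on q S f \<Longrightarrow> T \<subseteq> S \<Longrightarrow> reg_on q T f"
  by (auto simp: reg_on_def real_analytic_on_def split: option.splits intro: Ck_on_subset)

lemma reg_on_local:
  assumes "\<And>a. a \<in> S \<Longrightarrow> \<exists>U. open U \<and> a \<in> U \<and> reg_on q U f"
  shows "reg_on q S f"
proof (cases q)
  case None
  then show ?thesis using assms unfolding reg_on_def real_analytic_on_def by auto
next
  case (Some k)
  then show ?thesis using assms by (auto simp: reg_on_def intro: Ck_on_local)
qed

lemma reg_on_const: "reg_on q S (\<lambda>_. c::'b::banach)"
  by (simp add: reg_on_def real_analytic_on_const Ck_on_const split: option.splits)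

lemma reg_on_bounded_linear:
  "bounded_linear T \<Longrightarrow> reg_on q S (T :: 'a::euclidean_space \<Rightarrow> 'b::banach)"
  by (auto simp: reg_on_def real_analytic_on_bounded_linear Ck_on_bounded_linear split: option.splits)

lemma reg_on_add:
  fixes f g :: "'a::euclidean_space \<Rightarrow> 'b::banach"
  shows "open S \<Longrightarrow> reg_on q S f \<Longrightarrow> reg_on q S g \<Longrightarrow> reg_on q S (\<lambda>x. f x + g x)"
  by (auto simp: reg_on_def intro: real_analytic_on_add Ck_on_add split: option.splits)

lemma reg_on_scaleR:
  fixes g :: "'a::euclidean_space \<Rightarrow> 'b::banach"
  shows "open S \<Longrightarrow> reg_on q S f \<Longrightarrow> reg_on q S g \<Longrightarrow> reg_on q S (\<lambda>x. f x *\<^sub>R g x)"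
  by (auto simp: reg_on_def intro: real_analytic_on_scaleR Ck_on_scaleR split: option.splits)

lemma reg_on_compose:
  fixes f :: "'c::euclidean_space \<Rightarrow> 'b::banach" and g :: "'a::euclidean_space \<Rightarrow> 'c"
  assumes "open S" "open T" "g ` S \<subseteq> T" "reg_on q S g" "reg_on q T f"
  shows "reg_on q S (\<lambda>x. f (g x))"
  using assms by (auto simp: reg_on_def split: option.splits intro: real_analytic_on_compose Ck_on_compose)

lemma reg_on_bounded_linear_compose:
  fixes f :: "'a::euclidean_space \<Rightarrow> 'c::banach" and T :: "'c \<Rightarrow> 'b::banach"
  assumes "open S" "bounded_linear T" "reg_on q S f"
  shows "reg_on q S (\<lambda>x. T (f x))"
  using assms by (auto simp: reg_on_def split: option.splits
    intro: real_analytic_on_bounded_linear_compose Ck_on_bounded_linear_compose)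

lemma reg_on_mult:
  fixes f g :: "'a::euclidean_space \<Rightarrow> real"
  shows "open S \<Longrightarrow> reg_on q S f \<Longrightarrow> reg_on q S g \<Longrightarrow> reg_on q S (\<lambda>x. f x * g x)"
  using reg_on_scaleR[of S q f g] by simp

lemma reg_on_sum:
  fixes f :: "'i \<Rightarrow> 'a::euclidean_space \<Rightarrow> 'b::banach"
  assumes "open S" "\<And>i. i \<in> I \<Longrightarrow> reg_on q S (f i)"
  shows "reg_on q S (\<lambda>x. \<Sum>i\<in>I. f i x)"
  using assms(2) by (induction I rule: infinite_finite_induct) (auto intro: reg_on_const reg_on_add[OF assms(1)])

lemma reg_on_prod:
  fixes f :: "'i \<Rightarrow> 'a::euclidean_space \<Rightarrow> real"
  assumes "open S" "\<And>i. i \<in> I \<Longrightarrow> reg_on q S (f i)"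
  shows "reg_on q S (\<lambda>x. \<Prod>i\<in>I. f i x)"
  using assms(2) by (induction I rule: infinite_finite_induct) (auto intro: reg_on_const reg_on_mult[OF assms(1)])

lemma reg_on_divide:
  fixes f g :: "'a::euclidean_space \<Rightarrow> real"
  assumes "open S" "reg_on q S f" "reg_on q S g" "\<And>x. x \<in> S \<Longrightarrow> g x \<noteq> 0"
  shows "reg_on q S (\<lambda>x. f x / g x)"
proof -
  have op: "open {x::real. x \<noteq> 0}" using open_Compl[of "{0::real}"] by (simp add: Compl_eq)
  have "reg_on q S (\<lambda>x. inverse (g x))"
    using assms(4) by (intro reg_on_compose[OF assms(1) op _ assms(3)])
      (auto simp: reg_on_def real_analytic_on_inverse Ck_on_inverse split: option.splits)
  then show ?thesis
    unfolding divide_inverse using assms by (intro reg_on_mult)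
qed

lemma reg_on_componentwise:
  fixes f :: "'a::euclidean_space \<Rightarrow> 'b::euclidean_space"
  assumes "open S" "\<And>i. i \<in> Basis \<Longrightarrow> reg_on q S (\<lambda>x. f x \<bullet> i)"
  shows "reg_on q S f"
proof -
  have "reg_on q S (\<lambda>x. \<Sum>i\<in>Basis. (f x \<bullet> i) *\<^sub>R i)"
    by (intro reg_on_sum reg_on_scaleR reg_on_const assms)
  then show ?thesis by (simp add: euclidean_representation)
qed

lemma reg_on_vec:
  fixes f :: "'a::euclidean_space \<Rightarrow> real^'n"
  assumes "open S" "\<And>i. reg_on q S (\<lambda>x. f x $ i)"
  shows "reg_on q S f"
  by (rule reg_on_componentwise[OF assms(1)]) (auto simp: Basis_vec_def inner_axis intro: assms)

lemma reg_on_det: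
  fixes A :: "'a::euclidean_space \<Rightarrow> real^'n^'n"
  assumes "open S" "\<And>i j. reg_on q S (\<lambda>x. A x $ i $ j)"
  shows "reg_on q S (\<lambda>x. det (A x))"
  unfolding det_def by (intro reg_on_sum reg_on_mult reg_on_prod reg_on_const assms)

text \<open>Cramer's rule writes the solution as a quotient of determinants, which are polynomials
  in the entries. It is meant for the derivative of an inverse map, one order \<open>k\<close> at a
  time.\<close>

lemma reg_on_Cramer:
  fixes A :: "'a::euclidean_space \<Rightarrow> real^'n^'n"
  assumes "open S" "\<And>i j. reg_on q S (\<lambda>x. A x $ i $ j)" "\<And>x. x \<in> S \<Longrightarrow> det (A x) \<noteq> 0"
    and w: "\<And>x. x \<in> S \<Longrightarrow> A x *v w x = v"
  shows "reg_on q S w"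
proof -
  have "reg_on q S (\<lambda>x. \<chi> k. det (\<chi> i j. if j = k then v $ i else A x $ i $ j) / det (A x))"
  proof (rule reg_on_vec[OF assms(1)], unfold vec_lambda_beta, intro reg_on_divide reg_on_det assms)
    fix k i j
    show "reg_on q S (\<lambda>x. (\<chi> i j. if j = k then v $ i else A x $ i $ j) $ i $ j)"
      using assms(2)[of i j] by (cases "j = k") (auto intro: reg_on_const)
  qed
  then show ?thesis
    by (rule reg_on_cong[OF assms(1)]) (use cramer[OF assms(3)] w in auto)
qed

lemma Cr_on_continuous_on:
  fixes f :: "'a::euclidean_space \<Rightarrow> 'b::banach"
  assumes "Cr_on r S f" shows "continuous_on S f"
proof (cases r)
  case Smooth
  then show ?thesis using assms by (auto simp: Cr_on_def dest: spec[of _ 0])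
next
  case Analytic
  then show ?thesis using assms real_analytic_on_differentiable[of S f]
    by (auto simp: Cr_on_def intro!: continuous_at_imp_continuous_on differentiable_imp_continuous_within)
qed

lemma Cr_on_differentiable:
  fixes f :: "'a::euclidean_space \<Rightarrow> 'b::banach"
  assumes "Cr_on r S f" "x \<in> S" shows "f differentiable (at x)"
proof (cases r)
  case Smooth
  then have "Ck_on (Suc 0) S f" using assms unfolding Cr_on_def by (metis regularity.simps(3))
  then show ?thesis using assms by simp
qed (use assms real_analytic_on_differentiable in \<open>auto simp: Cr_on_def\<close>)

lemma Cr_on_has_derivative:
  fixes f :: "'a::euclidean_space \<Rightarrow> 'b::banach"
  shows "Cr_on r S f \<Longrightarrow> x \<in> S \<Longrightarrow> (f has_derivative frechet_derivative f (at x)) (at x)"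
  by (intro frechet_derivativeI Cr_on_differentiable)

lemma Cr_on_derivative:
  fixes f :: "'a::euclidean_space \<Rightarrow> 'b::banach"
  assumes "Cr_on r S f" "open S" shows "Cr_on r S (\<lambda>x. frechet_derivative f (at x) v)"
proof (cases r)
  case Smooth
  have "Ck_on k S (\<lambda>x. frechet_derivative f (at x) v)" for k
    using assms Smooth unfolding Cr_on_def by (metis regularity.simps(3) Ck_on.simps(2))
  then show ?thesis using Smooth by (simp add: Cr_on_def)
qed (use assms real_analytic_on_directional in \<open>auto simp: Cr_on_def\<close>)

lemma Cr_on_cong:
  fixes f :: "'a::euclidean_space \<Rightarrow> 'b::banach"
  shows "open S \<Longrightarrow> Cr_on r S f \<Longrightarrow> (\<And>x. x \<in> S \<Longrightarrow> f x = g x) \<Longrightarrow> Cr_on r S g"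
  using reg_on_cong unfolding Cr_on_iff_reg by blast

lemma Cr_on_subset: "Cr_on r S f \<Longrightarrow> T \<subseteq> S \<Longrightarrow> Cr_on r T f"
  using reg_on_subset unfolding Cr_on_iff_reg by blast

lemma Cr_on_local: "(\<And>a. a \<in> S \<Longrightarrow> \<exists>U. open U \<and> a \<in> U \<and> Cr_on r U f) \<Longrightarrow> Cr_on r S f"
  unfolding Cr_on_iff_reg by (meson reg_on_local)

lemma Cr_on_const: "Cr_on r S (\<lambda>_. c::'b::banach)"
  by (simp add: Cr_on_iff_reg reg_on_const)

lemma Cr_on_bounded_linear: "bounded_linear T \<Longrightarrow> Cr_on r S (T :: 'a::euclidean_space \<Rightarrow> 'b::banach)"
  by (simp add: Cr_on_iff_reg reg_on_bounded_linear)

lemma Cr_on_id: "Cr_on r S (\<lambda>x. x :: 'a::euclidean_space)"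
  by (rule Cr_on_bounded_linear[OF bounded_linear_ident])

lemma Cr_on_add:
  fixes f g :: "'a::euclidean_space \<Rightarrow> 'b::banach"
  shows "open S \<Longrightarrow> Cr_on r S f \<Longrightarrow> Cr_on r S g \<Longrightarrow> Cr_on r S (\<lambda>x. f x + g x)"
  by (simp add: Cr_on_iff_reg reg_on_add)

lemma Cr_on_scaleR:
  fixes g :: "'a::euclidean_space \<Rightarrow> 'b::banach"
  shows "open S \<Longrightarrow> Cr_on r S f \<Longrightarrow> Cr_on r S g \<Longrightarrow> Cr_on r S (\<lambda>x. f x *\<^sub>R g x)"
  by (simp add: Cr_on_iff_reg reg_on_scaleR)

lemma Cr_on_compose:
  fixes f :: "'c::euclidean_space \<Rightarrow> 'b::banach" and g :: "'a::euclidean_space \<Rightarrow> 'c"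
  shows "open S \<Longrightarrow> open T \<Longrightarrow> g ` S \<subseteq> T \<Longrightarrow> Cr_on r S g \<Longrightarrow> Cr_on r T f \<Longrightarrow> Cr_on r S (\<lambda>x. f (g x))"
  unfolding Cr_on_iff_reg using reg_on_compose by blast

lemma Cr_on_bounded_linear_compose:
  fixes f :: "'a::euclidean_space \<Rightarrow> 'c::banach" and T :: "'c \<Rightarrow> 'b::banach"
  shows "open S \<Longrightarrow> bounded_linear T \<Longrightarrow> Cr_on r S f \<Longrightarrow> Cr_on r S (\<lambda>x. T (f x))"
  by (simp add: Cr_on_iff_reg reg_on_bounded_linear_compose)

lemma Cr_on_divide:
  fixes f g :: "'a::euclidean_space \<Rightarrow> real"
  shows "open S \<Longrightarrow> Cr_on r S f \<Longrightarrow> Cr_on r S g \<Longrightarrow> (\<And>x. x \<in> S \<Longrightarrow> g x \<noteq> 0) \<Longrightarrow> Cr_on r S (\<lambda>x. f x / g x)"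
  by (simp add: Cr_on_iff_reg reg_on_divide)

lemma Cr_on_vec:
  fixes f :: "'a::euclidean_space \<Rightarrow> real^'n"
  shows "open S \<Longrightarrow> (\<And>i. Cr_on r S (\<lambda>x. f x $ i)) \<Longrightarrow> Cr_on r S f"
  by (simp add: Cr_on_iff_reg reg_on_vec)

lemma Cr_on_Pair:
  fixes f :: "'a::euclidean_space \<Rightarrow> 'b::euclidean_space" and g :: "'a \<Rightarrow> 'c::euclidean_space"
  assumes "open S" "Cr_on r S f" "Cr_on r S g" shows "Cr_on r S (\<lambda>x. (f x, g x))"
proof -
  have "Cr_on r S (\<lambda>x. (f x, 0) + (0, g x))"
    by (intro Cr_on_add assms Cr_on_bounded_linear_compose[where T="\<lambda>y. (y, 0)"]
      Cr_on_bounded_linear_compose[where T="\<lambda>y. (0, y)"])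
       (auto intro: bounded_linear_Pair bounded_linear_ident bounded_linear_zero)
  then show ?thesis by simp
qed

section \<open>The inverse function theorem\<close>

text \<open>The classical theorem gives a differentiable local inverse \<open>g\<close>. In the
  smooth case its derivative is the inverse matrix of F' at \<open>g y\<close>, as regular as
  \<open>g\<close> by Cramer's rule, so \<open>g\<close> gains one order at each step. In the
  analytic case \<open>ps_right_inverse\<close> gives a power series near each point, and it agrees
  with \<open>g\<close> because its values stay where \<open>F\<close> is injective.\<close>

lemma Cr_inverse_function_aux:
  fixes F :: "real^'m \<Rightarrow> real^'m"
  assumes S: "open S" "Cr_on r S F" "a \<in> S" and inj: "inj (frechet_derivative F (at a))"
  obtains U V g where "open U" "U \<subseteq> S" "a \<in> U" "open V" "F a \<in> V" "homeomorphism U V F g" "Cr_on r V g"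
proof -
  let ?D = "\<lambda>x. frechet_derivative F (at x)"
  define F' where "F' x = Blinfun (?D x)" for x
  have der: "(F has_derivative ?D x) (at x)" if "x \<in> S" for x
    by (rule Cr_on_has_derivative[OF S(2) that])
  have F': "blinfun_apply (F' x) = ?D x" if "x \<in> S" for x
    unfolding F'_def by (rule bounded_linear_Blinfun_apply[OF has_derivative_bounded_linear[OF der[OF that]]])
  have cont: "continuous_on S F'"
  proof (rule continuous_on_blinfun_componentwise)
    fix i :: "real^'m"
    have "continuous_on S (\<lambda>x. ?D x i)"
      by (rule Cr_on_continuous_on[OF Cr_on_derivative[OF S(2,1)]])
    then show "continuous_on S (\<lambda>x. blinfun_apply (F' x) i)"
      by (rule continuous_on_eq) (simp add: F')
  qed
  have "linear (?D a)" using der[OF S(3)] by (rule has_derivative_linear)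
  then obtain T where T: "linear T" "T \<circ> ?D a = id"
    using linear_injective_left_inverse inj by metis
  have invf: "Blinfun T o\<^sub>L F' a = id_blinfun"
    by (rule blinfun_eqI)
       (use T S(3) in \<open>auto simp: F' bounded_linear_Blinfun_apply linear_linear fun_eq_iff\<close>)
  obtain U V g g' where U: "open U" "U \<subseteq> S" "a \<in> U" "open V" "F a \<in> V" "homeomorphism U V F g"
    and g': "\<And>y. y \<in> V \<Longrightarrow> (g has_derivative (g' y)) (at y)"
    "\<And>y. y \<in> V \<Longrightarrow> g' y = inv (blinfun_apply (F' (g y)))"
    "\<And>y. y \<in> V \<Longrightarrow> bij (blinfun_apply (F' (g y)))"
    using inverse_function_theorem[OF S(1) _ cont S(3) invf] der F' by metis
  have gV: "g y \<in> U" "g y \<in> S" "F (g y) = y" if "y \<in> V" for y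
    using U that by (auto simp: homeomorphism_def)
  have bij: "bij (?D (g y))" if "y \<in> V" for y
    using g'(3)[OF that] F'[OF gV(2)[OF that]] by simp
  have lin: "linear (?D (g y))" if "y \<in> V" for y
    using der[OF gV(2)[OF that]] by (rule has_derivative_linear)
  have Ck: "Ck_on k V g" if Fk: "\<And>k. Ck_on k S F" for k
  proof (induction k)
    case 0
    then show ?case using U(6) by (simp add: homeomorphism_def)
  next
    case (Suc k)
    show ?case
    proof (rule Ck_on_SucI'[OF U(4) g'(1)])
      fix v
      have "reg_on (Some k) V (\<lambda>y. g' y v)"
      proof (rule reg_on_Cramer[OF U(4), where A="\<lambda>y. matrix (?D (g y))" and v=v])
        fix i j
        have "reg_on (Some k) V (\<lambda>y. ?D (g y) (axis j 1))"
          by (rule reg_on_compose[OF U(4) S(1), where g=g])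
             (use gV Suc Fk[of "Suc k"] in \<open>auto simp: reg_on_def\<close>)
        from reg_on_bounded_linear_compose[OF U(4) bounded_linear_vec_nth[of i] this]
        show "reg_on (Some k) V (\<lambda>y. matrix (?D (g y)) $ i $ j)"
          by (simp add: matrix_def)
      next
        fix y assume y: "y \<in> V"
        show "det (matrix (?D (g y))) \<noteq> 0"
          using det_nz_iff_inj[OF lin[OF y]] bij[OF y] by (simp add: bij_def)
        show "matrix (?D (g y)) *v g' y v = v"
          using bij[OF y] by (simp add: fun_cong[OF matrix_vector_mul(2)[OF lin[OF y]]] g'(2)[OF y] F'[OF gV(2)[OF y]] bij_is_surj surj_f_inv_f)
      qed
      then show "Ck_on k V (\<lambda>y. g' y v)" by (simp add: reg_on_def)
    qed
  qed
  have an: "real_analytic_on V g" if Fa: "real_analytic_on S F"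
    unfolding real_analytic_on_pointwise[of V]
  proof
    fix y assume y: "y \<in> V"
    let ?b = "g y"
    obtain \<rho>0 C where \<rho>0: "0 < \<rho>0" "ps \<rho>0 C (\<lambda>x. F (?b + x))"
      using Fa gV(2)[OF y] unfolding real_analytic_on_iff_ps by auto
    obtain e where e: "0 < e" "ball ?b e \<subseteq> U" by (rule openE[OF U(1) gV(1)[OF y]])
    \<comment> \<open>The cube of this size around \<open>?b\<close> lies in \<open>U\<close>, on
      which \<open>F\<close> is injective; so the series \<open>u\<close> can describe no other
      inverse than \<open>g\<close>.\<close>
    define \<epsilon> where "\<epsilon> = e / (2 * real DIM(real^'m))"
    have \<epsilon>: "0 < \<epsilon>" using e by (simp add: \<epsilon>_def)
    have d0: "((\<lambda>x. F (?b + x)) has_derivative ?D ?b) (at 0)"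
      by (rule has_derivative_compose[where f="\<lambda>x. ?b + x" and g=F and f'="\<lambda>x. x"])
         (auto intro!: derivative_eq_intros der gV(2)[OF y])
    obtain T where "linear T" "T \<circ> ?D ?b = id"
      using linear_injective_left_inverse[OF lin[OF y]] bij[OF y] by (auto simp: bij_def)
    then have bl: "bounded_linear T" and TD: "?D ?b (T w) = w" for w
      using bij[OF y] by (auto simp: linear_conv_bounded_linear bij_def surj_def fun_eq_iff) metis
    obtain \<rho> u where \<rho>: "0 < \<rho>" and u: "\<And>i. i \<in> Basis \<Longrightarrow> ps \<rho> \<epsilon> (\<lambda>z. u z \<bullet> i)"
      and Fu: "\<And>z. z \<in> box_ball \<rho> \<Longrightarrow> F (?b + u z) = F (?b + 0) + z"
      using ps_right_inverse[OF \<rho>0(2,1) d0 bl TD \<epsilon>] by metis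
    have gu: "g (y + z) = ?b + u z" if z: "z \<in> box_ball \<rho>" for z
    proof -
      have "norm (u z) \<le> real DIM(real^'m) * \<epsilon>"
        by (rule norm_box_ball_le[OF ps_range[OF u z]])
      also have "\<dots> < e" using e by (simp add: \<epsilon>_def)
      finally have "?b + u z \<in> U" using e(2) by (auto simp: dist_norm)
      moreover have "F (?b + u z) = y + z" using Fu[OF z] gV(3)[OF y] by simp
      ultimately show ?thesis using U(6) by (metis homeomorphism_apply1)
    qed
    have "reg_on None {y} g"
    proof -
      have "real_analytic_on {y} (\<lambda>x. g x \<bullet> i)" if i: "i \<in> Basis" for i
      proof -
        have "ps \<rho> (norm (?b \<bullet> i) + \<epsilon>) (\<lambda>z. ?b \<bullet> i + u z \<bullet> i)"
          by (intro ps_add ps_const u \<rho> i)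
        then have "ps \<rho> (norm (?b \<bullet> i) + \<epsilon>) (\<lambda>z. g (y + z) \<bullet> i)"
          by (rule ps_cong) (simp add: gu inner_add_left)
        then show ?thesis unfolding real_analytic_on_iff_ps using \<rho> by auto
      qed
      then have "real_analytic_on {y} (\<lambda>x. \<Sum>i\<in>Basis. (g x \<bullet> i) *\<^sub>R i)"
        by (induction rule: infinite_finite_induct[of _ Basis])
           (auto intro!: real_analytic_on_const real_analytic_on_add real_analytic_on_scaleR)
      then show ?thesis by (simp add: euclidean_representation reg_on_def)
    qed
    then show "real_analytic_on {y} g" by (simp add: reg_on_def)
  qed
  have "Cr_on r V g"
    using Ck an S(2) by (cases r) (auto simp: Cr_on_def)
  with U show thesis by (rule that)
qed

text \<open>A linear left inverse \<open>T\<close> of the derivative is bijective for reasons of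
  dimension; composing with it reduces the claim to a map of \<open>real^'m\<close> into
  itself.\<close>

lemma Cr_inverse_function:
  fixes f :: "real^'m \<Rightarrow> 'b::euclidean_space"
  assumes S: "open S" "Cr_on r S f" "a \<in> S" and inj: "inj (frechet_derivative f (at a))"
    and dim: "DIM('b) = CARD('m)"
  obtains U V g where "open U" "U \<subseteq> S" "a \<in> U" "open V" "f a \<in> V" "homeomorphism U V f g" "Cr_on r V g"
proof -
  let ?D = "frechet_derivative f (at a)"
  have der: "(f has_derivative ?D) (at a)" by (rule Cr_on_has_derivative[OF S(2,3)])
  then have "linear ?D" by (rule has_derivative_linear)
  then obtain T where T: "linear T" "T \<circ> ?D = id"
    using linear_injective_left_inverse inj by metis
  have sT: "surj T" using T(2) by (metis comp_apply id_apply surjI)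
  have iT: "inj T"
    by (rule linear_surjective_imp_injective[OF T(1) sT]) (simp add: dim)
  note bT = T(1)[unfolded linear_conv_bounded_linear]
  have "((\<lambda>x. T (f x)) has_derivative (\<lambda>v. T (?D v))) (at a)"
    by (rule bounded_linear.has_derivative[OF bT der])
  then have "frechet_derivative (\<lambda>x. T (f x)) (at a) = (\<lambda>v. T (?D v))"
    by (rule frechet_derivative_at[symmetric])
  also have "\<dots> = id" using T(2) by (simp add: fun_eq_iff)
  finally have "inj (frechet_derivative (\<lambda>x. T (f x)) (at a))" by simp
  then obtain U V g where U: "open U" "U \<subseteq> S" "a \<in> U" "open V" "T (f a) \<in> V"
    "homeomorphism U V (\<lambda>x. T (f x)) g" "Cr_on r V g"
    using Cr_inverse_function_aux[OF S(1) Cr_on_bounded_linear_compose[OF S(1) bT S(2)] S(3)] by metis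
  have cT: "continuous_on A T" for A using bT by (rule linear_continuous_on)
  have oV: "open (T -` V)" using continuous_on_open_vimage[of UNIV T] cT U(4) by auto
  have fU: "f ` U = T -` V"
  proof
    show "f ` U \<subseteq> T -` V" using U(6) by (auto simp: homeomorphism_def)
    show "T -` V \<subseteq> f ` U"
    proof
      fix y assume "y \<in> T -` V"
      then obtain x where "x \<in> U" "T y = T (f x)" using U(6) by (auto simp: homeomorphism_def)
      then show "y \<in> f ` U" using iT by (auto dest: injD)
    qed
  qed
  have cf: "continuous_on U f"
    using Cr_on_continuous_on[OF S(2)] U(2) continuous_on_subset by blast
  have "homeomorphism U (T -` V) f (g \<circ> T)"
  proof (rule homeomorphismI[OF cf])
    show "continuous_on (T -` V) (g \<circ> T)"
      using U(6) by (intro continuous_on_compose cT) (auto simp: homeomorphism_def elim: continuous_on_subset)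
    fix y assume "y \<in> T -` V"
    then obtain x where x: "x \<in> U" "y = f x" using fU by auto
    then show "f ((g \<circ> T) y) = y" using U(6) by (auto simp: homeomorphism_def)
  qed (use U(6) fU in \<open>auto simp: homeomorphism_def\<close>)
  moreover have "Cr_on r (T -` V) (g \<circ> T)"
    unfolding o_def by (rule Cr_on_compose[OF oV U(4)]) (auto intro: U Cr_on_bounded_linear bT)
  ultimately show thesis
    using that[OF U(1-3) oV, of "g \<circ> T"] U(5) by auto
qed

text \<open>Here the target may have larger dimension and \<open>T\<close> is only a left inverse of
  the derivative. The local inverse of T \<circ> f, preceded by \<open>T\<close>, is defined on the
  whole preimage of \<open>V\<close> under \<open>T\<close>, an open set of the ambient space, and
  undoes \<open>f\<close>.\<close>

lemma Cr_local_retraction: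
  fixes f :: "real^'m \<Rightarrow> 'b::euclidean_space"
  assumes S: "open S" "Cr_on r S f" "a \<in> S" and inj: "inj (frechet_derivative f (at a))"
  obtains W Q R where "open W" "a \<in> W" "W \<subseteq> S" "open Q" "f ` W \<subseteq> Q" "Cr_on r Q R" "R ` Q \<subseteq> W"
    "\<And>x. x \<in> W \<Longrightarrow> R (f x) = x"
proof -
  let ?D = "frechet_derivative f (at a)"
  have der: "(f has_derivative ?D) (at a)" by (rule Cr_on_has_derivative[OF S(2,3)])
  then have "linear ?D" by (rule has_derivative_linear)
  then obtain T where T: "linear T" "T \<circ> ?D = id"
    using linear_injective_left_inverse inj by metis
  note bT = T(1)[unfolded linear_conv_bounded_linear]
  have "((\<lambda>x. T (f x)) has_derivative (\<lambda>v. T (?D v))) (at a)"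
    by (rule bounded_linear.has_derivative[OF bT der])
  then have "frechet_derivative (\<lambda>x. T (f x)) (at a) = (\<lambda>v. T (?D v))"
    by (rule frechet_derivative_at[symmetric])
  also have "\<dots> = id" using T(2) by (simp add: fun_eq_iff)
  finally have "inj (frechet_derivative (\<lambda>x. T (f x)) (at a))" by simp
  then obtain U V g where U: "open U" "U \<subseteq> S" "a \<in> U" "open V" "T (f a) \<in> V"
    "homeomorphism U V (\<lambda>x. T (f x)) g" "Cr_on r V g"
    using Cr_inverse_function_aux[OF S(1) Cr_on_bounded_linear_compose[OF S(1) bT S(2)] S(3)] by metis
  have oV: "open (T -` V)"
    using continuous_on_open_vimage[of UNIV T] linear_continuous_on[OF bT] U(4) by auto
  have "Cr_on r (T -` V) (\<lambda>y. g (T y))"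
    by (rule Cr_on_compose[OF oV U(4)]) (auto intro: U Cr_on_bounded_linear bT)
  with oV show thesis
    by (intro that[OF U(1,3,2), of "T -` V" "\<lambda>y. g (T y)"]) (use U(6) in \<open>auto simp: homeomorphism_def\<close>)
qed

section \<open>The identity theorem and symmetry of second derivatives\<close>

text \<open>Near \<open>a\<close> the function behaves like its first non-zero term c (s - a)^k, so
  zeros accumulating at \<open>a\<close> force every coefficient to vanish.\<close>

lemma real_analytic_zeros_isolated:
  fixes g :: "real \<Rightarrow> 'b::banach"
  assumes "real_analytic_on {a} g" and z: "\<And>e. 0 < e \<Longrightarrow> \<exists>s. s \<noteq> a \<and> \<bar>s - a\<bar> < e \<and> g s = 0"
  shows "\<exists>e>0. \<forall>s. \<bar>s - a\<bar> < e \<longrightarrow> g s = 0"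
proof -
  obtain \<rho> c where \<rho>: "0 < \<rho>" and c: "ps_coeffs \<rho> c (\<lambda>x. g (a + x))"
    using assms(1) unfolding real_analytic_on_iff_ps ps_def by auto
  show ?thesis
  proof (cases "\<exists>m\<in>multi_idx. c m \<noteq> 0")
    case False
    have "g s = 0" if "\<bar>s - a\<bar> < \<rho>" for s
    proof -
      have "((\<lambda>m. mpow (s - a) m *\<^sub>R c m) has_sum g (a + (s - a))) multi_idx"
        using bspec[OF conjunct2[OF c[unfolded ps_coeffs_def]], of "s - a"] that by (simp add: box_ball_def)
      then have "((\<lambda>m. 0) has_sum g s) (multi_idx :: (real \<Rightarrow> nat) set)"
        using False by (subst (asm) has_sum_cong[where g="\<lambda>_. 0"]) auto
      then show ?thesis using has_sum_unique has_sum_0_simp by blast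
    qed
    then show ?thesis using \<rho> by blast
  next
    case True
    then obtain m where m: "m \<in> multi_idx" "c m \<noteq> 0" and least: "\<And>k. k \<in> multi_idx \<Longrightarrow> c k \<noteq> 0 \<Longrightarrow> mdeg m \<le> mdeg k"
      using ex_has_least_nat[of "\<lambda>m. m \<in> multi_idx \<and> c m \<noteq> 0" _ mdeg] by blast
    \<comment> \<open>In one variable an exponent is determined by its degree, so subtracting the
      single lowest term leaves a remainder of strictly higher degree.\<close>
    have uniq: "k = m" if "k \<in> multi_idx" "mdeg k = mdeg m" for k :: "real \<Rightarrow> nat"
      using that m(1) unfolding mdeg_def multi_idx_def
      by (intro PiE_ext[of k "Basis" "\<lambda>_. UNIV" m]) auto
    define d where "d k = (if k = m then 0 else c k)" for k
    have d: "ps_coeffs \<rho> d (\<lambda>x. g (a + x) - mpow x m *\<^sub>R c m)"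
      unfolding ps_coeffs_def
    proof (intro conjI ballI)
      show "(\<lambda>m. norm (d m) * \<rho> ^ mdeg m) summable_on multi_idx"
        by (rule summable_on_comparison_test[where f="\<lambda>m. norm (c m) * \<rho> ^ mdeg m"])
           (use c \<rho> in \<open>auto simp: d_def ps_coeffs_def\<close>)
      fix x :: real assume x: "x \<in> box_ball \<rho>"
      have "((\<lambda>k. if k = m then mpow x k *\<^sub>R c k else 0) has_sum mpow x m *\<^sub>R c m) multi_idx"
        by (rule has_sum_finite_neutralI[where B="{m}"]) (use m in auto)
      then have "((\<lambda>k. mpow x k *\<^sub>R c k - (if k = m then mpow x k *\<^sub>R c k else 0)) has_sum (g (a + x) - mpow x m *\<^sub>R c m)) multi_idx"
        using c x by (intro has_sum_minus) (auto simp: ps_coeffs_def)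
      then show "((\<lambda>k. mpow x k *\<^sub>R d k) has_sum (g (a + x) - mpow x m *\<^sub>R c m)) multi_idx"
        unfolding d_def by (rule has_sum_cong[THEN iffD1, rotated]) auto
    qed
    have d0: "d k = 0" if "k \<in> multi_idx" "mdeg k < Suc (mdeg m)" for k
      using uniq[OF that(1)] least[OF that(1)] that(2) unfolding d_def
      by (metis less_Suc_eq_le order_antisym)
    let ?D = "\<Sum>\<^sub>\<infinity>m\<in>multi_idx. norm (d m) * \<rho> ^ mdeg m"
    define K where "K = ?D / \<rho> ^ Suc (mdeg m) + 1"
    have D: "0 \<le> ?D" using \<rho> by (intro infsum_nonneg) auto
    then have K: "0 < K" using \<rho> by (simp add: K_def add_nonneg_pos)
    \<comment> \<open>For 0 < |s - a| < e the remainder is strictly smaller than the leading term,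
      so \<open>g s\<close> cannot be 0. The summand 1 in \<open>K\<close> makes the divisor
      positive.\<close>
    define e where "e = min \<rho> (norm (c m) / K)"
    have "0 < e" using \<rho> K m by (auto simp: e_def)
    then obtain s where s: "s \<noteq> a" "\<bar>s - a\<bar> < e" "g s = 0" using z by blast
    have "norm (g (a + (s - a)) - mpow (s - a) m *\<^sub>R c m) \<le> ?D * (norm (s - a) / \<rho>) ^ Suc (mdeg m)"
      by (rule ps_coeffs_deg_bound[OF d \<rho> d0]) (use s in \<open>auto simp: e_def\<close>)
    moreover have "mpow (s - a) m = (s - a) ^ mdeg m" by (simp add: mpow_def mdeg_def)
    ultimately have "\<bar>s - a\<bar> ^ mdeg m * norm (c m) \<le> ?D * (\<bar>s - a\<bar> / \<rho>) ^ Suc (mdeg m)"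
      using s by (simp add: power_abs)
    also have "\<dots> = \<bar>s - a\<bar> ^ mdeg m * (?D / \<rho> ^ Suc (mdeg m) * \<bar>s - a\<bar>)"
      by (simp add: power_divide)
    finally have "norm (c m) \<le> ?D / \<rho> ^ Suc (mdeg m) * \<bar>s - a\<bar>"
      using s(1) by (subst (asm) mult_le_cancel_left_pos) auto
    also have "\<dots> \<le> K * \<bar>s - a\<bar>" by (intro mult_right_mono) (auto simp: K_def)
    also have "\<dots> < K * (norm (c m) / K)"
      using s K by (intro mult_strict_left_mono) (auto simp: e_def)
    finally show ?thesis using K by simp
  qed
qed

text \<open>On the segment from \<open>b\<close> to \<open>x\<close> only one variable is left. The
  interior of the zero set in the parameter interval contains 0, is open, and is also closed there:
  at a point outside it the zeros are isolated.\<close>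

lemma real_analytic_identity:
  fixes f :: "'a::euclidean_space \<Rightarrow> 'b::banach"
  assumes f: "real_analytic_on B f" and B: "open B" "convex B"
    and W: "open W" "W \<subseteq> B" "b \<in> W" "\<And>x. x \<in> W \<Longrightarrow> f x = 0" and x: "x \<in> B"
  shows "f x = 0"
proof -
  define p where "p t = b + t *\<^sub>R (x - b)" for t
  have pc: "continuous_on UNIV p" unfolding p_def by (intro continuous_intros)
  define J where "J = p -` B"
  have oJ: "open J" unfolding J_def using continuous_on_open_vimage[of UNIV p] pc B by auto
  have p_comb: "p ((1 - u) * s + u * t) = (1 - u) *\<^sub>R p s + u *\<^sub>R p t" for s t u
    by (simp add: p_def algebra_simps)
  have "convex J"
    unfolding convex_alt J_def using B(2)[unfolded convex_alt] by (simp add: p_comb)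
  then have cJ: "connected J" by (rule convex_connected)
  have J01: "0 \<in> J" "1 \<in> J" using x W by (auto simp: J_def p_def)
  have pa: "real_analytic_on J p"
  proof -
    have "bounded_linear (\<lambda>t::real. t *\<^sub>R (x - b))" by (rule bounded_linear_scaleR_left)
    then show ?thesis
      unfolding p_def by (intro real_analytic_on_add real_analytic_on_const real_analytic_on_bounded_linear)
  qed
  have ga: "real_analytic_on J (\<lambda>t. f (p t))"
    by (rule real_analytic_on_compose[OF pa f]) (auto simp: J_def)
  define Z where "Z = interior {t\<in>J. f (p t) = 0}"
  have oZ: "open Z" by (simp add: Z_def)
  have ZJ: "Z \<subseteq> J" unfolding Z_def using interior_subset by blast
  have "0 \<in> Z"
    unfolding Z_def
  proof (rule interiorI)
    show "open (p -` W)" using continuous_on_open_vimage[of UNIV p] pc W by auto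
  qed (use W in \<open>auto simp: p_def J_def\<close>)
  have "open (J - Z)"
  proof (rule openI)
    fix t assume t: "t \<in> J - Z"
    then obtain e0 where e0: "0 < e0" "ball t e0 \<subseteq> J" using oJ openE by blast
    have "\<not> (\<exists>e>0. \<forall>s. \<bar>s - t\<bar> < e \<longrightarrow> f (p s) = 0)"
    proof
      assume "\<exists>e>0. \<forall>s. \<bar>s - t\<bar> < e \<longrightarrow> f (p s) = 0"
      then obtain e where e: "0 < e" "\<And>s. \<bar>s - t\<bar> < e \<Longrightarrow> f (p s) = 0" by blast
      have "t \<in> Z"
        unfolding Z_def
        by (rule interiorI[where T="ball t (min e e0)"])
           (use e e0 in \<open>auto simp: dist_real_def abs_minus_commute\<close>)
      then show False using t by blast
    qed
    moreover have "real_analytic_on {t} (\<lambda>s. f (p s))"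
      using ga t unfolding real_analytic_on_pointwise[of J] by blast
    ultimately obtain e where e: "0 < e" "\<And>s. s \<noteq> t \<Longrightarrow> \<bar>s - t\<bar> < e \<Longrightarrow> f (p s) \<noteq> 0"
      using real_analytic_zeros_isolated[of t "\<lambda>s. f (p s)"] by metis
    have "ball t (min e e0) \<subseteq> J - Z"
    proof
      fix s assume s: "s \<in> ball t (min e e0)"
      moreover have "s \<notin> Z"
      proof
        assume "s \<in> Z"
        then have "f (p s) = 0" unfolding Z_def using interior_subset by blast
        then show False using e(2)[of s] s t \<open>s \<in> Z\<close> by (auto simp: dist_real_def abs_minus_commute)
      qed
      ultimately show "s \<in> J - Z" using e0 by auto
    qed
    then show "\<exists>e>0. ball t e \<subseteq> J - Z" using e e0 by (intro exI[of _ "min e e0"]) auto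
  qed
  then have "J - Z = {} \<or> Z = {}"
    using connectedD[OF cJ oZ, of "J - Z"] ZJ by blast
  then have "1 \<in> Z" using J01 \<open>0 \<in> Z\<close> by blast
  then have "f (p 1) = 0" unfolding Z_def using interior_subset by blast
  then show ?thesis by (simp add: p_def)
qed

text \<open>The mean value theorem in the direction \<open>u\<close> is applied to a difference in
  the direction \<open>v\<close>, and then once more in the direction \<open>v\<close>. The second
  difference is symmetric in \<open>u\<close> and \<open>v\<close>, which is what makes the mixed
  derivatives comparable.\<close>

lemma second_difference_mvt:
  fixes \<phi> :: "'a::euclidean_space \<Rightarrow> real"
  assumes \<phi>: "Cr_on r S \<phi>" and S: "open S" "ball x d \<subseteq> S" and h: "0 < h" "h * (norm u + norm v) < d"
  obtains p where "dist p x < d" "dist p x \<le> h * (norm u + norm v)"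
    "\<phi> (x + h *\<^sub>R u + h *\<^sub>R v) - \<phi> (x + h *\<^sub>R u) - \<phi> (x + h *\<^sub>R v) + \<phi> x
      = h * h * frechet_derivative (\<lambda>y. frechet_derivative \<phi> (at y) u) (at p) v"
proof -
  define A where "A y = frechet_derivative \<phi> (at y) u" for y
  have A: "Cr_on r S A" unfolding A_def by (rule Cr_on_derivative[OF \<phi> S(1)])
  have nb: "norm (s *\<^sub>R u + t *\<^sub>R v) \<le> h * (norm u + norm v)" if "0 \<le> s" "s \<le> h" "0 \<le> t" "t \<le> h" for s t
  proof -
    have "norm (s *\<^sub>R u + t *\<^sub>R v) \<le> s * norm u + t * norm v"
      using norm_triangle_ineq[of "s *\<^sub>R u" "t *\<^sub>R v"] that by simp
    also have "\<dots> \<le> h * norm u + h * norm v" using that by (intro add_mono mult_right_mono) auto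
    finally show ?thesis by (simp add: distrib_left)
  qed
  have inS: "x + s *\<^sub>R u + t *\<^sub>R v \<in> S" if "0 \<le> s" "s \<le> h" "0 \<le> t" "t \<le> h" for s t
  proof -
    have "dist x (x + (s *\<^sub>R u + t *\<^sub>R v)) = norm (s *\<^sub>R u + t *\<^sub>R v)"
      by (metis add_diff_cancel_left' dist_commute dist_norm)
    then show ?thesis
      using nb[OF that] h by (intro subsetD[OF S(2)]) (simp add: add.assoc)
  qed
  have d1: "((\<lambda>s. \<phi> (x + s *\<^sub>R u + t *\<^sub>R v)) has_real_derivative A (x + s *\<^sub>R u + t *\<^sub>R v)) (at s)"
    if "0 \<le> s" "s \<le> h" "0 \<le> t" "t \<le> h" for s t
  proof -
    have "((\<lambda>s. \<phi> (x + s *\<^sub>R u + t *\<^sub>R v)) has_derivative (\<lambda>k. frechet_derivative \<phi> (at (x + s *\<^sub>R u + t *\<^sub>R v)) (k *\<^sub>R u))) (at s)"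
      by (rule has_derivative_compose[where f="\<lambda>s. x + s *\<^sub>R u + t *\<^sub>R v" and g=\<phi> and f'="\<lambda>k. k *\<^sub>R u"])
         (auto intro!: derivative_eq_intros Cr_on_has_derivative[OF \<phi> inS[OF that]])
    then show ?thesis
      unfolding has_field_derivative_def A_def
      by (rule has_derivative_eq_rhs)
         (simp add: fun_eq_iff linear_cmul[OF has_derivative_linear[OF Cr_on_has_derivative[OF \<phi> inS[OF that]]]])
  qed
  have d2: "((\<lambda>t. A (x + s *\<^sub>R u + t *\<^sub>R v)) has_real_derivative frechet_derivative A (at (x + s *\<^sub>R u + t *\<^sub>R v)) v) (at t)"
    if "0 \<le> s" "s \<le> h" "0 \<le> t" "t \<le> h" for s t
  proof -
    have "((\<lambda>t. A (x + s *\<^sub>R u + t *\<^sub>R v)) has_derivative (\<lambda>k. frechet_derivative A (at (x + s *\<^sub>R u + t *\<^sub>R v)) (k *\<^sub>R v))) (at t)"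
      by (rule has_derivative_compose[where f="\<lambda>t. x + s *\<^sub>R u + t *\<^sub>R v" and g=A and f'="\<lambda>k. k *\<^sub>R v"])
         (auto intro!: derivative_eq_intros Cr_on_has_derivative[OF A inS[OF that]])
    then show ?thesis
      unfolding has_field_derivative_def
      by (rule has_derivative_eq_rhs)
         (simp add: fun_eq_iff linear_cmul[OF has_derivative_linear[OF Cr_on_has_derivative[OF A inS[OF that]]]])
  qed
  let ?\<psi> = "\<lambda>s. \<phi> (x + s *\<^sub>R u + h *\<^sub>R v) - \<phi> (x + s *\<^sub>R u + 0 *\<^sub>R v)"
  have "\<exists>s. 0 < s \<and> s < h \<and> ?\<psi> h - ?\<psi> 0 = (h - 0) * (A (x + s *\<^sub>R u + h *\<^sub>R v) - A (x + s *\<^sub>R u + 0 *\<^sub>R v))"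
    by (rule MVT2[OF h(1)]) (intro DERIV_diff d1; use h in auto)
  then obtain s where s: "0 < s" "s < h"
    and e1: "?\<psi> h - ?\<psi> 0 = h * (A (x + s *\<^sub>R u + h *\<^sub>R v) - A (x + s *\<^sub>R u + 0 *\<^sub>R v))" by auto
  have "\<exists>t. 0 < t \<and> t < h \<and> A (x + s *\<^sub>R u + h *\<^sub>R v) - A (x + s *\<^sub>R u + 0 *\<^sub>R v)
      = (h - 0) * frechet_derivative A (at (x + s *\<^sub>R u + t *\<^sub>R v)) v"
    by (rule MVT2[OF h(1)]) (intro d2; use s in auto)
  then obtain t where t: "0 < t" "t < h" and e2: "A (x + s *\<^sub>R u + h *\<^sub>R v) - A (x + s *\<^sub>R u + 0 *\<^sub>R v)
      = h * frechet_derivative A (at (x + s *\<^sub>R u + t *\<^sub>R v)) v" by auto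
  have "dist (x + s *\<^sub>R u + t *\<^sub>R v) x \<le> h * (norm u + norm v)"
    using nb[of s t] s t by (simp add: dist_norm add.assoc)
  then show thesis
    using that[of "x + s *\<^sub>R u + t *\<^sub>R v"] h(2) e1 e2 unfolding A_def by (simp add: algebra_simps)
qed

lemma symmetric_second_derivative_real:
  fixes \<phi> :: "'a::euclidean_space \<Rightarrow> real"
  assumes \<phi>: "Cr_on r S \<phi>" and S: "open S" "x \<in> S"
  shows "frechet_derivative (\<lambda>y. frechet_derivative \<phi> (at y) u) (at x) v
       = frechet_derivative (\<lambda>y. frechet_derivative \<phi> (at y) v) (at x) u"
proof -
  let ?D = "\<lambda>u v y. frechet_derivative (\<lambda>y. frechet_derivative \<phi> (at y) u) (at y) v"
  have cont: "isCont (?D u v) x" for u v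
    using Cr_on_continuous_on[OF Cr_on_derivative[OF Cr_on_derivative[OF \<phi> S(1)] S(1)]] S
    by (simp add: continuous_on_eq_continuous_at)
  obtain d where d: "0 < d" "ball x d \<subseteq> S" by (rule openE[OF S])
  define N where "N = norm u + norm v"
  have N: "0 \<le> N" by (simp add: N_def)
  define h where "h n = d / (2 * (N + 1)) / real (Suc n)" for n
  have h: "0 < h n" "h n * N < d" for n
  proof -
    show "0 < h n" using d N by (simp add: h_def)
    have "h n \<le> d / (2 * (N + 1))" unfolding h_def using d N by (simp add: divide_le_eq mult_left_mono)
    then have "h n * N \<le> d / (2 * (N + 1)) * N" using N by (rule mult_right_mono)
    also have "\<dots> < d" using d N by (simp add: field_simps add_nonneg_pos)
    finally show "h n * N < d" .
  qed
  have h0: "(\<lambda>n. h n * N) \<longlonglongrightarrow> 0"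
    unfolding h_def by (intro tendsto_mult_left_zero tendsto_divide_0[OF tendsto_const] filterlim_compose[OF filterlim_real_at_infinity_sequentially filterlim_Suc])
  have "\<exists>p q. dist p x \<le> h n * N \<and> dist q x \<le> h n * N \<and> ?D u v p = ?D v u q" for n
  proof -
    obtain p where p: "dist p x \<le> h n * N"
      "\<phi> (x + h n *\<^sub>R u + h n *\<^sub>R v) - \<phi> (x + h n *\<^sub>R u) - \<phi> (x + h n *\<^sub>R v) + \<phi> x = h n * h n * ?D u v p"
      using second_difference_mvt[OF \<phi> S(1) d(2) h(1)[of n], of u v] h(2)[of n] unfolding N_def by metis
    obtain q where q: "dist q x \<le> h n * N"
      "\<phi> (x + h n *\<^sub>R v + h n *\<^sub>R u) - \<phi> (x + h n *\<^sub>R v) - \<phi> (x + h n *\<^sub>R u) + \<phi> x = h n * h n * ?D v u q"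
      using second_difference_mvt[OF \<phi> S(1) d(2) h(1)[of n], of v u] h(2)[of n] unfolding N_def by (metis add.commute)
    have "h n * h n * ?D u v p = h n * h n * ?D v u q"
      using p(2) q(2) by (simp add: algebra_simps)
    then have "?D u v p = ?D v u q" using h(1)[of n] by simp
    then show ?thesis using p q by blast
  qed
  then obtain p q where p: "\<And>n. dist (p n) x \<le> h n * N" and q: "\<And>n. dist (q n) x \<le> h n * N"
    and eq: "\<And>n. ?D u v (p n) = ?D v u (q n)" by metis
  have "p \<longlonglongrightarrow> x" "q \<longlonglongrightarrow> x"
    by (rule metric_tendsto_imp_tendsto[OF h0]; use p q in \<open>simp add: N h less_imp_le\<close>)+
  then have "(\<lambda>n. ?D u v (p n)) \<longlonglongrightarrow> ?D u v x" "(\<lambda>n. ?D v u (q n)) \<longlonglongrightarrow> ?D v u x"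
    using isCont_tendsto_compose[OF cont] by blast+
  then show ?thesis unfolding eq by (rule LIMSEQ_unique)
qed

lemma symmetric_second_derivative:
  fixes f :: "'a::euclidean_space \<Rightarrow> 'b::euclidean_space"
  assumes f: "Cr_on r S f" and S: "open S" "x \<in> S"
  shows "frechet_derivative (\<lambda>y. frechet_derivative f (at y) u) (at x) v
       = frechet_derivative (\<lambda>y. frechet_derivative f (at y) v) (at x) u"
proof (rule euclidean_eqI)
  fix i :: 'b assume "i \<in> Basis"
  have bl: "bounded_linear (\<lambda>y. y \<bullet> i)" by (rule bounded_linear_inner_left)
  have 1: "frechet_derivative (\<lambda>z. g z \<bullet> i) (at y) = (\<lambda>w. frechet_derivative g (at y) w \<bullet> i)"
    if "Cr_on r S g" "y \<in> S" for g :: "'a \<Rightarrow> 'b" and y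
    using bounded_linear.has_derivative[OF bl Cr_on_has_derivative[OF that]]
    by (rule frechet_derivative_at[symmetric])
  have 2: "frechet_derivative (\<lambda>y. frechet_derivative (\<lambda>z. f z \<bullet> i) (at y) w) (at x)
      = frechet_derivative (\<lambda>y. frechet_derivative f (at y) w \<bullet> i) (at x)" for w
  proof (rule frechet_derivative_at[symmetric])
    have "((\<lambda>y. frechet_derivative f (at y) w \<bullet> i) has_derivative frechet_derivative (\<lambda>y. frechet_derivative f (at y) w \<bullet> i) (at x)) (at x)"
      by (rule Cr_on_has_derivative[OF Cr_on_bounded_linear_compose[OF S(1) bl Cr_on_derivative[OF f S(1)]] S(2)])
    then show "((\<lambda>y. frechet_derivative (\<lambda>z. f z \<bullet> i) (at y) w) has_derivative frechet_derivative (\<lambda>y. frechet_derivative f (at y) w \<bullet> i) (at x)) (at x)"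
      by (rule has_derivative_transform_within_open[OF _ S]) (simp add: 1[OF f])
  qed
  have "frechet_derivative (\<lambda>y. frechet_derivative f (at y) w) (at x) z \<bullet> i
      = frechet_derivative (\<lambda>y. frechet_derivative (\<lambda>z. f z \<bullet> i) (at y) w) (at x) z" for w z
    unfolding 2 1[OF Cr_on_derivative[OF f S(1)] S(2)] ..
  then show "frechet_derivative (\<lambda>y. frechet_derivative f (at y) u) (at x) v \<bullet> i
       = frechet_derivative (\<lambda>y. frechet_derivative f (at y) v) (at x) u \<bullet> i"
    using symmetric_second_derivative_real[OF Cr_on_bounded_linear_compose[OF S(1) bl f] S] by simp
qed

section \<open>Charts and topology\<close>

abbreviation cinv :: "('a, 'e) chart \<Rightarrow> 'e \<Rightarrow> 'a" where
  "cinv c \<equiv> inv_into (fst c) (snd c)"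

text \<open>Enough structure for \<open>carrier M\<close> to be open and for maps into
  \<open>M\<close> to be tested in charts; the sphere and the projective space enter in this
  form.\<close>

definition open_atlas :: "('a, 'e::real_normed_vector) atlas \<Rightarrow> bool" where
  "open_atlas M \<longleftrightarrow> (\<forall>c\<in>M. inj_on (snd c) (fst c) \<and> open (snd c ` fst c))"

text \<open>A manifold before its two global axioms. Compatible charts carry the calculus, and the
  quotient of the slices must be handled through its charts while its Hausdorff property is still to
  be shown.\<close>

definition pre_manifold :: "regularity \<Rightarrow> ('a, 'e::euclidean_space) atlas \<Rightarrow> bool" where
  "pre_manifold r M \<longleftrightarrow> (\<forall>c\<in>M. inj_on (snd c) (fst c)) \<and>
     (\<forall>c\<in>M. \<forall>d\<in>M. open (snd c ` (fst c \<inter> fst d)) \<and>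
                     Cr_on r (snd c ` (fst c \<inter> fst d)) (local_rep c d (\<lambda>x. x)))"

lemma Cr_manifold_iff:
  "Cr_manifold r M \<longleftrightarrow> pre_manifold r M \<and> Hausdorff_space (mtop M) \<and> second_countable (mtop M)"
  by (auto simp: Cr_manifold_def pre_manifold_def)

lemma Cr_manifold_pre: "Cr_manifold r M \<Longrightarrow> pre_manifold r M"
  by (simp add: Cr_manifold_iff)

lemma pre_manifold_open_atlas: "pre_manifold r M \<Longrightarrow> open_atlas M"
  unfolding pre_manifold_def open_atlas_def by (metis Int_absorb)

lemma openin_mtop_iff: "open_atlas M \<Longrightarrow> openin (mtop M) W \<longleftrightarrow> mopen M W"
  by (rule openin_mtop) (simp add: open_atlas_def)

lemma mopen_carrier: "open_atlas M \<Longrightarrow> mopen M (carrier M)"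
proof -
  assume M: "open_atlas M"
  have "carrier M \<inter> fst c = fst c" if "c \<in> M" for c using that by (auto simp: carrier_def)
  then show ?thesis using M by (simp add: mopen_def open_atlas_def)
qed

lemma topspace_mtop: "open_atlas M \<Longrightarrow> topspace (mtop M) = carrier M"
proof
  assume M: "open_atlas M"
  show "topspace (mtop M) \<subseteq> carrier M"
    using openin_topspace[of "mtop M"] unfolding openin_mtop_iff[OF M] mopen_def by blast
  show "carrier M \<subseteq> topspace (mtop M)"
    using mopen_carrier[OF M] openin_mtop_iff[OF M] openin_subset by blast
qed

lemma cinv_chart [simp]: "open_atlas M \<Longrightarrow> c \<in> M \<Longrightarrow> p \<in> fst c \<Longrightarrow> cinv c (snd c p) = p"
  by (simp add: open_atlas_def)

lemma chart_cinv: "y \<in> snd c ` fst c \<Longrightarrow> snd c (cinv c y) = y"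
  by (rule f_inv_into_f)

lemma cinv_into: "y \<in> snd c ` fst c \<Longrightarrow> cinv c y \<in> fst c"
  by (rule inv_into_into)

lemma carrierI: "c \<in> M \<Longrightarrow> p \<in> fst c \<Longrightarrow> p \<in> carrier M"
  by (auto simp: carrier_def)

lemma carrierE: assumes "p \<in> carrier M" obtains c where "c \<in> M" "p \<in> fst c"
  using assms by (auto simp: carrier_def)

text \<open>Transition maps are continuous, so openness in one chart implies openness in all the
  others.\<close>

lemma openin_chart_subset:
  assumes M: "pre_manifold r M" and c: "c \<in> M" and V: "V \<subseteq> fst c"
  shows "openin (mtop M) V \<longleftrightarrow> open (snd c ` V)"
proof -
  note oa = pre_manifold_open_atlas[OF M]
  have "mopen M V" if o: "open (snd c ` V)"
    unfolding mopen_def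
  proof (intro conjI ballI)
    show "V \<subseteq> carrier M" using V c by (auto simp: carrier_def)
    fix d assume d: "d \<in> M"
    let ?S = "snd d ` (fst d \<inter> fst c)" and ?t = "local_rep d c (\<lambda>x. x)"
    have "open ?S" "Cr_on r ?S ?t"
      using M c d by (auto simp: pre_manifold_def)
    then have S: "open ?S" "continuous_on ?S ?t"
      using Cr_on_continuous_on by blast+
    have t: "?t (snd d p) = snd c p" if "p \<in> fst d" for p
      using cinv_chart[OF oa d that] by (simp add: local_rep_def)
    have "snd d ` (V \<inter> fst d) = ?S \<inter> ?t -` (snd c ` V)"
    proof
      show "snd d ` (V \<inter> fst d) \<subseteq> ?S \<inter> ?t -` (snd c ` V)"
        using V t by auto
      show "?S \<inter> ?t -` (snd c ` V) \<subseteq> snd d ` (V \<inter> fst d)"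
      proof clarify
        fix p q assume p: "p \<in> fst d" "p \<in> fst c" and q: "q \<in> V" and eq: "?t (snd d p) = snd c q"
        have "p = q"
          using inj_onD[of "snd c" "fst c" p q] oa c p q V eq t[OF p(1)] by (auto simp: open_atlas_def)
        then show "snd d p \<in> snd d ` (V \<inter> fst d)" using p q by blast
      qed
    qed
    then show "open (snd d ` (V \<inter> fst d))"
      using continuous_open_preimage[OF S(2,1) o] by simp
  qed
  moreover have "open (snd c ` V)" if "mopen M V"
    using that c V by (auto simp: mopen_def Int_absorb2)
  ultimately show ?thesis using openin_mtop_iff[OF oa] by blast
qed

lemma openin_chart: "pre_manifold r M \<Longrightarrow> c \<in> M \<Longrightarrow> openin (mtop M) (fst c)"
  using openin_chart_subset[of r M c "fst c"] pre_manifold_open_atlas[of r M] by (simp add: open_atlas_def)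

lemma openin_cinv_image:
  assumes M: "pre_manifold r M" and c: "c \<in> M" and W: "open W" "W \<subseteq> snd c ` fst c"
  shows "openin (mtop M) (cinv c ` W)"
proof -
  have 1: "snd c ` cinv c ` W = W"
    using W(2) by (force simp: image_image chart_cinv)
  have 2: "cinv c ` W \<subseteq> fst c" using W(2) by (auto intro: cinv_into)
  show ?thesis using openin_chart_subset[OF M c 2] 1 W by simp
qed

lemma continuous_map_into_mtop:
  assumes N: "open_atlas N" and f: "f ` topspace X \<subseteq> carrier N"
    and loc: "\<And>x d. x \<in> topspace X \<Longrightarrow> d \<in> N \<Longrightarrow> f x \<in> fst d \<Longrightarrow>
      \<exists>T. openin X T \<and> x \<in> T \<and> f ` T \<subseteq> fst d \<and> continuous_map (subtopology X T) euclidean (snd d \<circ> f)"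
  shows "continuous_map X (mtop N) f"
  unfolding continuous_map_def
proof (intro conjI allI impI)
  show "f \<in> topspace X \<rightarrow> topspace (mtop N)" using f by (auto simp: topspace_mtop[OF N])
  fix W assume "openin (mtop N) W"
  then have W: "mopen N W" using openin_mtop_iff[OF N] by blast
  show "openin X {x \<in> topspace X. f x \<in> W}"
  proof (subst openin_subopen, safe)
    fix x assume x: "x \<in> topspace X" "f x \<in> W"
    then obtain d where d: "d \<in> N" "f x \<in> fst d" using W by (auto simp: mopen_def carrier_def)
    obtain T where T: "openin X T" "x \<in> T" "f ` T \<subseteq> fst d"
      and c: "continuous_map (subtopology X T) euclidean (snd d \<circ> f)"
      using loc[OF x(1) d] by auto
    have "open (snd d ` (W \<inter> fst d))" using W d by (auto simp: mopen_def)
    then have "openin (subtopology X T) {y \<in> topspace (subtopology X T). (snd d \<circ> f) y \<in> snd d ` (W \<inter> fst d)}"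
      by (intro openin_continuous_map_preimage[OF c]) simp
    then have o: "openin X {y \<in> topspace (subtopology X T). (snd d \<circ> f) y \<in> snd d ` (W \<inter> fst d)}"
      using openin_open_subtopology[OF T(1)] by blast
    have "{y \<in> topspace (subtopology X T). (snd d \<circ> f) y \<in> snd d ` (W \<inter> fst d)} \<subseteq> {x \<in> topspace X. f x \<in> W}"
    proof (rule subsetI)
      fix y assume "y \<in> {y \<in> topspace (subtopology X T). (snd d \<circ> f) y \<in> snd d ` (W \<inter> fst d)}"
      then have y: "y \<in> topspace (subtopology X T)" "(snd d \<circ> f) y \<in> snd d ` (W \<inter> fst d)" by blast+
      from y(2) obtain w where w: "w \<in> W" "w \<in> fst d" "snd d (f y) = snd d w" by auto
      have "f y \<in> fst d" using y(1) T(3) by auto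
      then have "f y = w" using N d w by (auto simp: open_atlas_def dest: inj_onD)
      then show "y \<in> {x \<in> topspace X. f x \<in> W}" using w y(1) by auto
    qed
    then show "\<exists>T. openin X T \<and> x \<in> T \<and> T \<subseteq> {x \<in> topspace X. f x \<in> W}"
      using o T x d by (intro exI[of _ "{y \<in> topspace (subtopology X T). (snd d \<circ> f) y \<in> snd d ` (W \<inter> fst d)}"]) auto
  qed
qed

section \<open>Regularity at a point\<close>

text \<open>Regularity near a point for maps into a vector space, tested in one chart; by
  \<open>Cr_at_chartE\<close> the chart does not matter. The pointwise form spares the closure rules
  from carrying open domains along.\<close>

definition Cr_at :: "regularity \<Rightarrow> ('a, 'e::euclidean_space) atlas \<Rightarrow> ('a \<Rightarrow> 'v::banach) \<Rightarrow> 'a \<Rightarrow> bool" where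
  "Cr_at r M f p \<longleftrightarrow> (\<exists>c\<in>M. p \<in> fst c \<and>
     (\<exists>W. open W \<and> snd c p \<in> W \<and> W \<subseteq> snd c ` fst c \<and> Cr_on r W (\<lambda>x. f (cinv c x))))"

lemma Cr_atI:
  assumes "c \<in> M" "p \<in> fst c" "open W" "snd c p \<in> W" "W \<subseteq> snd c ` fst c" "Cr_on r W (\<lambda>x. f (cinv c x))"
  shows "Cr_at r M f p"
  using assms unfolding Cr_at_def by blast

lemma Cr_at_chartE:
  assumes M: "pre_manifold r M" and f: "Cr_at r M f p" and c: "c \<in> M" "p \<in> fst c"
  obtains W where "open W" "snd c p \<in> W" "W \<subseteq> snd c ` fst c" "Cr_on r W (\<lambda>x. f (cinv c x))"
proof -
  note oa = pre_manifold_open_atlas[OF M]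
  from f obtain d V where d: "d \<in> M" "p \<in> fst d" and V: "open V" "snd d p \<in> V" "V \<subseteq> snd d ` fst d"
    "Cr_on r V (\<lambda>x. f (cinv d x))" unfolding Cr_at_def by blast
  let ?S = "snd c ` (fst c \<inter> fst d)" and ?t = "local_rep c d (\<lambda>x. x)"
  have S: "open ?S" "Cr_on r ?S ?t" using M c d by (auto simp: pre_manifold_def)
  have t: "?t (snd c q) = snd d q" if "q \<in> fst c" for q
    using cinv_chart[OF oa c(1) that] by (simp add: local_rep_def)
  define W where "W = ?S \<inter> ?t -` V"
  have W: "open W" unfolding W_def by (rule continuous_open_preimage[OF Cr_on_continuous_on[OF S(2)] S(1) V(1)])
  have "Cr_on r W (\<lambda>x. f (cinv d (?t x)))"
    by (rule Cr_on_compose[OF W V(1) _ Cr_on_subset[OF S(2)] V(4)]) (auto simp: W_def)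
  then have "Cr_on r W (\<lambda>x. f (cinv c x))"
  proof (rule Cr_on_cong[OF W])
    fix x assume "x \<in> W"
    then obtain q where q: "q \<in> fst c" "q \<in> fst d" "x = snd c q" by (auto simp: W_def)
    then show "f (cinv d (?t x)) = f (cinv c x)"
      using t[OF q(1)] cinv_chart[OF oa d(1) q(2)] cinv_chart[OF oa c(1) q(1)] by simp
  qed
  then show thesis
    using c d V t[OF c(2)] by (intro that[OF W]) (auto simp: W_def)
qed

lemma Cr_at_nbhd:
  assumes M: "pre_manifold r M" and f: "Cr_at r M f p" and c: "c \<in> M" "p \<in> fst c" and U: "openin (mtop M) U" "p \<in> U"
  obtains W where "open W" "snd c p \<in> W" "W \<subseteq> snd c ` (fst c \<inter> U)" "Cr_on r W (\<lambda>x. f (cinv c x))"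
proof -
  obtain W where W: "open W" "snd c p \<in> W" "W \<subseteq> snd c ` fst c" "Cr_on r W (\<lambda>x. f (cinv c x))"
    by (rule Cr_at_chartE[OF M f c])
  have "mopen M U" using U openin_mtop_iff[OF pre_manifold_open_atlas[OF M]] by blast
  then have "open (snd c ` (U \<inter> fst c))" using c by (auto simp: mopen_def)
  then show thesis
    using that[of "W \<inter> snd c ` (U \<inter> fst c)"] W U c by (auto intro: Cr_on_subset)
qed

lemma Cr_at_cong:
  assumes M: "pre_manifold r M" and f: "Cr_at r M f p" and U: "openin (mtop M) U" "p \<in> U"
    and eq: "\<And>q. q \<in> U \<Longrightarrow> f q = g q"
  shows "Cr_at r M g p"
proof -
  from f obtain c where c: "c \<in> M" "p \<in> fst c" unfolding Cr_at_def by blast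
  obtain W where W: "open W" "snd c p \<in> W" "W \<subseteq> snd c ` (fst c \<inter> U)" "Cr_on r W (\<lambda>x. f (cinv c x))"
    by (rule Cr_at_nbhd[OF M f c U])
  have "cinv c x \<in> U" if "x \<in> W" for x
    using that W(3) pre_manifold_open_atlas[OF M] c by auto
  then have "Cr_on r W (\<lambda>x. g (cinv c x))"
    using eq by (intro Cr_on_cong[OF W(1,4)]) auto
  then show ?thesis using W by (intro Cr_atI[OF c W(1,2)]) auto
qed

lemma Cr_at_openin:
  assumes M: "pre_manifold r M" and f: "Cr_at r M f p"
  obtains U where "openin (mtop M) U" "p \<in> U" "\<And>q. q \<in> U \<Longrightarrow> Cr_at r M f q"
proof -
  from f obtain c W where c: "c \<in> M" "p \<in> fst c" and W: "open W" "snd c p \<in> W" "W \<subseteq> snd c ` fst c"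
    "Cr_on r W (\<lambda>x. f (cinv c x))" unfolding Cr_at_def by blast
  show thesis
  proof (rule that[OF openin_cinv_image[OF M c(1) W(1,3)]])
    show "p \<in> cinv c ` W" using c W(2) cinv_chart[OF pre_manifold_open_atlas[OF M] c] by (metis image_eqI)
    fix q assume "q \<in> cinv c ` W"
    then obtain w where w: "w \<in> W" "q = cinv c w" by blast
    then show "Cr_at r M f q"
      using W cinv_into[of w c] chart_cinv[of w c] by (intro Cr_atI[OF c(1) _ W(1) _ W(3,4)]) auto
  qed
qed

lemma Cr_at_carrier: "Cr_at r M f p \<Longrightarrow> p \<in> carrier M"
  unfolding Cr_at_def by (auto intro: carrierI)

lemma continuous_map_Cr_at:
  assumes M: "pre_manifold r M" and f: "\<And>p. p \<in> U \<Longrightarrow> Cr_at r M f p" and U: "openin (mtop M) U"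
  shows "continuous_map (subtopology (mtop M) U) euclidean f"
  unfolding continuous_map_def
proof (intro conjI allI impI)
  note oa = pre_manifold_open_atlas[OF M]
  fix V :: "'c set" assume "openin euclidean V"
  then have V: "open V" by simp
  have tU: "topspace (subtopology (mtop M) U) = U" using openin_subset[OF U] by auto
  show "openin (subtopology (mtop M) U) {x \<in> topspace (subtopology (mtop M) U). f x \<in> V}"
    unfolding tU openin_open_subtopology[OF U]
  proof (intro conjI)
    show "openin (mtop M) {x \<in> U. f x \<in> V}"
    proof (subst openin_subopen, safe)
      fix p assume p: "p \<in> U" "f p \<in> V"
      obtain c where c: "c \<in> M" "p \<in> fst c" using f[OF p(1)] unfolding Cr_at_def by blast
      obtain W where W: "open W" "snd c p \<in> W" "W \<subseteq> snd c ` (fst c \<inter> U)" "Cr_on r W (\<lambda>x. f (cinv c x))"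
        by (rule Cr_at_nbhd[OF M f[OF p(1)] c U p(1)])
      let ?W = "W \<inter> (\<lambda>x. f (cinv c x)) -` V"
      have o: "open ?W"
        by (rule continuous_open_preimage[OF Cr_on_continuous_on[OF W(4)] W(1) V])
      have "openin (mtop M) (cinv c ` ?W)"
        using W(3) by (intro openin_cinv_image[OF M c(1) o]) auto
      moreover have "p \<in> cinv c ` ?W"
        using W(2) p cinv_chart[OF oa c] by (metis IntI image_eqI vimageI)
      moreover have "cinv c ` ?W \<subseteq> {x \<in> U. f x \<in> V}"
        using W(3) oa c by auto
      ultimately show "\<exists>T. openin (mtop M) T \<and> p \<in> T \<and> T \<subseteq> {x \<in> U. f x \<in> V}" by blast
    qed
  qed auto
qed auto

lemma openin_Cr_at_preimage:
  assumes M: "pre_manifold r M" and f: "Cr_at r M f p" and V: "open V" "f p \<in> V"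
  obtains U where "openin (mtop M) U" "p \<in> U" "\<And>q. q \<in> U \<Longrightarrow> Cr_at r M f q \<and> f q \<in> V"
proof -
  obtain U where U: "openin (mtop M) U" "p \<in> U" "\<And>q. q \<in> U \<Longrightarrow> Cr_at r M f q"
    by (rule Cr_at_openin[OF M f]) auto
  have tU: "topspace (subtopology (mtop M) U) = U" using openin_subset[OF U(1)] by auto
  have "openin (subtopology (mtop M) U) {q \<in> topspace (subtopology (mtop M) U). f q \<in> V}"
    using V by (intro openin_continuous_map_preimage[OF continuous_map_Cr_at[OF M U(3,1)]]) auto
  then have "openin (mtop M) {q \<in> U. f q \<in> V}"
    unfolding tU openin_open_subtopology[OF U(1)] by blast
  then show thesis using that[of "{q \<in> U. f q \<in> V}"] U V by blast
qed

lemma Cr_at_compose: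
  fixes f :: "'a \<Rightarrow> 'v::euclidean_space" and g :: "'v \<Rightarrow> 'w::banach"
  assumes M: "pre_manifold r M" and f: "Cr_at r M f p" and g: "open T" "Cr_on r T g" "f p \<in> T"
  shows "Cr_at r M (\<lambda>q. g (f q)) p"
proof -
  from f obtain c W where c: "c \<in> M" "p \<in> fst c" and W: "open W" "snd c p \<in> W" "W \<subseteq> snd c ` fst c"
    "Cr_on r W (\<lambda>x. f (cinv c x))" unfolding Cr_at_def by blast
  let ?W = "W \<inter> (\<lambda>x. f (cinv c x)) -` T"
  have o: "open ?W" by (rule continuous_open_preimage[OF Cr_on_continuous_on[OF W(4)] W(1) g(1)])
  have "Cr_on r ?W (\<lambda>x. g (f (cinv c x)))"
    by (rule Cr_on_compose[OF o g(1) _ Cr_on_subset[OF W(4)] g(2)]) auto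
  then show ?thesis
    using W g(3) cinv_chart[OF pre_manifold_open_atlas[OF M] c] by (intro Cr_atI[OF c o]) auto
qed

lemma Cr_at_bounded_linear:
  assumes "Cr_at r M f p" "bounded_linear T"
  shows "Cr_at r M (\<lambda>q. T (f q)) p"
proof -
  from assms(1) obtain c W where c: "c \<in> M" "p \<in> fst c" and W: "open W" "snd c p \<in> W" "W \<subseteq> snd c ` fst c"
    "Cr_on r W (\<lambda>x. f (cinv c x))" unfolding Cr_at_def by blast
  show ?thesis by (rule Cr_atI[OF c W(1-3) Cr_on_bounded_linear_compose[OF W(1) assms(2) W(4)]])
qed

lemma Cr_at_chart:
  assumes M: "pre_manifold r M" and c: "c \<in> M" "p \<in> fst c"
  shows "Cr_at r M (snd c) p"
proof -
  have o: "open (snd c ` fst c)" using pre_manifold_open_atlas[OF M] c by (simp add: open_atlas_def)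
  have "Cr_on r (snd c ` fst c) (\<lambda>x. snd c (cinv c x))"
    by (rule Cr_on_cong[OF o Cr_on_id]) (simp add: chart_cinv)
  then show ?thesis by (intro Cr_atI[OF c o]) (use c in auto)
qed

lemma Cr_at_const:
  assumes M: "pre_manifold r M" and p: "p \<in> carrier M"
  shows "Cr_at r M (\<lambda>_. k) p"
proof -
  obtain c where c: "c \<in> M" "p \<in> fst c" by (rule carrierE[OF p])
  have o: "open (snd c ` fst c)" using pre_manifold_open_atlas[OF M] c by (simp add: open_atlas_def)
  show ?thesis by (rule Cr_atI[OF c o]) (use c in \<open>auto intro: Cr_on_const\<close>)
qed

lemma Cr_at_Pair:
  fixes f :: "'a \<Rightarrow> 'v::euclidean_space" and g :: "'a \<Rightarrow> 'w::euclidean_space"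
  assumes M: "pre_manifold r M" and f: "Cr_at r M f p" and g: "Cr_at r M g p"
  shows "Cr_at r M (\<lambda>q. (f q, g q)) p"
proof -
  from f obtain c W where c: "c \<in> M" "p \<in> fst c" and W: "open W" "snd c p \<in> W" "W \<subseteq> snd c ` fst c"
    "Cr_on r W (\<lambda>x. f (cinv c x))" unfolding Cr_at_def by blast
  obtain V where V: "open V" "snd c p \<in> V" "V \<subseteq> snd c ` fst c" "Cr_on r V (\<lambda>x. g (cinv c x))"
    by (rule Cr_at_chartE[OF M g c])
  have o: "open (W \<inter> V)" using W V by blast
  have "Cr_on r (W \<inter> V) (\<lambda>x. (f (cinv c x), g (cinv c x)))"
    by (intro Cr_on_Pair[OF o] Cr_on_subset[OF W(4)] Cr_on_subset[OF V(4)]) auto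
  then show ?thesis using W V by (intro Cr_atI[OF c o]) auto
qed

lemma Cr_at_add:
  fixes f g :: "'a \<Rightarrow> 'v::euclidean_space"
  assumes "pre_manifold r M" "Cr_at r M f p" "Cr_at r M g p"
  shows "Cr_at r M (\<lambda>q. f q + g q) p"
  using Cr_at_bounded_linear[OF Cr_at_Pair[OF assms] bounded_linear_add[OF bounded_linear_fst bounded_linear_snd]] by simp

lemma Cr_at_scaleR:
  fixes f :: "'a \<Rightarrow> real" and g :: "'a \<Rightarrow> 'v::euclidean_space"
  assumes "pre_manifold r M" "Cr_at r M f p" "Cr_at r M g p"
  shows "Cr_at r M (\<lambda>q. f q *\<^sub>R g q) p"
proof -
  have "Cr_on r UNIV (\<lambda>z::real \<times> 'v. fst z *\<^sub>R snd z)"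
    by (intro Cr_on_scaleR Cr_on_bounded_linear bounded_linear_fst bounded_linear_snd open_UNIV)
  from Cr_at_compose[OF assms(1) Cr_at_Pair[OF assms] open_UNIV this] show ?thesis by simp
qed

lemma Cr_at_divide:
  fixes f g :: "'a \<Rightarrow> real"
  assumes "pre_manifold r M" "Cr_at r M f p" "Cr_at r M g p" "g p \<noteq> 0"
  shows "Cr_at r M (\<lambda>q. f q / g q) p"
proof -
  have o: "open {z::real \<times> real. snd z \<noteq> 0}"
    by (intro open_Collect_neq continuous_intros)
  have "Cr_on r {z::real \<times> real. snd z \<noteq> 0} (\<lambda>z. fst z / snd z)"
    by (intro Cr_on_divide o Cr_on_bounded_linear bounded_linear_fst bounded_linear_snd) auto
  from Cr_at_compose[OF assms(1) Cr_at_Pair[OF assms(1-3)] o this] assms(4) show ?thesis by simp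
qed

lemma Cr_at_vec:
  fixes f :: "'a \<Rightarrow> real^'n"
  assumes M: "pre_manifold r M" and p: "p \<in> carrier M" and f: "\<And>i. Cr_at r M (\<lambda>q. f q $ i) p"
  shows "Cr_at r M f p"
proof -
  have fin: "Cr_at r M (\<lambda>q. \<Sum>i\<in>I. (f q $ i) *\<^sub>R (axis i 1 :: real^'n)) p" if "finite I" for I
    using that
  proof (induction I)
    case (insert i I)
    show ?case
      unfolding sum.insert[OF insert(1,2)]
      by (rule Cr_at_add[OF M Cr_at_scaleR[OF M f Cr_at_const[OF M p]] insert(3)])
  qed (simp add: Cr_at_const[OF M p])
  have "(\<Sum>i\<in>UNIV. (f q $ i) *\<^sub>R (axis i 1 :: real^'n)) = f q" for q
    by (simp add: vec_eq_iff axis_def if_distrib cong: if_cong)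
  then show ?thesis using fin[of UNIV] by simp
qed

section \<open>Differentiable maps\<close>

lemma Cr_mapI:
  assumes M: "pre_manifold r M" and N: "open_atlas N" and im: "f ` carrier M \<subseteq> carrier N"
    and loc: "\<And>p d. p \<in> carrier M \<Longrightarrow> d \<in> N \<Longrightarrow> f p \<in> fst d \<Longrightarrow>
      Cr_at r M (\<lambda>q. snd d (f q)) p \<and> (\<exists>U. openin (mtop M) U \<and> p \<in> U \<and> f ` U \<subseteq> fst d)"
  shows "Cr_map r M N (f :: 'a \<Rightarrow> 'b)"
  unfolding Cr_map_def
proof (intro conjI ballI im)
  note oa = pre_manifold_open_atlas[OF M]
  have tM: "topspace (mtop M) = carrier M" by (rule topspace_mtop[OF oa])
  show "continuous_map (mtop M) (mtop N) f"
  proof (rule continuous_map_into_mtop[OF N])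
    show "f ` topspace (mtop M) \<subseteq> carrier N" using im by (simp add: tM)
    fix p d assume pd: "p \<in> topspace (mtop M)" "d \<in> N" "f p \<in> fst d"
    then obtain U where U: "openin (mtop M) U" "p \<in> U" "f ` U \<subseteq> fst d" using loc[of p d] tM by blast
    have "Cr_at r M (\<lambda>q. snd d (f q)) q" if "q \<in> U" for q
      using loc[of q d] that U openin_subset[OF U(1)] pd(2) tM by blast
    then show "\<exists>T. openin (mtop M) T \<and> p \<in> T \<and> f ` T \<subseteq> fst d \<and> continuous_map (subtopology (mtop M) T) euclidean (snd d \<circ> f)"
      using U continuous_map_Cr_at[OF M _ U(1)] by (auto simp: o_def)
  qed
  fix c d assume c: "c \<in> M" and d: "d \<in> N"
  show "Cr_on r (snd c ` (fst c \<inter> f -` fst d)) (local_rep c d f)"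
  proof (rule Cr_on_local)
    fix a assume "a \<in> snd c ` (fst c \<inter> f -` fst d)"
    then obtain p where p: "p \<in> fst c" "f p \<in> fst d" "a = snd c p" by auto
    then have "Cr_at r M (\<lambda>q. snd d (f q)) p" using loc[of p d] carrierI[OF c] d by blast
    then obtain W where "open W" "snd c p \<in> W" "W \<subseteq> snd c ` fst c" "Cr_on r W (\<lambda>x. snd d (f (cinv c x)))"
      by (rule Cr_at_chartE[OF M _ c p(1)])
    then show "\<exists>U. open U \<and> a \<in> U \<and> Cr_on r U (local_rep c d f)"
      using p by (auto simp: local_rep_def o_def)
  qed
qed

lemma Cr_mapD:
  assumes M: "pre_manifold r M" and N: "openin (mtop N) (fst d)" and f: "Cr_map r M N f" and p: "p \<in> carrier M"
    and d: "d \<in> N" "f p \<in> fst d"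
  shows "Cr_at r M (\<lambda>q. snd d (f q)) p" "\<exists>U. openin (mtop M) U \<and> p \<in> U \<and> f ` U \<subseteq> fst d"
proof -
  note oa = pre_manifold_open_atlas[OF M]
  have tM: "topspace (mtop M) = carrier M" by (rule topspace_mtop[OF oa])
  define U where "U = {q \<in> carrier M. f q \<in> fst d}"
  have U: "openin (mtop M) U"
    using f openin_continuous_map_preimage[OF _ N] unfolding U_def Cr_map_def tM[symmetric] by blast
  then show "\<exists>U. openin (mtop M) U \<and> p \<in> U \<and> f ` U \<subseteq> fst d"
    using p d by (intro exI[of _ U]) (auto simp: U_def)
  obtain c where c: "c \<in> M" "p \<in> fst c" by (rule carrierE[OF p])
  have o: "open (snd c ` (U \<inter> fst c))"
    using U c openin_mtop_iff[OF oa] by (auto simp: mopen_def)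
  have "U \<inter> fst c = fst c \<inter> f -` fst d" using c by (auto simp: U_def carrier_def)
  then have "Cr_on r (snd c ` (U \<inter> fst c)) (\<lambda>x. snd d (f (cinv c x)))"
    using f c d by (auto simp: Cr_map_def local_rep_def o_def)
  then show "Cr_at r M (\<lambda>q. snd d (f q)) p"
    using c p d by (intro Cr_atI[OF c o]) (auto simp: U_def)
qed

lemma Cr_mapD_pre:
  assumes "pre_manifold r M" "pre_manifold r N" "Cr_map r M N f" "p \<in> carrier M" "d \<in> N" "f p \<in> fst d"
  shows "Cr_at r M (\<lambda>q. snd d (f q)) p"
  by (rule Cr_mapD(1)[OF assms(1) openin_chart[OF assms(2,5)] assms(3-6)])

text \<open>One chart around each image point is enough: any other chart is reached through a
  transition map, after the neighbourhood has been shrunk to the preimage of the overlap.\<close>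

lemma Cr_mapI_pre:
  assumes M: "pre_manifold r M" and N: "pre_manifold r N"
    and loc: "\<And>p. p \<in> carrier M \<Longrightarrow> \<exists>d\<in>N. f p \<in> fst d \<and> Cr_at r M (\<lambda>q. snd d (f q)) p \<and>
      (\<exists>U. openin (mtop M) U \<and> p \<in> U \<and> f ` U \<subseteq> fst d)"
  shows "Cr_map r M N (f :: 'a \<Rightarrow> 'b)"
proof -
  note oa = pre_manifold_open_atlas[OF N]
  have im: "f ` carrier M \<subseteq> carrier N" using loc by (blast intro: carrierI)
  have "Cr_at r M (\<lambda>q. snd e (f q)) p \<and> (\<exists>U. openin (mtop M) U \<and> p \<in> U \<and> f ` U \<subseteq> fst e)"
    if p: "p \<in> carrier M" and e: "e \<in> N" "f p \<in> fst e" for p e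
  proof -
  obtain d U where d: "d \<in> N" "f p \<in> fst d" "Cr_at r M (\<lambda>q. snd d (f q)) p"
    and U: "openin (mtop M) U" "p \<in> U" "f ` U \<subseteq> fst d" using loc[OF p] by blast
  let ?S = "snd d ` (fst d \<inter> fst e)"
  have S: "open ?S" "Cr_on r ?S (local_rep d e (\<lambda>x. x))" using N d e by (auto simp: pre_manifold_def)
  have pS: "snd d (f p) \<in> ?S" using d e by blast
  obtain V where V: "openin (mtop M) V" "p \<in> V" "\<And>q. q \<in> V \<Longrightarrow> snd d (f q) \<in> ?S"
    using openin_Cr_at_preimage[OF M d(3) S(1) pS] by metis
  have UV: "f q \<in> fst e" "local_rep d e (\<lambda>x. x) (snd d (f q)) = snd e (f q)" if q: "q \<in> U \<inter> V" for q
  proof -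
    have fd: "f q \<in> fst d" using q U by auto
    then show "local_rep d e (\<lambda>x. x) (snd d (f q)) = snd e (f q)"
      using cinv_chart[OF oa d(1)] by (simp add: local_rep_def)
    have "snd d (f q) \<in> ?S" by (rule V(3)) (use q in simp)
    then obtain w where w: "w \<in> fst d" "w \<in> fst e" "snd d (f q) = snd d w" by blast
    have "inj_on (snd d) (fst d)" using oa d by (simp add: open_atlas_def)
    then show "f q \<in> fst e" using inj_onD[OF _ w(3) fd w(1)] w(2) by simp
  qed
  have o: "openin (mtop M) (U \<inter> V)" using U(1) V(1) by (rule openin_Int)
  have "Cr_at r M (\<lambda>q. local_rep d e (\<lambda>x. x) (snd d (f q))) p"
    by (rule Cr_at_compose[OF M d(3) S pS])
  then have "Cr_at r M (\<lambda>q. snd e (f q)) p"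
    by (rule Cr_at_cong[OF M _ o IntI[OF U(2) V(2)]]) (rule UV(2))
  moreover have "f ` (U \<inter> V) \<subseteq> fst e"
    by (rule image_subsetI) (rule UV(1))
  moreover have "p \<in> U \<inter> V" using U(2) V(2) by (rule IntI)
  ultimately show ?thesis using o by auto
  qed
  then show ?thesis by (rule Cr_mapI[OF M oa im])
qed

section \<open>Euclidean spaces, open submanifolds and products\<close>

lemma open_atlas_euclid: "open_atlas (euclid :: ('v::real_normed_vector, 'v) atlas)"
  by (simp add: open_atlas_def euclid_def)

lemma carrier_euclid [simp]: "carrier euclid = UNIV"
  by (simp add: carrier_def euclid_def)

lemma mtop_euclid: "mtop (euclid :: ('v::real_normed_vector, 'v) atlas) = euclidean"
  unfolding topology_eq openin_mtop_iff[OF open_atlas_euclid]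
  by (simp add: mopen_def euclid_def carrier_def)

lemma pre_manifold_euclid: "pre_manifold r (euclid :: ('v::euclidean_space, 'v) atlas)"
proof -
  have "local_rep (UNIV, \<lambda>x. x) (UNIV, \<lambda>x. x) (\<lambda>x. x) = (\<lambda>x::'v. x)"
    by (auto simp: local_rep_def fun_eq_iff inv_into_f_f)
  then show ?thesis by (simp add: pre_manifold_def euclid_def Cr_on_id)
qed

lemma Cr_map_euclid_iff:
  fixes f :: "'a \<Rightarrow> 'v::banach"
  assumes M: "pre_manifold r M"
  shows "Cr_map r M euclid f \<longleftrightarrow> (\<forall>p\<in>carrier M. Cr_at r M f p)"
proof
  assume f: "Cr_map r M euclid f"
  have o: "openin (mtop (euclid :: ('v, 'v) atlas)) (fst (UNIV, \<lambda>x. x))" by (simp add: mtop_euclid)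
  show "\<forall>p\<in>carrier M. Cr_at r M f p"
    using Cr_mapD(1)[OF M o f] by (simp add: euclid_def)
next
  assume f: "\<forall>p\<in>carrier M. Cr_at r M f p"
  have "openin (mtop M) (carrier M)"
    using openin_mtop_iff mopen_carrier pre_manifold_open_atlas[OF M] by blast
  then show "Cr_map r M euclid f"
    using f by (intro Cr_mapI[OF M open_atlas_euclid]) (simp, auto simp: euclid_def)
qed

lemma openin_restr:
  assumes M: "open_atlas M" and W: "openin (mtop M) W"
  shows "open_atlas (restr M W)" "carrier (restr M W) = W" "openin (mtop (restr M W)) V \<longleftrightarrow> openin (mtop M) V \<and> V \<subseteq> W"
proof -
  have mW: "mopen M W" using openin_mtop_iff[OF M] W by blast
  then have o: "open (snd c ` (W \<inter> fst c))" if "c \<in> M" for c using that by (auto simp: mopen_def)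
  show oa: "open_atlas (restr M W)"
    using M o by (auto simp: open_atlas_def restr_def intro: inj_on_subset)
  show cW: "carrier (restr M W) = W"
    using mW by (auto simp: carrier_def restr_def mopen_def)
  have eq: "V \<inter> (W \<inter> X) = V \<inter> X" if "V \<subseteq> W" for X using that by blast
  show "openin (mtop (restr M W)) V \<longleftrightarrow> openin (mtop M) V \<and> V \<subseteq> W"
    unfolding openin_mtop_iff[OF oa] openin_mtop_iff[OF M] mopen_def cW
    using mW by (cases "V \<subseteq> W") (auto simp: restr_def mopen_def eq)
qed

lemma cinv_restr:
  assumes "open_atlas M" "c \<in> M" "y \<in> snd c ` (W \<inter> fst c)"
  shows "inv_into (W \<inter> fst c) (snd c) y = cinv c y"
proof -
  obtain p where p: "p \<in> W \<inter> fst c" "y = snd c p" using assms(3) by blast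
  have "inj_on (snd c) (fst c)" "inj_on (snd c) (W \<inter> fst c)"
    using assms(1,2) by (auto simp: open_atlas_def intro: inj_on_subset)
  then show ?thesis using p by (simp add: inv_into_f_f)
qed

lemma pre_manifold_restr:
  assumes M: "pre_manifold r M" and W: "openin (mtop M) W"
  shows "pre_manifold r (restr M W)"
  unfolding pre_manifold_def
proof (intro conjI ballI)
  note oa = pre_manifold_open_atlas[OF M]
  show "inj_on (snd c) (fst c)" if "c \<in> restr M W" for c
    using openin_restr(1)[OF oa W] that by (simp add: open_atlas_def)
  fix c' d' assume "c' \<in> restr M W" "d' \<in> restr M W"
  then obtain c d where cd: "c \<in> M" "d \<in> M" "c' = (W \<inter> fst c, snd c)" "d' = (W \<inter> fst d, snd d)"
    by (auto simp: restr_def)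
  let ?S = "snd c ` (fst c \<inter> fst d)" and ?S' = "snd c' ` (fst c' \<inter> fst d')"
  have S: "Cr_on r ?S (local_rep c d (\<lambda>x. x))" using M cd by (auto simp: pre_manifold_def)
  have "openin (mtop M) (W \<inter> fst c \<inter> fst d)"
    using W openin_chart[OF M cd(1)] openin_chart[OF M cd(2)] by blast
  then have "open (snd c ` (W \<inter> fst c \<inter> fst d))"
    using openin_chart_subset[OF M cd(1), of "W \<inter> fst c \<inter> fst d"] by auto
  moreover have eq: "?S' = snd c ` (W \<inter> fst c \<inter> fst d)" by (simp add: cd(3,4)) (metis Int_assoc inf_left_idem inf_left_commute)
  ultimately show S': "open ?S'" by simp
  show "Cr_on r ?S' (local_rep c' d' (\<lambda>x. x))"
  proof (rule Cr_on_cong[OF S' Cr_on_subset[OF S]])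
    show "?S' \<subseteq> ?S" by (auto simp: cd)
    fix x assume "x \<in> ?S'"
    then have "x \<in> snd c ` (W \<inter> fst c)" by (auto simp: cd)
    then show "local_rep c d (\<lambda>x. x) x = local_rep c' d' (\<lambda>x. x) x"
      using cinv_restr[OF oa cd(1)] by (simp add: local_rep_def cd(3,4))
  qed
qed

lemma Cr_at_restr:
  assumes M: "pre_manifold r M" and W: "openin (mtop M) W" and p: "p \<in> W"
  shows "Cr_at r (restr M W) f p \<longleftrightarrow> Cr_at r M f p"
proof
  note oa = pre_manifold_open_atlas[OF M]
  assume "Cr_at r (restr M W) f p"
  then obtain c V where c: "c \<in> M" "p \<in> fst c" and V: "open V" "snd c p \<in> V" "V \<subseteq> snd c ` (W \<inter> fst c)"
    "Cr_on r V (\<lambda>x. f (inv_into (W \<inter> fst c) (snd c) x))"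
    unfolding Cr_at_def restr_def by auto
  have "Cr_on r V (\<lambda>x. f (cinv c x))"
    by (rule Cr_on_cong[OF V(1,4)]) (use V(3) cinv_restr[OF oa c(1)] in auto)
  then show "Cr_at r M f p" using V by (intro Cr_atI[OF c V(1,2)]) auto
next
  note oa = pre_manifold_open_atlas[OF M]
  assume f: "Cr_at r M f p"
  then obtain c where c: "c \<in> M" "p \<in> fst c" unfolding Cr_at_def by blast
  obtain V where V: "open V" "snd c p \<in> V" "V \<subseteq> snd c ` (fst c \<inter> W)" "Cr_on r V (\<lambda>x. f (cinv c x))"
    by (rule Cr_at_nbhd[OF M f c W p])
  have "Cr_on r V (\<lambda>x. f (inv_into (W \<inter> fst c) (snd c) x))"
    by (rule Cr_on_cong[OF V(1,4)]) (use V(3) cinv_restr[OF oa c(1)] in \<open>auto simp: Int_commute\<close>)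
  then show "Cr_at r (restr M W) f p"
    using c p V by (intro Cr_atI[where c="(W \<inter> fst c, snd c)" and W=V]) (auto simp: restr_def Int_commute)
qed

abbreviation pchart :: "('a, 'e) chart \<Rightarrow> ('b, 'f) chart \<Rightarrow> ('a \<times> 'b, 'e \<times> 'f) chart" where
  "pchart c d \<equiv> (fst c \<times> fst d, map_prod (snd c) (snd d))"

lemma prod_atlasE:
  assumes "e \<in> prod_atlas M N" obtains c d where "c \<in> M" "d \<in> N" "e = pchart c d"
  using assms by (auto simp: prod_atlas_def)

lemma pchart_in: "c \<in> M \<Longrightarrow> d \<in> N \<Longrightarrow> pchart c d \<in> prod_atlas M N"
  by (force simp: prod_atlas_def)

lemma carrier_prod: "carrier (prod_atlas M N) = carrier M \<times> carrier N"
  by (force simp: carrier_def prod_atlas_def)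

lemma pchart_inj:
  "inj_on (snd c) (fst c) \<Longrightarrow> inj_on (snd d) (fst d) \<Longrightarrow> inj_on (map_prod (snd c) (snd d)) (fst c \<times> fst d)"
  by (rule map_prod_inj_on)

lemma open_atlas_prod:
  assumes "open_atlas M" "open_atlas N" shows "open_atlas (prod_atlas M N)"
  unfolding open_atlas_def
proof
  fix e assume "e \<in> prod_atlas M N"
  then obtain c d where e: "c \<in> M" "d \<in> N" "e = pchart c d" by (rule prod_atlasE)
  then show "inj_on (snd e) (fst e) \<and> open (snd e ` fst e)"
    using assms pchart_inj[of c d] by (auto simp: open_atlas_def map_prod_surj_on[OF refl refl] intro!: open_Times)
qed

lemma cinv_pchart:
  assumes "open_atlas M" "open_atlas N" "c \<in> M" "d \<in> N" "z \<in> snd c ` fst c \<times> snd d ` fst d"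
  shows "inv_into (fst c \<times> fst d) (map_prod (snd c) (snd d)) z = (cinv c (fst z), cinv d (snd z))"
proof (rule inv_into_f_eq)
  show "inj_on (map_prod (snd c) (snd d)) (fst c \<times> fst d)"
    using assms by (intro pchart_inj) (auto simp: open_atlas_def)
  show "(cinv c (fst z), cinv d (snd z)) \<in> fst c \<times> fst d"
    using assms(5) by (auto intro: cinv_into)
  show "map_prod (snd c) (snd d) (cinv c (fst z), cinv d (snd z)) = z"
    using assms(5) by (auto simp: chart_cinv)
qed

lemma pre_manifold_prod:
  assumes M: "pre_manifold r M" and N: "pre_manifold r N"
  shows "pre_manifold r (prod_atlas M N)"
  unfolding pre_manifold_def
proof (intro conjI ballI)
  note oM = pre_manifold_open_atlas[OF M] and oN = pre_manifold_open_atlas[OF N]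
  show "inj_on (snd e) (fst e)" if "e \<in> prod_atlas M N" for e
    using open_atlas_prod[OF oM oN] that by (simp add: open_atlas_def)
  fix e e' assume "e \<in> prod_atlas M N" "e' \<in> prod_atlas M N"
  then obtain c d c' d' where e: "c \<in> M" "d \<in> N" "e = pchart c d" and e': "c' \<in> M" "d' \<in> N" "e' = pchart c' d'"
    by (metis prod_atlasE)
  let ?S = "snd c ` (fst c \<inter> fst c')" and ?T = "snd d ` (fst d \<inter> fst d')"
  have S: "open ?S" "Cr_on r ?S (local_rep c c' (\<lambda>x. x))" using M e e' by (auto simp: pre_manifold_def)
  have T: "open ?T" "Cr_on r ?T (local_rep d d' (\<lambda>x. x))" using N e e' by (auto simp: pre_manifold_def)
  have im: "snd e ` (fst e \<inter> fst e') = ?S \<times> ?T"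
    unfolding e e' by (simp add: Times_Int_Times map_prod_surj_on[OF refl refl])
  show o: "open (snd e ` (fst e \<inter> fst e'))" unfolding im using S T by (intro open_Times)
  have o': "open (?S \<times> ?T)" using o im by simp
  have "Cr_on r (?S \<times> ?T) (\<lambda>z. (local_rep c c' (\<lambda>x. x) (fst z), local_rep d d' (\<lambda>x. x) (snd z)))"
    by (intro Cr_on_Pair[OF o'] Cr_on_compose[OF o' S(1) _ _ S(2)] Cr_on_compose[OF o' T(1) _ _ T(2)]
        Cr_on_bounded_linear bounded_linear_fst bounded_linear_snd) auto
  then show "Cr_on r (snd e ` (fst e \<inter> fst e')) (local_rep e e' (\<lambda>x. x))"
    unfolding im
  proof (rule Cr_on_cong[OF o'])
    fix z assume "z \<in> ?S \<times> ?T"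
    then have "z \<in> snd c ` fst c \<times> snd d ` fst d" by auto
    from cinv_pchart[OF oM oN e(1,2) this]
    show "(local_rep c c' (\<lambda>x. x) (fst z), local_rep d d' (\<lambda>x. x) (snd z)) = local_rep e e' (\<lambda>x. x) z"
      by (simp add: local_rep_def e e')
  qed
qed

lemma mtop_prod:
  assumes M: "pre_manifold r M" and N: "pre_manifold r N"
  shows "mtop (prod_atlas M N) = prod_topology (mtop M) (mtop N)"
  unfolding topology_eq
proof (intro allI iffI)
  note oM = pre_manifold_open_atlas[OF M] and oN = pre_manifold_open_atlas[OF N]
  note P = pre_manifold_prod[OF M N]
  note oP = pre_manifold_open_atlas[OF P]
  fix W assume W: "openin (mtop (prod_atlas M N)) W"
  show "openin (prod_topology (mtop M) (mtop N)) W"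
    unfolding openin_prod_topology_alt
  proof (intro allI impI)
    fix p q assume pq: "(p, q) \<in> W"
    have mW: "mopen (prod_atlas M N) W" using W openin_mtop_iff[OF oP] by blast
    then obtain c d where c: "c \<in> M" "p \<in> fst c" and d: "d \<in> N" "q \<in> fst d"
      using pq carrier_prod[of M N] by (auto simp: mopen_def elim!: carrierE)
    have "open (snd (pchart c d) ` (W \<inter> fst (pchart c d)))"
      using mW pchart_in[OF c(1) d(1)] unfolding mopen_def by blast
    moreover have "(snd c p, snd d q) \<in> snd (pchart c d) ` (W \<inter> fst (pchart c d))"
      using pq c d by force
    ultimately obtain A B where AB: "open A" "open B" "(snd c p, snd d q) \<in> A \<times> B"
      "A \<times> B \<subseteq> snd (pchart c d) ` (W \<inter> fst (pchart c d))"
      by (rule open_prod_elim)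
    have A: "A \<subseteq> snd c ` fst c" and B: "B \<subseteq> snd d ` fst d"
    proof -
      have "A \<times> B \<subseteq> snd c ` fst c \<times> snd d ` fst d"
        using AB(4) map_prod_surj_on[of "snd c" "fst c" _ "snd d" "fst d", OF refl refl] by auto
      then show "A \<subseteq> snd c ` fst c" "B \<subseteq> snd d ` fst d" using AB(3) by (auto simp: times_subset_iff)
    qed
    show "\<exists>U V. openin (mtop M) U \<and> openin (mtop N) V \<and> p \<in> U \<and> q \<in> V \<and> U \<times> V \<subseteq> W"
    proof (intro exI conjI)
      show "openin (mtop M) (cinv c ` A)" by (rule openin_cinv_image[OF M c(1) AB(1) A])
      show "openin (mtop N) (cinv d ` B)" by (rule openin_cinv_image[OF N d(1) AB(2) B])
      show "p \<in> cinv c ` A" using AB(3) cinv_chart[OF oM c] by (metis image_eqI mem_Times_iff fst_conv)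
      show "q \<in> cinv d ` B" using AB(3) cinv_chart[OF oN d] by (metis image_eqI mem_Times_iff snd_conv)
      show "cinv c ` A \<times> cinv d ` B \<subseteq> W"
      proof clarify
        fix a b assume ab: "a \<in> A" "b \<in> B"
        then obtain x y where xy: "(x, y) \<in> W" "x \<in> fst c" "y \<in> fst d" "a = snd c x" "b = snd d y"
        proof -
          have "(a, b) \<in> map_prod (snd c) (snd d) ` (W \<inter> fst c \<times> fst d)" using AB(4) ab by auto
          then show thesis using that by auto
        qed
        then show "(cinv c a, cinv d b) \<in> W" using cinv_chart[OF oM c(1)] cinv_chart[OF oN d(1)] by simp
      qed
    qed
  qed
next
  note oM = pre_manifold_open_atlas[OF M] and oN = pre_manifold_open_atlas[OF N]
  note P = pre_manifold_prod[OF M N]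
  note oP = pre_manifold_open_atlas[OF P]
  have box: "openin (mtop (prod_atlas M N)) (U \<times> V)" if "openin (mtop M) U" "openin (mtop N) V" for U V
    unfolding openin_mtop_iff[OF oP] mopen_def carrier_prod
  proof (intro conjI ballI)
    have m: "mopen M U" "mopen N V" using that openin_mtop_iff oM oN by blast+
    show "U \<times> V \<subseteq> carrier M \<times> carrier N" using m by (auto simp: mopen_def)
    fix e assume "e \<in> prod_atlas M N"
    then obtain c d where e: "c \<in> M" "d \<in> N" "e = pchart c d" by (rule prod_atlasE)
    have "open (snd c ` (U \<inter> fst c) \<times> snd d ` (V \<inter> fst d))"
      using m e by (intro open_Times) (auto simp: mopen_def)
    then show "open (snd e ` (U \<times> V \<inter> fst e))"
      unfolding e by (simp add: Times_Int_Times map_prod_surj_on[OF refl refl])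
  qed
  fix W assume W: "openin (prod_topology (mtop M) (mtop N)) W"
  show "openin (mtop (prod_atlas M N)) W"
  proof (subst openin_subopen, safe)
    fix p q assume "(p, q) \<in> W"
    then obtain U V where "openin (mtop M) U" "openin (mtop N) V" "p \<in> U" "q \<in> V" "U \<times> V \<subseteq> W"
      using W unfolding openin_prod_topology_alt by meson
    then show "\<exists>T. openin (mtop (prod_atlas M N)) T \<and> (p, q) \<in> T \<and> T \<subseteq> W"
      using box by (intro exI[of _ "U \<times> V"]) auto
  qed
qed

lemma Cr_at_fst:
  assumes M: "pre_manifold r M" and N: "pre_manifold r N" and f: "Cr_at r M f (fst p)" and p: "snd p \<in> carrier N"
  shows "Cr_at r (prod_atlas M N) (\<lambda>q. f (fst q)) p"
proof -
  note oM = pre_manifold_open_atlas[OF M] and oN = pre_manifold_open_atlas[OF N]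
  from f obtain c W where c: "c \<in> M" "fst p \<in> fst c" and W: "open W" "snd c (fst p) \<in> W" "W \<subseteq> snd c ` fst c"
    "Cr_on r W (\<lambda>x. f (cinv c x))" unfolding Cr_at_def by blast
  obtain d where d: "d \<in> N" "snd p \<in> fst d" by (rule carrierE[OF p])
  let ?V = "W \<times> snd d ` fst d"
  have o: "open ?V" using W oN d by (intro open_Times) (auto simp: open_atlas_def)
  have "Cr_on r ?V (\<lambda>z. f (cinv c (fst z)))"
    by (rule Cr_on_compose[OF o W(1) _ _ W(4)]) (auto intro: Cr_on_bounded_linear bounded_linear_fst)
  then have "Cr_on r ?V (\<lambda>z. f (fst (inv_into (fst c \<times> fst d) (map_prod (snd c) (snd d)) z)))"
  proof (rule Cr_on_cong[OF o])
    fix z assume "z \<in> ?V"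
    then have "z \<in> snd c ` fst c \<times> snd d ` fst d" using W(3) by auto
    from cinv_pchart[OF oM oN c(1) d(1) this]
    show "f (cinv c (fst z)) = f (fst (inv_into (fst c \<times> fst d) (map_prod (snd c) (snd d)) z))" by simp
  qed
  then show ?thesis
    using c d W
    by (cases p; intro Cr_atI[where c="pchart c d" and W="?V"] pchart_in o)
       (auto simp: map_prod_surj_on[OF refl refl])
qed

lemma Cr_at_snd:
  assumes M: "pre_manifold r M" and N: "pre_manifold r N" and f: "Cr_at r N f (snd p)" and p: "fst p \<in> carrier M"
  shows "Cr_at r (prod_atlas M N) (\<lambda>q. f (snd q)) p"
proof -
  note oM = pre_manifold_open_atlas[OF M] and oN = pre_manifold_open_atlas[OF N]
  from f obtain d W where d: "d \<in> N" "snd p \<in> fst d" and W: "open W" "snd d (snd p) \<in> W" "W \<subseteq> snd d ` fst d"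
    "Cr_on r W (\<lambda>x. f (cinv d x))" unfolding Cr_at_def by blast
  obtain c where c: "c \<in> M" "fst p \<in> fst c" by (rule carrierE[OF p])
  let ?V = "snd c ` fst c \<times> W"
  have o: "open ?V" using W oM c by (intro open_Times) (auto simp: open_atlas_def)
  have "Cr_on r ?V (\<lambda>z. f (cinv d (snd z)))"
    by (rule Cr_on_compose[OF o W(1) _ _ W(4)]) (auto intro: Cr_on_bounded_linear bounded_linear_snd)
  then have "Cr_on r ?V (\<lambda>z. f (snd (inv_into (fst c \<times> fst d) (map_prod (snd c) (snd d)) z)))"
  proof (rule Cr_on_cong[OF o])
    fix z assume "z \<in> ?V"
    then have "z \<in> snd c ` fst c \<times> snd d ` fst d" using W(3) by auto
    from cinv_pchart[OF oM oN c(1) d(1) this]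
    show "f (cinv d (snd z)) = f (snd (inv_into (fst c \<times> fst d) (map_prod (snd c) (snd d)) z))" by simp
  qed
  then show ?thesis
    using c d W
    by (cases p; intro Cr_atI[where c="pchart c d" and W="?V"] pchart_in o)
       (auto simp: map_prod_surj_on[OF refl refl])
qed

section \<open>Differentials\<close>

text \<open>The differential of a vector-valued map in the source chart \<open>c\<close>. A chart of
  the target is absorbed into \<open>f\<close>, see \<open>mderiv_vd\<close>, and ordinary calculus
  applies.\<close>

definition vd :: "('a, 'e::real_normed_vector) chart \<Rightarrow> ('a \<Rightarrow> 'v::real_normed_vector) \<Rightarrow> 'a \<Rightarrow> 'e \<Rightarrow> 'v" where
  "vd c f p = frechet_derivative (\<lambda>x. f (cinv c x)) (at (snd c p))"

lemma mderiv_vd: "mderiv c d f p = vd c (\<lambda>q. snd d (f q)) p"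
  by (simp add: mderiv_def vd_def local_rep_def o_def)

lemma vd_has_derivative:
  assumes M: "pre_manifold r M" and f: "Cr_at r M f p" and c: "c \<in> M" "p \<in> fst c"
  shows "((\<lambda>x. f (cinv c x)) has_derivative vd c f p) (at (snd c p))"
proof -
  obtain W where "open W" "snd c p \<in> W" "W \<subseteq> snd c ` fst c" "Cr_on r W (\<lambda>x. f (cinv c x))"
    by (rule Cr_at_chartE[OF M f c])
  then show ?thesis unfolding vd_def by (auto intro: Cr_on_has_derivative)
qed

lemma linear_vd:
  assumes "pre_manifold r M" "Cr_at r M f p" "c \<in> M" "p \<in> fst c"
  shows "linear (vd c f p)"
  using has_derivative_linear[OF vd_has_derivative[OF assms]] .

lemma vd_eqI: "((\<lambda>x. f (cinv c x)) has_derivative D) (at (snd c p)) \<Longrightarrow> vd c f p = D"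
  unfolding vd_def by (rule frechet_derivative_at[symmetric])

lemma vd_cong:
  assumes M: "pre_manifold r M" and f: "Cr_at r M f p" and c: "c \<in> M" "p \<in> fst c"
    and U: "openin (mtop M) U" "p \<in> U" and eq: "\<And>q. q \<in> U \<Longrightarrow> f q = g q"
  shows "vd c g p = vd c f p"
proof (rule vd_eqI)
  have "mopen M U" using U openin_mtop_iff[OF pre_manifold_open_atlas[OF M]] by blast
  then have o: "open (snd c ` (U \<inter> fst c))" using c by (auto simp: mopen_def)
  show "((\<lambda>x. g (cinv c x)) has_derivative vd c f p) (at (snd c p))"
    by (rule has_derivative_transform_within_open[OF vd_has_derivative[OF M f c] o])
       (use c U eq cinv_chart[OF pre_manifold_open_atlas[OF M] c(1)] in auto)
qed

lemma vd_compose: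
  assumes M: "pre_manifold r M" and f: "Cr_at r M f p" and c: "c \<in> M" "p \<in> fst c"
    and g: "(g has_derivative g') (at (f p))"
  shows "vd c (\<lambda>q. g (f q)) p = (\<lambda>v. g' (vd c f p v))"
proof (rule vd_eqI)
  have "cinv c (snd c p) = p" by (rule cinv_chart[OF pre_manifold_open_atlas[OF M] c])
  then show "((\<lambda>x. g (f (cinv c x))) has_derivative (\<lambda>v. g' (vd c f p v))) (at (snd c p))"
    using has_derivative_compose[OF vd_has_derivative[OF M f c], of g g'] g by simp
qed

lemma vd_bounded_linear:
  assumes "pre_manifold r M" "Cr_at r M f p" "c \<in> M" "p \<in> fst c" "bounded_linear T"
  shows "vd c (\<lambda>q. T (f q)) p = (\<lambda>v. T (vd c f p v))"
  by (rule vd_compose[OF assms(1-4)]) (rule bounded_linear_imp_has_derivative[OF assms(5)])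

text \<open>If h = g \<circ> f near p, then dh = g' \<circ> df, and injectivity of dh passes to df.
  The immersion claims are mostly obtained in this way, by recovering a chart or a known immersion
  from the map at hand.\<close>

lemma inj_vd_factor:
  assumes M: "pre_manifold r M" and f: "Cr_at r M f p" and c: "c \<in> M" "p \<in> fst c"
    and g: "(g has_derivative g') (at (f p))"
    and h: "Cr_at r M h p" "inj (vd c h p)"
    and U: "openin (mtop M) U" "p \<in> U" and eq: "\<And>q. q \<in> U \<Longrightarrow> h q = g (f q)"
  shows "inj (vd c f p)"
proof -
  have "vd c (\<lambda>q. g (f q)) p = vd c h p"
    by (rule vd_cong[OF M h(1) c U eq])
  then have "inj (\<lambda>v. g' (vd c f p v))"
    using h(2) vd_compose[OF M f c g] by simp
  then show ?thesis by (auto simp: inj_def)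
qed

lemma vd_chart:
  assumes M: "pre_manifold r M" and c: "c \<in> M" "p \<in> fst c"
  shows "vd c (snd c) p = (\<lambda>v. v)"
proof (rule vd_eqI)
  have o: "open (snd c ` fst c)" using pre_manifold_open_atlas[OF M] c by (simp add: open_atlas_def)
  show "((\<lambda>x. snd c (cinv c x)) has_derivative (\<lambda>v. v)) (at (snd c p))"
    by (rule has_derivative_transform_within_open[OF has_derivative_ident o]) (use c in \<open>auto simp: chart_cinv\<close>)
qed

lemma vd_change_chart:
  fixes f :: "'a \<Rightarrow> 'v::banach"
  assumes M: "pre_manifold r M" and f: "Cr_at r M f p" and c: "c \<in> M" "p \<in> fst c" and d: "d \<in> M" "p \<in> fst d"
  shows "vd d f p v = vd c f p (vd d (snd c) p v)"
proof -
  note oa = pre_manifold_open_atlas[OF M]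
  note s = Cr_at_chart[OF M c]
  have "Cr_at r M (\<lambda>q. f (cinv c (snd c q))) p"
    by (rule Cr_at_cong[OF M f openin_chart[OF M c(1)] c(2)]) (simp add: cinv_chart[OF oa c(1)])
  then have "vd d f p = vd d (\<lambda>q. f (cinv c (snd c q))) p"
    by (intro vd_cong[OF M _ d openin_chart[OF M c(1)] c(2)]) (auto simp: cinv_chart[OF oa c(1)])
  also have "\<dots> = (\<lambda>v. vd c f p (vd d (snd c) p v))"
    by (rule vd_compose[OF M s d vd_has_derivative[OF M f c]])
  finally show ?thesis by simp
qed

lemma vd_transition:
  assumes M: "pre_manifold r M" and c: "c \<in> M" "p \<in> fst c" and d: "d \<in> M" "p \<in> fst d"
  shows "vd c (snd d) p (vd d (snd c) p v) = v"
  using vd_change_chart[OF M Cr_at_chart[OF M d] c d, of v] vd_chart[OF M d] by simp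

lemma inj_vd_change_chart:
  fixes f :: "'a \<Rightarrow> 'v::banach"
  assumes M: "pre_manifold r M" and f: "Cr_at r M f p" and c: "c \<in> M" "p \<in> fst c" and d: "d \<in> M" "p \<in> fst d"
    and inj: "inj (vd c f p)"
  shows "inj (vd d f p)"
  unfolding inj_def
proof (intro allI impI)
  fix v w assume "vd d f p v = vd d f p w"
  then have "vd d (snd c) p v = vd d (snd c) p w"
    using inj unfolding vd_change_chart[OF M f c d] by (auto dest: injD)
  then show "v = w" using vd_transition[OF M c d] by metis
qed

lemma surj_vd_change_chart:
  fixes f :: "'a \<Rightarrow> 'v::banach"
  assumes M: "pre_manifold r M" and f: "Cr_at r M f p" and c: "c \<in> M" "p \<in> fst c" and d: "d \<in> M" "p \<in> fst d"
    and surj: "surj (vd c f p)"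
  shows "surj (vd d f p)"
  unfolding surj_def
proof
  fix y
  obtain v where "y = vd c f p v" using surj by (auto simp: surj_def)
  then have "y = vd d f p (vd c (snd d) p v)"
    using vd_change_chart[OF M f c d] vd_transition[OF M d c] by simp
  then show "\<exists>v. y = vd d f p v" by blast
qed

lemma Cr_immersionI:
  assumes M: "pre_manifold r M" and f: "Cr_map r M N f"
    and N: "\<And>p d. p \<in> carrier M \<Longrightarrow> d \<in> N \<Longrightarrow> f p \<in> fst d \<Longrightarrow>
      Cr_at r M (\<lambda>q. snd d (f q)) p \<and> (\<exists>c\<in>M. p \<in> fst c \<and> inj (vd c (\<lambda>q. snd d (f q)) p))"
  shows "Cr_immersion r M N f"
  unfolding Cr_immersion_def mderiv_vd
proof (intro conjI ballI impI f)
  fix p c d assume "p \<in> carrier M" "c \<in> M" "d \<in> N" "p \<in> fst c \<and> f p \<in> fst d"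
  then show "inj (vd c (\<lambda>q. snd d (f q)) p)"
    using N[of p d] inj_vd_change_chart[OF M] by blast
qed

lemma Cr_immersion_euclid_iff:
  fixes f :: "'a \<Rightarrow> 'v::banach"
  assumes M: "pre_manifold r M"
  shows "Cr_immersion r M euclid f \<longleftrightarrow>
    (\<forall>p\<in>carrier M. Cr_at r M f p) \<and> (\<forall>p\<in>carrier M. \<forall>c\<in>M. p \<in> fst c \<longrightarrow> inj (vd c f p))"
  unfolding Cr_immersion_def Cr_map_euclid_iff[OF M] mderiv_vd by (simp add: euclid_def)

section \<open>Lifting through embeddings\<close>

text \<open>\<open>R\<close> reads the coordinates of a point off its value under \<open>l\<close>
  and is regular on an open set of the ambient space. The sets \<open>Q\<close> and \<open>V\<close>
  are matched so that \<open>R\<close> lands in the coordinates of \<open>V\<close>, and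
  \<open>cinv d\<close> can be applied to the result.\<close>

lemma immersion_local_retraction:
  fixes l :: "'a \<Rightarrow> 'v::euclidean_space" and S :: "('a, real^'k) atlas"
  assumes S: "pre_manifold r S" and l: "Cr_at r S l y" and d: "d \<in> S" "y \<in> fst d" and inj: "inj (vd d l y)"
    and U: "openin (mtop S) U" "y \<in> U"
  obtains Q R V where "open Q" "Cr_on r Q R" "openin (mtop S) V" "y \<in> V" "V \<subseteq> fst d" "V \<subseteq> U"
    "\<And>q. q \<in> V \<Longrightarrow> l q \<in> Q" "\<And>q. q \<in> V \<Longrightarrow> R (l q) = snd d q" "R ` Q \<subseteq> snd d ` V"
proof -
  note oa = pre_manifold_open_atlas[OF S]
  obtain W where W: "open W" "snd d y \<in> W" "W \<subseteq> snd d ` (fst d \<inter> U)" "Cr_on r W (\<lambda>x. l (cinv d x))"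
    by (rule Cr_at_nbhd[OF S l d U])
  obtain W' Q R where W': "open W'" "snd d y \<in> W'" "W' \<subseteq> W" and Q: "open Q" "(\<lambda>x. l (cinv d x)) ` W' \<subseteq> Q"
    "Cr_on r Q R" "R ` Q \<subseteq> W'" and R: "\<And>x. x \<in> W' \<Longrightarrow> R (l (cinv d x)) = x"
    by (rule Cr_local_retraction[OF W(1,4,2) inj[unfolded vd_def]]) (rule that)
  have sub: "W' \<subseteq> snd d ` fst d" using W'(3) W(3) by blast
  have q: "\<exists>x\<in>W'. q = cinv d x \<and> snd d q = x \<and> q \<in> fst d \<inter> U" if q: "q \<in> cinv d ` W'" for q
  proof -
    obtain x where x: "x \<in> W'" "q = cinv d x" using q by blast
    obtain p where p: "p \<in> fst d \<inter> U" "x = snd d p" using x W'(3) W(3) by blast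
    then show ?thesis using x cinv_chart[OF oa d(1), of p] by auto
  qed
  show thesis
  proof (rule that[OF Q(1,3) openin_cinv_image[OF S d(1) W'(1) sub]])
    show "y \<in> cinv d ` W'" using W'(2) cinv_chart[OF oa d] by (metis image_eqI)
    show "cinv d ` W' \<subseteq> fst d" "cinv d ` W' \<subseteq> U" using q by blast+
    show "l p \<in> Q" "R (l p) = snd d p" if p: "p \<in> cinv d ` W'" for p
    proof -
      obtain x where x: "x \<in> W'" "p = cinv d x" "snd d p = x" using q[OF p] by blast
      show "l p \<in> Q" using Q(2) x(1,2) by auto
      show "R (l p) = snd d p" unfolding x(3) using R[OF x(1)] x(2) by simp
    qed
    have "snd d ` cinv d ` W' = W'" using sub by (force simp: image_image chart_cinv)
    then show "R ` Q \<subseteq> snd d ` cinv d ` W'" using Q(4) by simp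
  qed
qed

text \<open>The last part is the form in which the embedding property is used: open sets of the
  source are cut out by open sets of the ambient space.\<close>

lemma Cr_embedding_euclidD:
  fixes l :: "'a \<Rightarrow> 'v::euclidean_space"
  assumes S: "pre_manifold r S" and l: "Cr_embedding r S euclid l"
  shows "\<And>p. p \<in> carrier S \<Longrightarrow> Cr_at r S l p" "\<And>p c. c \<in> S \<Longrightarrow> p \<in> fst c \<Longrightarrow> inj (vd c l p)"
    "inj_on l (carrier S)"
    "\<And>U. openin (mtop S) U \<Longrightarrow> \<exists>N. open N \<and> (\<forall>p\<in>carrier S. l p \<in> N \<longleftrightarrow> p \<in> U)"
proof -
  note oa = pre_manifold_open_atlas[OF S]
  have im: "Cr_immersion r S euclid l" and e: "embedding_map (mtop S) euclidean l"
    using l by (simp_all add: Cr_embedding_def mtop_euclid)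
  show "\<And>p. p \<in> carrier S \<Longrightarrow> Cr_at r S l p" "\<And>p c. c \<in> S \<Longrightarrow> p \<in> fst c \<Longrightarrow> inj (vd c l p)"
    using im unfolding Cr_immersion_euclid_iff[OF S] by (simp, metis carrierI)
  have hm: "homeomorphic_map (mtop S) (subtopology euclidean (l ` carrier S)) l"
    using e by (simp add: embedding_map_def topspace_mtop[OF oa])
  then show inj: "inj_on l (carrier S)"
    using homeomorphic_eq_everything_map topspace_mtop[OF oa] by metis
  fix U assume U: "openin (mtop S) U"
  then have "openin (subtopology euclidean (l ` carrier S)) (l ` U)"
    using hm homeomorphic_imp_open_map open_map_def by metis
  then obtain N where N: "open N" "l ` U = N \<inter> l ` carrier S"
    by (auto simp: openin_subtopology)
  have "U \<subseteq> carrier S" using openin_subset[OF U] by (simp add: topspace_mtop[OF oa])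
  then have "\<forall>p\<in>carrier S. l p \<in> N \<longleftrightarrow> p \<in> U"
    using N(2) inj by (metis IntD1 IntI image_eqI inj_on_image_mem_iff)
  then show "\<exists>N. open N \<and> (\<forall>p\<in>carrier S. l p \<in> N \<longleftrightarrow> p \<in> U)" using N by blast
qed

text \<open>Continuity of \<open>h\<close> is part of the gain: as \<open>l\<close> is an embedding,
  values \<open>k q\<close> close to \<open>k p\<close> force \<open>h q\<close> close to
  \<open>h p\<close>, and then the coordinates of \<open>h q\<close> are \<open>R (k q)\<close>. The
  transition maps of the quotient and the inverse of \<I> are lifts of this kind.\<close>

lemma Cr_at_lift:
  fixes l :: "'b \<Rightarrow> 'v::euclidean_space" and S :: "('b, real^'k) atlas"
  assumes S: "pre_manifold r S" and l: "Cr_embedding r S euclid l"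
    and M: "pre_manifold r M" and k: "Cr_at r M k p" and U: "openin (mtop M) U" "p \<in> U"
    and h: "\<And>q. q \<in> U \<Longrightarrow> h q \<in> carrier S" "\<And>q. q \<in> U \<Longrightarrow> l (h q) = k q"
    and A: "openin (mtop S) A" "h p \<in> A" and d: "d \<in> S" "h p \<in> fst d"
  obtains V where "openin (mtop M) V" "p \<in> V" "V \<subseteq> U" "h ` V \<subseteq> A" "h ` V \<subseteq> fst d" "Cr_at r M (\<lambda>q. snd d (h q)) p"
proof -
  note lS = Cr_embedding_euclidD[OF S l]
  obtain Q R W where Q: "open Q" "Cr_on r Q R" and W: "openin (mtop S) W" "h p \<in> W" "W \<subseteq> fst d" "W \<subseteq> A"
    and lQ: "\<And>q. q \<in> W \<Longrightarrow> l q \<in> Q" and R: "\<And>q. q \<in> W \<Longrightarrow> R (l q) = snd d q"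
    by (rule immersion_local_retraction[OF S lS(1)[OF h(1)[OF U(2)]] d lS(2)[OF d] A]) blast
  obtain N where N: "open N" "\<And>q. q \<in> carrier S \<Longrightarrow> l q \<in> N \<longleftrightarrow> q \<in> W"
    using lS(4)[OF W(1)] by blast
  have kN: "k p \<in> N" using N(2)[OF h(1)[OF U(2)]] W(2) h(2)[OF U(2)] by simp
  obtain V where V: "openin (mtop M) V" "p \<in> V" and VN: "\<And>q. q \<in> V \<Longrightarrow> Cr_at r M k q \<and> k q \<in> N"
    by (rule openin_Cr_at_preimage[OF M k N(1) kN]) blast
  have o: "openin (mtop M) (U \<inter> V)" using U(1) V(1) by (rule openin_Int)
  have hW: "h q \<in> W" if "q \<in> U \<inter> V" for q
    using that VN[of q] h[of q] N(2)[of "h q"] by simp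
  have "Cr_at r M (\<lambda>q. R (k q)) p"
    by (rule Cr_at_compose[OF M k Q]) (use lQ[OF W(2)] h(2)[OF U(2)] in simp)
  then have "Cr_at r M (\<lambda>q. snd d (h q)) p"
  proof (rule Cr_at_cong[OF M _ o IntI[OF U(2) V(2)]])
    show "R (k q) = snd d (h q)" if "q \<in> U \<inter> V" for q
      using R[OF hW[OF that]] h(2)[of q] that by simp
  qed
  then show thesis
    using hW W(3,4) U(2) V(2) by (intro that[OF o]) auto
qed

lemma embedding_mapI:
  assumes f: "continuous_map X Y f" and g: "continuous_map (subtopology Y (f ` topspace X)) X g"
    and gf: "\<And>x. x \<in> topspace X \<Longrightarrow> g (f x) = x"
  shows "embedding_map X Y f"
proof -
  have "homeomorphic_maps X (subtopology Y (f ` topspace X)) f g"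
    unfolding homeomorphic_maps_def
  proof (intro conjI ballI)
    show "continuous_map X (subtopology Y (f ` topspace X)) f"
      using f by (simp add: continuous_map_in_subtopology)
    show "f (g y) = y" if "y \<in> topspace (subtopology Y (f ` topspace X))" for y
      using that gf by auto
  qed (use g gf in auto)
  then show ?thesis unfolding embedding_map_def using homeomorphic_maps_map by blast
qed

section \<open>Differentials of pairs and on products\<close>

lemma vd_Pair:
  fixes f :: "'a \<Rightarrow> 'v::banach" and g :: "'a \<Rightarrow> 'w::banach"
  assumes M: "pre_manifold r M" and f: "Cr_at r M f p" and g: "Cr_at r M g p" and c: "c \<in> M" "p \<in> fst c"
  shows "vd c (\<lambda>q. (f q, g q)) p = (\<lambda>v. (vd c f p v, vd c g p v))"
  by (rule vd_eqI) (intro has_derivative_Pair vd_has_derivative[OF M] f g c)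

lemma vd_snd:
  fixes f :: "'b \<Rightarrow> 'v::banach"
  assumes M: "pre_manifold r M" and N: "pre_manifold r N" and f: "Cr_at r N f (snd p)"
    and c: "c \<in> M" "fst p \<in> fst c" and d: "d \<in> N" "snd p \<in> fst d"
  shows "vd (pchart c d) (\<lambda>q. f (snd q)) p = (\<lambda>v. vd d f (snd p) (snd v))"
proof (rule vd_eqI)
  note oM = pre_manifold_open_atlas[OF M] and oN = pre_manifold_open_atlas[OF N]
  let ?S = "snd c ` fst c \<times> snd d ` fst d"
  have o: "open ?S" using oM oN c d by (intro open_Times) (auto simp: open_atlas_def)
  have "((\<lambda>z. f (cinv d (snd z))) has_derivative (\<lambda>v. vd d f (snd p) (snd v))) (at (map_prod (snd c) (snd d) p))"
    by (rule has_derivative_compose[where f=snd and g="\<lambda>x. f (cinv d x)"])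
       (auto intro!: derivative_eq_intros vd_has_derivative[OF N f d])
  then show "((\<lambda>z. f (snd (cinv (pchart c d) z))) has_derivative (\<lambda>v. vd d f (snd p) (snd v))) (at (snd (pchart c d) p))"
  proof (subst snd_conv, rule has_derivative_transform_within_open[OF _ o])
    show "map_prod (snd c) (snd d) p \<in> ?S" using c d by (cases p) auto
    show "f (cinv d (snd z)) = f (snd (cinv (pchart c d) z))" if "z \<in> ?S" for z
      using cinv_pchart[OF oM oN c(1) d(1) that] by simp
  qed
qed

lemma vd_fst:
  fixes f :: "'a \<Rightarrow> 'v::banach"
  assumes M: "pre_manifold r M" and N: "pre_manifold r N" and f: "Cr_at r M f (fst p)"
    and c: "c \<in> M" "fst p \<in> fst c" and d: "d \<in> N" "snd p \<in> fst d"
  shows "vd (pchart c d) (\<lambda>q. f (fst q)) p = (\<lambda>v. vd c f (fst p) (fst v))"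
proof (rule vd_eqI)
  note oM = pre_manifold_open_atlas[OF M] and oN = pre_manifold_open_atlas[OF N]
  let ?S = "snd c ` fst c \<times> snd d ` fst d"
  have o: "open ?S" using oM oN c d by (intro open_Times) (auto simp: open_atlas_def)
  have "((\<lambda>z. f (cinv c (fst z))) has_derivative (\<lambda>v. vd c f (fst p) (fst v))) (at (map_prod (snd c) (snd d) p))"
    by (rule has_derivative_compose[where f=fst and g="\<lambda>x. f (cinv c x)"])
       (auto intro!: derivative_eq_intros vd_has_derivative[OF M f c])
  then show "((\<lambda>z. f (fst (cinv (pchart c d) z))) has_derivative (\<lambda>v. vd c f (fst p) (fst v))) (at (snd (pchart c d) p))"
  proof (subst snd_conv, rule has_derivative_transform_within_open[OF _ o])
    show "map_prod (snd c) (snd d) p \<in> ?S" using c d by (cases p) auto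
    show "f (cinv c (fst z)) = f (fst (cinv (pchart c d) z))" if "z \<in> ?S" for z
      using cinv_pchart[OF oM oN c(1) d(1) that] by simp
  qed
qed

section \<open>Charts of the sphere\<close>

lemma norm_split_coordinate:
  fixes x :: "real^'n" and h :: "'k::finite \<Rightarrow> 'n"
  assumes "bij_betw h UNIV (UNIV - {i})"
  shows "(norm x)\<^sup>2 = (x $ i)\<^sup>2 + (norm ((\<chi> j. x $ h j) :: real^'k))\<^sup>2"
proof -
  have "(norm x)\<^sup>2 = (\<Sum>m\<in>UNIV. (x $ m)\<^sup>2)"
    by (simp add: norm_vec_def L2_set_def sum_nonneg)
  also have "\<dots> = (x $ i)\<^sup>2 + (\<Sum>m\<in>UNIV - {i}. (x $ m)\<^sup>2)"
    by (rule sum.remove) auto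
  also have "(\<Sum>m\<in>UNIV - {i}. (x $ m)\<^sup>2) = (\<Sum>j\<in>UNIV. (x $ h j)\<^sup>2)"
    using sum.reindex_bij_betw[OF assms, of "\<lambda>m. (x $ m)\<^sup>2"] by simp
  also have "\<dots> = (norm ((\<chi> j. x $ h j) :: real^'k))\<^sup>2"
    by (simp add: norm_vec_def L2_set_def sum_nonneg)
  finally show ?thesis .
qed

lemma sphere_atlasE:
  fixes d :: "(real^'n, real^'k) chart"
  assumes "d \<in> sphere_atlas"
  obtains s i h where "s \<in> {1, -1 :: real}" "bij_betw h UNIV (UNIV - {i})"
    "fst d = {x \<in> sphere 0 1. s * x $ i > 0}" "snd d = (\<lambda>x. \<chi> j. x $ h j)"
proof -
  obtain s i h where "d = ({x \<in> sphere 0 1. s * x $ i > 0}, \<lambda>x. \<chi> j. x $ h j)" "s \<in> {1, -1}" "bij_betw h UNIV (UNIV - {i})"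
    using assms unfolding sphere_atlas_def mem_Collect_eq by blast
  then show thesis using that by simp
qed

text \<open>The omitted coordinate is recovered as s sqrt(1 - |y|^2), so each hemisphere corresponds
  bijectively to the open unit ball.\<close>

lemma open_atlas_sphere: "open_atlas (sphere_atlas :: (real^'n, real^'k) atlas)"
  unfolding open_atlas_def
proof
  fix d :: "(real^'n, real^'k) chart" assume "d \<in> sphere_atlas"
  then obtain s i h where s: "s \<in> {1, -1 :: real}" and h: "bij_betw h UNIV (UNIV - {i})"
    and d: "fst d = {x \<in> sphere 0 1. s * x $ i > 0}" "snd d = (\<lambda>x. \<chi> j. x $ h j)" by (rule sphere_atlasE)
  note ns = norm_split_coordinate[OF h]
  have "inj_on (snd d) (fst d)"
  proof (rule inj_onI)
    fix x y assume x: "x \<in> fst d" and y: "y \<in> fst d" and eq: "snd d x = snd d y"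
    have "(x $ i)\<^sup>2 = (y $ i)\<^sup>2" using ns[of x] ns[of y] x y eq by (simp add: d)
    then have i: "x $ i = y $ i" using x y s by (auto simp: d power2_eq_iff)
    show "x = y"
    proof (rule vec_eq_iff[THEN iffD2], rule)
      fix m
      show "x $ m = y $ m"
      proof (cases "m = i")
        case False
        then obtain j where "m = h j" using h by (auto simp: bij_betw_def)
        then show ?thesis using eq by (simp add: d vec_eq_iff)
      qed (simp add: i)
    qed
  qed
  moreover have "snd d ` fst d = ball 0 1"
  proof
    show "snd d ` fst d \<subseteq> ball 0 1"
    proof clarify
      fix x assume x: "x \<in> fst d"
      then have "x $ i \<noteq> 0" using s by (auto simp: d)
      then have pos: "(x $ i)\<^sup>2 > 0" by simp
      have "(norm (snd d x))\<^sup>2 = 1 - (x $ i)\<^sup>2" using ns[of x] x by (simp add: d)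
      then have "(norm (snd d x))\<^sup>2 < 1" using pos by linarith
      then show "snd d x \<in> ball 0 1" by (simp add: abs_square_less_1)
    qed
    show "ball 0 1 \<subseteq> snd d ` fst d"
    proof
      fix y :: "real^'k" assume y: "y \<in> ball 0 1"
      define x :: "real^'n" where "x = (\<chi> m. if m = i then s * sqrt (1 - (norm y)\<^sup>2) else y $ (inv h m))"
      have injh: "inj h" "h j \<noteq> i" for j using h by (auto simp: bij_betw_def)
      have sx: "snd d x = y" using injh by (simp add: d x_def vec_eq_iff inv_f_f)
      have y1: "(norm y)\<^sup>2 < 1" using y by (simp add: abs_square_less_1)
      have "(x $ i)\<^sup>2 = 1 - (norm y)\<^sup>2" using s y1 by (auto simp: x_def)
      then have "(norm x)\<^sup>2 = 1" using ns[of x] sx by (simp add: d)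
      then have "norm x = 1" by (simp add: power2_eq_1_iff) (metis norm_ge_zero not_one_le_zero neg_0_le_iff_le)
      moreover have "s * x $ i > 0" using s y1 by (auto simp: x_def)
      ultimately show "y \<in> snd d ` fst d" using sx by (auto simp: d)
    qed
  qed
  ultimately show "inj_on (snd d) (fst d) \<and> open (snd d ` fst d)" by simp
qed

lemma carrier_sphere:
  assumes "CARD('k::finite) = CARD('n::finite) - 1"
  shows "carrier (sphere_atlas :: (real^'n, real^'k) atlas) = sphere 0 1"
proof
  show "carrier (sphere_atlas :: (real^'n, real^'k) atlas) \<subseteq> sphere 0 1"
    unfolding carrier_def sphere_atlas_def by auto
  show "sphere 0 1 \<subseteq> carrier (sphere_atlas :: (real^'n, real^'k) atlas)"
  proof
    fix x :: "real^'n" assume x: "x \<in> sphere 0 1"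
    then have "x \<noteq> 0" by auto
    then obtain i where i: "x $ i \<noteq> 0" by (auto simp: vec_eq_iff)
    have "card (UNIV :: 'k set) = card (UNIV - {i})" using assms by simp
    then obtain h :: "'k \<Rightarrow> 'n" where h: "bij_betw h UNIV (UNIV - {i})"
      using finite_same_card_bij[of "UNIV :: 'k set" "UNIV - {i}"] by auto
    \<comment> \<open>The sign of a non-zero coordinate of x selects the hemisphere.\<close>
    let ?d = "({y \<in> sphere 0 1. sgn (x $ i) * y $ i > 0}, \<lambda>y. \<chi> j. y $ h j)"
    have "?d \<in> sphere_atlas"
      unfolding sphere_atlas_def mem_Collect_eq
      by (rule exI[of _ "sgn (x $ i)"], rule exI[of _ i], rule exI[of _ h]) (use i h in \<open>auto simp: sgn_if\<close>)
    moreover have "x \<in> fst ?d" using x i by (simp add: sgn_mult_self_eq sgn_if mult_neg_neg)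
    ultimately show "x \<in> carrier (sphere_atlas :: (real^'n, real^'k) atlas)" by (rule carrierI)
  qed
qed

section \<open>Charts of the projective space\<close>

text \<open>The charts evaluate an arbitrarily chosen representative; it is a non-zero multiple of
  any other one, and since the coordinates are ratios the factor cancels.\<close>

lemma proj_class_some:
  assumes "P = proj_class a"
  obtains c where "c \<noteq> 0" "(SOME b. b \<in> P) = c *\<^sub>R a"
proof -
  have "a \<in> P" using assms by (auto simp: proj_class_def intro!: exI[of _ 1])
  then have "(SOME b. b \<in> P) \<in> P" by (rule someI)
  then show thesis using that assms by (auto simp: proj_class_def)
qed

lemma proj_class_eq: "c \<noteq> 0 \<Longrightarrow> proj_class (c *\<^sub>R a) = proj_class a"
proof -
  assume c: "c \<noteq> 0"
  have "\<exists>e. e \<noteq> 0 \<and> k *\<^sub>R a = e *\<^sub>R c *\<^sub>R a" if "k \<noteq> 0" for k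
    using c that by (intro exI[of _ "k / c"]) auto
  then show ?thesis using c by (auto simp: proj_class_def) (metis mult_eq_0_iff)
qed

definition proj_coord0 :: "('n::finite) dual set \<Rightarrow> real^'n" where
  "proj_coord0 P = (let a = (SOME a. a \<in> P) in \<chi> j. dcoord a j / dcoord0 a)"

definition proj_coord :: "'n \<Rightarrow> ('n::finite) dual set \<Rightarrow> real^'n" where
  "proj_coord i P = (let a = (SOME a. a \<in> P) in \<chi> j. (if j = i then dcoord0 a else dcoord a j) / dcoord a i)"

lemma proj_coord0_class: "proj_coord0 (proj_class a) = (\<chi> j. dcoord a j / dcoord0 a)"
proof -
  obtain c where c: "c \<noteq> 0" "(SOME b. b \<in> proj_class a) = c *\<^sub>R a" by (rule proj_class_some[OF refl])
  then show ?thesis by (simp add: proj_coord0_def Let_def scaleR_blinfun.rep_eq vec_eq_iff)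
qed

lemma proj_coord_class: "proj_coord i (proj_class a) = (\<chi> j. (if j = i then dcoord0 a else dcoord a j) / dcoord a i)"
proof -
  obtain c where c: "c \<noteq> 0" "(SOME b. b \<in> proj_class a) = c *\<^sub>R a" by (rule proj_class_some[OF refl])
  then show ?thesis by (simp add: proj_coord_def Let_def scaleR_blinfun.rep_eq vec_eq_iff)
qed

lemma proj_atlas_eq:
  "proj_atlas = insert (proj_class ` {a. dcoord0 a \<noteq> 0}, proj_coord0)
     (range (\<lambda>i. (proj_class ` {a. dcoord a i \<noteq> 0}, proj_coord i)))"
  unfolding proj_atlas_def proj_coord0_def[abs_def] proj_coord_def[abs_def] ..

lemma dual_eqI:
  fixes a b :: "('n::finite) dual"
  assumes "dcoord0 a = dcoord0 b" "\<And>j. dcoord a j = dcoord b j"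
  shows "a = b"
proof (rule blinfun_eqI)
  fix x :: "'n mink"
  have x: "x = fst x *\<^sub>R (1, 0) + (\<Sum>j\<in>UNIV. (snd x $ j) *\<^sub>R (0, axis j 1))"
    by (simp add: prod_eq_iff fst_sum snd_sum basis_expansion scalar_mult_eq_scaleR[symmetric])
  have "blinfun_apply c x = fst x *\<^sub>R dcoord0 c + (\<Sum>j\<in>UNIV. (snd x $ j) *\<^sub>R dcoord c j)" for c :: "'n dual"
    by (subst x) (simp only: blinfun.add_right blinfun.scaleR_right blinfun.sum_right)
  then show "blinfun_apply a x = blinfun_apply b x" using assms by simp
qed

definition dual_of :: "real \<Rightarrow> real^'n \<Rightarrow> ('n::finite) dual" where
  "dual_of s w = Blinfun (\<lambda>x. s * fst x + w \<bullet> snd x)"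

lemma dual_of_apply [simp]: "blinfun_apply (dual_of s w) x = s * fst x + w \<bullet> snd x"
  unfolding dual_of_def
  by (subst bounded_linear_Blinfun_apply)
     (auto intro!: bounded_linear_add bounded_linear_const_mult bounded_linear_fst
       bounded_linear_compose[OF bounded_linear_inner_right bounded_linear_snd])

lemma open_atlas_proj: "open_atlas (proj_atlas :: (('n::finite) dual set, real^'n) atlas)"
  unfolding open_atlas_def
proof
  fix d :: "('n dual set, real^'n) chart" assume "d \<in> proj_atlas"
  then consider "d = (proj_class ` {a. dcoord0 a \<noteq> 0}, proj_coord0)"
    | i where "d = (proj_class ` {a. dcoord a i \<noteq> 0}, proj_coord i)"
    by (auto simp: proj_atlas_eq)
  then show "inj_on (snd d) (fst d) \<and> open (snd d ` fst d)"
  proof cases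
    case 1
    have "proj_class a = proj_class b" if "dcoord0 a \<noteq> 0" "dcoord0 b \<noteq> 0"
      "proj_coord0 (proj_class a) = proj_coord0 (proj_class b)" for a b :: "'n dual"
    proof -
      have "a = (dcoord0 a / dcoord0 b) *\<^sub>R b"
        using that by (intro dual_eqI) (auto simp: proj_coord0_class vec_eq_iff scaleR_blinfun.rep_eq field_simps)
      then show ?thesis using proj_class_eq[of "dcoord0 a / dcoord0 b" b] that by auto
    qed
    then have inj: "inj_on (snd d) (fst d)" by (auto simp: 1 inj_on_def)
    have "w \<in> proj_coord0 ` proj_class ` {a. dcoord0 a \<noteq> 0}" for w :: "real^'n"
    proof -
      have "w = proj_coord0 (proj_class (dual_of 1 w))" "dcoord0 (dual_of 1 w) \<noteq> 0"
        by (simp_all add: proj_coord0_class inner_axis vec_eq_iff)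
      then show ?thesis by blast
    qed
    then have "snd d ` fst d = UNIV" by (auto simp: 1)
    then show ?thesis using inj by simp
  next
    case 2
    have "proj_class a = proj_class b" if "dcoord a i \<noteq> 0" "dcoord b i \<noteq> 0"
      "proj_coord i (proj_class a) = proj_coord i (proj_class b)" for a b :: "'n dual"
    proof -
      have 0: "(if j = i then dcoord0 a else dcoord a j) / dcoord a i = (if j = i then dcoord0 b else dcoord b j) / dcoord b i" for j
        using that(3) unfolding proj_coord_class vec_eq_iff by simp
      have "a = (dcoord a i / dcoord b i) *\<^sub>R b"
      proof (rule dual_eqI)
        show "dcoord0 a = dcoord0 ((dcoord a i / dcoord b i) *\<^sub>R b)"
          using 0[of i] that(1,2) by (simp add: scaleR_blinfun.rep_eq field_simps)
        show "dcoord a j = dcoord ((dcoord a i / dcoord b i) *\<^sub>R b) j" for j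
          using 0[of j] that(1,2) by (cases "j = i") (simp_all add: scaleR_blinfun.rep_eq field_simps)
      qed
      then show ?thesis using proj_class_eq[of "dcoord a i / dcoord b i" b] that by auto
    qed
    then have inj: "inj_on (snd d) (fst d)" by (auto simp: 2 inj_on_def)
    have "w \<in> proj_coord i ` proj_class ` {a. dcoord a i \<noteq> 0}" for w :: "real^'n"
    proof -
      \<comment> \<open>The inverse of the chart: coordinate \<open>i\<close> is normalised to 1,
        and the slot \<open>i\<close> of \<open>w\<close>, freed by this, supplies the time
        coordinate.\<close>
      let ?a = "dual_of (w $ i) (\<chi> j. if j = i then 1 else w $ j)"
      have "w = proj_coord i (proj_class ?a)" "dcoord ?a i \<noteq> 0"
        by (simp_all add: proj_coord_class inner_axis vec_eq_iff)
      then show ?thesis by blast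
    qed
    then have "snd d ` fst d = UNIV" by (auto simp: 2)
    then show ?thesis using inj by simp
  qed
qed

section \<open>Light-like vectors\<close>

lemma dual_expand:
  "blinfun_apply (a :: ('n::finite) dual) x = fst x * dcoord0 a + (\<Sum>j\<in>UNIV. snd x $ j * dcoord a j)"
proof -
  have x: "x = fst x *\<^sub>R (1, 0) + (\<Sum>j\<in>UNIV. (snd x $ j) *\<^sub>R (0, axis j 1))"
    by (simp add: prod_eq_iff fst_sum snd_sum basis_expansion scalar_mult_eq_scaleR[symmetric])
  show ?thesis
    by (subst x) (simp only: blinfun.add_right blinfun.scaleR_right blinfun.sum_right real_scaleR_def)
qed

lemma sharp_eq: "sharp (a :: ('n::finite) dual) = (- dcoord0 a, \<chi> j. dcoord a j)"
  unfolding sharp_def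
proof (rule the_equality, rule allI)
  show "lorentz (- dcoord0 a, \<chi> j. dcoord a j) x = blinfun_apply a x" for x :: "'n mink"
    unfolding dual_expand[of a x] by (simp add: lorentz_def inner_vec_def mult.commute)
  fix v :: "'n mink" assume v: "\<forall>x. lorentz v x = blinfun_apply a x"
  have "fst v = - dcoord0 a" using v[rule_format, of "(1, 0)"] by (simp add: lorentz_def)
  moreover have "snd v $ j = dcoord a j" for j
    using v[rule_format, of "(0, axis j 1)"] by (simp add: lorentz_def inner_axis)
  ultimately show "v = (- dcoord0 a, \<chi> j. dcoord a j)" by (simp add: prod_eq_iff vec_eq_iff)
qed

lemma lightlike_fst: "lightlike v \<Longrightarrow> fst v \<noteq> 0"
  by (auto simp: lightlike_def lorentz_def prod_eq_iff)

text \<open>The Euclidean norm of a light-like vector is sqrt 2 times the absolute value of its time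
  component, so rescaling to length sqrt 2 amounts to making the time component 1.\<close>

lemma E_normalize_lightlike:
  assumes "lightlike v" shows "E_normalize v = (1, (1 / fst v) *\<^sub>R snd v)"
proof -
  have "snd v \<bullet> snd v = (fst v)\<^sup>2" using assms by (simp add: lightlike_def lorentz_def power2_eq_square)
  then have "norm v = sqrt 2 * \<bar>fst v\<bar>"
    by (simp add: norm_prod_def dot_square_norm real_sqrt_mult)
  then show ?thesis
    using lightlike_fst[OF assms] by (cases "fst v > 0") (auto simp: E_normalize_def prod_eq_iff)
qed

lemma lightlike_unit: "norm w = 1 \<Longrightarrow> lightlike (1, w)"
  by (simp add: lightlike_def lorentz_def dot_square_norm zero_prod_def)

text \<open>Serves integral curves on the empty interval, for which some light-like line still has
  to be exhibited.\<close>

lemma lightlike_line_exists: "\<exists>L :: ('n::finite) mink set. lightlike_line L"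
proof -
  have "lightlike (1 :: real, axis undefined 1 :: real^'n)" by (rule lightlike_unit) simp
  then show ?thesis unfolding lightlike_line_def by blast
qed

section \<open>Integral curves\<close>

lemma integral_curve_has_derivative:
  fixes P :: "('b, 'e::euclidean_space) atlas" and g :: "'b \<Rightarrow> 'v::euclidean_space"
  assumes P: "pre_manifold r P" and \<gamma>: "integral_curve P X J \<gamma>" and t: "t \<in> J" and c: "c \<in> P" "\<gamma> t \<in> fst c"
    and g: "Cr_at r P g (\<gamma> t)"
  shows "((\<lambda>s. g (\<gamma> s)) has_vector_derivative vd c g (\<gamma> t) (X c (\<gamma> t))) (at t within J)"
proof -
  note oa = pre_manifold_open_atlas[OF P]
  have cont: "continuous_map (top_of_set J) (mtop P) \<gamma>"
    and der: "((\<lambda>s. snd c (\<gamma> s)) has_derivative (\<lambda>h. h *\<^sub>R X c (\<gamma> t))) (at t within J)"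
    using \<gamma> t c by (auto simp: integral_curve_def has_vector_derivative_def)
  have "openin (top_of_set J) {s \<in> J. \<gamma> s \<in> fst c}"
    using openin_continuous_map_preimage[OF cont openin_chart[OF P c(1)]] by simp
  then obtain \<delta> where \<delta>: "0 < \<delta>" "ball t \<delta> \<inter> J \<subseteq> {s \<in> J. \<gamma> s \<in> fst c}"
    unfolding openin_contains_ball using t c by blast
  note lin = linear_vd[OF P g c]
  from has_derivative_compose[OF der vd_has_derivative[OF P g c]]
  have "((\<lambda>s. g (cinv c (snd c (\<gamma> s)))) has_derivative (\<lambda>h. h *\<^sub>R vd c g (\<gamma> t) (X c (\<gamma> t)))) (at t within J)"
    by (simp add: linear_cmul[OF lin])
  then have "((\<lambda>s. g (\<gamma> s)) has_derivative (\<lambda>h. h *\<^sub>R vd c g (\<gamma> t) (X c (\<gamma> t)))) (at t within J)"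
  proof (rule has_derivative_transform_within[OF _ \<delta>(1) t])
    fix s assume "s \<in> J" "dist s t < \<delta>"
    then have "s \<in> ball t \<delta> \<inter> J" by (simp add: dist_commute)
    then have "\<gamma> s \<in> fst c" using \<delta>(2) by blast
    then show "g (cinv c (snd c (\<gamma> s))) = g (\<gamma> s)" using cinv_chart[OF oa c(1)] by simp
  qed
  then show ?thesis by (simp add: has_vector_derivative_def)
qed

text \<open>Subtracting s w from g \<circ> \<gamma> leaves a function with zero derivative on an
  interval. With w = 0 it says that \<open>g\<close> is constant along the curve.\<close>

lemma integral_curve_affine:
  fixes P :: "('b, 'e::euclidean_space) atlas" and g :: "'b \<Rightarrow> 'v::euclidean_space"
  assumes P: "pre_manifold r P" and \<gamma>: "integral_curve P X J \<gamma>"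
    and g: "\<And>p. p \<in> carrier P \<Longrightarrow> Cr_at r P g p"
    and w: "\<And>c s. s \<in> J \<Longrightarrow> c \<in> P \<Longrightarrow> \<gamma> s \<in> fst c \<Longrightarrow> vd c g (\<gamma> s) (X c (\<gamma> s)) = w"
    and st: "s \<in> J" "t \<in> J"
  shows "g (\<gamma> s) = g (\<gamma> t) + (s - t) *\<^sub>R w"
proof -
  have J: "convex J" and cont: "continuous_map (top_of_set J) (mtop P) \<gamma>"
    using \<gamma> by (auto simp: integral_curve_def is_interval_convex)
  have "((\<lambda>s. g (\<gamma> s) - s *\<^sub>R w) has_derivative (\<lambda>h. 0)) (at u within J)" if u: "u \<in> J" for u
  proof -
    have "\<gamma> u \<in> carrier P"
      using cont u topspace_mtop[OF pre_manifold_open_atlas[OF P]] by (auto simp: continuous_map_def)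
    then obtain c where c: "c \<in> P" "\<gamma> u \<in> fst c" by (rule carrierE)
    have "((\<lambda>s. g (\<gamma> s)) has_derivative (\<lambda>h. h *\<^sub>R w)) (at u within J)"
      using integral_curve_has_derivative[OF P \<gamma> u c g[OF carrierI[OF c]]] w[OF u c]
      by (simp add: has_vector_derivative_def)
    from has_derivative_diff[OF this has_derivative_scaleR_left[OF has_derivative_ident, of w]]
    show ?thesis by simp
  qed
  from has_derivative_zero_constant[OF J this]
  have "g (\<gamma> s) - s *\<^sub>R w = g (\<gamma> t) - t *\<^sub>R w" using st by auto
  then show ?thesis by (simp add: algebra_simps)
qed

section \<open>Fronts in normal form\<close>

text \<open>Differentiate \<nu> \<bullet> \<nu> = 1.\<close>

lemma unit_field_orth:
  fixes \<nu> :: "'a \<Rightarrow> 'v::euclidean_space"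
  assumes M: "pre_manifold r M" and \<nu>: "Cr_at r M \<nu> p" and c: "c \<in> M" "p \<in> fst c"
    and unit: "\<And>q. q \<in> fst c \<Longrightarrow> norm (\<nu> q) = 1"
  shows "\<nu> p \<bullet> vd c \<nu> p v = 0"
proof -
  note p = carrierI[OF c]
  have "((\<lambda>x. x \<bullet> x) has_derivative (\<lambda>v. 2 * (\<nu> p \<bullet> v))) (at (\<nu> p))"
    by (auto intro!: derivative_eq_intros simp: inner_commute)
  from vd_compose[OF M \<nu> c this]
  have "vd c (\<lambda>q. \<nu> q \<bullet> \<nu> q) p v = 2 * (\<nu> p \<bullet> vd c \<nu> p v)" by simp
  moreover have "vd c (\<lambda>q. \<nu> q \<bullet> \<nu> q) p = vd c (\<lambda>_. 1::real) p"
    by (rule vd_cong[OF M Cr_at_const[OF M p] c openin_chart[OF M c(1)] c(2)])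
       (use unit in \<open>simp add: dot_square_norm\<close>)
  moreover have "vd c (\<lambda>_. 1::real) p = (\<lambda>_. 0)"
    by (rule vd_eqI) simp
  ultimately show ?thesis by simp
qed

definition normal_F :: "('b \<Rightarrow> real^'n) \<Rightarrow> ('b \<Rightarrow> real^'n) \<Rightarrow> real \<times> 'b \<Rightarrow> ('n::finite) mink" where
  "normal_F f \<nu> q = (0, f (snd q)) + fst q *\<^sub>R (1, \<nu> (snd q))"

text \<open>The Lorentz dual of \<open>(1, \<nu>)\<close>: the coefficient -1 reflects the sign of
  the time direction in the inner product.\<close>

definition normal_\<alpha> :: "('b \<Rightarrow> real^'n) \<Rightarrow> real \<times> 'b \<Rightarrow> ('n::finite) dual" where
  "normal_\<alpha> \<nu> q = dual_of (-1) (\<nu> (snd q))"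

text \<open>A Euclidean front with its conditions phrased for vector-valued maps, where
  \<open>vd\<close> can check them; the lemmas of the locale translate them into the charts of the
  sphere and of the projective space. It is instantiated by the global quotient and by the slice of
  a single patch.\<close>

locale euclidean_front =
  fixes r :: regularity and S :: "('b, real^'k) atlas" and f \<nu> :: "'b \<Rightarrow> real^'n"
  assumes S: "pre_manifold r S" and dim: "CARD('k) = CARD('n) - 1"
    and f: "\<And>p. p \<in> carrier S \<Longrightarrow> Cr_at r S f p"
    and \<nu>: "\<And>p. p \<in> carrier S \<Longrightarrow> Cr_at r S \<nu> p"
    and unit: "\<And>p. p \<in> carrier S \<Longrightarrow> norm (\<nu> p) = 1"
    and orth: "\<And>c p v. c \<in> S \<Longrightarrow> p \<in> fst c \<Longrightarrow> \<nu> p \<bullet> vd c f p v = 0"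
    and imm: "\<And>c p. c \<in> S \<Longrightarrow> p \<in> fst c \<Longrightarrow> inj (vd c (\<lambda>q. (f q, \<nu> q)) p)"
begin

lemma oS: "open_atlas S" by (rule pre_manifold_open_atlas[OF S])

lemma unit_orth:
  assumes c: "c \<in> S" "p \<in> fst c" shows "\<nu> p \<bullet> vd c \<nu> p v = 0"
  by (rule unit_field_orth[OF S \<nu>[OF carrierI[OF c]] c]) (use unit carrierI[OF c(1)] in blast)

lemma imm_kernel:
  assumes c: "c \<in> S" "p \<in> fst c" and z: "vd c f p v = 0" "vd c \<nu> p v = 0"
  shows "v = 0"
proof -
  note p = carrierI[OF c]
  note C = Cr_at_Pair[OF S f[OF p] \<nu>[OF p]]
  have "vd c (\<lambda>q. (f q, \<nu> q)) p v = 0"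
    using z by (simp add: vd_Pair[OF S f[OF p] \<nu>[OF p] c] zero_prod_def)
  then show ?thesis
    using injD[OF imm[OF c], of v 0] linear_0[OF linear_vd[OF S C c]] by simp
qed

text \<open>The chart forgets the coordinate \<open>i\<close>. For the third claim its derivative is
  recovered from \<nu> \<bullet> d\<nu> = 0, since the coordinate \<open>i\<close> of \<nu> is
  non-zero on the hemisphere.\<close>

lemma sphere_chart_regular:
  fixes d :: "(real^'n, real^'k) chart"
  assumes d: "d \<in> sphere_atlas" "\<nu> p \<in> fst d" and p: "p \<in> carrier S"
  shows "Cr_at r S (\<lambda>q. snd d (\<nu> q)) p" "\<exists>U. openin (mtop S) U \<and> p \<in> U \<and> \<nu> ` U \<subseteq> fst d"
    "c \<in> S \<Longrightarrow> p \<in> fst c \<Longrightarrow> vd c (\<lambda>q. snd d (\<nu> q)) p v = 0 \<Longrightarrow> vd c \<nu> p v = 0"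
proof -
  obtain s i h where s: "s \<in> {1, -1 :: real}" and h: "bij_betw h UNIV (UNIV - {i})"
    and d': "fst d = {x \<in> sphere 0 1. s * x $ i > 0}" "snd d = (\<lambda>x. \<chi> j. x $ h j)"
    using d(1) by (rule sphere_atlasE)
  have bl: "bounded_linear (\<lambda>x::real^'n. (\<chi> j. x $ h j) :: real^'k)"
    by (rule linear_conv_bounded_linear[THEN iffD1], rule linearI) (auto simp: vec_eq_iff)
  show "Cr_at r S (\<lambda>q. snd d (\<nu> q)) p"
    unfolding d' by (rule Cr_at_bounded_linear[OF \<nu>[OF p] bl])
  have o: "open {x::real^'n. s * x $ i > 0}" by (intro open_Collect_less continuous_intros)
  obtain U where U: "openin (mtop S) U" "p \<in> U" "\<And>q. q \<in> U \<Longrightarrow> Cr_at r S \<nu> q \<and> \<nu> q \<in> {x. s * x $ i > 0}"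
    by (rule openin_Cr_at_preimage[OF S \<nu>[OF p] o]) (use d(2) d' in auto)
  then have "\<nu> ` U \<subseteq> fst d" using unit Cr_at_carrier by (fastforce simp: d')
  then show "\<exists>U. openin (mtop S) U \<and> p \<in> U \<and> \<nu> ` U \<subseteq> fst d" using U by blast
  assume c: "c \<in> S" "p \<in> fst c" and z: "vd c (\<lambda>q. snd d (\<nu> q)) p v = 0"
  let ?w = "vd c \<nu> p v"
  have "(\<chi> j. ?w $ h j) = (0 :: real^'k)"
    using z unfolding d' vd_bounded_linear[OF S \<nu>[OF p] c bl] .
  then have wh: "?w $ h j = 0" for j by (simp add: vec_eq_iff)
  have w0: "?w $ m = 0" if "m \<noteq> i" for m
  proof -
    have "m \<in> range h" using h that by (simp add: bij_betw_def)
    then show ?thesis using wh by auto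
  qed
  have "0 = \<nu> p \<bullet> ?w" using unit_orth[OF c] by simp
  also have "\<dots> = (\<Sum>m\<in>UNIV. \<nu> p $ m * ?w $ m)" by (simp add: inner_vec_def)
  also have "\<dots> = \<nu> p $ i * ?w $ i"
    by (subst sum.remove[of _ i]) (auto simp: w0)
  finally have "?w $ i = 0" using d(2) d' by auto
  then show "?w = 0" using w0 by (metis vec_eq_iff zero_index)
qed

lemma unit_normal_field: "unit_normal_field r S f \<nu>"
  unfolding unit_normal_field_def
proof (intro conjI ballI impI allI)
  show "Cr_map r S (sphere_atlas :: (real^'n, real^'k) atlas) \<nu>"
    by (rule Cr_mapI[OF S open_atlas_sphere])
       (use unit carrier_sphere[OF dim] sphere_chart_regular in auto)
  fix p c v assume "c \<in> S" "p \<in> fst c"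
  then show "\<nu> p \<bullet> vderiv c f p v = 0" using orth by (simp add: mderiv_vd)
qed

lemma euclidean_front_with: "euclidean_front_with r S f \<nu>"
  unfolding euclidean_front_with_def
proof (intro conjI unit_normal_field)
  let ?N = "prod_atlas euclid (sphere_atlas :: (real^'n, real^'k) atlas)"
  show "Cr_map r S euclid f" unfolding Cr_map_euclid_iff[OF S] using f by blast
  have oN: "open_atlas ?N" by (intro open_atlas_prod open_atlas_euclid open_atlas_sphere)
  have *: "Cr_at r S (\<lambda>q. snd e (f q, \<nu> q)) p \<and> (\<exists>U. openin (mtop S) U \<and> p \<in> U \<and> (\<lambda>q. (f q, \<nu> q)) ` U \<subseteq> fst e)
      \<and> (\<exists>c\<in>S. p \<in> fst c \<and> inj (vd c (\<lambda>q. snd e (f q, \<nu> q)) p))"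
    if p: "p \<in> carrier S" and e: "e \<in> ?N" "(f p, \<nu> p) \<in> fst e" for p e
  proof -
    obtain d where d: "d \<in> sphere_atlas" "e = pchart (UNIV, \<lambda>x. x) d"
      using e(1) by (auto elim!: prod_atlasE simp: euclid_def)
    have pd: "\<nu> p \<in> fst d" using e d by simp
    note sc = sphere_chart_regular[OF d(1) pd p]
    have eq: "(\<lambda>q. snd e (f q, \<nu> q)) = (\<lambda>q. (f q, snd d (\<nu> q)))" by (simp add: d)
    have C: "Cr_at r S (\<lambda>q. (f q, snd d (\<nu> q))) p" by (rule Cr_at_Pair[OF S f[OF p] sc(1)])
    obtain c where c: "c \<in> S" "p \<in> fst c" by (rule carrierE[OF p])
    have "inj (vd c (\<lambda>q. (f q, snd d (\<nu> q))) p)"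
      unfolding linear_injective_0[OF linear_vd[OF S C c]]
    proof (intro allI impI)
      fix v assume "vd c (\<lambda>q. (f q, snd d (\<nu> q))) p v = 0"
      then have "vd c f p v = 0" "vd c (\<lambda>q. snd d (\<nu> q)) p v = 0"
        by (simp_all add: vd_Pair[OF S f[OF p] sc(1) c] zero_prod_def)
      then show "v = 0" using imm_kernel[OF c] sc(3)[OF c] by blast
    qed
    moreover have "\<exists>U. openin (mtop S) U \<and> p \<in> U \<and> (\<lambda>q. (f q, \<nu> q)) ` U \<subseteq> fst e"
      using sc(2) by (auto simp: d)
    ultimately show ?thesis unfolding eq using C c by blast
  qed
  show "Cr_immersion r S ?N (\<lambda>p. (f p, \<nu> p))"
  proof (rule Cr_immersionI[OF S])
    show "Cr_map r S ?N (\<lambda>p. (f p, \<nu> p))"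
    proof (rule Cr_mapI[OF S oN])
      show "(\<lambda>p. (f p, \<nu> p)) ` carrier S \<subseteq> carrier ?N"
        using unit carrier_sphere[OF dim] by (auto simp: carrier_prod)
    qed (rule conjI[OF conjunct1[OF *] conjunct1[OF conjunct2[OF *]]])
  qed (rule conjI[OF conjunct1[OF *] conjunct2[OF conjunct2[OF *]]])
qed

abbreviation P :: "(real \<times> 'b, real \<times> (real^'k)) atlas" where "P \<equiv> prod_atlas euclid S"

lemma P: "pre_manifold r P" by (rule pre_manifold_prod[OF pre_manifold_euclid S])

lemma carP: "p \<in> carrier P \<longleftrightarrow> snd p \<in> carrier S"
  by (cases p) (simp add: carrier_prod)

lemma PE:
  assumes "e \<in> P" "p \<in> fst e"
  obtains d where "d \<in> S" "snd p \<in> fst d" "e = pchart (UNIV, \<lambda>x. x) d"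
  using assms by (auto elim!: prod_atlasE simp: euclid_def)

lemma P_regular:
  assumes p: "p \<in> carrier P"
  shows "Cr_at r P fst p" "Cr_at r P (\<lambda>q. f (snd q)) p" "Cr_at r P (\<lambda>q. \<nu> (snd q)) p" "Cr_at r P (normal_F f \<nu>) p"
proof -
  have sp: "snd p \<in> carrier S" using p carP by blast
  have id: "Cr_at r (euclid :: (real, real) atlas) (\<lambda>x. x) (fst p)"
    using Cr_at_chart[OF pre_manifold_euclid, of "(UNIV, \<lambda>x::real. x)" "fst p"] by (simp add: euclid_def)
  show 1: "Cr_at r P fst p" using Cr_at_fst[OF pre_manifold_euclid S id sp] .
  show 2: "Cr_at r P (\<lambda>q. f (snd q)) p" by (rule Cr_at_snd[OF pre_manifold_euclid S f[OF sp]]) simp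
  show 3: "Cr_at r P (\<lambda>q. \<nu> (snd q)) p" by (rule Cr_at_snd[OF pre_manifold_euclid S \<nu>[OF sp]]) simp
  have "Cr_at r P (\<lambda>q. (fst q, f (snd q) + fst q *\<^sub>R \<nu> (snd q))) p"
    by (intro Cr_at_Pair[OF P] Cr_at_add[OF P] Cr_at_scaleR[OF P] 1 2 3)
  then show "Cr_at r P (normal_F f \<nu>) p" by (simp add: normal_F_def[abs_def])
qed

lemma P_vd:
  assumes d: "d \<in> S" "snd p \<in> fst d"
  defines "e \<equiv> pchart (UNIV, \<lambda>x. x) d"
  shows "vd e fst p = fst" "vd e (\<lambda>q. f (snd q)) p = (\<lambda>v. vd d f (snd p) (snd v))"
    "vd e (\<lambda>q. \<nu> (snd q)) p = (\<lambda>v. vd d \<nu> (snd p) (snd v))"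
    "vd e (normal_F f \<nu>) p = (\<lambda>v. (fst v, vd d f (snd p) (snd v) + (fst p *\<^sub>R vd d \<nu> (snd p) (snd v) + fst v *\<^sub>R \<nu> (snd p))))"
proof -
  have sp: "snd p \<in> carrier S" using carrierI[OF d] .
  then have p: "p \<in> carrier P" using carP by blast
  have u: "(UNIV, \<lambda>x::real. x) \<in> euclid" "fst p \<in> fst (UNIV :: real set, \<lambda>x::real. x)" by (auto simp: euclid_def)
  have e: "e \<in> P" "p \<in> fst e"
    using pchart_in[OF u(1) d(1)] d by (simp_all add: e_def mem_Times_iff)
  have id: "Cr_at r (euclid :: (real, real) atlas) (\<lambda>x. x) (fst p)"
    using Cr_at_chart[OF pre_manifold_euclid, of "(UNIV, \<lambda>x::real. x)" "fst p"] by (simp add: euclid_def)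
  have "vd (UNIV, \<lambda>x::real. x) (\<lambda>x. x) (fst p) = (\<lambda>v. v)"
    using vd_chart[OF pre_manifold_euclid, of "(UNIV, \<lambda>x::real. x)" "fst p"] u by simp
  then show 1: "vd e fst p = fst"
    using vd_fst[OF pre_manifold_euclid S id u d] by (simp add: e_def fun_eq_iff)
  show 2: "vd e (\<lambda>q. f (snd q)) p = (\<lambda>v. vd d f (snd p) (snd v))"
    unfolding e_def by (rule vd_snd[OF pre_manifold_euclid S f[OF sp] u d])
  show 3: "vd e (\<lambda>q. \<nu> (snd q)) p = (\<lambda>v. vd d \<nu> (snd p) (snd v))"
    unfolding e_def by (rule vd_snd[OF pre_manifold_euclid S \<nu>[OF sp] u d])
  note C = P_regular[OF p]
  let ?G = "\<lambda>z :: real \<times> (real^'n) \<times> (real^'n). (fst z, fst (snd z) + fst z *\<^sub>R snd (snd z))"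
  have G: "(?G has_derivative (\<lambda>v. (fst v, fst (snd v) + (fst z *\<^sub>R snd (snd v) + fst v *\<^sub>R snd (snd z))))) (at z)" for z
    by (auto intro!: derivative_eq_intros)
  have C3: "Cr_at r P (\<lambda>q. (fst q, f (snd q), \<nu> (snd q))) p" by (intro Cr_at_Pair[OF P] C)
  have F: "normal_F f \<nu> = (\<lambda>q. ?G (fst q, f (snd q), \<nu> (snd q)))" by (simp add: normal_F_def fun_eq_iff)
  show "vd e (normal_F f \<nu>) p = (\<lambda>v. (fst v, vd d f (snd p) (snd v) + (fst p *\<^sub>R vd d \<nu> (snd p) (snd v) + fst v *\<^sub>R \<nu> (snd p))))"
    unfolding F vd_compose[OF P C3 e G] vd_Pair[OF P C(1) Cr_at_Pair[OF P C(2,3)] e] vd_Pair[OF P C(2,3) e] 1 2 3 by simp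
qed

lemma normal_xihat: "p \<in> carrier P \<Longrightarrow> xihat_E (normal_\<alpha> \<nu>) p = (1, \<nu> (snd p))"
proof -
  assume "p \<in> carrier P"
  then have u: "norm (\<nu> (snd p)) = 1" using carP unit by blast
  have sh: "sharp (normal_\<alpha> \<nu> p) = (1, \<nu> (snd p))"
    by (simp add: normal_\<alpha>_def sharp_eq vec_eq_iff inner_axis)
  show ?thesis unfolding xihat_E_def sh using E_normalize_lightlike[OF lightlike_unit[OF u]] by simp
qed

text \<open>The differential of the front is (dt, df + t d\<nu> + dt \<nu>). If it vanishes together
  with d\<nu>, then dt = 0 and df = 0, so the vector is 0 because (f, \<nu>) is an immersion, even
  at singular points of the front itself.\<close>

lemma lift_immersion:
  assumes e: "e \<in> P" "p \<in> fst e"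
  shows "inj (vd e (\<lambda>q. (normal_F f \<nu> q, \<nu> (snd q))) p)"
proof -
  obtain d where d: "d \<in> S" "snd p \<in> fst d" "e = pchart (UNIV, \<lambda>x. x) d" using e by (rule PE)
  note p = carrierI[OF e]
  note C = P_regular[OF p] and D = P_vd[OF d(1,2), folded d(3)]
  have L: "Cr_at r P (\<lambda>q. (normal_F f \<nu> q, \<nu> (snd q))) p" by (intro Cr_at_Pair[OF P] C)
  show ?thesis
    unfolding linear_injective_0[OF linear_vd[OF P L e]]
  proof (intro allI impI)
    fix v assume "vd e (\<lambda>q. (normal_F f \<nu> q, \<nu> (snd q))) p v = 0"
    then have z: "fst v = 0" "vd d \<nu> (snd p) (snd v) = 0" "vd d f (snd p) (snd v) = 0"
      by (auto simp: vd_Pair[OF P C(4,3) e] D zero_prod_def)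
    then show "v = 0" using imm_kernel[OF d(1,2) z(3,2)] by (simp add: prod_eq_iff)
  qed
qed

text \<open>In every projective chart \<nu> is a regular function \<open>g\<close> of the
  coordinates, obtained by scaling the functional to time coefficient -1. Through \<open>g\<close>
  the injectivity of \<open>lift_immersion\<close> is transferred to the projectivised
  conormal.\<close>

lemma proj_chart_regular:
  fixes d :: "('n dual set, real^'n) chart"
  assumes d: "d \<in> proj_atlas" "proj_class (normal_\<alpha> \<nu> p) \<in> fst d" and p: "p \<in> carrier P"
  obtains T g U where "open T" "Cr_on r T g" "snd d (proj_class (normal_\<alpha> \<nu> p)) \<in> T"
    "openin (mtop P) U" "p \<in> U" "\<And>q. q \<in> U \<Longrightarrow> proj_class (normal_\<alpha> \<nu> q) \<in> fst d"
    "\<And>q. q \<in> U \<Longrightarrow> g (snd d (proj_class (normal_\<alpha> \<nu> q))) = \<nu> (snd q)"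
    "Cr_at r P (\<lambda>q. snd d (proj_class (normal_\<alpha> \<nu> q))) p"
proof -
  have co: "dcoord0 (normal_\<alpha> \<nu> q) = -1" "dcoord (normal_\<alpha> \<nu> q) j = \<nu> (snd q) $ j" for q j
    by (simp_all add: normal_\<alpha>_def inner_axis)
  note C = P_regular(3)[OF p]
  have Cj: "Cr_at r P (\<lambda>q. \<nu> (snd q) $ j) p" for j
    by (rule Cr_at_bounded_linear[OF C bounded_linear_vec_nth])
  have opc: "openin (mtop P) (carrier P)"
    using openin_mtop_iff mopen_carrier pre_manifold_open_atlas[OF P] by blast
  from d(1) consider "d = (proj_class ` {a. dcoord0 a \<noteq> 0}, proj_coord0)"
    | i where "d = (proj_class ` {a. dcoord a i \<noteq> 0}, proj_coord i)"
    by (auto simp: proj_atlas_eq)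
  then show thesis
  proof cases
    case 1
    have s: "snd d (proj_class (normal_\<alpha> \<nu> q)) = - \<nu> (snd q)" for q
      by (simp add: 1 proj_coord0_class co vec_eq_iff)
    show thesis
    proof (rule that[of UNIV uminus "carrier P"])
      show "Cr_on r UNIV (uminus :: real^'n \<Rightarrow> real^'n)"
        by (intro Cr_on_bounded_linear bounded_linear_minus bounded_linear_ident)
      show "proj_class (normal_\<alpha> \<nu> q) \<in> fst d" for q unfolding 1 using co(1)[of q] by auto
      show "Cr_at r P (\<lambda>q. snd d (proj_class (normal_\<alpha> \<nu> q))) p"
        unfolding s by (rule Cr_at_bounded_linear[OF C bounded_linear_minus[OF bounded_linear_ident]])
    qed (use p opc s in auto)
  next
    case 2
    obtain a where a: "dcoord a i \<noteq> 0" "proj_class (normal_\<alpha> \<nu> p) = proj_class a" using d(2) 2 by auto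
    have "normal_\<alpha> \<nu> p \<in> proj_class (normal_\<alpha> \<nu> p)"
      unfolding proj_class_def by (intro CollectI exI[of _ 1]) simp
    then obtain k where "normal_\<alpha> \<nu> p = k *\<^sub>R a" "k \<noteq> 0"
      unfolding a(2) by (auto simp: proj_class_def)
    then have "\<nu> (snd p) $ i = k * dcoord a i" using co(2)[of p i] by (simp add: scaleR_blinfun.rep_eq)
    then have nz: "\<nu> (snd p) $ i \<noteq> 0" using a(1) \<open>k \<noteq> 0\<close> by simp
    have s: "snd d (proj_class (normal_\<alpha> \<nu> q)) = (\<chi> j. (if j = i then -1 else \<nu> (snd q) $ j) / \<nu> (snd q) $ i)" for q
      by (simp add: 2 proj_coord_class co vec_eq_iff)
    have o: "open {x::real^'n. x $ i \<noteq> 0}" by (intro open_Collect_neq continuous_intros)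
    obtain U where U: "openin (mtop P) U" "p \<in> U" "\<And>q. q \<in> U \<Longrightarrow> Cr_at r P (\<lambda>q. \<nu> (snd q)) q \<and> \<nu> (snd q) \<in> {x. x $ i \<noteq> 0}"
      by (rule openin_Cr_at_preimage[OF P C o]) (use nz in auto)
    \<comment> \<open>In this chart the slot \<open>i\<close> holds -1/\<nu>_i and the other slots
      hold \<nu>_j/\<nu>_i; dividing by the former, with the sign corrected, gives back
      \<nu>.\<close>
    let ?g = "\<lambda>w::real^'n. \<chi> j. (if j = i then -1 else - w $ j) / w $ i"
    show thesis
    proof (rule that[of "{w. w $ i \<noteq> 0}" ?g U])
      have "Cr_on r {w::real^'n. w $ i \<noteq> 0} (\<lambda>w. (if j = i then -1 else - w $ j) / w $ i)" for j
      proof (rule Cr_on_divide[OF o])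
        show "Cr_on r {w::real^'n. w $ i \<noteq> 0} (\<lambda>w. if j = i then -1 else - w $ j)"
          by (cases "j = i") (simp_all add: Cr_on_const Cr_on_bounded_linear[OF bounded_linear_minus[OF bounded_linear_vec_nth]])
      qed (auto intro: Cr_on_bounded_linear bounded_linear_vec_nth)
      then show "Cr_on r {w::real^'n. w $ i \<noteq> 0} ?g" by (intro Cr_on_vec[OF o]) simp
      show "snd d (proj_class (normal_\<alpha> \<nu> p)) \<in> {w. w $ i \<noteq> 0}" using nz by (simp add: s)
      show "proj_class (normal_\<alpha> \<nu> q) \<in> fst d" if "q \<in> U" for q
        unfolding 2 using U(3)[OF that] co(2)[of q i] by auto
      show "?g (snd d (proj_class (normal_\<alpha> \<nu> q))) = \<nu> (snd q)" if "q \<in> U" for q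
        using U(3)[OF that] by (simp add: s vec_eq_iff)
      show "Cr_at r P (\<lambda>q. snd d (proj_class (normal_\<alpha> \<nu> q))) p"
        unfolding s
      proof (rule Cr_at_vec[OF P p], unfold vec_lambda_beta)
        show "Cr_at r P (\<lambda>q. (if j = i then -1 else \<nu> (snd q) $ j) / \<nu> (snd q) $ i) p" for j
        proof (rule Cr_at_divide[OF P _ Cj nz])
          show "Cr_at r P (\<lambda>q. if j = i then -1 else \<nu> (snd q) $ j) p"
            using Cr_at_const[OF P p, of "-1::real"] Cj[of j] by (cases "j = i") simp_all
        qed
      qed
    qed (use o U in auto)
  qed
qed

lemma null_front: "null_wave_front r P (normal_F f \<nu>) (normal_\<alpha> \<nu>)"
  unfolding null_wave_front_def wave_front_def
proof (intro conjI ballI impI allI)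
  let ?N = "prod_atlas euclid (proj_atlas :: ('n dual set, real^'n) atlas)"
  show "Cr_map r P euclid (normal_F f \<nu>)" unfolding Cr_map_euclid_iff[OF P] using P_regular by blast
  have lin: "bounded_linear (\<lambda>w::real^'n. dual_of 0 w)"
    by (rule linear_conv_bounded_linear[THEN iffD1], rule linearI)
       (auto intro!: blinfun_eqI simp: blinfun.add_left blinfun.scaleR_left inner_add_left algebra_simps)
  \<comment> \<open>In \<open>w\<close> the functional is only affine: its linear part is handled by
    a bounded linear map and the constant is added afterwards.\<close>
  have decomp: "dual_of s w = dual_of s 0 + dual_of 0 w" for s and w :: "real^'n"
    by (rule blinfun_eqI) (simp add: blinfun.add_left)
  have \<alpha>C: "Cr_at r P (normal_\<alpha> \<nu>) p" if p: "p \<in> carrier P" for p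
  proof -
    obtain c W where c: "c \<in> P" "p \<in> fst c" and W: "open W" "snd c p \<in> W" "W \<subseteq> snd c ` fst c"
      "Cr_on r W (\<lambda>x. dual_of 0 (\<nu> (snd (cinv c x))))"
      using Cr_at_bounded_linear[OF P_regular(3)[OF p] lin] unfolding Cr_at_def by blast
    have "Cr_on r W (\<lambda>x. dual_of (-1) 0 + dual_of 0 (\<nu> (snd (cinv c x))))"
      by (intro Cr_on_add[OF W(1)] Cr_on_const W(4))
    then have "Cr_on r W (\<lambda>x. normal_\<alpha> \<nu> (cinv c x))" unfolding normal_\<alpha>_def by (subst decomp)
    then show ?thesis by (rule Cr_atI[OF c W(1-3)])
  qed
  have opc: "openin (mtop P) (carrier P)"
    using openin_mtop_iff mopen_carrier pre_manifold_open_atlas[OF P] by blast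
  have nz: "normal_\<alpha> \<nu> p \<noteq> 0" for p
  proof
    assume "normal_\<alpha> \<nu> p = 0"
    then have "dcoord0 (normal_\<alpha> \<nu> p) = 0" by simp
    then show False by (simp add: normal_\<alpha>_def)
  qed
  have o0: "openin (mtop (euclid :: ('n dual, 'n dual) atlas)) (- {0})" by (simp add: mtop_euclid open_Compl)
  show "Cr_map r P (restr euclid (- {0})) (normal_\<alpha> \<nu>)"
  proof (rule Cr_mapI[OF P openin_restr(1)[OF open_atlas_euclid o0]])
    show "normal_\<alpha> \<nu> ` carrier P \<subseteq> carrier (restr euclid (- {0}))"
      using openin_restr(2)[OF open_atlas_euclid o0] nz by auto
    fix p and d :: "('n dual, 'n dual) chart" assume p: "p \<in> carrier P" and d: "d \<in> restr euclid (- {0})"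
    then have "d = (- {0}, \<lambda>x. x)" by (auto simp: restr_def euclid_def)
    then show "Cr_at r P (\<lambda>q. snd d (normal_\<alpha> \<nu> q)) p \<and> (\<exists>U. openin (mtop P) U \<and> p \<in> U \<and> normal_\<alpha> \<nu> ` U \<subseteq> fst d)"
      using \<alpha>C[OF p] opc p nz by auto
  qed
  show "blinfun_apply (normal_\<alpha> \<nu> p) (vderiv e (normal_F f \<nu>) p v) = 0" if e: "e \<in> P" "p \<in> fst e" for p e v
  proof -
    obtain d where d: "d \<in> S" "snd p \<in> fst d" "e = pchart (UNIV, \<lambda>x. x) d" using e by (rule PE)
    have "norm (\<nu> (snd p)) = 1" using unit carrierI[OF d(1,2)] by blast
    then show ?thesis
      using orth[OF d(1,2)] unit_orth[OF d(1,2)]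
      by (simp add: mderiv_vd P_vd(4)[OF d(1,2), folded d(3)] normal_\<alpha>_def inner_add_right dot_square_norm)
  qed
  show "lightlike (sharp (normal_\<alpha> \<nu> p))" if "p \<in> carrier P" for p
  proof -
    have "sharp (normal_\<alpha> \<nu> p) = (1, \<nu> (snd p))"
      by (simp add: normal_\<alpha>_def sharp_eq vec_eq_iff inner_axis)
    then show ?thesis using lightlike_unit[of "\<nu> (snd p)"] unit that carP by simp
  qed
  have *: "Cr_at r P (\<lambda>q. snd e (normal_F f \<nu> q, proj_class (normal_\<alpha> \<nu> q))) p \<and>
      (\<exists>U. openin (mtop P) U \<and> p \<in> U \<and> (\<lambda>q. (normal_F f \<nu> q, proj_class (normal_\<alpha> \<nu> q))) ` U \<subseteq> fst e)
      \<and> (\<exists>c\<in>P. p \<in> fst c \<and> inj (vd c (\<lambda>q. snd e (normal_F f \<nu> q, proj_class (normal_\<alpha> \<nu> q))) p))"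
    if p: "p \<in> carrier P" and e: "e \<in> ?N" "(normal_F f \<nu> p, proj_class (normal_\<alpha> \<nu> p)) \<in> fst e" for p e
  proof -
    obtain d where d: "d \<in> proj_atlas" "e = pchart (UNIV, \<lambda>x. x) d"
      using e(1) by (auto elim!: prod_atlasE simp: euclid_def)
    have pd: "proj_class (normal_\<alpha> \<nu> p) \<in> fst d" using e d by simp
    obtain T g U where T: "open T" "Cr_on r T g" "snd d (proj_class (normal_\<alpha> \<nu> p)) \<in> T"
      and U: "openin (mtop P) U" "p \<in> U" "\<And>q. q \<in> U \<Longrightarrow> proj_class (normal_\<alpha> \<nu> q) \<in> fst d"
        "\<And>q. q \<in> U \<Longrightarrow> g (snd d (proj_class (normal_\<alpha> \<nu> q))) = \<nu> (snd q)"
      and Cd: "Cr_at r P (\<lambda>q. snd d (proj_class (normal_\<alpha> \<nu> q))) p"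
      by (rule proj_chart_regular[OF d(1) pd p]) blast
    note C = P_regular[OF p]
    let ?u = "\<lambda>q. (normal_F f \<nu> q, snd d (proj_class (normal_\<alpha> \<nu> q)))"
    have eq: "(\<lambda>q. snd e (normal_F f \<nu> q, proj_class (normal_\<alpha> \<nu> q))) = ?u" by (simp add: d)
    have Cu: "Cr_at r P ?u p" by (intro Cr_at_Pair[OF P] C Cd)
    obtain c where c: "c \<in> P" "p \<in> fst c" by (rule carrierE[OF p])
    have "inj (vd c ?u p)"
    proof (rule inj_vd_factor[OF P Cu c _ _ lift_immersion[OF c] U(1,2)])
      show "Cr_at r P (\<lambda>q. (normal_F f \<nu> q, \<nu> (snd q))) p" by (intro Cr_at_Pair[OF P] C)
      have "((\<lambda>z. g (snd z)) has_derivative (\<lambda>v. frechet_derivative g (at (snd (?u p))) (snd v))) (at (?u p))"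
        by (rule has_derivative_compose[where f=snd and g=g])
           (auto intro!: derivative_eq_intros Cr_on_has_derivative[OF T(2,3)])
      then show "((\<lambda>z. (fst z, g (snd z))) has_derivative (\<lambda>v. (fst v, frechet_derivative g (at (snd (?u p))) (snd v)))) (at (?u p))"
        by (intro has_derivative_Pair) (auto intro!: derivative_eq_intros)
      show "(normal_F f \<nu> q, \<nu> (snd q)) = (fst (?u q), g (snd (?u q)))" if "q \<in> U" for q
        using U(4)[OF that] by simp
    qed
    moreover have "(\<lambda>q. (normal_F f \<nu> q, proj_class (normal_\<alpha> \<nu> q))) ` U \<subseteq> fst e" using U(3) by (auto simp: d)
    ultimately show ?thesis unfolding eq using Cu c U by blast
  qed
  show "Cr_immersion r P ?N (\<lambda>p. (normal_F f \<nu> p, proj_class (normal_\<alpha> \<nu> p)))"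
  proof (rule Cr_immersionI[OF P])
    have "proj_class (normal_\<alpha> \<nu> p) \<in> carrier proj_atlas" for p
    proof (rule carrierI)
      show "(proj_class ` {a. dcoord0 a \<noteq> 0}, proj_coord0) \<in> proj_atlas" by (simp add: proj_atlas_eq)
      have "dcoord0 (normal_\<alpha> \<nu> p) \<noteq> 0" by (simp add: normal_\<alpha>_def)
      then show "proj_class (normal_\<alpha> \<nu> p) \<in> fst (proj_class ` {a. dcoord0 a \<noteq> 0}, proj_coord0)" by auto
    qed
    then have im: "(\<lambda>p. (normal_F f \<nu> p, proj_class (normal_\<alpha> \<nu> p))) ` carrier P \<subseteq> carrier ?N"
      by (auto simp: carrier_prod)
    show "Cr_map r P ?N (\<lambda>p. (normal_F f \<nu> p, proj_class (normal_\<alpha> \<nu> p)))"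
      by (rule Cr_mapI[OF P open_atlas_prod[OF open_atlas_euclid open_atlas_proj] im])
         (rule conjI[OF conjunct1[OF *] conjunct1[OF conjunct2[OF *]]])
  qed (rule conjI[OF conjunct1[OF *] conjunct2[OF conjunct2[OF *]]])
qed

text \<open>The field is d/dt. Its components (1, 0) are the same in every product chart, as
  transitions act on the first factor as the identity. Along an integral curve \<open>f\<close> and
  \<nu> are constant while t runs at unit speed, so the image stays on one line.\<close>

lemma null_field: "null_vector_field_E r P (normal_F f \<nu>) (normal_\<alpha> \<nu>) (\<lambda>_ _. (1, 0))"
  unfolding null_vector_field_E_def Cr_vector_field_def
proof (intro conjI ballI allI impI)
  have lin: "linear (vd d f (snd p))" "linear (vd d \<nu> (snd p))" if "d \<in> S" "snd p \<in> fst d" for d p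
    by (rule linear_vd[OF S _ that]; use f \<nu> carrierI[OF that] in blast)+
  show "Cr_on r (snd c ` fst c) ((\<lambda>_. (1 :: real, 0 :: real^'k)) \<circ> cinv c)" for c :: "(real \<times> 'b, real \<times> (real^'k)) chart"
    unfolding o_def by (rule Cr_on_const)
  show "(1, 0) = mderiv e e' (\<lambda>x. x) p (1, 0)" if e: "e \<in> P" "e' \<in> P" "p \<in> fst e \<inter> fst e'" for e e' p
  proof -
    obtain d where d: "d \<in> S" "snd p \<in> fst d" "e = pchart (UNIV, \<lambda>x. x) d" by (rule PE[of e p]) (use e in auto)
    obtain d' where d': "d' \<in> S" "snd p \<in> fst d'" "e' = pchart (UNIV, \<lambda>x. x) d'" by (rule PE[of e' p]) (use e in auto)
    have p: "p \<in> carrier P" "p \<in> fst e" using e by (auto intro: carrierI)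
    note Cd = Cr_at_chart[OF S d'(1,2)]
    have u: "(UNIV, \<lambda>x::real. x) \<in> euclid" "fst p \<in> fst (UNIV :: real set, \<lambda>x::real. x)" by (auto simp: euclid_def)
    have C2: "Cr_at r P (\<lambda>q. snd d' (snd q)) p" by (rule Cr_at_snd[OF pre_manifold_euclid S Cd]) simp
    have eq: "(\<lambda>q. snd e' q) = (\<lambda>q. (fst q, snd d' (snd q)))" by (auto simp: d')
    have "vd e (\<lambda>q. snd e' q) p (1, 0) = (1, vd d (snd d') (snd p) 0)"
      unfolding eq vd_Pair[OF P P_regular(1)[OF p(1)] C2 e(1) p(2)] P_vd(1)[OF d(1,2), folded d(3)]
        vd_snd[OF pre_manifold_euclid S Cd u d(1,2), folded d(3)] by simp
    then show ?thesis
      using linear_0[OF linear_vd[OF S Cd d(1,2)]] by (simp add: mderiv_vd)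
  qed
  show vF: "vderiv e (normal_F f \<nu>) p (1, 0) = xihat_E (normal_\<alpha> \<nu>) p" if e: "e \<in> P" "p \<in> fst e" for e p
  proof -
    obtain d where d: "d \<in> S" "snd p \<in> fst d" "e = pchart (UNIV, \<lambda>x. x) d" using e by (rule PE)
    show ?thesis
      using P_vd(4)[OF d(1,2), folded d(3)] normal_xihat[OF carrierI[OF e]] linear_0[OF lin(1)[OF d(1,2)]] linear_0[OF lin(2)[OF d(1,2)]]
      by (simp add: mderiv_vd)
  qed
  fix J \<gamma> assume \<gamma>: "integral_curve P (\<lambda>_ _. (1, 0)) J \<gamma>"
  show "\<exists>L. lightlike_line L \<and> normal_F f \<nu> ` \<gamma> ` J \<subseteq> L"
  proof (cases "J = {}")
    case True
    then show ?thesis using lightlike_line_exists by auto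
  next
    case False
    then obtain t where t: "t \<in> J" by blast
    have car: "\<gamma> s \<in> carrier P" if "s \<in> J" for s
      using \<gamma> that topspace_mtop[OF pre_manifold_open_atlas[OF P]] by (auto simp: integral_curve_def continuous_map_def)
    have d0: "vd e fst (\<gamma> s) (1, 0) = 1" "vd e (\<lambda>q. f (snd q)) (\<gamma> s) (1, 0) = 0" "vd e (\<lambda>q. \<nu> (snd q)) (\<gamma> s) (1, 0) = 0"
      if e: "e \<in> P" "\<gamma> s \<in> fst e" for s e
    proof -
      obtain d where d: "d \<in> S" "snd (\<gamma> s) \<in> fst d" "e = pchart (UNIV, \<lambda>x. x) d" using e by (rule PE)
      show "vd e fst (\<gamma> s) (1, 0) = 1" "vd e (\<lambda>q. f (snd q)) (\<gamma> s) (1, 0) = 0" "vd e (\<lambda>q. \<nu> (snd q)) (\<gamma> s) (1, 0) = 0"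
        using P_vd[OF d(1,2), folded d(3)] linear_0[OF lin(1)[OF d(1,2)]] linear_0[OF lin(2)[OF d(1,2)]] by simp_all
    qed
    have c: "fst (\<gamma> s) = fst (\<gamma> t) + (s - t)" "f (snd (\<gamma> s)) = f (snd (\<gamma> t))" "\<nu> (snd (\<gamma> s)) = \<nu> (snd (\<gamma> t))"
      if s: "s \<in> J" for s
      using integral_curve_affine[OF P \<gamma> P_regular(1) d0(1) s t]
        integral_curve_affine[OF P \<gamma> P_regular(2) d0(2) s t] integral_curve_affine[OF P \<gamma> P_regular(3) d0(3) s t] by simp_all
    let ?v = "(1, \<nu> (snd (\<gamma> t)))"
    have "lightlike ?v" using lightlike_unit unit car[OF t] carP by blast
    moreover have "normal_F f \<nu> (\<gamma> s) \<in> range (\<lambda>s. (0, f (snd (\<gamma> t))) + s *\<^sub>R ?v)" if "s \<in> J" for s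
      using c[OF that] by (auto simp: normal_F_def)
    ultimately show ?thesis unfolding lightlike_line_def by blast
  qed
qed

lemma L_complete: "L_complete r P (normal_F f \<nu>) (normal_\<alpha> \<nu>)"
  unfolding L_complete_def
proof (intro exI[of _ "\<lambda>_ _. (1, 0)"] conjI null_field ballI)
  fix p assume p: "p \<in> carrier P"
  let ?\<gamma> = "\<lambda>s. (s, snd p)"
  have sp: "snd p \<in> carrier S" using p carP by blast
  have "integral_curve P (\<lambda>_ _. (1, 0)) UNIV ?\<gamma>"
    unfolding integral_curve_def
  proof (intro conjI ballI impI)
    show "continuous_map (top_of_set UNIV) (mtop P) ?\<gamma>"
      unfolding mtop_prod[OF pre_manifold_euclid S] mtop_euclid
      using sp topspace_mtop[OF oS] by (simp add: continuous_map_paired)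
    fix t e assume e: "e \<in> P" "?\<gamma> t \<in> fst e"
    obtain d where d: "d \<in> S" "e = pchart (UNIV, \<lambda>x. x) d" using e by (rule PE)
    show "((\<lambda>s. snd e (?\<gamma> s)) has_vector_derivative (1, 0)) (at t within UNIV)"
      unfolding d by (auto simp: has_vector_derivative_def intro!: derivative_eq_intros)
  qed auto
  moreover have "p \<in> range ?\<gamma>" by (rule range_eqI[of _ _ "fst p"]) simp
  moreover have "lightlike (1, \<nu> (snd p))" using lightlike_unit unit sp by blast
  then have "lightlike_line (range (normal_F f \<nu> \<circ> ?\<gamma>))"
    unfolding lightlike_line_def o_def normal_F_def fst_conv snd_conv by blast
  ultimately show "\<exists>\<gamma>. integral_curve P (\<lambda>_ _. (1, 0)) UNIV \<gamma> \<and> p \<in> range \<gamma> \<and> lightlike_line (range (normal_F f \<nu> \<circ> \<gamma>))"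
    by blast
qed

lemma normal_form: "normal_form r S (normal_F f \<nu>) (normal_\<alpha> \<nu>)"
  unfolding normal_form_def
  by (intro exI[of _ f] exI[of _ \<nu>] conjI euclidean_front_with)
     (use normal_xihat carP in \<open>auto simp: normal_F_def\<close>)

end

section \<open>Gluing slices along the relation\<close>

lemma openin_carrier: "pre_manifold r M \<Longrightarrow> openin (mtop M) U \<Longrightarrow> U \<subseteq> carrier M"
  using openin_subset topspace_mtop[OF pre_manifold_open_atlas] by metis

lemma openin_carrier_self: "pre_manifold r M \<Longrightarrow> openin (mtop M) (carrier M)"
  using openin_mtop_iff mopen_carrier pre_manifold_open_atlas by blast

lemma openin_Cr_preimage:
  assumes M: "pre_manifold r M" and f: "\<And>p. p \<in> carrier M \<Longrightarrow> Cr_at r M f p" and U: "openin (mtop M) U" and N: "open N"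
  shows "openin (mtop M) {p \<in> U. f p \<in> N}"
proof -
  have Cf: "Cr_at r M f p" if "p \<in> U" for p using f openin_carrier[OF M U] that by blast
  have tU: "topspace (subtopology (mtop M) U) = U" using openin_subset[OF U] by auto
  have "openin (subtopology (mtop M) U) {p \<in> topspace (subtopology (mtop M) U). f p \<in> N}"
    by (rule openin_continuous_map_preimage[OF continuous_map_Cr_at[OF M Cf U]]) (use N in simp_all)
  then show ?thesis unfolding tU openin_open_subtopology[OF U] by blast
qed

lemma related_sym: "related U V f g x y \<Longrightarrow> related V U g f y x"
  unfolding related_def by metis

lemma related_eq: "related U V f g x y \<Longrightarrow> f x = g y"
  unfolding related_def by blast

text \<open>The images of the two neighbourhoods are cut down to the same piece by an open set of the
  ambient space that exists because \<open>g\<close> is an embedding.\<close>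

lemma related_trans:
  fixes f :: "'a \<Rightarrow> 'v::euclidean_space" and g :: "'b \<Rightarrow> 'v" and h :: "'c \<Rightarrow> 'v"
  assumes U: "pre_manifold r U" and V: "pre_manifold r V" and W: "pre_manifold r W"
    and f: "\<And>p. p \<in> carrier U \<Longrightarrow> Cr_at r U f p" and g: "Cr_embedding r V euclid g"
    and h: "\<And>p. p \<in> carrier W \<Longrightarrow> Cr_at r W h p"
    and 1: "related U V f g x y" and 2: "related V W g h y z"
  shows "related U W f h x z"
proof -
  obtain Ox Oy where O: "openin (mtop U) Ox" "x \<in> Ox" "openin (mtop V) Oy" "y \<in> Oy" "f ` Ox = g ` Oy"
    and fg: "f x = g y" using 1 unfolding related_def by blast
  obtain Oy' Oz where O': "openin (mtop V) Oy'" "y \<in> Oy'" "openin (mtop W) Oz" "z \<in> Oz" "g ` Oy' = h ` Oz"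
    and gh: "g y = h z" using 2 unfolding related_def by blast
  have B: "openin (mtop V) (Oy \<inter> Oy')" using O(3) O'(1) by (rule openin_Int)
  have cV: "Oy \<subseteq> carrier V" "Oy' \<subseteq> carrier V" using openin_carrier[OF V] O(3) O'(1) by auto
  obtain N where N: "open N" and Nq: "\<And>q. q \<in> carrier V \<Longrightarrow> g q \<in> N \<longleftrightarrow> q \<in> Oy \<inter> Oy'"
    using Cr_embedding_euclidD(4)[OF V g B] by blast
  have gN: "g y \<in> N" using Nq[of y] O(4) O'(2) cV by blast
  have "f ` {x\<in>Ox. f x \<in> N} = f ` Ox \<inter> N" by auto
  also have "\<dots> = g ` Oy \<inter> N" unfolding O(5) ..
  also have "\<dots> = g ` (Oy \<inter> Oy')" using Nq cV by auto
  also have "\<dots> = g ` Oy' \<inter> N" using Nq cV by auto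
  also have "\<dots> = h ` Oz \<inter> N" unfolding O'(5) ..
  also have "\<dots> = h ` {z\<in>Oz. h z \<in> N}" by auto
  finally have eq: "f ` {x\<in>Ox. f x \<in> N} = h ` {z\<in>Oz. h z \<in> N}" .
  show ?thesis
    unfolding related_def
  proof (intro conjI exI)
    show "openin (mtop U) {x\<in>Ox. f x \<in> N}" by (rule openin_Cr_preimage[OF U f O(1) N])
    show "openin (mtop W) {z\<in>Oz. h z \<in> N}" by (rule openin_Cr_preimage[OF W h O'(3) N])
  qed (use fg gh gN O O' eq in auto)
qed

text \<open>Near a related pair the two images agree, so every point near \<open>x\<close> has a
  partner near \<open>y\<close>; an ambient open set that cuts out \<open>B\<close> keeps the
  partner inside \<open>B\<close>. This is what makes the overlaps of the glued charts open.\<close>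

lemma openin_related:
  fixes f :: "'a \<Rightarrow> 'v::euclidean_space" and g :: "'b \<Rightarrow> 'v"
  assumes U: "pre_manifold r U" and V: "pre_manifold r V"
    and f: "\<And>p. p \<in> carrier U \<Longrightarrow> Cr_at r U f p" and g: "Cr_embedding r V euclid g"
    and A: "openin (mtop U) A" and B: "openin (mtop V) B"
  shows "openin (mtop U) {x\<in>A. \<exists>y\<in>B. related U V f g x y}"
proof (subst openin_subopen, safe)
  fix x y assume x: "x \<in> A" and y: "y \<in> B" and rel: "related U V f g x y"
  obtain Ox Oy where O: "openin (mtop U) Ox" "x \<in> Ox" "openin (mtop V) Oy" "y \<in> Oy" "f ` Ox = g ` Oy"
    and fg: "f x = g y" using rel unfolding related_def by blast
  obtain N where N: "open N" and Nq: "\<And>q. q \<in> carrier V \<Longrightarrow> g q \<in> N \<longleftrightarrow> q \<in> B"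
    using Cr_embedding_euclidD(4)[OF V g B] by blast
  have cV: "Oy \<subseteq> carrier V" "B \<subseteq> carrier V" using openin_carrier[OF V] O(3) B by auto
  let ?T = "A \<inter> {x\<in>Ox. f x \<in> N}"
  have "openin (mtop U) ?T" using A openin_Cr_preimage[OF U f O(1) N] by (rule openin_Int)
  moreover have "x \<in> ?T" using x O(2) fg Nq[of y] y cV by auto
  moreover have "?T \<subseteq> {x\<in>A. \<exists>y\<in>B. related U V f g x y}"
  proof
    fix x' assume x': "x' \<in> ?T"
    then obtain y' where y': "y' \<in> Oy" "f x' = g y'" using O(5) by blast
    have "y' \<in> B" using x' y' Nq[of y'] cV by auto
    moreover have "related U V f g x' y'"
      unfolding related_def
      by (rule conjI[OF y'(2)], rule exI[of _ Ox], rule exI[of _ Oy]) (use x' y' O in simp)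
    ultimately show "x' \<in> {x\<in>A. \<exists>y\<in>B. related U V f g x y}" using x' by blast
  qed
  ultimately show "\<exists>T. openin (mtop U) T \<and> x \<in> T \<and> T \<subseteq> {x\<in>A. \<exists>y\<in>B. related U V f g x y}" by blast
qed

text \<open>The quotient of the disjoint union of the slices, described abstractly: the fibres of
  \<sigma> are the classes of the relation, and \<open>lS\<close> is the common value of the
  embeddings on a class. The type of the classes is left open.\<close>

locale gluing =
  fixes r :: regularity and \<Lambda> :: "'i set" and Sg :: "'i \<Rightarrow> ('a, real^'k) atlas"
    and l :: "'i \<Rightarrow> 'a \<Rightarrow> 'v::euclidean_space" and \<sigma> :: "'i \<Rightarrow> 'a \<Rightarrow> 'b" and lS :: "'b \<Rightarrow> 'v"
  assumes adm: "admissible_family r \<Lambda> Sg l"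
    and \<sigma>: "\<And>D D' x x'. D \<in> \<Lambda> \<Longrightarrow> D' \<in> \<Lambda> \<Longrightarrow> x \<in> carrier (Sg D) \<Longrightarrow> x' \<in> carrier (Sg D') \<Longrightarrow>
      \<sigma> D x = \<sigma> D' x' \<longleftrightarrow> related (Sg D) (Sg D') (l D) (l D') x x'"
    and lS: "\<And>D x. D \<in> \<Lambda> \<Longrightarrow> x \<in> carrier (Sg D) \<Longrightarrow> lS (\<sigma> D x) = l D x"
begin

lemma mf: "D \<in> \<Lambda> \<Longrightarrow> Cr_manifold r (Sg D)" and emb: "D \<in> \<Lambda> \<Longrightarrow> Cr_embedding r (Sg D) euclid (l D)"
  and pm: "D \<in> \<Lambda> \<Longrightarrow> pre_manifold r (Sg D)"
  using adm Cr_manifold_pre unfolding admissible_family_def by blast+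

lemma oa: "D \<in> \<Lambda> \<Longrightarrow> open_atlas (Sg D)" by (rule pre_manifold_open_atlas[OF pm])

lemma lC: "D \<in> \<Lambda> \<Longrightarrow> p \<in> carrier (Sg D) \<Longrightarrow> Cr_at r (Sg D) (l D) p"
  by (rule Cr_embedding_euclidD(1)[OF pm emb])

lemma \<sigma>_inj: "D \<in> \<Lambda> \<Longrightarrow> inj_on (\<sigma> D) (carrier (Sg D))"
proof (rule inj_onI)
  fix x y assume D: "D \<in> \<Lambda>" and x: "x \<in> carrier (Sg D)" "y \<in> carrier (Sg D)" "\<sigma> D x = \<sigma> D y"
  then have "l D x = l D y" using lS by metis
  then show "x = y" using Cr_embedding_euclidD(3)[OF pm emb, OF D D] x by (auto dest: inj_onD)
qed

definition \<tau> :: "'i \<Rightarrow> 'b \<Rightarrow> 'a" where "\<tau> D = inv_into (carrier (Sg D)) (\<sigma> D)"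

lemma \<tau>_\<sigma> [simp]: "D \<in> \<Lambda> \<Longrightarrow> x \<in> carrier (Sg D) \<Longrightarrow> \<tau> D (\<sigma> D x) = x"
  using \<sigma>_inj by (simp add: \<tau>_def)

definition chart :: "'i \<Rightarrow> ('a, real^'k) chart \<Rightarrow> ('b, real^'k) chart" where
  "chart D c = (\<sigma> D ` fst c, \<lambda>s. snd c (\<tau> D s))"

definition S :: "('b, real^'k) atlas" where
  "S = (\<Union>D\<in>\<Lambda>. chart D ` Sg D)"

lemma SE: assumes "e \<in> S" obtains D c where "D \<in> \<Lambda>" "c \<in> Sg D" "e = chart D c"
  using assms by (auto simp: S_def)

lemma SI: "D \<in> \<Lambda> \<Longrightarrow> c \<in> Sg D \<Longrightarrow> chart D c \<in> S"
  by (auto simp: S_def)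

lemma fst_chart: "fst (chart D c) = \<sigma> D ` fst c" by (simp add: chart_def)

lemma snd_chart: "D \<in> \<Lambda> \<Longrightarrow> x \<in> carrier (Sg D) \<Longrightarrow> snd (chart D c) (\<sigma> D x) = snd c x"
  by (simp add: chart_def)

lemma carrier_S: "carrier S = (\<Union>D\<in>\<Lambda>. \<sigma> D ` carrier (Sg D))"
  by (auto simp: carrier_def S_def chart_def)

lemma SE_point: assumes "s \<in> carrier S" obtains D x where "D \<in> \<Lambda>" "x \<in> carrier (Sg D)" "s = \<sigma> D x"
  using assms by (auto simp: carrier_S)

lemma chart_image: "D \<in> \<Lambda> \<Longrightarrow> X \<subseteq> carrier (Sg D) \<Longrightarrow> snd (chart D c) ` \<sigma> D ` X = snd c ` X"
  by (force simp: image_image chart_def)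

lemma fst_carrier: "c \<in> Sg D \<Longrightarrow> fst c \<subseteq> carrier (Sg D)" by (auto simp: carrier_def)

lemma chart_inj: "D \<in> \<Lambda> \<Longrightarrow> c \<in> Sg D \<Longrightarrow> inj_on (snd (chart D c)) (fst (chart D c))"
proof (rule inj_onI)
  fix s t assume D: "D \<in> \<Lambda>" and c: "c \<in> Sg D" and st: "s \<in> fst (chart D c)" "t \<in> fst (chart D c)"
    and eq: "snd (chart D c) s = snd (chart D c) t"
  obtain x y where xy: "x \<in> fst c" "y \<in> fst c" "s = \<sigma> D x" "t = \<sigma> D y" using st by (auto simp: fst_chart)
  then have "snd c x = snd c y" using eq snd_chart[OF D] carrierI[OF c] by auto
  then show "s = t" using xy oa[OF D] c by (auto simp: open_atlas_def dest: inj_onD)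
qed

lemma cinv_chart_eq:
  assumes D: "D \<in> \<Lambda>" "c \<in> Sg D" and y: "y \<in> snd c ` fst c"
  shows "cinv (chart D c) y = \<sigma> D (cinv c y)"
proof (rule inv_into_f_eq[OF chart_inj[OF D]])
  have "cinv c y \<in> fst c" using y by (rule cinv_into)
  then show "\<sigma> D (cinv c y) \<in> fst (chart D c)" by (auto simp: fst_chart)
  show "snd (chart D c) (\<sigma> D (cinv c y)) = y"
    using snd_chart[OF D(1) carrierI[OF D(2) cinv_into[OF y]]] chart_cinv[OF y] by simp
qed

text \<open>The set in question consists of the points of \<open>A\<close> that have a related
  partner in \<open>B\<close>.\<close>

lemma \<sigma>_vimage:
  assumes D: "D \<in> \<Lambda>" "D' \<in> \<Lambda>" and A: "openin (mtop (Sg D)) A" and B: "openin (mtop (Sg D')) B"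
  shows "openin (mtop (Sg D)) {x\<in>A. \<sigma> D x \<in> \<sigma> D' ` B}"
proof -
  have "{x\<in>A. \<sigma> D x \<in> \<sigma> D' ` B} = {x\<in>A. \<exists>y\<in>B. related (Sg D) (Sg D') (l D) (l D') x y}"
    using openin_carrier[OF pm[OF D(1)] A] openin_carrier[OF pm[OF D(2)] B] \<sigma>[OF D] by (auto simp: image_iff) blast+
  then show ?thesis
    using openin_related[OF pm[OF D(1)] pm[OF D(2)] lC[OF D(1)] emb[OF D(2)] A B] by simp
qed

lemma chart_overlap:
  assumes D: "D \<in> \<Lambda>" "c \<in> Sg D" and D': "D' \<in> \<Lambda>" and B: "openin (mtop (Sg D')) B"
  shows "snd (chart D c) ` (\<sigma> D' ` B \<inter> fst (chart D c)) = snd c ` {x\<in>fst c. \<sigma> D x \<in> \<sigma> D' ` B}"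
    "open (snd c ` {x\<in>fst c. \<sigma> D x \<in> \<sigma> D' ` B})"
proof -
  have "\<sigma> D' ` B \<inter> fst (chart D c) = \<sigma> D ` {x\<in>fst c. \<sigma> D x \<in> \<sigma> D' ` B}"
    unfolding fst_chart
  proof
    show "\<sigma> D' ` B \<inter> \<sigma> D ` fst c \<subseteq> \<sigma> D ` {x\<in>fst c. \<sigma> D x \<in> \<sigma> D' ` B}"
    proof
      fix s assume s: "s \<in> \<sigma> D' ` B \<inter> \<sigma> D ` fst c"
      then obtain x where x: "x \<in> fst c" "s = \<sigma> D x" by (elim IntE imageE)
      show "s \<in> \<sigma> D ` {x\<in>fst c. \<sigma> D x \<in> \<sigma> D' ` B}"
        unfolding x(2) by (rule imageI) (use s x in simp)
    qed
  qed auto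
  then show "snd (chart D c) ` (\<sigma> D' ` B \<inter> fst (chart D c)) = snd c ` {x\<in>fst c. \<sigma> D x \<in> \<sigma> D' ` B}"
    using chart_image[OF D(1), of "{x\<in>fst c. \<sigma> D x \<in> \<sigma> D' ` B}" c] fst_carrier[OF D(2)] by auto
  have "openin (mtop (Sg D)) {x\<in>fst c. \<sigma> D x \<in> \<sigma> D' ` B}"
    by (rule \<sigma>_vimage[OF D(1) D' openin_chart[OF pm[OF D(1)] D(2)] B])
  then show "open (snd c ` {x\<in>fst c. \<sigma> D x \<in> \<sigma> D' ` B})"
    by (subst (asm) openin_chart_subset[OF pm[OF D(1)] D(2)]) auto
qed

text \<open>The passage from one slice to another is the lift of \<open>l D\<close> through the
  embedding \<open>l D'\<close>.\<close>

lemma Cr_at_transition: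
  assumes D: "D \<in> \<Lambda>" and D': "D' \<in> \<Lambda>" "c' \<in> Sg D'" and x: "x \<in> carrier (Sg D)" "\<sigma> D x \<in> \<sigma> D' ` fst c'"
  shows "Cr_at r (Sg D) (\<lambda>x. snd c' (\<tau> D' (\<sigma> D x))) x"
proof -
  let ?U = "{y\<in>carrier (Sg D). \<sigma> D y \<in> \<sigma> D' ` fst c'}"
  note cc = fst_carrier[OF D'(2)]
  have U: "openin (mtop (Sg D)) ?U"
    by (rule \<sigma>_vimage[OF D D'(1) openin_carrier_self[OF pm[OF D]] openin_chart[OF pm[OF D'(1)] D'(2)]])
  have h: "\<tau> D' (\<sigma> D y) \<in> fst c'" "l D' (\<tau> D' (\<sigma> D y)) = l D y" if y: "y \<in> ?U" for y
  proof -
    obtain z where z: "z \<in> fst c'" "\<sigma> D y = \<sigma> D' z" using y by blast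
    have zc: "z \<in> carrier (Sg D')" using z cc by blast
    have "\<tau> D' (\<sigma> D y) = z" unfolding z(2) by (rule \<tau>_\<sigma>[OF D'(1) zc])
    moreover have "l D y = l D' z" using lS[OF D, of y] lS[OF D'(1) zc] z(2) y by simp
    ultimately show "\<tau> D' (\<sigma> D y) \<in> fst c'" "l D' (\<tau> D' (\<sigma> D y)) = l D y" using z by simp_all
  qed
  have xU: "x \<in> ?U" using x by blast
  have hc: "\<And>q. q \<in> ?U \<Longrightarrow> \<tau> D' (\<sigma> D q) \<in> carrier (Sg D')" using h(1) cc by blast
  obtain V where "Cr_at r (Sg D) (\<lambda>x. snd c' (\<tau> D' (\<sigma> D x))) x"
    by (rule Cr_at_lift[OF pm[OF D'(1)] emb[OF D'(1)] pm[OF D] lC[OF D x(1)] U xU hc h(2)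
          openin_chart[OF pm[OF D'(1)] D'(2)] h(1)[OF xU] D'(2) h(1)[OF xU]])
  then show ?thesis .
qed

lemma S_pre: "pre_manifold r S"
  unfolding pre_manifold_def
proof (intro conjI ballI)
  show "inj_on (snd e) (fst e)" if "e \<in> S" for e
    using that chart_inj by (metis SE)
  fix e e' assume "e \<in> S" "e' \<in> S"
  then obtain D c D' c' where e: "D \<in> \<Lambda>" "c \<in> Sg D" "e = chart D c" and e': "D' \<in> \<Lambda>" "c' \<in> Sg D'" "e' = chart D' c'"
    by (metis SE)
  let ?A = "{x\<in>fst c. \<sigma> D x \<in> \<sigma> D' ` fst c'}"
  note ov = chart_overlap[OF e(1,2) e'(1) openin_chart[OF pm[OF e'(1)] e'(2)]]
  have im: "snd e ` (fst e \<inter> fst e') = snd c ` ?A"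
    unfolding e e' using ov(1) by (simp add: fst_chart Int_commute)
  show "open (snd e ` (fst e \<inter> fst e'))" unfolding im by (rule ov(2))
  have "Cr_on r (snd c ` ?A) (\<lambda>y. snd c' (\<tau> D' (\<sigma> D (cinv c y))))"
  proof (rule Cr_on_local)
    fix a assume "a \<in> snd c ` ?A"
    then obtain x where x: "x \<in> fst c" "\<sigma> D x \<in> \<sigma> D' ` fst c'" "a = snd c x" by blast
    obtain W where W: "open W" "snd c x \<in> W" "W \<subseteq> snd c ` fst c" "Cr_on r W (\<lambda>y. snd c' (\<tau> D' (\<sigma> D (cinv c y))))"
      by (rule Cr_at_chartE[OF pm[OF e(1)] Cr_at_transition[OF e(1) e'(1,2) carrierI[OF e(2) x(1)] x(2)] e(2) x(1)])
    then show "\<exists>U. open U \<and> a \<in> U \<and> Cr_on r U (\<lambda>y. snd c' (\<tau> D' (\<sigma> D (cinv c y))))" using x(3) by blast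
  qed
  then show "Cr_on r (snd e ` (fst e \<inter> fst e')) (local_rep e e' (\<lambda>x. x))"
    unfolding im
  proof (rule Cr_on_cong[OF ov(2)])
    fix y assume "y \<in> snd c ` ?A"
    then have "y \<in> snd c ` fst c" by blast
    from cinv_chart_eq[OF e(1,2) this]
    show "snd c' (\<tau> D' (\<sigma> D (cinv c y))) = local_rep e e' (\<lambda>x. x) y"
      unfolding local_rep_def e(3) e'(3) o_def by (simp add: chart_def)
  qed
qed

lemma \<sigma>_open:
  assumes D: "D \<in> \<Lambda>" and B: "openin (mtop (Sg D)) B" shows "openin (mtop S) (\<sigma> D ` B)"
  unfolding openin_mtop_iff[OF pre_manifold_open_atlas[OF S_pre]] mopen_def
proof (intro conjI ballI)
  show "\<sigma> D ` B \<subseteq> carrier S" using openin_carrier[OF pm[OF D] B] D by (auto simp: carrier_S)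
  fix e assume "e \<in> S"
  then obtain D' c where e: "D' \<in> \<Lambda>" "c \<in> Sg D'" "e = chart D' c" by (rule SE)
  show "open (snd e ` (\<sigma> D ` B \<inter> fst e))"
    unfolding e(3) chart_overlap(1)[OF e(1,2) D B] by (rule chart_overlap(2)[OF e(1,2) D B])
qed

lemma \<sigma>_continuous:
  assumes D: "D \<in> \<Lambda>" and W: "openin (mtop S) W" shows "openin (mtop (Sg D)) {x\<in>carrier (Sg D). \<sigma> D x \<in> W}"
  unfolding openin_mtop_iff[OF oa[OF D]] mopen_def
proof (intro conjI ballI)
  fix c assume c: "c \<in> Sg D"
  have "mopen S W" using W openin_mtop_iff[OF pre_manifold_open_atlas[OF S_pre]] by blast
  then have o: "open (snd (chart D c) ` (W \<inter> fst (chart D c)))" using SI[OF D c] unfolding mopen_def by blast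
  have "W \<inter> fst (chart D c) = \<sigma> D ` ({x\<in>carrier (Sg D). \<sigma> D x \<in> W} \<inter> fst c)"
    using fst_carrier[OF c] by (auto simp: fst_chart)
  show "open (snd c ` ({x\<in>carrier (Sg D). \<sigma> D x \<in> W} \<inter> fst c))"
  proof -
    have sub: "{x\<in>carrier (Sg D). \<sigma> D x \<in> W} \<inter> fst c \<subseteq> carrier (Sg D)" by blast
    show ?thesis using o unfolding \<open>W \<inter> fst (chart D c) = _\<close> chart_image[OF D sub] .
  qed
qed auto

text \<open>Distinct classes come from unrelated points, so the second alternative of admissibility
  holds: neighbourhoods without any related pair, and their images under \<sigma> are open and
  disjoint.\<close>

lemma S_Hausdorff: "Hausdorff_space (mtop S)"
  unfolding Hausdorff_space_def topspace_mtop[OF pre_manifold_open_atlas[OF S_pre]]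
proof (intro allI impI, elim conjE)
  fix s t assume s: "s \<in> carrier S" and t: "t \<in> carrier S" and ne: "s \<noteq> t"
  obtain D x where D: "D \<in> \<Lambda>" "x \<in> carrier (Sg D)" "s = \<sigma> D x" using s by (rule SE_point)
  obtain D' y where D': "D' \<in> \<Lambda>" "y \<in> carrier (Sg D')" "t = \<sigma> D' y" using t by (rule SE_point)
  have ap: "admissible_pair (Sg D) (Sg D') (l D) (l D')" using adm D D' unfolding admissible_family_def by blast
  have nr: "\<not> related (Sg D) (Sg D') (l D) (l D') x y" using \<sigma>[OF D(1) D'(1) D(2) D'(2)] ne D D' by blast
  obtain A B where A: "openin (mtop (Sg D)) A" "x \<in> A" and B: "openin (mtop (Sg D')) B" "y \<in> B"
    and dis: "\<And>x' y'. x' \<in> A \<Longrightarrow> y' \<in> B \<Longrightarrow> \<not> related (Sg D) (Sg D') (l D) (l D') x' y'"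
    using ap nr D(2) D'(2) unfolding admissible_pair_def by meson
  have "\<sigma> D ` A \<inter> \<sigma> D' ` B = {}"
    using dis \<sigma>[OF D(1) D'(1)] openin_carrier[OF pm[OF D(1)] A(1)] openin_carrier[OF pm[OF D'(1)] B(1)] by blast
  then show "\<exists>U V. openin (mtop S) U \<and> openin (mtop S) V \<and> s \<in> U \<and> t \<in> V \<and> disjnt U V"
    using \<sigma>_open[OF D(1) A(1)] \<sigma>_open[OF D'(1) B(1)] A(2) B(2) D(3) D'(3) unfolding disjnt_def by blast
qed

text \<open>The family of slices is countable and each \<sigma> is open and continuous, so the
  images of countable bases of the slices form a countable basis together.\<close>

lemma S_second_countable: "second_countable (mtop S)"
proof -
  have "\<forall>D\<in>\<Lambda>. \<exists>B. countable B \<and> (\<forall>V\<in>B. openin (mtop (Sg D)) V) \<and>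
     (\<forall>W x. openin (mtop (Sg D)) W \<and> x \<in> W \<longrightarrow> (\<exists>V\<in>B. x \<in> V \<and> V \<subseteq> W))"
    using mf unfolding Cr_manifold_def second_countable_def by blast
  then obtain B where B: "\<And>D. D \<in> \<Lambda> \<Longrightarrow> countable (B D)" "\<And>D V. D \<in> \<Lambda> \<Longrightarrow> V \<in> B D \<Longrightarrow> openin (mtop (Sg D)) V"
    "\<And>D W x. D \<in> \<Lambda> \<Longrightarrow> openin (mtop (Sg D)) W \<Longrightarrow> x \<in> W \<Longrightarrow> \<exists>V\<in>B D. x \<in> V \<and> V \<subseteq> W"
    by metis
  have "countable \<Lambda>" using adm by (simp add: admissible_family_def)
  then have 1: "countable (\<Union>D\<in>\<Lambda>. image (\<sigma> D) ` B D)" using B(1) by auto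
  have 2: "openin (mtop S) V" if "V \<in> (\<Union>D\<in>\<Lambda>. image (\<sigma> D) ` B D)" for V
    using that B(2) \<sigma>_open by blast
  have 3: "\<exists>V\<in>(\<Union>D\<in>\<Lambda>. image (\<sigma> D) ` B D). s \<in> V \<and> V \<subseteq> W" if W: "openin (mtop S) W" "s \<in> W" for W s
  proof -
    have "s \<in> carrier S" using openin_carrier[OF S_pre W(1)] W(2) by blast
    then obtain D x where D: "D \<in> \<Lambda>" "x \<in> carrier (Sg D)" "s = \<sigma> D x" by (rule SE_point)
    obtain V where "V \<in> B D" "x \<in> V" "V \<subseteq> {x\<in>carrier (Sg D). \<sigma> D x \<in> W}"
      using B(3)[OF D(1) \<sigma>_continuous[OF D(1) W(1)], of x] D W(2) by blast
    then show ?thesis using D by blast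
  qed
  show ?thesis
    unfolding second_countable_def
  proof (rule exI[of _ "\<Union>D\<in>\<Lambda>. image (\<sigma> D) ` B D"], intro conjI ballI allI impI)
    show "\<exists>V\<in>(\<Union>D\<in>\<Lambda>. image (\<sigma> D) ` B D). s \<in> V \<and> V \<subseteq> W" if "openin (mtop S) W \<and> s \<in> W" for W s
      using 3 that by blast
  qed (fact 1, rule 2)
qed

lemma S_manifold: "Cr_manifold r S"
  by (simp add: Cr_manifold_iff S_pre S_Hausdorff S_second_countable)

lemma Cr_at_\<sigma>:
  assumes D: "D \<in> \<Lambda>" "x \<in> carrier (Sg D)" and u: "Cr_at r (Sg D) (\<lambda>x. u (\<sigma> D x)) x"
  shows "Cr_at r S u (\<sigma> D x)"
proof -
  obtain c W where c: "c \<in> Sg D" "x \<in> fst c" and W: "open W" "snd c x \<in> W" "W \<subseteq> snd c ` fst c"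
    "Cr_on r W (\<lambda>y. u (\<sigma> D (cinv c y)))" using u unfolding Cr_at_def by blast
  have "Cr_on r W (\<lambda>y. u (cinv (chart D c) y))"
    by (rule Cr_on_cong[OF W(1,4)]) (use W(3) cinv_chart_eq[OF D(1) c(1)] in auto)
  moreover have "snd (chart D c) ` fst (chart D c) = snd c ` fst c"
    using chart_image[OF D(1) fst_carrier[OF c(1)]] by (simp add: fst_chart)
  ultimately show ?thesis
    using W c snd_chart[OF D] by (intro Cr_atI[OF SI[OF D(1) c(1)] _ W(1)]) (auto simp: fst_chart)
qed

lemma vd_\<sigma>:
  assumes D: "D \<in> \<Lambda>" "c \<in> Sg D" "x \<in> fst c" and u: "Cr_at r (Sg D) (\<lambda>x. u (\<sigma> D x)) x"
  shows "vd (chart D c) u (\<sigma> D x) = vd c (\<lambda>x. u (\<sigma> D x)) x"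
proof (rule vd_eqI)
  have o: "open (snd c ` fst c)" using oa[OF D(1)] D(2) by (simp add: open_atlas_def)
  have "((\<lambda>y. u (cinv (chart D c) y)) has_derivative vd c (\<lambda>x. u (\<sigma> D x)) x) (at (snd c x))"
    by (rule has_derivative_transform_within_open[OF vd_has_derivative[OF pm[OF D(1)] u D(2,3)] o])
       (use D(3) cinv_chart_eq[OF D(1,2)] in auto)
  then show "((\<lambda>y. u (cinv (chart D c) y)) has_derivative vd c (\<lambda>x. u (\<sigma> D x)) x) (at (snd (chart D c) (\<sigma> D x)))"
    unfolding snd_chart[OF D(1) carrierI[OF D(2,3)]] .
qed

lemma Cr_at_lS: "s \<in> carrier S \<Longrightarrow> Cr_at r S lS s"
proof -
  assume "s \<in> carrier S"
  then obtain D x where D: "D \<in> \<Lambda>" "x \<in> carrier (Sg D)" "s = \<sigma> D x" by (rule SE_point)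
  have "Cr_at r (Sg D) (\<lambda>x. lS (\<sigma> D x)) x"
    by (rule Cr_at_cong[OF pm[OF D(1)] lC[OF D(1,2)] openin_carrier_self[OF pm[OF D(1)]] D(2)])
       (simp add: lS[OF D(1)])
  then show ?thesis unfolding D(3) by (rule Cr_at_\<sigma>[OF D(1,2)])
qed

lemma SE_chart:
  assumes "e \<in> S" "s \<in> fst e"
  obtains D c x where "D \<in> \<Lambda>" "c \<in> Sg D" "x \<in> fst c" "e = chart D c" "s = \<sigma> D x"
  using assms by (auto elim!: SE simp: fst_chart)

lemma vd_lS:
  fixes u :: "'v \<Rightarrow> 'w::banach"
  assumes D: "D \<in> \<Lambda>" "c \<in> Sg D" "x \<in> fst c" and u: "bounded_linear u"
  shows "vd (chart D c) (\<lambda>s. u (lS s)) (\<sigma> D x) = vd c (\<lambda>x. u (l D x)) x"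
proof -
  note x = carrierI[OF D(2,3)]
  note C = Cr_at_bounded_linear[OF lC[OF D(1) x] u]
  have "Cr_at r (Sg D) (\<lambda>x. u (lS (\<sigma> D x))) x"
    by (rule Cr_at_cong[OF pm[OF D(1)] C openin_carrier_self[OF pm[OF D(1)]] x]) (simp add: lS[OF D(1)])
  then have "vd (chart D c) (\<lambda>s. u (lS s)) (\<sigma> D x) = vd c (\<lambda>x. u (lS (\<sigma> D x))) x"
    by (rule vd_\<sigma>[OF D])
  also have "\<dots> = vd c (\<lambda>x. u (l D x)) x"
    by (rule vd_cong[OF pm[OF D(1)] C D(2,3) openin_carrier_self[OF pm[OF D(1)]] x]) (simp add: lS[OF D(1)])
  finally show ?thesis .
qed

end

section \<open>Null wave fronts\<close>

locale null_front =
  fixes r :: regularity and M :: "('a, real^'n::finite) atlas" and F :: "'a \<Rightarrow> 'n mink" and \<alpha> :: "'a \<Rightarrow> 'n dual"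
  assumes M: "pre_manifold r M" and front: "null_wave_front r M F \<alpha>"
begin

text \<open>The spatial part of the normalised normal: raising the index gives (- dcoord0, dcoord),
  and dividing by the time component produces the minus sign. In these terms \<open>f q\<close> is
  the point at which the line through \<open>F q\<close> in the direction
  \<open>(1, \<nu> q)\<close> meets time 0.\<close>

definition \<nu> :: "'a \<Rightarrow> real^'n" where "\<nu> q = (\<chi> j. - (dcoord (\<alpha> q) j / dcoord0 (\<alpha> q)))"
definition f :: "'a \<Rightarrow> real^'n" where "f q = snd (F q) - fst (F q) *\<^sub>R \<nu> q"

lemma \<alpha>0: "p \<in> carrier M \<Longrightarrow> dcoord0 (\<alpha> p) \<noteq> 0"
  using front lightlike_fst[of "sharp (\<alpha> p)"] by (simp add: null_wave_front_def sharp_eq)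

lemma xihat: "p \<in> carrier M \<Longrightarrow> xihat_E \<alpha> p = (1, \<nu> p)"
proof -
  assume p: "p \<in> carrier M"
  have "lightlike (sharp (\<alpha> p))" using front p by (simp add: null_wave_front_def)
  from E_normalize_lightlike[OF this] show ?thesis
    by (simp add: xihat_E_def sharp_eq \<nu>_def vec_eq_iff)
qed

lemma unit: "p \<in> carrier M \<Longrightarrow> norm (\<nu> p) = 1"
proof -
  assume p: "p \<in> carrier M"
  have "lorentz (sharp (\<alpha> p)) (sharp (\<alpha> p)) = 0" using front p by (simp add: null_wave_front_def lightlike_def)
  then have eq: "(\<Sum>j\<in>UNIV. dcoord (\<alpha> p) j * dcoord (\<alpha> p) j) = dcoord0 (\<alpha> p) * dcoord0 (\<alpha> p)"
    by (simp add: lorentz_def sharp_eq inner_vec_def)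
  have "\<nu> p \<bullet> \<nu> p = (\<Sum>j\<in>UNIV. dcoord (\<alpha> p) j * dcoord (\<alpha> p) j) / (dcoord0 (\<alpha> p) * dcoord0 (\<alpha> p))"
    by (simp add: \<nu>_def inner_vec_def sum_divide_distrib)
  also have "\<dots> = 1" unfolding eq using \<alpha>0[OF p] by simp
  finally show ?thesis by (simp add: norm_eq_1)
qed

lemma CF: "p \<in> carrier M \<Longrightarrow> Cr_at r M F p"
  using front Cr_map_euclid_iff[OF M] by (auto simp: null_wave_front_def wave_front_def)

lemma C\<alpha>: "p \<in> carrier M \<Longrightarrow> Cr_at r M \<alpha> p"
proof -
  assume p: "p \<in> carrier M"
  have o0: "openin (mtop (euclid :: ('n dual, 'n dual) atlas)) (- {0})" by (simp add: mtop_euclid open_Compl)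
  have d: "(- {0}, \<lambda>x. x) \<in> restr (euclid :: ('n dual, 'n dual) atlas) (- {0})" by (simp add: restr_def euclid_def)
  have o: "openin (mtop (restr (euclid :: ('n dual, 'n dual) atlas) (- {0}))) (fst (- {0}, \<lambda>x. x))"
    unfolding openin_restr(3)[OF open_atlas_euclid o0] using o0 by simp
  have cm: "Cr_map r M (restr euclid (- {0})) \<alpha>" using front by (simp add: null_wave_front_def wave_front_def)
  have "\<alpha> p \<noteq> 0" using \<alpha>0[OF p] by auto
  then show ?thesis using Cr_mapD(1)[OF M o cm p d] by simp
qed

lemma C\<nu>: "p \<in> carrier M \<Longrightarrow> Cr_at r M \<nu> p"
proof -
  assume p: "p \<in> carrier M"
  have ev: "Cr_at r M (\<lambda>q. blinfun_apply (\<alpha> q) x) p" for x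
    by (rule Cr_at_bounded_linear[OF C\<alpha>[OF p]]) (rule blinfun.bounded_linear_left)
  have "Cr_at r M (\<lambda>q. - (dcoord (\<alpha> q) j / dcoord0 (\<alpha> q))) p" for j
    by (rule Cr_at_bounded_linear[OF Cr_at_divide[OF M ev ev \<alpha>0[OF p]] bounded_linear_minus[OF bounded_linear_ident]])
  then show ?thesis by (intro Cr_at_vec[OF M p]) (simp add: \<nu>_def)
qed

lemma Cf: "p \<in> carrier M \<Longrightarrow> Cr_at r M f p"
proof -
  assume p: "p \<in> carrier M"
  have 1: "Cr_at r M (\<lambda>q. fst (F q)) p" "Cr_at r M (\<lambda>q. snd (F q)) p"
    by (rule Cr_at_bounded_linear[OF CF[OF p]], rule bounded_linear_fst bounded_linear_snd)+
  have "Cr_at r M (\<lambda>q. snd (F q) + - (fst (F q) *\<^sub>R \<nu> q)) p"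
    by (intro Cr_at_add[OF M 1(2)] Cr_at_bounded_linear[OF Cr_at_scaleR[OF M 1(1) C\<nu>[OF p]] bounded_linear_minus[OF bounded_linear_ident]])
  then show ?thesis by (simp add: f_def[abs_def])
qed

lemma F_eq: "F q = (0, f q) + fst (F q) *\<^sub>R (1, \<nu> q)"
  by (simp add: f_def prod_eq_iff)

text \<open>The conormal is proportional to -dt + \<nu> \<bullet> dx and annihilates the
  differential of the front, which reads dt = \<nu> \<bullet> dx.\<close>

lemma F_orth:
  assumes c: "c \<in> M" "p \<in> fst c" shows "fst (vd c F p v) = \<nu> p \<bullet> snd (vd c F p v)"
proof -
  note p = carrierI[OF c]
  let ?w = "vd c F p v"
  have "blinfun_apply (\<alpha> p) ?w = 0"
    using front c p by (auto simp: null_wave_front_def wave_front_def mderiv_vd)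
  then have z: "fst ?w * dcoord0 (\<alpha> p) + (\<Sum>j\<in>UNIV. snd ?w $ j * dcoord (\<alpha> p) j) = 0"
    unfolding dual_expand[of "\<alpha> p" ?w] .
  have "\<nu> p \<bullet> snd ?w = - (\<Sum>j\<in>UNIV. snd ?w $ j * dcoord (\<alpha> p) j) / dcoord0 (\<alpha> p)"
    by (simp add: \<nu>_def inner_vec_def sum_divide_distrib sum_negf[symmetric] mult.commute)
  also have "\<dots> = fst ?w" using z \<alpha>0[OF p] by (simp add: field_simps)
  finally show ?thesis by simp
qed

text \<open>A light-like functional has a non-zero time coefficient, so a single projective chart
  covers all conormals. Its coordinates are those of -\<nu>, and the sign is removed by a linear
  map.\<close>

lemma imm:
  assumes c: "c \<in> M" "p \<in> fst c" shows "inj (vd c (\<lambda>q. (F q, \<nu> q)) p)"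
proof -
  note p = carrierI[OF c]
  let ?N = "prod_atlas euclid (proj_atlas :: ('n dual set, real^'n) atlas)"
  let ?d = "pchart (UNIV, \<lambda>x. x) (proj_class ` {a. dcoord0 a \<noteq> 0}, proj_coord0)"
  have d: "?d \<in> ?N" by (rule pchart_in) (auto simp: euclid_def proj_atlas_eq)
  have im: "Cr_immersion r M ?N (\<lambda>p. (F p, proj_class (\<alpha> p)))"
    using front by (simp add: null_wave_front_def wave_front_def)
  have mem: "proj_class (\<alpha> p) \<in> proj_class ` {a. dcoord0 a \<noteq> 0}" using \<alpha>0[OF p] by blast
  then have "inj (vd c (\<lambda>q. snd ?d (F q, proj_class (\<alpha> q))) p)"
    using conjunct2[OF im[unfolded Cr_immersion_def mderiv_vd], rule_format, OF p c(1) d] c(2) by simp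
  moreover have "(\<lambda>q. snd ?d (F q, proj_class (\<alpha> q))) = (\<lambda>q. (F q, - \<nu> q))"
    by (auto simp: proj_coord0_class \<nu>_def vec_eq_iff fun_eq_iff)
  ultimately have i: "inj (vd c (\<lambda>q. (F q, - \<nu> q)) p)" by simp
  have C': "Cr_at r M (\<lambda>q. - \<nu> q) p" by (rule Cr_at_bounded_linear[OF C\<nu>[OF p] bounded_linear_minus[OF bounded_linear_ident]])
  have "((\<lambda>z. (fst z, - snd z)) has_derivative (\<lambda>z. (fst z, - snd z))) (at (F p, \<nu> p))"
    by (auto intro!: derivative_eq_intros)
  then show ?thesis
    by (rule inj_vd_factor[OF M Cr_at_Pair[OF M CF[OF p] C\<nu>[OF p]] c _ Cr_at_Pair[OF M CF[OF p] C'] i openin_carrier_self[OF M] p]) simp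
qed

end

section \<open>The quotient of an admissible front\<close>

locale front_data = null_front r M F \<alpha> for r and M :: "('a, real^'n::finite) atlas" and F \<alpha> +
  fixes \<Lambda> :: "('a, 'n, 'k::finite) fdata set"
  assumes dim: "CARD('k) = CARD('n) - 1"
    and fd: "\<And>D. D \<in> \<Lambda> \<Longrightarrow> \<exists>p\<in>carrier M. fundamental_data r M F \<alpha> p D"
    and cover: "(\<Union>D\<in>\<Lambda>. U_of D) = carrier M"
    and adm: "admissible_family r \<Lambda> Sigma_of l_of"
begin

lemma fdD:
  assumes D: "D \<in> \<Lambda>"
  shows "openin (mtop M) (U_of D)" "pre_manifold r (Sigma_of D)"
    "rho_of D ` U_of D = carrier (Sigma_of D)"
    "\<And>x. x \<in> carrier (Sigma_of D) \<Longrightarrow> fst (g_of D x) = 0"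
    "\<And>x. x \<in> carrier (Sigma_of D) \<Longrightarrow> fst (xi_of D x) = 1"
    "unit_normal_field r (Sigma_of D) (snd \<circ> g_of D) (snd \<circ> xi_of D)"
    "open (I_of D)"
    "Cr_diffeo r (restr M (U_of D)) (prod_atlas (restr euclid (I_of D)) (Sigma_of D)) (Phi_of D)"
    "Cr_embedding r (Sigma_of D) euclid (l_of D)"
  using fd[OF D] Cr_manifold_pre unfolding fundamental_data_def by auto

text \<open>The canonical lift moved to time 0 along its line. By \<open>l_rho\<close> it equals
  \<open>l_of D\<close> after \<open>rho_of D\<close> for every datum \<open>D\<close>, and so it
  compares different slices.\<close>

definition ell :: "'a \<Rightarrow> 'n mink \<times> 'n mink" where "ell q = ((0, f q), (1, \<nu> q))"

lemma U_carrier: "D \<in> \<Lambda> \<Longrightarrow> q \<in> U_of D \<Longrightarrow> q \<in> carrier M"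
  using cover by blast

lemma coverE: assumes "q \<in> carrier M" obtains D where "D \<in> \<Lambda>" "q \<in> U_of D"
  using assms cover by blast

lemma tau: "D \<in> \<Lambda> \<Longrightarrow> q \<in> U_of D \<Longrightarrow> tau_of D q = fst (F q)"
  using fd unfolding fundamental_data_def by blast

lemma l_rho: assumes D: "D \<in> \<Lambda>" "q \<in> U_of D" shows "l_of D (rho_of D q) = ell q"
proof -
  have 1: "F q = G_of D (Phi_of D q)" and 2: "canonical_lift F \<alpha> q = L_of D (Phi_of D q)"
    using fd[OF D(1)] D(2) unfolding fundamental_data_def by blast+
  have xi: "xi_of D (rho_of D q) = (1, \<nu> q)"
    using 2 xihat[OF U_carrier[OF D]] by (simp add: canonical_lift_def L_of_def Phi_of_def)
  have "F q = g_of D (rho_of D q) + fst (F q) *\<^sub>R (1, \<nu> q)"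
    using 1 xi tau[OF D] by (simp add: G_of_def Phi_of_def)
  then have "g_of D (rho_of D q) = (0, f q)"
    using F_eq[of q] by (metis add_right_cancel)
  then show ?thesis using xi by (simp add: l_of_def ell_def)
qed

lemma rho_carrier: "D \<in> \<Lambda> \<Longrightarrow> q \<in> U_of D \<Longrightarrow> rho_of D q \<in> carrier (Sigma_of D)"
  using fdD(3) by blast

lemma rhoE: assumes "D \<in> \<Lambda>" "x \<in> carrier (Sigma_of D)" obtains q where "q \<in> U_of D" "x = rho_of D q"
  using assms fdD(3)[of D] by blast

lemma C_ell: "p \<in> carrier M \<Longrightarrow> Cr_at r M ell p"
proof -
  assume p: "p \<in> carrier M"
  have "Cr_at r M (\<lambda>q. ((0::real, f q), (1::real, \<nu> q))) p"
    by (intro Cr_at_Pair[OF M] Cr_at_const[OF M p] Cf[OF p] C\<nu>[OF p])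
  then show ?thesis by (simp add: ell_def[abs_def])
qed

lemma pre_I: "D \<in> \<Lambda> \<Longrightarrow> pre_manifold r (restr (euclid :: (real, real) atlas) (I_of D))"
  by (rule pre_manifold_restr[OF pre_manifold_euclid]) (simp add: mtop_euclid fdD(7))

lemma carrier_I: "D \<in> \<Lambda> \<Longrightarrow> carrier (restr (euclid :: (real, real) atlas) (I_of D)) = I_of D"
  by (rule openin_restr(2)[OF open_atlas_euclid]) (simp add: mtop_euclid fdD(7))

text \<open>\<open>Phi_of D\<close> is a homeomorphism onto a product, \<open>rho_of D\<close> is
  its second component, and projections of products are open maps.\<close>

lemma rho_open:
  assumes D: "D \<in> \<Lambda>" and W: "openin (mtop M) W" "W \<subseteq> U_of D"
  shows "openin (mtop (Sigma_of D)) (rho_of D ` W)"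
proof -
  let ?P = "prod_atlas (restr (euclid :: (real, real) atlas) (I_of D)) (Sigma_of D)"
  let ?\<Psi> = "inv_into (carrier (restr M (U_of D))) (Phi_of D)"
  note oM = pre_manifold_open_atlas[OF M]
  have cU: "carrier (restr M (U_of D)) = U_of D" by (rule openin_restr(2)[OF oM fdD(1)[OF D]])
  have bij: "bij_betw (Phi_of D) (U_of D) (carrier ?P)" and cont: "continuous_map (mtop ?P) (mtop (restr M (U_of D))) ?\<Psi>"
    using fdD(8)[OF D] cU unfolding Cr_diffeo_def Cr_map_def by auto
  have mP: "mtop ?P = prod_topology (mtop (restr euclid (I_of D))) (mtop (Sigma_of D))"
    by (rule mtop_prod[OF pre_I[OF D] fdD(2)[OF D]])
  have tP: "topspace (mtop ?P) = carrier ?P"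
    by (rule topspace_mtop[OF pre_manifold_open_atlas[OF pre_manifold_prod[OF pre_I[OF D] fdD(2)[OF D]]]])
  have "openin (mtop (restr M (U_of D))) W"
    using openin_restr(3)[OF oM fdD(1)[OF D]] W by blast
  then have T: "openin (mtop ?P) {z \<in> carrier ?P. ?\<Psi> z \<in> W}"
    using openin_continuous_map_preimage[OF cont, of W] unfolding tP by simp
  have eq: "{z \<in> carrier ?P. ?\<Psi> z \<in> W} = Phi_of D ` W"
  proof
    show "{z \<in> carrier ?P. ?\<Psi> z \<in> W} \<subseteq> Phi_of D ` W"
    proof
      fix z assume z: "z \<in> {z \<in> carrier ?P. ?\<Psi> z \<in> W}"
      then have "z \<in> Phi_of D ` carrier (restr M (U_of D))" using bij unfolding cU bij_betw_def by simp
      then have "Phi_of D (?\<Psi> z) = z" by (rule f_inv_into_f)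
      then show "z \<in> Phi_of D ` W" using z by (metis (lifting) imageI mem_Collect_eq)
    qed
    show "Phi_of D ` W \<subseteq> {z \<in> carrier ?P. ?\<Psi> z \<in> W}"
    proof
      fix z assume "z \<in> Phi_of D ` W"
      then obtain q where q: "q \<in> W" "z = Phi_of D q" by blast
      have qU: "q \<in> U_of D" using q(1) W(2) by blast
      have "?\<Psi> z = q" unfolding q(2) cU by (rule inv_into_f_f) (use bij qU in \<open>auto simp: bij_betw_def\<close>)
      moreover have "z \<in> carrier ?P" unfolding q(2) using bij_betwE[OF bij] qU by blast
      ultimately show "z \<in> {z \<in> carrier ?P. ?\<Psi> z \<in> W}" using q(1) by simp
    qed
  qed
  have "snd ` Phi_of D ` W = rho_of D ` W" by (force simp: Phi_of_def image_image)
  moreover have "openin (mtop (Sigma_of D)) (snd ` Phi_of D ` W)"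
    using T open_map_snd unfolding mP eq open_map_def by blast
  ultimately show ?thesis by simp
qed

text \<open>The overlap of the two patches projects to open subsets of both slices, and the
  embeddings map both of them onto the image of the overlap under \<open>ell\<close>.\<close>

lemma rel_same:
  assumes D: "D \<in> \<Lambda>" "D' \<in> \<Lambda>" and q: "q \<in> U_of D" "q \<in> U_of D'"
  shows "related (Sigma_of D) (Sigma_of D') (l_of D) (l_of D') (rho_of D q) (rho_of D' q)"
proof -
  let ?W = "U_of D \<inter> U_of D'"
  have W: "openin (mtop M) ?W" using fdD(1)[OF D(1)] fdD(1)[OF D(2)] by (rule openin_Int)
  have "l_of D ` rho_of D ` ?W = ell ` ?W" "l_of D' ` rho_of D' ` ?W = ell ` ?W"
    using l_rho D by (auto simp: image_image intro!: image_cong)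
  then show ?thesis
    unfolding related_def
    using rho_open[OF D(1) W] rho_open[OF D(2) W] l_rho[OF D(1) q(1)] l_rho[OF D(2) q(2)] q
    by (intro conjI exI[of _ "rho_of D ` ?W"] exI[of _ "rho_of D' ` ?W"]) auto
qed

text \<open>A point of the quotient is the set of all points of \<open>M\<close> whose slices are related to a given
  point of a slice.\<close>

definition \<sigma> :: "('a, 'n, 'k) fdata \<Rightarrow> 'a \<Rightarrow> 'a set" where
  "\<sigma> D x = {q \<in> carrier M. \<exists>D'\<in>\<Lambda>. q \<in> U_of D' \<and>
     related (Sigma_of D') (Sigma_of D) (l_of D') (l_of D) (rho_of D' q) x}"

text \<open>The representative is arbitrary, because related points have the same value under the
  embeddings.\<close>

definition lS :: "'a set \<Rightarrow> 'n mink \<times> 'n mink" where "lS s = ell (SOME q. q \<in> s)"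

lemma lC: "D \<in> \<Lambda> \<Longrightarrow> p \<in> carrier (Sigma_of D) \<Longrightarrow> Cr_at r (Sigma_of D) (l_of D) p"
  by (rule Cr_embedding_euclidD(1)[OF fdD(2,9)])

lemma rel_trans:
  assumes "D \<in> \<Lambda>" "D' \<in> \<Lambda>" "D'' \<in> \<Lambda>"
    "related (Sigma_of D) (Sigma_of D') (l_of D) (l_of D') x y"
    "related (Sigma_of D') (Sigma_of D'') (l_of D') (l_of D'') y z"
  shows "related (Sigma_of D) (Sigma_of D'') (l_of D) (l_of D'') x z"
  by (rule related_trans[OF fdD(2)[OF assms(1)] fdD(2)[OF assms(2)] fdD(2)[OF assms(3)]
     lC[OF assms(1)] fdD(9)[OF assms(2)] lC[OF assms(3)] assms(4,5)])

lemma mem_\<sigma>: "D \<in> \<Lambda> \<Longrightarrow> q \<in> U_of D \<Longrightarrow> q \<in> \<sigma> D (rho_of D q)"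
  unfolding \<sigma>_def using rel_same[of D D q] U_carrier by blast

text \<open>A class contains every point of M lying over \<open>x\<close>, and there is one since
  \<open>rho_of D\<close> is onto its slice; two equal classes are compared at such a point.
  Conversely, relatedness is symmetric and transitive.\<close>

lemma \<sigma>_iff:
  assumes D: "D \<in> \<Lambda>" "D' \<in> \<Lambda>" and x: "x \<in> carrier (Sigma_of D)" "x' \<in> carrier (Sigma_of D')"
  shows "\<sigma> D x = \<sigma> D' x' \<longleftrightarrow> related (Sigma_of D) (Sigma_of D') (l_of D) (l_of D') x x'"
proof
  assume eq: "\<sigma> D x = \<sigma> D' x'"
  obtain q where q: "q \<in> U_of D" "x = rho_of D q" using D(1) x(1) by (rule rhoE)
  have "q \<in> \<sigma> D' x'" using mem_\<sigma>[OF D(1) q(1)] eq q(2) by simp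
  then obtain D'' where D'': "D'' \<in> \<Lambda>" "q \<in> U_of D''"
    "related (Sigma_of D'') (Sigma_of D') (l_of D'') (l_of D') (rho_of D'' q) x'"
    unfolding \<sigma>_def by blast
  show "related (Sigma_of D) (Sigma_of D') (l_of D) (l_of D') x x'"
    unfolding q(2) by (rule rel_trans[OF D(1) D''(1) D(2) rel_same[OF D(1) D''(1) q(1) D''(2)] D''(3)])
next
  assume rel: "related (Sigma_of D) (Sigma_of D') (l_of D) (l_of D') x x'"
  have "\<sigma> D x \<subseteq> \<sigma> D' x'"
    unfolding \<sigma>_def using rel_trans[OF _ D _ rel] by fast
  moreover have "\<sigma> D' x' \<subseteq> \<sigma> D x"
    unfolding \<sigma>_def using rel_trans[OF _ D(2,1) _ related_sym[OF rel]] by fast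
  ultimately show "\<sigma> D x = \<sigma> D' x'" by blast
qed

lemma lS_\<sigma>:
  assumes D: "D \<in> \<Lambda>" and x: "x \<in> carrier (Sigma_of D)" shows "lS (\<sigma> D x) = l_of D x"
proof -
  obtain q0 where "q0 \<in> U_of D" "x = rho_of D q0" using D x by (rule rhoE)
  then have "q0 \<in> \<sigma> D x" using mem_\<sigma>[OF D] by simp
  then have "(SOME q. q \<in> \<sigma> D x) \<in> \<sigma> D x" by (rule someI)
  then obtain D' where D': "D' \<in> \<Lambda>" "(SOME q. q \<in> \<sigma> D x) \<in> U_of D'"
    "related (Sigma_of D') (Sigma_of D) (l_of D') (l_of D) (rho_of D' (SOME q. q \<in> \<sigma> D x)) x"
    by (auto simp: \<sigma>_def)
  then show ?thesis unfolding lS_def using l_rho[OF D'(1,2)] related_eq[OF D'(3)] by simp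
qed

sublocale glue: gluing r \<Lambda> Sigma_of l_of \<sigma> lS
  by unfold_locales (use adm \<sigma>_iff lS_\<sigma> in auto)

definition pr :: "'a \<Rightarrow> 'a set" where
  "pr q = (let D = SOME D. D \<in> \<Lambda> \<and> q \<in> U_of D in \<sigma> D (rho_of D q))"

lemma pr_eq: assumes D: "D \<in> \<Lambda>" "q \<in> U_of D" shows "pr q = \<sigma> D (rho_of D q)"
proof -
  define E where "E = (SOME D. D \<in> \<Lambda> \<and> q \<in> U_of D)"
  have E: "E \<in> \<Lambda>" "q \<in> U_of E"
    using someI[of "\<lambda>D. D \<in> \<Lambda> \<and> q \<in> U_of D" D] D unfolding E_def by blast+
  have "\<sigma> E (rho_of E q) = \<sigma> D (rho_of D q)"
    using \<sigma>_iff[OF E(1) D(1) rho_carrier[OF E] rho_carrier[OF D]] rel_same[OF E(1) D(1) E(2) D(2)] by blast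
  then show ?thesis by (simp add: pr_def E_def Let_def)
qed

lemma lS_pr: assumes q: "q \<in> carrier M" shows "lS (pr q) = ell q"
proof -
  obtain D where D: "D \<in> \<Lambda>" "q \<in> U_of D" using q by (rule coverE)
  show ?thesis unfolding pr_eq[OF D] lS_\<sigma>[OF D(1) rho_carrier[OF D]] by (rule l_rho[OF D])
qed

lemma pr_carrier: assumes q: "q \<in> carrier M" shows "pr q \<in> carrier glue.S"
proof -
  obtain D where D: "D \<in> \<Lambda>" "q \<in> U_of D" using q by (rule coverE)
  show ?thesis unfolding pr_eq[OF D] glue.carrier_S using D rho_carrier[OF D] by blast
qed

lemma prE: assumes "s \<in> carrier glue.S" obtains D q where "D \<in> \<Lambda>" "q \<in> U_of D" "s = pr q"
proof -
  obtain D x where D: "D \<in> \<Lambda>" "x \<in> carrier (Sigma_of D)" "s = \<sigma> D x" using assms by (rule glue.SE_point)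
  obtain q where "q \<in> U_of D" "x = rho_of D q" using D(1,2) by (rule rhoE)
  then show thesis using that D pr_eq by simp
qed

definition f' :: "'a set \<Rightarrow> real^'n" where "f' s = snd (fst (lS s))"
definition \<nu>' :: "'a set \<Rightarrow> real^'n" where "\<nu>' s = snd (snd (lS s))"

lemma f'_pr: "q \<in> carrier M \<Longrightarrow> f' (pr q) = f q" and \<nu>'_pr: "q \<in> carrier M \<Longrightarrow> \<nu>' (pr q) = \<nu> q"
  using lS_pr by (simp_all add: f'_def \<nu>'_def ell_def)

lemma bl: "bounded_linear (\<lambda>z :: 'n mink \<times> 'n mink. snd (fst z))" "bounded_linear (\<lambda>z :: 'n mink \<times> 'n mink. snd (snd z))"
  by (intro bounded_linear_compose[OF bounded_linear_snd] bounded_linear_fst bounded_linear_snd)+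

text \<open>The conditions are local, and in a chart coming from the slice of \<open>D\<close> the
  maps f' and \<nu>' are the spatial parts of \<open>l_of D\<close>.\<close>

lemma front_S: "euclidean_front r glue.S f' \<nu>'"
proof
  show "pre_manifold r glue.S" by (rule glue.S_pre)
  show "CARD('k) = CARD('n) - 1" by (rule dim)
  show C1: "Cr_at r glue.S f' p" if "p \<in> carrier glue.S" for p
    using Cr_at_bounded_linear[OF glue.Cr_at_lS[OF that] bl(1)] by (simp add: f'_def[abs_def])
  show C2: "Cr_at r glue.S \<nu>' p" if "p \<in> carrier glue.S" for p
    using Cr_at_bounded_linear[OF glue.Cr_at_lS[OF that] bl(2)] by (simp add: \<nu>'_def[abs_def])
  show "norm (\<nu>' p) = 1" if "p \<in> carrier glue.S" for p
    using that unit \<nu>'_pr U_carrier by (metis prE)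
  fix e s assume e: "e \<in> glue.S" "s \<in> fst e"
  obtain D c x where D: "D \<in> \<Lambda>" "c \<in> Sigma_of D" "x \<in> fst c" "e = glue.chart D c" "s = \<sigma> D x"
    using e by (rule glue.SE_chart)
  note x = carrierI[OF D(2,3)]
  note pm = fdD(2)[OF D(1)]
  have v: "vd e (\<lambda>s. u (lS s)) s = vd c (\<lambda>x. u (l_of D x)) x" if "bounded_linear u" for u :: "'n mink \<times> 'n mink \<Rightarrow> 'w::banach"
    unfolding D(4,5) by (rule glue.vd_lS[OF D(1-3) that])
  show "\<nu>' s \<bullet> vd e f' s w = 0" for w
  proof -
    have "\<nu>' s = (snd \<circ> xi_of D) x" unfolding \<nu>'_def D(5) lS_\<sigma>[OF D(1) x] by (simp add: l_of_def)
    moreover have "vd e f' s = vd c (snd \<circ> g_of D) x"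
      using v[OF bl(1)] by (simp add: f'_def[abs_def] l_of_def o_def)
    ultimately show ?thesis
      using fdD(6)[OF D(1)] x D(2,3) by (auto simp: unit_normal_field_def mderiv_vd o_def)
  qed
  show "inj (vd e (\<lambda>q. (f' q, \<nu>' q)) s)"
  proof -
    let ?T = "\<lambda>z :: 'n mink \<times> 'n mink. (snd (fst z), snd (snd z))"
    \<comment> \<open>Restores the constant time components 0 and 1 of \<open>l_of D\<close>, so
      that its immersion property passes to the spatial parts.\<close>
    let ?J = "\<lambda>z :: (real^'n) \<times> (real^'n). ((0::real, fst z), (1::real, snd z))"
    have T: "bounded_linear ?T" by (intro bounded_linear_Pair bl)
    have "vd e (\<lambda>q. (f' q, \<nu>' q)) s = vd c (\<lambda>x. ?T (l_of D x)) x"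
      using v[OF T] by (simp add: f'_def \<nu>'_def)
    moreover have "inj (vd c (\<lambda>x. ?T (l_of D x)) x)"
    proof (rule inj_vd_factor[OF pm Cr_at_bounded_linear[OF lC[OF D(1) x] T] D(2,3) _ lC[OF D(1) x]
          Cr_embedding_euclidD(2)[OF pm fdD(9)[OF D(1)] D(2,3)] openin_carrier_self[OF pm] x])
      show "(?J has_derivative (\<lambda>v. ((0, fst v), (0, snd v)))) (at (?T (l_of D x)))"
        by (auto intro!: derivative_eq_intros)
      show "l_of D y = ?J (?T (l_of D y))" if "y \<in> carrier (Sigma_of D)" for y
        using fdD(4,5)[OF D(1) that] by (simp add: l_of_def prod_eq_iff)
    qed
    ultimately show ?thesis by simp
  qed
qed

sublocale fS: euclidean_front r glue.S f' \<nu>' by (rule front_S)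

abbreviation P where "P \<equiv> fS.P"

definition \<I> :: "'a \<Rightarrow> real \<times> 'a set" where "\<I> q = (fst (F q), pr q)"

lemma \<I>_carrier: "q \<in> carrier M \<Longrightarrow> \<I> q \<in> carrier P"
  using pr_carrier by (simp add: fS.carP \<I>_def)

lemma F'_\<I>: assumes q: "q \<in> carrier M" shows "normal_F f' \<nu>' (\<I> q) = F q"
  using F_eq[of q] f'_pr[OF q] \<nu>'_pr[OF q] by (simp add: normal_F_def \<I>_def)

lemma lift_\<I>: assumes q: "q \<in> carrier M"
  shows "canonical_lift (normal_F f' \<nu>') (normal_\<alpha> \<nu>') (\<I> q) = canonical_lift F \<alpha> q"
  using F'_\<I>[OF q] fS.normal_xihat[OF \<I>_carrier[OF q]] xihat[OF q] \<nu>'_pr[OF q]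
  by (simp add: canonical_lift_def \<I>_def)

lemma \<I>_regular:
  assumes q: "q \<in> carrier M"
  obtains e V where "e \<in> P" "\<I> q \<in> fst e" "Cr_at r M (\<lambda>q. snd e (\<I> q)) q"
    "openin (mtop M) V" "q \<in> V" "\<I> ` V \<subseteq> fst e"
proof -
  obtain D where D: "D \<in> \<Lambda>" "q \<in> U_of D" using q by (rule coverE)
  note pm = fdD(2)[OF D(1)]
  obtain c where c: "c \<in> Sigma_of D" "rho_of D q \<in> fst c" using rho_carrier[OF D] by (rule carrierE)
  obtain V where V: "openin (mtop M) V" "q \<in> V" "V \<subseteq> U_of D" "rho_of D ` V \<subseteq> fst c"
    and C: "Cr_at r M (\<lambda>q. snd c (rho_of D q)) q"
    by (rule Cr_at_lift[OF pm fdD(9)[OF D(1)] M C_ell[OF q] fdD(1)[OF D(1)] D(2) rho_carrier[OF D(1)] l_rho[OF D(1)]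
        openin_chart[OF pm c(1)] c(2) c]) blast
  let ?e = "pchart (UNIV, \<lambda>x::real. x) (glue.chart D c)"
  have e: "?e \<in> P" by (rule pchart_in) (use glue.SI[OF D(1) c(1)] in \<open>auto simp: euclid_def\<close>)
  have Ie: "\<I> ` V \<subseteq> fst ?e"
    using V(3,4) pr_eq[OF D(1)] by (force simp: \<I>_def glue.fst_chart image_subset_iff)
  have CF1: "Cr_at r M (\<lambda>q. fst (F q)) q" by (rule Cr_at_bounded_linear[OF CF[OF q] bounded_linear_fst])
  have "Cr_at r M (\<lambda>q. snd ?e (\<I> q)) q"
  proof (rule Cr_at_cong[OF M Cr_at_Pair[OF M CF1 C] V(1,2)])
    show "(fst (F p), snd c (rho_of D p)) = snd ?e (\<I> p)" if "p \<in> V" for p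
      using that V(3) pr_eq[OF D(1), of p] glue.snd_chart[OF D(1) rho_carrier[OF D(1)], of p c] by (auto simp: \<I>_def)
  qed
  then show thesis using that[OF e _ _ V(1,2) Ie] Ie V(2) by blast
qed

lemma \<I>_map: "Cr_map r M P \<I>"
proof (rule Cr_mapI_pre[OF M fS.P])
  fix p assume "p \<in> carrier M"
  then show "\<exists>d\<in>P. \<I> p \<in> fst d \<and> Cr_at r M (\<lambda>q. snd d (\<I> q)) p \<and> (\<exists>U. openin (mtop M) U \<and> p \<in> U \<and> \<I> ` U \<subseteq> fst d)"
    by (rule \<I>_regular) blast
qed

text \<open>Following \<I> by the lift of the quotient front, with components
  \<open>normal_F f' \<nu>'\<close> and \<nu>', gives (F, \<nu>), which is an immersion.\<close>

lemma \<I>_immersion: "Cr_immersion r M P \<I>"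
proof (rule Cr_immersionI[OF M \<I>_map])
  fix p e assume p: "p \<in> carrier M" and e: "e \<in> P" "\<I> p \<in> fst e"
  note C = Cr_mapD_pre[OF M fS.P \<I>_map p e]
  obtain U where U: "openin (mtop M) U" "p \<in> U" "\<I> ` U \<subseteq> fst e"
    using Cr_mapD(2)[OF M openin_chart[OF fS.P e(1)] \<I>_map p e] by blast
  obtain c where c: "c \<in> M" "p \<in> fst c" using p by (rule carrierE)
  let ?L = "\<lambda>z. (normal_F f' \<nu>' z, \<nu>' (snd z))"
  have CL: "Cr_at r P ?L (\<I> p)"
    by (intro Cr_at_Pair[OF fS.P] fS.P_regular \<I>_carrier p)
  have "inj (vd c (\<lambda>q. snd e (\<I> q)) p)"
  proof (rule inj_vd_factor[OF M C c vd_has_derivative[OF fS.P CL e] Cr_at_Pair[OF M CF[OF p] C\<nu>[OF p]] imm[OF c] U(1,2)])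
    fix q assume q: "q \<in> U"
    then have "cinv e (snd e (\<I> q)) = \<I> q"
      using U(3) cinv_chart[OF pre_manifold_open_atlas[OF fS.P] e(1)] by blast
    then show "(F q, \<nu> q) = ?L (cinv e (snd e (\<I> q)))"
      using F'_\<I> \<nu>'_pr openin_carrier[OF M U(1)] q by (auto simp: \<I>_def)
  qed
  then show "Cr_at r M (\<lambda>q. snd e (\<I> q)) p \<and> (\<exists>c\<in>M. p \<in> fst c \<and> inj (vd c (\<lambda>q. snd e (\<I> q)) p))"
    using C c by blast
qed

text \<open>Each patch contributes a full box, since \<open>Phi_of D\<close> is onto its product;
  the openness of the image is read off from this description.\<close>

lemma \<I>_image: "\<I> ` carrier M = (\<Union>D\<in>\<Lambda>. I_of D \<times> \<sigma> D ` carrier (Sigma_of D))"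
proof -
  have "\<I> ` U_of D = I_of D \<times> \<sigma> D ` carrier (Sigma_of D)" if D: "D \<in> \<Lambda>" for D
  proof -
    have "carrier (restr M (U_of D)) = U_of D"
      by (rule openin_restr(2)[OF pre_manifold_open_atlas[OF M] fdD(1)[OF D]])
    then have im: "Phi_of D ` U_of D = I_of D \<times> carrier (Sigma_of D)"
      using fdD(8)[OF D] carrier_I[OF D] by (simp add: Cr_diffeo_def bij_betw_def carrier_prod)
    have "\<I> ` U_of D = map_prod (\<lambda>t. t) (\<sigma> D) ` Phi_of D ` U_of D"
      unfolding image_image using pr_eq[OF D] tau[OF D] by (intro image_cong) (auto simp: \<I>_def Phi_of_def)
    then show ?thesis unfolding im by (simp add: map_prod_surj_on[OF refl refl])
  qed
  then show ?thesis unfolding cover[symmetric] by (simp add: image_UN)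
qed

lemma \<I>_open: "openin (mtop P) (\<I> ` carrier M)"
  unfolding \<I>_image mtop_prod[OF pre_manifold_euclid glue.S_pre] mtop_euclid
proof (intro openin_Union, clarify)
  fix D assume D: "D \<in> \<Lambda>"
  show "openin (prod_topology euclidean (mtop glue.S)) (I_of D \<times> \<sigma> D ` carrier (Sigma_of D))"
    using glue.\<sigma>_open[OF D openin_carrier_self[OF fdD(2)[OF D]]] fdD(7)[OF D]
    by (simp add: openin_prod_Times_iff)
qed

text \<open>The inverse of \<I> is the lift of the canonical lift of the quotient front through the
  embedding \<open>canonical_lift F \<alpha>\<close>, hence regular by \<open>Cr_at_lift\<close>.
  Injectivity holds because \<I> determines the canonical lift.\<close>

lemma \<I>_diffeo:
  assumes e: "Cr_embedding r M euclid (canonical_lift F \<alpha>)"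
  shows "Cr_diffeo r M (restr P (\<I> ` carrier M)) \<I>"
proof -
  let ?W = "\<I> ` carrier M" and ?R = "restr P (\<I> ` carrier M)"
  let ?J = "inv_into (carrier M) \<I>"
  note oP = pre_manifold_open_atlas[OF fS.P]
  note R = pre_manifold_restr[OF fS.P \<I>_open]
  have cR: "carrier ?R = ?W" by (rule openin_restr(2)[OF oP \<I>_open])
  have inj: "inj_on \<I> (carrier M)"
  proof (rule inj_onI)
    fix x y assume xy: "x \<in> carrier M" "y \<in> carrier M" "\<I> x = \<I> y"
    then have "canonical_lift F \<alpha> x = canonical_lift F \<alpha> y" using lift_\<I> by metis
    then show "x = y" using inj_onD[OF Cr_embedding_euclidD(3)[OF M e]] xy by blast
  qed
  have J: "?J z \<in> carrier M" "\<I> (?J z) = z" if "z \<in> ?W" for z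
    using that by (auto intro: inv_into_into f_inv_into_f)
  show ?thesis
    unfolding Cr_diffeo_def
  proof (intro conjI)
    show "bij_betw \<I> (carrier M) (carrier ?R)" using inj cR by (simp add: bij_betw_def)
    show "Cr_map r M ?R \<I>"
    proof (rule Cr_mapI_pre[OF M R])
      fix p assume p: "p \<in> carrier M"
      obtain d V where d: "d \<in> P" "\<I> p \<in> fst d" "Cr_at r M (\<lambda>q. snd d (\<I> q)) p"
        and V: "openin (mtop M) V" "p \<in> V" "\<I> ` V \<subseteq> fst d" using p by (rule \<I>_regular)
      show "\<exists>d\<in>?R. \<I> p \<in> fst d \<and> Cr_at r M (\<lambda>q. snd d (\<I> q)) p \<and> (\<exists>U. openin (mtop M) U \<and> p \<in> U \<and> \<I> ` U \<subseteq> fst d)"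
      proof (intro bexI[of _ "(?W \<inter> fst d, snd d)"] conjI exI[of _ V])
        show "\<I> ` V \<subseteq> fst (?W \<inter> fst d, snd d)" using V openin_carrier[OF M V(1)] by auto
        show "(?W \<inter> fst d, snd d) \<in> ?R" using d(1) by (auto simp: restr_def)
      qed (use d V p in auto)
    qed
    show "Cr_map r ?R M ?J"
    proof (rule Cr_mapI_pre[OF R M])
      fix z assume "z \<in> carrier ?R"
      then have z: "z \<in> ?W" using cR by simp
      then have zP: "z \<in> carrier P" using \<I>_carrier by auto
      obtain c where c: "c \<in> M" "?J z \<in> fst c" using J(1)[OF z] by (rule carrierE)
      let ?k = "canonical_lift (normal_F f' \<nu>') (normal_\<alpha> \<nu>')"
      have "Cr_at r P (\<lambda>z. (normal_F f' \<nu>' z, (1::real, \<nu>' (snd z)))) z"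
        by (intro Cr_at_Pair[OF fS.P] fS.P_regular zP Cr_at_const[OF fS.P zP])
      then have "Cr_at r P ?k z"
        by (rule Cr_at_cong[OF fS.P _ openin_carrier_self[OF fS.P] zP])
           (simp add: canonical_lift_def fS.normal_xihat)
      then have Ck: "Cr_at r ?R ?k z" unfolding Cr_at_restr[OF fS.P \<I>_open z] .
      have W: "openin (mtop ?R) ?W" using openin_carrier_self[OF R] cR by simp
      have k: "canonical_lift F \<alpha> (?J q) = ?k q" if "q \<in> ?W" for q
        using lift_\<I>[OF J(1)[OF that]] J(2)[OF that] by simp
      obtain V where "openin (mtop ?R) V" "z \<in> V" "?J ` V \<subseteq> fst c" "Cr_at r ?R (\<lambda>q. snd c (?J q)) z"
        by (rule Cr_at_lift[OF M e R Ck W z J(1) k openin_chart[OF M c(1)] c(2) c]) blast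
      then show "\<exists>d\<in>M. ?J z \<in> fst d \<and> Cr_at r ?R (\<lambda>q. snd d (?J q)) z \<and> (\<exists>U. openin (mtop ?R) U \<and> z \<in> U \<and> ?J ` U \<subseteq> fst d)"
        using c by blast
    qed
  qed
qed

text \<open>A curve that traces a light-like line moves in the fixed direction of that line, so
  \<nu> and with it \<open>ell\<close> are constant along the curve. As every \<open>l_of E\<close>
  is injective, the class \<open>pr\<close> is locally constant, hence constant.\<close>

lemma \<I>_surj:
  assumes L: "L_complete r M F \<alpha>"
  shows "\<I> ` carrier M = carrier P"
proof
  show "\<I> ` carrier M \<subseteq> carrier P" using \<I>_carrier by blast
  obtain X where X: "null_vector_field_E r M F \<alpha> X"
    and L': "\<And>p. p \<in> carrier M \<Longrightarrow> \<exists>\<gamma>. integral_curve M X UNIV \<gamma> \<and> p \<in> range \<gamma> \<and> lightlike_line (range (F \<circ> \<gamma>))"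
    using L unfolding L_complete_def by blast
  have XF: "vd c F p (X c p) = (1, \<nu> p)" if "c \<in> M" "p \<in> fst c" for c p
    using X that xihat[OF carrierI[OF that]] by (simp add: null_vector_field_E_def mderiv_vd)
  show "carrier P \<subseteq> \<I> ` carrier M"
  proof
    fix z assume "z \<in> carrier P"
    then have "snd z \<in> carrier glue.S" using fS.carP by blast
    then obtain D q where D: "D \<in> \<Lambda>" "q \<in> U_of D" "snd z = pr q" by (rule prE)
    have q: "q \<in> carrier M" by (rule U_carrier[OF D(1,2)])
    obtain \<gamma> where \<gamma>: "integral_curve M X UNIV \<gamma>" and "q \<in> range \<gamma>" and line: "lightlike_line (range (F \<circ> \<gamma>))"
      using L'[OF q] by blast
    then obtain t0 where t0: "\<gamma> t0 = q" by auto
    have cont: "continuous_map euclideanreal (mtop M) \<gamma>" using \<gamma> by (simp add: integral_curve_def)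
    have car: "\<gamma> s \<in> carrier M" for s
      using cont topspace_mtop[OF pre_manifold_open_atlas[OF M]] by (auto simp: continuous_map_def)
    obtain a v where v: "lightlike v" and av: "range (F \<circ> \<gamma>) = range (\<lambda>s. a + s *\<^sub>R v)"
      using line unfolding lightlike_line_def by blast
    define w where "w = (1 / fst v) *\<^sub>R snd v"
    have v0: "fst v \<noteq> 0" by (rule lightlike_fst[OF v])
    \<comment> \<open>A linear map that kills \<open>v\<close> and is therefore constant on the
      line. Differentiating it along the curve, where the velocity of the image is (1, \<nu>), gives
      \<nu> - w = 0.\<close>
    let ?T = "\<lambda>x::'n mink. snd x - fst x *\<^sub>R w"
    have blT: "bounded_linear ?T"
      by (intro bounded_linear_sub bounded_linear_snd bounded_linear_compose[OF bounded_linear_scaleR_left bounded_linear_fst])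
    have Tc: "?T (F (\<gamma> s)) = ?T a" for s
    proof -
      have "F (\<gamma> s) \<in> range (\<lambda>s. a + s *\<^sub>R v)" using av by (metis comp_apply rangeI)
      then obtain k where k: "F (\<gamma> s) = a + k *\<^sub>R v" by blast
      show ?thesis unfolding k w_def using v0 by (simp add: algebra_simps add_divide_distrib)
    qed
    have \<nu>w: "\<nu> (\<gamma> s) = w" for s
    proof -
      obtain c where c: "c \<in> M" "\<gamma> s \<in> fst c" using car by (rule carrierE)
      note CT = Cr_at_bounded_linear[OF CF[OF car[of s]] blT]
      have "((\<lambda>s. ?T (F (\<gamma> s))) has_vector_derivative vd c (\<lambda>q. ?T (F q)) (\<gamma> s) (X c (\<gamma> s))) (at s within UNIV)"
        by (rule integral_curve_has_derivative[OF M \<gamma> UNIV_I c CT])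
      then have "((\<lambda>s::real. ?T a) has_vector_derivative vd c (\<lambda>q. ?T (F q)) (\<gamma> s) (X c (\<gamma> s))) (at s)"
        unfolding Tc by simp
      then have "vd c (\<lambda>q. ?T (F q)) (\<gamma> s) (X c (\<gamma> s)) = 0"
        using vector_derivative_unique_at has_vector_derivative_const by blast
      then show ?thesis
        by (simp add: vd_bounded_linear[OF M CF[OF car] c blT] XF[OF c])
    qed
    have Fa: "F (\<gamma> s) = F (\<gamma> t) + (s - t) *\<^sub>R (1, w)" for s t
      by (rule integral_curve_affine[OF M \<gamma> CF]) (use XF \<nu>w in auto)
    have ell: "ell (\<gamma> s) = ell (\<gamma> t)" for s t
      unfolding ell_def f_def \<nu>w Fa[of s t] by (simp add: algebra_simps)
    have "(\<lambda>s. pr (\<gamma> s)) constant_on UNIV"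
    proof (rule locally_constant_imp_constant[OF connected_UNIV])
      fix t :: real
      obtain E where E: "E \<in> \<Lambda>" "\<gamma> t \<in> U_of E" using car by (rule coverE)
      have o: "open {s. \<gamma> s \<in> U_of E}"
        using openin_continuous_map_preimage[OF cont fdD(1)[OF E(1)]] by simp
      have "\<forall>s\<in>{s. \<gamma> s \<in> U_of E}. pr (\<gamma> s) = pr (\<gamma> t)"
      proof clarify
        fix s assume s: "\<gamma> s \<in> U_of E"
        have "l_of E (rho_of E (\<gamma> s)) = l_of E (rho_of E (\<gamma> t))"
          using l_rho[OF E(1) s] l_rho[OF E] ell[of s t] by simp
        then have "rho_of E (\<gamma> s) = rho_of E (\<gamma> t)"
          using inj_onD[OF Cr_embedding_euclidD(3)[OF fdD(2)[OF E(1)] fdD(9)[OF E(1)]]] rho_carrier[OF E(1)] s E(2) by blast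
        then show "pr (\<gamma> s) = pr (\<gamma> t)" using pr_eq[OF E(1)] s E(2) by simp
      qed
      then show "\<exists>T. openin (top_of_set UNIV) T \<and> t \<in> T \<and> (\<forall>x\<in>T. pr (\<gamma> x) = pr (\<gamma> t))"
      proof (intro exI[of _ "{s. \<gamma> s \<in> U_of E}"] conjI)
        show "openin (top_of_set UNIV) {s. \<gamma> s \<in> U_of E}" using o by simp
        show "t \<in> {s. \<gamma> s \<in> U_of E}" using E(2) by simp
      qed
    qed
    then obtain y where "\<And>s. pr (\<gamma> s) = y" unfolding constant_on_def by blast
    then have pc: "pr (\<gamma> s) = pr q" for s unfolding t0[symmetric] by simp
    \<comment> \<open>Time grows at unit speed along the curve from its value at \<open>t0\<close>;
      this is the parameter at which it equals the time of \<open>z\<close>.\<close>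
    let ?s = "fst z - fst (F q) + t0"
    have "\<I> (\<gamma> ?s) = z"
      using Fa[of ?s t0] t0 pc[of ?s] D(3) by (simp add: \<I>_def prod_eq_iff)
    then show "z \<in> \<I> ` carrier M" using car[of ?s] by (metis image_eqI)
  qed
qed

end

lemma admissible_front_quotient:
  fixes M :: "('a, real^'n::finite) atlas" and F :: "'a \<Rightarrow> 'n mink" and \<alpha> :: "'a \<Rightarrow> 'n dual"
  assumes "CARD('k::finite) = CARD('n) - 1" and M: "Cr_manifold r M" and front: "null_wave_front r M F \<alpha>"
    and adm: "admissible_front TYPE('k) r M F \<alpha>"
  shows "\<exists>(S :: ('a set, real^'k) atlas) (\<I> :: 'a \<Rightarrow> real \<times> 'a set)
         (F' :: real \<times> 'a set \<Rightarrow> 'n mink) (\<alpha>' :: real \<times> 'a set \<Rightarrow> 'n dual).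
         Cr_manifold r S \<and>
         Cr_immersion r M (prod_atlas euclid S) \<I> \<and>
         null_wave_front r (prod_atlas euclid S) F' \<alpha>' \<and>
         L_complete r (prod_atlas euclid S) F' \<alpha>' \<and>
         normal_form r S F' \<alpha>' \<and>
         (\<forall>q\<in>carrier M. F' (\<I> q) = F q \<and>
                         canonical_lift F' \<alpha>' (\<I> q) = canonical_lift F \<alpha> q) \<and>
         (Cr_embedding r M euclid (canonical_lift F \<alpha>) \<longrightarrow>
            openin (mtop (prod_atlas euclid S)) (\<I> ` carrier M) \<and>
            Cr_diffeo r M (restr (prod_atlas euclid S) (\<I> ` carrier M)) \<I>) \<and>
         (L_complete r M F \<alpha> \<longrightarrow> \<I> ` carrier M = carrier (prod_atlas euclid S))"
proof -
  obtain \<Lambda> :: "('a, 'n, 'k) fdata set" where \<Lambda>: "\<forall>D\<in>\<Lambda>. \<exists>p\<in>carrier M. fundamental_data r M F \<alpha> p D"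
    "(\<Union>D\<in>\<Lambda>. U_of D) = carrier M" "admissible_family r \<Lambda> Sigma_of l_of"
    using adm unfolding admissible_front_def by blast
  interpret front_data r M F \<alpha> \<Lambda>
    by unfold_locales (use assms \<Lambda> Cr_manifold_pre in auto)
  show ?thesis
    by (intro exI[of _ glue.S] exI[of _ \<I>] exI[of _ "normal_F f' \<nu>'"] exI[of _ "normal_\<alpha> \<nu>'"] conjI ballI impI
      glue.S_manifold \<I>_immersion fS.null_front fS.L_complete fS.normal_form F'_\<I> lift_\<I> \<I>_open \<I>_diffeo \<I>_surj)
qed

section \<open>Analytic fronts are admissible\<close>

lemma Cr_on_chart:
  assumes M: "pre_manifold r M" and c: "c \<in> M" and V: "openin (mtop M) V" "V \<subseteq> fst c"
    and f: "\<And>p. p \<in> V \<Longrightarrow> Cr_at r M f p"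
  shows "Cr_on r (snd c ` V) (\<lambda>x. f (cinv c x))"
proof (rule Cr_on_local)
  fix a assume "a \<in> snd c ` V"
  then obtain p where p: "p \<in> V" "a = snd c p" by blast
  have pc: "p \<in> fst c" using p(1) V(2) by blast
  obtain W where "open W" "snd c p \<in> W" "Cr_on r W (\<lambda>x. f (cinv c x))"
    by (rule Cr_at_chartE[OF M f[OF p(1)] c pc])
  then show "\<exists>U. open U \<and> a \<in> U \<and> Cr_on r U (\<lambda>x. f (cinv c x))" using p(2) by blast
qed

text \<open>If two analytic slices are related at points arbitrarily close to \<open>x\<close> and \<open>y\<close>, the identity
  theorem makes the first one coincide near \<open>x\<close> with its retraction to the second one, and invariance
  of domain turns this into relatedness.\<close>

lemma analytic_admissible_pair:
  fixes U :: "('a, real^'k) atlas" and V :: "('b, real^'k) atlas" and f :: "'a \<Rightarrow> 'v::euclidean_space"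
  assumes U: "pre_manifold Analytic U" and V: "pre_manifold Analytic V"
    and f: "Cr_embedding Analytic U euclid f" and g: "Cr_embedding Analytic V euclid g"
  shows "admissible_pair U V f g"
  unfolding admissible_pair_def
proof (intro ballI)
  fix x y assume x: "x \<in> carrier U" and y: "y \<in> carrier V"
  note fC = Cr_embedding_euclidD(1)[OF U f] and gC = Cr_embedding_euclidD(1)[OF V g]
  show "related U V f g x y \<or>
        (\<exists>Ox Oy. openin (mtop U) Ox \<and> x \<in> Ox \<and> openin (mtop V) Oy \<and> y \<in> Oy \<and>
           (\<forall>x'\<in>Ox. \<forall>y'\<in>Oy. \<not> related U V f g x' y'))"
  proof (cases "f x = g y")
    case False
    then obtain A B where AB: "open A" "open B" "f x \<in> A" "g y \<in> B" "A \<inter> B = {}"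
      by (rule hausdorff[THEN exE]) blast
    have A: "openin (mtop U) {q \<in> carrier U. f q \<in> A}" and B: "openin (mtop V) {q \<in> carrier V. g q \<in> B}"
      using openin_Cr_preimage[OF U fC openin_carrier_self[OF U] AB(1)]
        openin_Cr_preimage[OF V gC openin_carrier_self[OF V] AB(2)] by blast+
    have "\<not> related U V f g x' y'" if "x' \<in> {q \<in> carrier U. f q \<in> A}" "y' \<in> {q \<in> carrier V. g q \<in> B}" for x' y'
      using that AB(5) related_eq[of U V f g x' y'] by auto
    then show ?thesis using A B AB(3,4) x y by blast
  next
    case True
    obtain d where d: "d \<in> V" "y \<in> fst d" using y by (rule carrierE)
    obtain c where c: "c \<in> U" "x \<in> fst c" using x by (rule carrierE)
    obtain Q R V' where Q: "open Q" "Cr_on Analytic Q R" and V': "openin (mtop V) V'" "y \<in> V'" "V' \<subseteq> fst d"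
      and gQ: "\<And>q. q \<in> V' \<Longrightarrow> g q \<in> Q" "\<And>q. q \<in> V' \<Longrightarrow> R (g q) = snd d q" and RQ: "R ` Q \<subseteq> snd d ` V'"
      by (rule immersion_local_retraction[OF V gC[OF y] d Cr_embedding_euclidD(2)[OF V g d] openin_carrier_self[OF V] y]) blast
    note V'car = openin_carrier[OF V V'(1)]
    have "openin (mtop U) {q \<in> fst c. f q \<in> Q}"
    proof -
      have "{q \<in> fst c. f q \<in> Q} = fst c \<inter> {q \<in> carrier U. f q \<in> Q}" using carrierI[OF c(1)] by blast
      then show ?thesis
        using openin_Int[OF openin_chart[OF U c(1)] openin_Cr_preimage[OF U fC openin_carrier_self[OF U] Q(1)]] by simp
    qed
    then obtain e where e: "0 < e" "ball (snd c x) e \<subseteq> snd c ` {q \<in> fst c. f q \<in> Q}"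
      using openin_chart_subset[OF U c(1), of "{q \<in> fst c. f q \<in> Q}"] True gQ(1)[OF V'(2)] c(2)
      by (auto simp: open_contains_ball)
    define B where "B = ball (snd c x) e"
    have B: "open B" "convex B" "snd c x \<in> B" using e by (auto simp: B_def)
    have Bc: "B \<subseteq> snd c ` fst c" using e(2) by (auto simp: B_def)
    let ?Ox = "cinv c ` B"
    have Ox: "openin (mtop U) ?Ox" by (rule openin_cinv_image[OF U c(1) B(1) Bc])
    have Oxc: "?Ox \<subseteq> fst c" using cinv_into[OF subsetD[OF Bc]] by blast
    have xO: "x \<in> ?Ox" using imageI[OF B(3), of "cinv c"] cinv_chart[OF pre_manifold_open_atlas[OF U] c] by simp
    have cO: "snd c ` ?Ox = B"
    proof -
      have "snd c (cinv c z) = z" if "z \<in> B" for z using chart_cinv[OF subsetD[OF Bc that]] .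
      then show ?thesis unfolding image_image by simp
    qed
    have fB: "Cr_on Analytic B (\<lambda>z. f (cinv c z))"
      using Cr_on_chart[OF U c(1) Ox Oxc fC] openin_carrier[OF U Ox] unfolding cO by blast
    have fQ: "f (cinv c z) \<in> Q" if z: "z \<in> B" for z
    proof -
      obtain q where q: "q \<in> fst c" "f q \<in> Q" "z = snd c q" using e(2) z by (auto simp: B_def)
      show ?thesis unfolding q(3) using cinv_chart[OF pre_manifold_open_atlas[OF U] c(1) q(1)] q(2) by simp
    qed
    define k where "k z = R (f (cinv c z))" for z
    have kC: "Cr_on Analytic B k"
      unfolding k_def[abs_def] by (rule Cr_on_compose[OF B(1) Q(1) _ fB Q(2)]) (use fQ in blast)
    have kV: "k z \<in> snd d ` V'" if "z \<in> B" for z using RQ fQ[OF that] by (auto simp: k_def)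
    \<comment> \<open>It vanishes at z exactly when the point \<open>f (cinv c z)\<close> of the
      first image is a value of \<open>g\<close> on \<open>V'\<close>.\<close>
    define \<Psi> where "\<Psi> z = f (cinv c z) - g (cinv d (k z))" for z
    have oV': "open (snd d ` V')" using openin_chart_subset[OF V d(1) V'(3)] V'(1) by blast
    have gk: "Cr_on Analytic B (\<lambda>z. g (cinv d (k z)))"
    proof (rule Cr_on_compose[OF B(1) oV' _ kC Cr_on_chart[OF V d(1) V'(1,3) gC]])
      show "k ` B \<subseteq> snd d ` V'" using kV by blast
    qed (use V'car in blast)
    have \<Psi>: "real_analytic_on B \<Psi>"
      using Cr_on_add[OF B(1) fB Cr_on_bounded_linear_compose[OF B(1) bounded_linear_minus[OF bounded_linear_ident] gk]]
      by (simp add: \<Psi>_def[abs_def] Cr_on_def)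
    show ?thesis
    proof (cases "\<exists>x'\<in>?Ox. \<exists>y'\<in>V'. related U V f g x' y'")
      case False
      then show ?thesis using Ox xO V'(1,2) by blast
    next
      case True': True
      then obtain x' y' where x': "x' \<in> ?Ox" and y': "y' \<in> V'" and rel: "related U V f g x' y'" by blast
      obtain O1 O2 where O1: "openin (mtop U) O1" "x' \<in> O1" and O2: "openin (mtop V) O2" and OO: "f ` O1 = g ` O2"
        using rel unfolding related_def by blast
      obtain N where N: "open N" "\<And>p. p \<in> carrier V \<Longrightarrow> g p \<in> N \<longleftrightarrow> p \<in> V'"
        using Cr_embedding_euclidD(4)[OF V g V'(1)] by blast
      \<comment> \<open>On \<open>O1\<close> the values of \<open>f\<close> are values of
        \<open>g\<close> on \<open>O2\<close>; intersecting with \<open>N\<close> forces the partner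
        into \<open>V'\<close>, where \<open>R\<close> undoes \<open>g\<close>.\<close>
      define O3 where "O3 = ?Ox \<inter> O1 \<inter> {q \<in> carrier U. f q \<in> N}"
      have O3: "openin (mtop U) O3"
        unfolding O3_def by (intro openin_Int Ox O1 openin_Cr_preimage[OF U fC openin_carrier_self[OF U] N(1)])
      have O3c: "O3 \<subseteq> fst c" using Oxc by (auto simp: O3_def)
      have x'3: "x' \<in> O3"
        using x' O1(2) openin_carrier[OF U O1(1)] N(2)[of y'] y' V'car related_eq[OF rel] by (auto simp: O3_def)
      have zero: "\<Psi> z = 0" if z: "z \<in> snd c ` O3" for z
      proof -
        obtain q where q: "q \<in> O3" "z = snd c q" using z by blast
        then have cq: "cinv c z = q" using cinv_chart[OF pre_manifold_open_atlas[OF U] c(1)] O3c by blast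
        have "f q \<in> g ` O2" using q(1) OO by (auto simp: O3_def)
        then obtain y2 where y2: "y2 \<in> O2" "f q = g y2" by blast
        have y2V: "y2 \<in> V'" using N(2)[of y2] y2 q(1) openin_carrier[OF V O2] by (auto simp: O3_def)
        then have "cinv d (R (g y2)) = y2"
          unfolding gQ(2)[OF y2V] using cinv_chart[OF pre_manifold_open_atlas[OF V] d(1)] V'(3) by blast
        then show ?thesis by (simp add: \<Psi>_def k_def cq y2(2))
      qed
      have W: "open (snd c ` O3)" using openin_chart_subset[OF U c(1) O3c] O3 by blast
      have WB: "snd c ` O3 \<subseteq> B" using cO by (auto simp: O3_def)
      have eq: "f (cinv c z) = g (cinv d (k z))" if "z \<in> B" for z
        using real_analytic_identity[OF \<Psi> B(1,2) W WB imageI[OF x'3] zero that] by (simp add: \<Psi>_def)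
      have inj: "inj_on k B"
      proof (rule inj_onI)
        fix z w assume zw: "z \<in> B" "w \<in> B" "k z = k w"
        then have "f (cinv c z) = f (cinv c w)" using eq by simp
        moreover have "cinv c z \<in> carrier U" "cinv c w \<in> carrier U"
          using zw openin_carrier[OF U Ox] by blast+
        ultimately have "cinv c z = cinv c w" using inj_onD[OF Cr_embedding_euclidD(3)[OF U f]] by blast
        then show "z = w" using chart_cinv[OF subsetD[OF Bc zw(1)]] chart_cinv[OF subsetD[OF Bc zw(2)]] by metis
      qed
      have kB: "open (k ` B)"
        by (rule invariance_of_domain[OF Cr_on_continuous_on[OF kC] B(1) inj])
      have kBd: "k ` B \<subseteq> snd d ` fst d" using kV V'(3) by blast
      have Oy: "openin (mtop V) (cinv d ` k ` B)" by (rule openin_cinv_image[OF V d(1) kB kBd])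
      have "cinv d (k (snd c x)) = y"
        using True gQ(2)[OF V'(2)] cinv_chart[OF pre_manifold_open_atlas[OF U] c] cinv_chart[OF pre_manifold_open_atlas[OF V] d]
        by (simp add: k_def)
      then have yO: "y \<in> cinv d ` k ` B" using B(3) by blast
      have "f ` ?Ox = g ` cinv d ` k ` B"
        unfolding image_image by (rule image_cong[OF refl eq])
      then have "related U V f g x y"
        unfolding related_def using True Ox xO Oy yO by blast
      then show ?thesis ..
    qed
  qed
qed

text \<open>The Lindelof property: for each set of a countable basis that fits into some
  \<open>U p\<close>, one such \<open>p\<close> is kept.\<close>

lemma countable_subcover:
  assumes X: "second_countable X" and U: "\<And>p. p \<in> topspace X \<Longrightarrow> openin X (U p) \<and> p \<in> U p"
  obtains A where "countable A" "A \<subseteq> topspace X" "(\<Union>p\<in>A. U p) = topspace X"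
proof -
  obtain B where B: "countable B" "\<forall>W x. openin X W \<and> x \<in> W \<longrightarrow> (\<exists>V\<in>B. x \<in> V \<and> V \<subseteq> W)"
    using X unfolding second_countable_def by blast
  define B' where "B' = {V \<in> B. \<exists>p\<in>topspace X. V \<subseteq> U p}"
  define s where "s V = (SOME p. p \<in> topspace X \<and> V \<subseteq> U p)" for V
  have s: "s V \<in> topspace X \<and> V \<subseteq> U (s V)" if "V \<in> B'" for V
  proof -
    have "\<exists>p. p \<in> topspace X \<and> V \<subseteq> U p" using that by (simp add: B'_def Bex_def)
    then show ?thesis unfolding s_def by (rule someI_ex)
  qed
  show thesis
  proof
    show "countable (s ` B')" using B(1) by (auto simp: B'_def)
    show "s ` B' \<subseteq> topspace X" using s by blast
    have "p \<in> (\<Union>p\<in>s ` B'. U p)" if p: "p \<in> topspace X" for p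
    proof -
      obtain V where "V \<in> B" "p \<in> V" "V \<subseteq> U p" using B(2)[rule_format, of "U p" p] U[OF p] by blast
      then show ?thesis using s[of V] p by (auto simp: B'_def)
    qed
    moreover have "U (s V) \<subseteq> topspace X" if "V \<in> B'" for V
      using U[of "s V"] s[OF that] openin_subset[of X "U (s V)"] by blast
    ultimately show "(\<Union>p\<in>s ` B'. U p) = topspace X" by blast
  qed
qed

section \<open>Existence of fundamental data\<close>

text \<open>The range \<open>W\<close> of an injective \<open>(A, B)\<close> and its image under the complex structure
  \<open>(a, b) \<mapsto> (-b, a)\<close> would fill the whole space, leaving no room for \<open>(w, 0)\<close>.\<close>

lemma isotropic_not_injective:
  fixes A B :: "real^'n \<Rightarrow> real^'n"
  assumes lin: "linear A" "linear B" and sym: "\<And>u v. A u \<bullet> B v = A v \<bullet> B u"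
    and w: "w \<noteq> 0" "\<And>v. w \<bullet> A v = 0" "\<And>v. w \<bullet> B v = 0"
  obtains \<xi> where "\<xi> \<noteq> 0" "A \<xi> = 0" "B \<xi> = 0"
proof -
  let ?T = "\<lambda>v. (A v, B v)" and ?J = "\<lambda>v. (- B v, A v)"
  interpret A: linear A by (rule lin)
  interpret B: linear B by (rule lin)
  have T: "linear ?T" by (rule linearI) (simp_all add: A.add B.add A.scale B.scale)
  have J: "linear ?J" by (rule linearI) (simp_all add: A.add B.add A.scale B.scale)
  have "\<not> inj ?T"
  proof
    assume inj: "inj ?T"
    have injJ: "inj ?J"
    proof (rule injI)
      fix x y assume "?J x = ?J y"
      then have "?T x = ?T y" by simp
      then show "x = y" by (rule injD[OF inj])
    qed
    have d: "dim (range ?T) = CARD('n)" "dim (range ?J) = CARD('n)"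
      using dim_image_eq[OF T, of UNIV] dim_image_eq[OF J, of UNIV] inj injJ by (simp_all add: dim_UNIV)
    let ?C = "{y. \<forall>x\<in>range ?T. orthogonal x y}"
    have "dim ?C + dim (range ?T) = dim (UNIV :: ((real^'n) \<times> (real^'n)) set)"
      using dim_subspace_orthogonal_to_vectors[OF linear_subspace_image[OF T subspace_UNIV] subspace_UNIV]
      by simp
    then have dC: "dim ?C = CARD('n)" using d by (simp add: dim_UNIV)
    \<comment> \<open>By the symmetry assumption the range of \<open>?J\<close> lies in the
      orthogonal complement \<open>?C\<close> of the range of \<open>?T\<close>. Both have dimension
      n, so they agree, and \<open>(w, 0)\<close>, which lies in \<open>?C\<close>, must have w = -
      B v for some v, although w is orthogonal to the range of \<open>B\<close>.\<close>
    have "subspace ?C" by (rule subspace_orthogonal_to_vectors)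
    moreover have "range ?J \<subseteq> ?C"
      using sym by (auto simp: orthogonal_def inner_commute)
    ultimately have eq: "range ?J = ?C"
      using subspace_dim_equal[OF linear_subspace_image[OF J subspace_UNIV]] dC d(2) by simp
    have "(w, 0) \<in> ?C" using w(2) by (auto simp: orthogonal_def inner_commute)
    then have "(w, 0) \<in> range ?J" unfolding eq .
    then obtain v where "w = - B v" by blast
    then have "w \<bullet> w = 0" using w(3)[of v] by simp
    then show False using w(1) by simp
  qed
  then obtain \<xi> where \<xi>: "\<xi> \<noteq> 0" "?T \<xi> = 0"
    using linear_injective_0[OF T] by blast
  show thesis by (rule that[of \<xi>]) (use \<xi> in \<open>simp_all add: zero_prod_def\<close>)
qed

text \<open>A kernel vector keeps the rank at most n - 1, so the range embeds linearly into
  \<open>real^'k\<close>. Applied to the differential of (f, \<nu>) at one point, it selects as many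
  combinations of (f, \<nu>) as a slice has coordinates.\<close>

lemma injective_on_range:
  fixes T :: "real^'n \<Rightarrow> 'v::euclidean_space"
  assumes T: "linear T" and \<xi>: "\<xi> \<noteq> 0" "T \<xi> = 0" and dim: "CARD('k::finite) = CARD('n) - 1"
  obtains P :: "'v \<Rightarrow> real^'k" where "bounded_linear P" "\<And>v. P (T v) = 0 \<Longrightarrow> T v = 0"
proof -
  interpret T: linear T by (rule T)
  have "range T \<subseteq> T ` {v. \<xi> \<bullet> v = 0}"
  proof clarify
    fix v
    have "T v = T (v - ((\<xi> \<bullet> v) / (\<xi> \<bullet> \<xi>)) *\<^sub>R \<xi>)" using \<xi>(2) by (simp add: T.diff T.scale)
    moreover have "\<xi> \<bullet> (v - ((\<xi> \<bullet> v) / (\<xi> \<bullet> \<xi>)) *\<^sub>R \<xi>) = 0" using \<xi>(1) by (simp add: inner_diff_right)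
    ultimately show "T v \<in> T ` {v. \<xi> \<bullet> v = 0}" by blast
  qed
  then have "dim (range T) \<le> dim (T ` {v. \<xi> \<bullet> v = 0})" by (rule dim_subset)
  also have "\<dots> \<le> dim {v. \<xi> \<bullet> v = 0}" by (rule dim_image_le[OF T])
  also have "\<dots> = CARD('n) - 1" using dim_hyperplane[OF \<xi>(1)] by simp
  also have "\<dots> = dim (UNIV :: (real^'k) set)" using dim by (simp add: dim_UNIV)
  finally obtain P :: "'v \<Rightarrow> real^'k" where P: "linear P" "\<And>x. x \<in> range T \<Longrightarrow> norm (P x) = norm x"
    using isometry_subset_subspace[OF linear_subspace_image[OF T subspace_UNIV] subspace_UNIV] by metis
  show thesis
  proof (rule that[of P])
    show "bounded_linear P" using P(1) linear_conv_bounded_linear by blast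
    show "T v = 0" if "P (T v) = 0" for v using P(2)[of "T v"] that by simp
  qed
qed

section \<open>The kernel of the differential of (f, \<nu>)\<close>

context null_front
begin

lemma vd_parts:
  assumes c: "c \<in> M" "p \<in> fst c"
  shows "vd c (\<lambda>q. fst (F q)) p = (\<lambda>v. fst (vd c F p v))" "vd c (\<lambda>q. snd (F q)) p = (\<lambda>v. snd (vd c F p v))"
    "vd c f p v = snd (vd c F p v) - (fst (F p) *\<^sub>R vd c \<nu> p v + fst (vd c F p v) *\<^sub>R \<nu> p)"
proof -
  note p = carrierI[OF c]
  show "vd c (\<lambda>q. fst (F q)) p = (\<lambda>v. fst (vd c F p v))" "vd c (\<lambda>q. snd (F q)) p = (\<lambda>v. snd (vd c F p v))"
    by (rule vd_bounded_linear[OF M CF[OF p] c bounded_linear_fst] vd_bounded_linear[OF M CF[OF p] c bounded_linear_snd])+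
  have "((\<lambda>z::'n mink \<times> (real^'n). snd (fst z) - fst (fst z) *\<^sub>R snd z) has_derivative
      (\<lambda>d. snd (fst d) - (fst (F p) *\<^sub>R snd d + fst (fst d) *\<^sub>R \<nu> p))) (at (F p, \<nu> p))"
    by (auto intro!: derivative_eq_intros)
  from vd_compose[OF M Cr_at_Pair[OF M CF[OF p] C\<nu>[OF p]] c this]
  show "vd c f p v = snd (vd c F p v) - (fst (F p) *\<^sub>R vd c \<nu> p v + fst (vd c F p v) *\<^sub>R \<nu> p)"
    by (simp add: f_def[abs_def] vd_Pair[OF M CF[OF p] C\<nu>[OF p] c])
qed

lemma f_orth:
  assumes c: "c \<in> M" "p \<in> fst c" shows "\<nu> p \<bullet> vd c f p v = 0"
proof -
  note p = carrierI[OF c]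
  have "\<nu> p \<bullet> vd c \<nu> p v = 0"
    by (rule unit_field_orth[OF M C\<nu>[OF p] c]) (use unit carrierI[OF c(1)] in blast)
  moreover have "\<nu> p \<bullet> \<nu> p = 1" using unit[OF p] by (simp add: dot_square_norm)
  ultimately show ?thesis
    unfolding vd_parts(3)[OF c] using F_orth[OF c, of v] by (simp add: inner_diff_right inner_add_right)
qed

text \<open>Differentiating \<nu> \<bullet> df(u) = 0 in the direction v gives df(u) \<bullet>
  d\<nu>(v) = - \<nu> \<bullet> d^2 f(u, v), and the right-hand side is symmetric in u and
  v.\<close>

lemma isotropic:
  assumes c: "c \<in> M" "p \<in> fst c"
  shows "vd c f p u \<bullet> vd c \<nu> p v = vd c f p v \<bullet> vd c \<nu> p u"
proof -
  let ?V = "snd c ` fst c" and ?f = "\<lambda>x. f (cinv c x)" and ?n = "\<lambda>x. \<nu> (cinv c x)"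
  have o: "open ?V" using pre_manifold_open_atlas[OF M] c(1) by (simp add: open_atlas_def)
  have Cf': "Cr_on r ?V ?f" and Cn: "Cr_on r ?V ?n"
    by (rule Cr_on_chart[OF M c(1) openin_chart[OF M c(1)] order_refl], use Cf C\<nu> carrierI[OF c(1)] in blast)+
  have x: "snd c p \<in> ?V" using c(2) by blast
  have cp: "cinv c (snd c p) = p" using cinv_chart[OF pre_manifold_open_atlas[OF M] c] .
  have *: "vd c f p u \<bullet> vd c \<nu> p v = - (\<nu> p \<bullet> frechet_derivative (\<lambda>y. frechet_derivative ?f (at y) u) (at (snd c p)) v)" for u v
  proof -
    let ?D = "\<lambda>y. frechet_derivative ?f (at y) u"
    have 1: "(?n has_derivative vd c \<nu> p) (at (snd c p))" unfolding vd_def by (rule Cr_on_has_derivative[OF Cn x])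
    have 2: "(?D has_derivative frechet_derivative ?D (at (snd c p))) (at (snd c p))"
      by (rule Cr_on_has_derivative[OF Cr_on_derivative[OF Cf' o] x])
    have "((\<lambda>y. ?n y \<bullet> ?D y) has_derivative (\<lambda>v. ?n (snd c p) \<bullet> frechet_derivative ?D (at (snd c p)) v
        + vd c \<nu> p v \<bullet> ?D (snd c p))) (at (snd c p))"
      by (rule has_derivative_inner[OF 1 2])
    moreover have "((\<lambda>y. ?n y \<bullet> ?D y) has_derivative (\<lambda>_. 0)) (at (snd c p))"
    proof (rule has_derivative_transform_within_open[OF has_derivative_const[of "0::real"] o x])
      fix y assume y: "y \<in> ?V"
      have "\<nu> (cinv c y) \<bullet> vd c f (cinv c y) u = 0" by (rule f_orth[OF c(1) cinv_into[OF y]])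
      then show "0 = ?n y \<bullet> ?D y" unfolding vd_def chart_cinv[OF y] by simp
    qed
    ultimately have "(\<lambda>v. ?n (snd c p) \<bullet> frechet_derivative ?D (at (snd c p)) v + vd c \<nu> p v \<bullet> ?D (snd c p)) = (\<lambda>_. 0)"
      by (rule has_derivative_unique)
    from fun_cong[OF this, of v] show ?thesis
      unfolding cp vd_def[of c f] by (simp add: inner_commute)
  qed
  show ?thesis unfolding * symmetric_second_derivative[OF Cf' o x, of u v] ..
qed

text \<open>Since F = (t, f + t \<nu>), its differential vanishes with dt, df and d\<nu>, and (F,
  \<nu>) is an immersion.\<close>

lemma vd_kernel:
  assumes c: "c \<in> M" "p \<in> fst c" and z: "vd c f p v = 0" "vd c \<nu> p v = 0" "fst (vd c F p v) = 0"
  shows "v = 0"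
proof -
  note p = carrierI[OF c]
  have "vd c F p v = 0"
    using z vd_parts(3)[OF c, of v] by (simp add: prod_eq_iff)
  then have "vd c (\<lambda>q. (F q, \<nu> q)) p v = 0"
    using z(2) by (simp add: vd_Pair[OF M CF[OF p] C\<nu>[OF p] c] zero_prod_def)
  then show ?thesis
    using iffD1[OF linear_injective_0[OF linear_vd[OF M Cr_at_Pair[OF M CF[OF p] C\<nu>[OF p]] c]] imm[OF c]] by simp
qed

text \<open>Isotropy provides a kernel vector of d(f, \<nu>); by \<open>vd_kernel\<close> its time
  component is non-zero and can be scaled to 1. The image of \<xi> under dF is then (1,
  \<nu>).\<close>

lemma null_direction:
  assumes c: "c \<in> M" "p \<in> fst c"
  obtains \<xi> where "vd c f p \<xi> = 0" "vd c \<nu> p \<xi> = 0" "fst (vd c F p \<xi>) = 1"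
proof -
  note p = carrierI[OF c]
  note lf = linear_vd[OF M Cf[OF p] c] and l\<nu> = linear_vd[OF M C\<nu>[OF p] c] and lF = linear_vd[OF M CF[OF p] c]
  have "\<nu> p \<noteq> 0" using unit[OF p] by auto
  moreover have "\<nu> p \<bullet> vd c \<nu> p v = 0" for v
    by (rule unit_field_orth[OF M C\<nu>[OF p] c]) (use unit carrierI[OF c(1)] in blast)
  ultimately obtain \<zeta> where \<zeta>: "\<zeta> \<noteq> 0" "vd c f p \<zeta> = 0" "vd c \<nu> p \<zeta> = 0"
    by (rule isotropic_not_injective[OF lf l\<nu> isotropic[OF c] _ f_orth[OF c]])
  have "fst (vd c F p \<zeta>) \<noteq> 0" using vd_kernel[OF c \<zeta>(2,3)] \<zeta>(1) by blast
  then show thesis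
    by (intro that[of "(1 / fst (vd c F p \<zeta>)) *\<^sub>R \<zeta>"])
       (simp_all add: linear_scale[OF lf] linear_scale[OF l\<nu>] linear_scale[OF lF] \<zeta>)
qed

end

section \<open>Manifolds with one global chart\<close>

locale single_chart =
  fixes A :: "'a set" and k :: "'a \<Rightarrow> 'e::euclidean_space"
  assumes inj: "inj_on k A" and op: "open (k ` A)"
begin

abbreviation S :: "('a, 'e) atlas" where "S \<equiv> {(A, k)}"

lemma carrier_S: "carrier S = A" by (simp add: carrier_def)

lemma S_pre: "pre_manifold r S"
proof -
  have "Cr_on r (k ` A) (local_rep (A, k) (A, k) (\<lambda>x. x))"
    by (rule Cr_on_cong[OF op Cr_on_id]) (use inj in \<open>auto simp: local_rep_def f_inv_into_f\<close>)
  then show ?thesis using inj op by (simp add: pre_manifold_def)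
qed

lemma openin_S: "openin (mtop S) V \<longleftrightarrow> V \<subseteq> A \<and> open (k ` V)"
proof -
  have "openin (mtop S) V \<Longrightarrow> V \<subseteq> A" using openin_carrier[OF S_pre] carrier_S by blast
  moreover have "V \<subseteq> A \<Longrightarrow> openin (mtop S) V \<longleftrightarrow> open (k ` V)"
    using openin_chart_subset[OF S_pre, where c = "(A, k)" and V = V] by simp
  ultimately show ?thesis by blast
qed

lemma topspace_S: "topspace (mtop S) = A"
  using topspace_mtop[OF pre_manifold_open_atlas[OF S_pre]] carrier_S by simp

lemma continuous_k: "continuous_map (mtop S) (top_of_set (k ` A)) k"
  unfolding continuous_map_def topspace_S
proof (intro conjI allI impI)
  show "k \<in> A \<rightarrow> topspace (top_of_set (k ` A))" by simp
  fix W assume "openin (top_of_set (k ` A)) W"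
  then have W: "open W" "W \<subseteq> k ` A" using op openin_open_eq by blast+
  have "k ` {x \<in> A. k x \<in> W} = W" using W(2) by blast
  then show "openin (mtop S) {x \<in> A. k x \<in> W}" using W(1) by (simp add: openin_S)
qed

lemma continuous_inv_k: "continuous_map (top_of_set (k ` A)) (mtop S) (inv_into A k)"
  unfolding continuous_map_def topspace_S
proof (intro conjI allI impI)
  show "inv_into A k \<in> topspace (top_of_set (k ` A)) \<rightarrow> A" by (auto intro: inv_into_into)
  fix W assume "openin (mtop S) W"
  then have W: "W \<subseteq> A" "open (k ` W)" by (simp_all add: openin_S)
  have "{x \<in> k ` A. inv_into A k x \<in> W} = k ` W"
    using W(1) inj by (auto simp: inv_into_f_f subset_iff)
  then have "{x \<in> topspace (top_of_set (k ` A)). inv_into A k x \<in> W} = k ` W" by simp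
  then show "openin (top_of_set (k ` A)) {x \<in> topspace (top_of_set (k ` A)). inv_into A k x \<in> W}"
    using W op by (simp add: openin_open_eq image_mono)
qed

lemma homeomorphic_S: "mtop S homeomorphic_space top_of_set (k ` A)"
  unfolding homeomorphic_space_def homeomorphic_maps_def topspace_S
  by (intro exI[of _ k] exI[of _ "inv_into A k"] conjI continuous_k continuous_inv_k)
     (use inj in \<open>auto simp: f_inv_into_f\<close>)

lemma connected_S: "connected (k ` A) \<Longrightarrow> connected_space (mtop S)"
  using homeomorphic_connected_space[OF homeomorphic_S] by (simp add: connected_space_subtopology)

lemma S_manifold: "Cr_manifold r S"
  unfolding Cr_manifold_iff
proof (intro conjI S_pre)
  show "Hausdorff_space (mtop S)"
    using homeomorphic_Hausdorff_space[OF homeomorphic_S] Hausdorff_space_subtopology[OF Hausdorff_space_euclidean]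
    by blast
  obtain B :: "'e set set" where B: "countable B" "topological_basis B"
    using ex_countable_basis by blast
  let ?B = "(\<lambda>b. {x\<in>A. k x \<in> b}) ` B"
  have im: "k ` {x\<in>A. k x \<in> b} = k ` A \<inter> b" for b by blast
  have "\<exists>V\<in>?B. x \<in> V \<and> V \<subseteq> W" if W: "openin (mtop S) W" "x \<in> W" for W x
  proof -
    have W': "W \<subseteq> A" "open (k ` W)" using W(1) by (simp_all add: openin_S)
    then obtain b where b: "b \<in> B" "k x \<in> b" "b \<subseteq> k ` W"
      using topological_basisE[OF B(2) W'(2), of "k x"] W(2) by blast
    have "y \<in> W" if y: "y \<in> A" "k y \<in> b" for y
    proof -
      obtain w where "w \<in> W" "k y = k w" using b(3) y(2) by blast
      then show ?thesis using inj_onD[OF inj _ y(1), of w] W'(1) by auto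
    qed
    then show ?thesis using b W W'(1) by (intro bexI[of _ "{x\<in>A. k x \<in> b}"]) auto
  qed
  note basis = this
  show "second_countable (mtop S)"
    unfolding second_countable_def
  proof (intro exI[of _ ?B] conjI ballI allI impI)
    show "countable ?B" using B(1) by (rule countable_image)
    show "openin (mtop S) V" if "V \<in> ?B" for V
      using that topological_basis_open[OF B(2)] op by (auto simp: openin_S im intro!: open_Int)
    show "\<exists>V\<in>?B. x \<in> V \<and> V \<subseteq> W" if "openin (mtop S) W \<and> x \<in> W" for W x
      by (rule basis[OF conjunct1[OF that] conjunct2[OF that]])
  qed
qed

lemma Cr_at_S: "Cr_on r (k ` A) (\<lambda>x. u (inv_into A k x)) \<Longrightarrow> q \<in> A \<Longrightarrow> Cr_at r S u q"
  by (rule Cr_atI[of "(A, k)" _ _ "k ` A"]) (use op in auto)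

text \<open>When the chart is a function \<open>T\<close> of \<open>l\<close>, the inverse chart
  preceded by \<open>T\<close> is a continuous left inverse of \<open>l\<close>, and the same
  factorisation shows that dl is injective.\<close>

lemma S_embedding:
  fixes l :: "'a \<Rightarrow> 'v::euclidean_space"
  assumes l: "\<And>q. q \<in> A \<Longrightarrow> Cr_at r S l q" and T: "\<And>z. (T has_derivative T' z) (at z)"
    and eq: "\<And>q. q \<in> A \<Longrightarrow> k q = T (l q)"
  shows "Cr_embedding r S euclid l"
proof -
  have c: "(A, k) \<in> S" by simp
  have im: "inj (vd (A, k) l q)" if q: "q \<in> A" for q
  proof (rule inj_vd_factor[OF S_pre l[OF q] c _ T])
    show "Cr_at r S k q" using Cr_at_chart[OF S_pre c, of q] q by simp
    have "vd (A, k) k q = (\<lambda>v. v)" using vd_chart[OF S_pre c, of q] q by simp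
    then show "inj (vd (A, k) k q)" by (simp add: inj_def)
    show "openin (mtop S) A" using op by (simp add: openin_S)
  qed (use q eq in auto)
  have "continuous_on UNIV T"
    using T by (intro continuous_at_imp_continuous_on ballI) (rule has_derivative_continuous)
  then have T': "continuous_map (top_of_set (l ` topspace (mtop S))) (top_of_set (k ` A)) T"
    using eq by (auto simp: topspace_S continuous_map_in_subtopology intro: continuous_on_subset)
  have "embedding_map (mtop S) euclidean l"
  proof (rule embedding_mapI[where g = "inv_into A k \<circ> T"])
    have "continuous_map (subtopology (mtop S) (carrier S)) euclidean l"
      by (rule continuous_map_Cr_at[OF S_pre l openin_carrier_self[OF S_pre]]) (simp add: carrier_S)
    moreover have "subtopology (mtop S) (carrier S) = mtop S"
      using subtopology_topspace[of "mtop S"] unfolding topspace_S carrier_S .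
    ultimately show "continuous_map (mtop S) euclidean l" by simp
    show "continuous_map (top_of_set (l ` topspace (mtop S))) (mtop S) (inv_into A k \<circ> T)"
      by (rule continuous_map_compose[OF T' continuous_inv_k])
    show "(inv_into A k \<circ> T) (l x) = x" if "x \<in> topspace (mtop S)" for x
      using that inj by (simp add: topspace_S eq[symmetric] inv_into_f_f)
  qed
  then show ?thesis
    unfolding Cr_embedding_def mtop_euclid Cr_immersion_euclid_iff[OF S_pre] using l im by (simp add: carrier_S)
qed

end

section \<open>Straightening the light-like lines\<close>

locale straight_patch = null_front r M F \<alpha> for r and M :: "('a, real^'n::finite) atlas" and F \<alpha> +
  fixes c :: "('a, real^'n) chart" and U :: "'a set" and t\<^sub>0 \<epsilon> :: real and b\<^sub>0 :: "real^'k::finite"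
    and \<theta> :: "real \<times> (real^'k) \<Rightarrow> 'a" and P :: "(real^'n) \<times> (real^'n) \<Rightarrow> real^'k"
    and I :: "real set" and B :: "(real^'k) set"
  assumes dim: "CARD('k) = CARD('n) - 1"
    and I_def: "I = {t\<^sub>0 - \<epsilon><..<t\<^sub>0 + \<epsilon>}" and B_def: "B = ball b\<^sub>0 \<epsilon>"
    and c: "c \<in> M" and U: "openin (mtop M) U" and Uc: "U \<subseteq> fst c" and \<epsilon>: "0 < \<epsilon>" and P: "bounded_linear P"
    and in_IB: "\<And>q. q \<in> U \<Longrightarrow> (fst (F q), P (f q, \<nu> q)) \<in> I \<times> B"
    and \<theta>_chart: "\<And>q. q \<in> U \<Longrightarrow> \<theta> (fst (F q), P (f q, \<nu> q)) = q"
    and \<theta>_in: "\<And>z. z \<in> I \<times> B \<Longrightarrow> \<theta> z \<in> U"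
    and chart_\<theta>: "\<And>z. z \<in> I \<times> B \<Longrightarrow> (fst (F (\<theta> z)), P (f (\<theta> z), \<nu> (\<theta> z))) = z"
    and C\<theta>: "Cr_on r (I \<times> B) (\<lambda>z. snd c (\<theta> z))"
    and const: "\<And>t t' b. t \<in> I \<Longrightarrow> t' \<in> I \<Longrightarrow> b \<in> B \<Longrightarrow>
       (f (\<theta> (t, b)), \<nu> (\<theta> (t, b))) = (f (\<theta> (t', b)), \<nu> (\<theta> (t', b)))"

text \<open>The coordinates are time and \<open>P (f, \<nu>)\<close>. Their joint differential is
  injective at \<open>p\<close>: a kernel vector has dt = 0, \<open>P\<close> loses nothing of d(f,
  \<nu>) there, and \<open>vd_kernel\<close> applies. The inverse function theorem gives \<theta>
  after the patch has been cut down to a box, in which the lines are the curves t \<mapsto> \<theta>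
  (t, b).\<close>

lemma (in null_front) straightening:
  assumes dim: "CARD('k::finite) = CARD('n) - 1" and p: "p \<in> carrier M"
  obtains c U t\<^sub>0 \<epsilon> b\<^sub>0 \<theta> and P :: "(real^'n) \<times> (real^'n) \<Rightarrow> real^'k" and I B where
    "straight_patch r M F \<alpha> c U t\<^sub>0 \<epsilon> b\<^sub>0 \<theta> P I B" "p \<in> U"
proof -
  obtain c where c: "c \<in> M" "p \<in> fst c" using p by (rule carrierE)
  let ?V = "snd c ` fst c"
  have oV: "open ?V" using pre_manifold_open_atlas[OF M] c(1) by (simp add: open_atlas_def)
  have cin: "\<And>q. q \<in> fst c \<Longrightarrow> q \<in> carrier M" using carrierI[OF c(1)] .
  let ?h = "\<lambda>q. (f q, \<nu> q)"
  have Ch: "Cr_at r M ?h q" if "q \<in> carrier M" for q by (rule Cr_at_Pair[OF M Cf[OF that] C\<nu>[OF that]])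
  have vdh: "vd c ?h q = (\<lambda>v. (vd c f q v, vd c \<nu> q v))" if "q \<in> fst c" for q
    by (rule vd_Pair[OF M Cf[OF cin[OF that]] C\<nu>[OF cin[OF that]] c(1) that])
  obtain \<zeta> where \<zeta>: "vd c f p \<zeta> = 0" "vd c \<nu> p \<zeta> = 0" "fst (vd c F p \<zeta>) = 1" using c by (rule null_direction)
  have z0: "\<zeta> \<noteq> 0" using \<zeta>(3) linear_0[OF linear_vd[OF M CF[OF p] c]] by auto
  have hz: "vd c ?h p \<zeta> = 0" using \<zeta> by (simp add: vdh[OF c(2)] zero_prod_def)
  obtain P :: "(real^'n) \<times> (real^'n) \<Rightarrow> real^'k" where P: "bounded_linear P"
    "\<And>v. P (vd c ?h p v) = 0 \<Longrightarrow> vd c ?h p v = 0"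
    by (rule injective_on_range[OF linear_vd[OF M Ch[OF p] c] z0 hz dim]) blast
  let ?\<psi>' = "\<lambda>q. (fst (F q), P (f q, \<nu> q))"
  have C\<psi>': "Cr_at r M ?\<psi>' q" if "q \<in> carrier M" for q
    by (rule Cr_at_Pair[OF M Cr_at_bounded_linear[OF CF[OF that] bounded_linear_fst] Cr_at_bounded_linear[OF Ch[OF that] P(1)]])
  have vd\<psi>: "vd c ?\<psi>' q = (\<lambda>v. (fst (vd c F q v), P (vd c f q v, vd c \<nu> q v)))" if q: "q \<in> fst c" for q
    unfolding vd_Pair[OF M Cr_at_bounded_linear[OF CF[OF cin[OF q]] bounded_linear_fst] Cr_at_bounded_linear[OF Ch[OF cin[OF q]] P(1)] c(1) q]
      vd_parts(1)[OF c(1) q] vd_bounded_linear[OF M Ch[OF cin[OF q]] c(1) q P(1)] vdh[OF q] ..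
  define \<psi> where "\<psi> x = ?\<psi>' (cinv c x)" for x
  have C\<psi>: "Cr_on r ?V \<psi>"
    unfolding \<psi>_def[abs_def]
    by (rule Cr_on_chart[OF M c(1) openin_chart[OF M c(1)] order_refl]) (use C\<psi>' cin in blast)
  have D\<psi>: "(\<psi> has_derivative vd c ?\<psi>' q) (at (snd c q))" if "q \<in> fst c" for q
    unfolding \<psi>_def[abs_def] by (rule vd_has_derivative[OF M C\<psi>'[OF cin[OF that]] c(1) that])
  have "inj (vd c ?\<psi>' p)"
    unfolding linear_injective_0[OF linear_vd[OF M C\<psi>'[OF p] c]]
  proof (intro allI impI)
    fix v assume "vd c ?\<psi>' p v = 0"
    then have v: "fst (vd c F p v) = 0" "P (vd c ?h p v) = 0" by (simp_all add: vd\<psi>[OF c(2)] vdh[OF c(2)] zero_prod_def)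
    have "vd c ?h p v = 0" by (rule P(2)[OF v(2)])
    then show "v = 0" using vd_kernel[OF c _ _ v(1)] by (simp add: vdh[OF c(2)] zero_prod_def)
  qed
  then have inj: "inj (frechet_derivative \<psi> (at (snd c p)))"
    using frechet_derivative_at[OF D\<psi>[OF c(2)]] by simp
  have "CARD('n) > 0" by simp
  then have DIM: "DIM(real \<times> (real^'k)) = CARD('n)" using dim by simp
  obtain U\<^sub>1 W\<^sub>1 g where U1: "open U\<^sub>1" "U\<^sub>1 \<subseteq> ?V" "snd c p \<in> U\<^sub>1" and W1: "open W\<^sub>1" "\<psi> (snd c p) \<in> W\<^sub>1"
    and hom: "homeomorphism U\<^sub>1 W\<^sub>1 \<psi> g" and Cg: "Cr_on r W\<^sub>1 g"
    by (rule Cr_inverse_function[OF oV C\<psi> imageI[OF c(2)] inj DIM])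
  obtain A B' where AB: "open A" "open B'" "\<psi> (snd c p) \<in> A \<times> B'" "A \<times> B' \<subseteq> W\<^sub>1"
    using open_prod_elim[OF W1] .
  define t\<^sub>0 b\<^sub>0 where "t\<^sub>0 = fst (\<psi> (snd c p))" and "b\<^sub>0 = snd (\<psi> (snd c p))"
  obtain e1 where e1: "0 < e1" "ball t\<^sub>0 e1 \<subseteq> A" using AB(1,3) open_contains_ball unfolding t\<^sub>0_def by (metis mem_Times_iff)
  obtain e2 where e2: "0 < e2" "ball b\<^sub>0 e2 \<subseteq> B'" using AB(2,3) open_contains_ball unfolding b\<^sub>0_def by (metis mem_Times_iff)
  define \<epsilon> where "\<epsilon> = min e1 e2"
  define I where "I = {t\<^sub>0 - \<epsilon><..<t\<^sub>0 + \<epsilon>}"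
  define B where "B = ball b\<^sub>0 \<epsilon>"
  have \<epsilon>: "0 < \<epsilon>" using e1 e2 by (simp add: \<epsilon>_def)
  have "I = ball t\<^sub>0 \<epsilon>" by (simp add: I_def ball_eq_greaterThanLessThan)
  then have IB: "I \<times> B \<subseteq> W\<^sub>1" "open (I \<times> B)" "\<psi> (snd c p) \<in> I \<times> B"
    using AB(4) e1(2) e2(2) \<epsilon> by (auto simp: \<epsilon>_def B_def I_def subset_iff open_Times t\<^sub>0_def b\<^sub>0_def mem_Times_iff)
  have g: "g z \<in> U\<^sub>1" "\<psi> (g z) = z" if "z \<in> W\<^sub>1" for z using hom that by (auto simp: homeomorphism_def)
  have g\<psi>: "\<psi> x \<in> W\<^sub>1" "g (\<psi> x) = x" if "x \<in> U\<^sub>1" for x using hom that by (auto simp: homeomorphism_def)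
  define \<theta> where "\<theta> z = cinv c (g z)" for z
  define U where "U = \<theta> ` (I \<times> B)"
  have c\<theta>: "snd c (\<theta> z) = g z" "\<theta> z \<in> fst c" if "z \<in> W\<^sub>1" for z
    using chart_cinv[of "g z" c] cinv_into[of "g z" c] U1(2) g(1)[OF that] unfolding \<theta>_def by blast+
  have \<psi>\<theta>: "?\<psi>' (\<theta> z) = z" if "z \<in> W\<^sub>1" for z using g(2)[OF that] by (simp add: \<psi>_def \<theta>_def)
  have gIB: "g ` (I \<times> B) = U\<^sub>1 \<inter> \<psi> -` (I \<times> B)"
  proof
    show "g ` (I \<times> B) \<subseteq> U\<^sub>1 \<inter> \<psi> -` (I \<times> B)" using g IB(1) by (force simp del: mem_Times_iff)
    show "U\<^sub>1 \<inter> \<psi> -` (I \<times> B) \<subseteq> g ` (I \<times> B)"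
    proof
      fix x assume "x \<in> U\<^sub>1 \<inter> \<psi> -` (I \<times> B)"
      then have x: "x \<in> U\<^sub>1" "\<psi> x \<in> I \<times> B" by blast+
      show "x \<in> g ` (I \<times> B)" using imageI[OF x(2), of g] unfolding g\<psi>(2)[OF x(1)] .
    qed
  qed
  have "open (g ` (I \<times> B))"
    unfolding gIB by (rule continuous_open_preimage[OF homeomorphism_cont1[OF hom] U1(1) IB(2)])
  moreover have "U = cinv c ` g ` (I \<times> B)" unfolding U_def \<theta>_def[abs_def] image_image ..
  moreover have "g ` (I \<times> B) \<subseteq> ?V" using gIB U1(2) by blast
  ultimately have Uop: "openin (mtop M) U" using openin_cinv_image[OF M c(1)] by metis
  have pU: "p \<in> U"
  proof -
    have "\<theta> (\<psi> (snd c p)) = p"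
      unfolding \<theta>_def g\<psi>(2)[OF U1(3)] by (rule cinv_chart[OF pre_manifold_open_atlas[OF M] c])
    then show ?thesis unfolding U_def using IB(3) by force
  qed
  have Uc: "U \<subseteq> fst c" using c\<theta>(2) IB(1) by (auto simp: U_def)
  have const: "?h (\<theta> (t, b)) = ?h (\<theta> (t', b))" if t: "t \<in> I" "t' \<in> I" and b: "b \<in> B" for t t' b
  proof -
    have D0: "((\<lambda>t. ?h (\<theta> (t, b))) has_derivative (\<lambda>_. 0)) (at t within I)" if t: "t \<in> I" for t
    proof -
      let ?z = "(t, b)"
      have z: "?z \<in> W\<^sub>1" using IB(1) t b by blast
      define q where "q = \<theta> ?z"
      have q: "q \<in> fst c" "snd c q = g ?z" using c\<theta>[OF z] by (simp_all add: q_def)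
      define Dg where "Dg = frechet_derivative g (at ?z)"
      have Dg: "(g has_derivative Dg) (at ?z)" unfolding Dg_def by (rule Cr_on_has_derivative[OF Cg z])
      have \<psi>q: "\<psi> (snd c q) = ?z" using g(2)[OF z] q(2) by simp
      \<comment> \<open>The coordinates send the null direction at \<open>q\<close> to (1, 0),
        because d(f, \<nu>) kills it and \<open>P\<close> is linear. It is therefore the tangent
        \<open>Dg (1, 0)\<close> of the t-line through \<open>q\<close>, and (f, \<nu>) has zero
        derivative along that line. This works at every \<open>q\<close>, although \<open>P\<close>
        was chosen for \<open>p\<close>.\<close>
      obtain \<xi> where \<xi>: "vd c f q \<xi> = 0" "vd c \<nu> q \<xi> = 0" "fst (vd c F q \<xi>) = 1" using c(1) q(1) by (rule null_direction)
      have P0: "P (0, 0) = 0" using linear_0[OF bounded_linear.linear[OF P(1)]] by (simp add: zero_prod_def)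
      have "((\<lambda>x. g (\<psi> x)) has_derivative (\<lambda>v. Dg (vd c ?\<psi>' q v))) (at (snd c q))"
        by (rule has_derivative_compose[OF D\<psi>[OF q(1)]]) (use Dg \<psi>q in simp)
      moreover have "((\<lambda>x. g (\<psi> x)) has_derivative (\<lambda>v. v)) (at (snd c q))"
      proof (rule has_derivative_transform_within_open[OF has_derivative_ident U1(1)])
        show "snd c q \<in> U\<^sub>1" using g(1)[OF z] q(2) by simp
      qed (use g\<psi>(2) in simp)
      ultimately have "(\<lambda>v. Dg (vd c ?\<psi>' q v)) = (\<lambda>v. v)" by (rule has_derivative_unique)
      from fun_cong[OF this, of \<xi>] have Dg1: "Dg (1, 0) = \<xi>" by (simp add: vd\<psi>[OF q(1)] \<xi> P0)
      have 1: "((\<lambda>t. (t, b)) has_derivative (\<lambda>s. (s, 0))) (at t within I)"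
        by (auto intro!: derivative_eq_intros)
      have 2: "((\<lambda>t. g (t, b)) has_derivative (\<lambda>s. Dg (s, 0))) (at t within I)"
        by (rule has_derivative_compose[OF 1 Dg])
      have 3: "((\<lambda>x. ?h (cinv c x)) has_derivative vd c ?h q) (at (g ?z))"
        using vd_has_derivative[OF M Ch[OF cin[OF q(1)]] c(1) q(1)] q(2) by simp
      have "((\<lambda>t. ?h (cinv c (g (t, b)))) has_derivative (\<lambda>s. vd c ?h q (Dg (s, 0)))) (at t within I)"
        by (rule has_derivative_compose[OF 2 3])
      moreover have "vd c ?h q (Dg (s, 0)) = 0" for s
      proof -
        have "Dg (s, 0) = Dg (s *\<^sub>R (1, 0))" by simp
        also have "\<dots> = s *\<^sub>R \<xi>" using linear_scale[OF has_derivative_linear[OF Dg], of s "(1, 0)"] Dg1 by simp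
        finally have "Dg (s, 0) = s *\<^sub>R \<xi>" .
        then show ?thesis
          using linear_scale[OF linear_vd[OF M Ch[OF cin[OF q(1)]] c(1) q(1)], of s \<xi>] \<xi>(1,2)
          by (simp add: vdh[OF q(1)] zero_prod_def)
      qed
      ultimately show ?thesis by (simp add: \<theta>_def)
    qed
    have "convex I" by (simp add: I_def)
    then obtain y where "\<And>t. t \<in> I \<Longrightarrow> ?h (\<theta> (t, b)) = y"
      using has_derivative_zero_constant[of I "\<lambda>t. ?h (\<theta> (t, b))"] D0 by blast
    then show ?thesis using t by simp
  qed
  show thesis
  proof (rule that[OF _ pU], rule straight_patch.intro[OF null_front_axioms],
      rule straight_patch_axioms.intro[OF dim I_def B_def c(1) Uop Uc \<epsilon> P(1)])
    show "?\<psi>' q \<in> I \<times> B" "\<theta> (?\<psi>' q) = q" if "q \<in> U" for q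
    proof -
      obtain z where z: "z \<in> I \<times> B" "q = \<theta> z" using \<open>q \<in> U\<close> by (auto simp: U_def)
      have "?\<psi>' q = z" unfolding z(2) by (rule \<psi>\<theta>) (use IB(1) z(1) in blast)
      then show "?\<psi>' q \<in> I \<times> B" "\<theta> (?\<psi>' q) = q" using z by simp_all
    qed
    show "\<theta> z \<in> U" if "z \<in> I \<times> B" for z using that unfolding U_def by (rule imageI)
    show "?\<psi>' (\<theta> z) = z" if "z \<in> I \<times> B" for z by (rule \<psi>\<theta>) (use IB(1) that in blast)
    show "Cr_on r (I \<times> B) (\<lambda>z. snd c (\<theta> z))"
      by (rule Cr_on_cong[OF IB(2) Cr_on_subset[OF Cg IB(1)]]) (use c\<theta>(1)[OF subsetD[OF IB(1)]] in simp)
    show "?h (\<theta> (t, b)) = ?h (\<theta> (t', b))" if "t \<in> I" "t' \<in> I" "b \<in> B" for t t' b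
      by (rule const[OF that])
  qed
qed

section \<open>The slice of a straight patch and its fundamental data\<close>

context straight_patch
begin

definition \<kappa> :: "'a \<Rightarrow> real^'k" where "\<kappa> q = P (f q, \<nu> q)"
text \<open>The slice lies at the central time \<open>t\<^sub>0\<close> of the patch, which may be
  far from time 0; the front that belongs to it is moved to time 0 by taking \<open>f\<close> as its
  position.\<close>

definition A :: "'a set" where "A = {q \<in> U. fst (F q) = t\<^sub>0}"
text \<open>Slides \<open>q\<close> along its light-like line to the slice.\<close>

definition \<rho> :: "'a \<Rightarrow> 'a" where "\<rho> q = \<theta> (t\<^sub>0, \<kappa> q)"

lemma t0: "t\<^sub>0 \<in> I" and oI: "open I" and oB: "open B" and oIB: "open (I \<times> B)"
  using \<epsilon> by (simp_all add: I_def B_def open_Times)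

lemma U_carrier: "q \<in> U \<Longrightarrow> q \<in> carrier M" using openin_carrier[OF M U] by blast
lemma AU: "A \<subseteq> U" by (auto simp: A_def)

lemma patch: "q \<in> U \<Longrightarrow> fst (F q) \<in> I" "q \<in> U \<Longrightarrow> \<kappa> q \<in> B" "q \<in> U \<Longrightarrow> \<theta> (fst (F q), \<kappa> q) = q"
  using in_IB \<theta>_chart by (simp_all add: \<kappa>_def)

lemma patch': "t \<in> I \<Longrightarrow> b \<in> B \<Longrightarrow> \<theta> (t, b) \<in> U" "t \<in> I \<Longrightarrow> b \<in> B \<Longrightarrow> fst (F (\<theta> (t, b))) = t"
  "t \<in> I \<Longrightarrow> b \<in> B \<Longrightarrow> \<kappa> (\<theta> (t, b)) = b"
  using \<theta>_in[of "(t, b)"] chart_\<theta>[of "(t, b)"] by (simp_all add: \<kappa>_def)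

lemma slice: "b \<in> B \<Longrightarrow> \<theta> (t\<^sub>0, b) \<in> A"
  using patch' t0 by (simp add: A_def)

lemma \<kappa>A: "\<kappa> ` A = B"
proof
  show "\<kappa> ` A \<subseteq> B" using patch(2) AU by blast
  show "B \<subseteq> \<kappa> ` A"
  proof
    fix b assume b: "b \<in> B"
    show "b \<in> \<kappa> ` A" using imageI[OF slice[OF b], of \<kappa>] patch'(3)[OF t0 b] by simp
  qed
qed

lemma \<theta>_A: "q \<in> A \<Longrightarrow> \<theta> (t\<^sub>0, \<kappa> q) = q"
  using patch(3)[of q] by (simp add: A_def)

lemma \<kappa>_inj: "inj_on \<kappa> A"
  by (rule inj_onI) (metis \<theta>_A)

lemma inv_\<kappa>: "b \<in> B \<Longrightarrow> inv_into A \<kappa> b = \<theta> (t\<^sub>0, b)"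
  by (rule inv_into_f_eq[OF \<kappa>_inj slice]) (use patch'(3)[OF t0] in auto)

sublocale s: single_chart A \<kappa>
  by unfold_locales (use \<kappa>_inj \<kappa>A oB in auto)

lemma \<rho>: assumes q: "q \<in> U"
  shows "\<rho> q \<in> A" "\<kappa> (\<rho> q) = \<kappa> q" "f (\<rho> q) = f q" "\<nu> (\<rho> q) = \<nu> q"
proof -
  note b = patch(2)[OF q]
  show "\<rho> q \<in> A" unfolding \<rho>_def by (rule slice[OF b])
  show "\<kappa> (\<rho> q) = \<kappa> q" unfolding \<rho>_def by (rule patch'(3)[OF t0 b])
  show "f (\<rho> q) = f q" "\<nu> (\<rho> q) = \<nu> q"
    using const[OF t0 patch(1)[OF q] b] patch(3)[OF q] by (simp_all add: \<rho>_def)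
qed

lemma \<rho>_A: "q \<in> A \<Longrightarrow> \<rho> q = q" by (simp add: \<rho>_def \<theta>_A)

lemma C\<kappa>: "q \<in> carrier M \<Longrightarrow> Cr_at r M \<kappa> q"
  unfolding \<kappa>_def[abs_def] by (rule Cr_at_bounded_linear[OF Cr_at_Pair[OF M Cf C\<nu>] P])

lemma C\<tau>: "q \<in> carrier M \<Longrightarrow> Cr_at r M (\<lambda>q. fst (F q)) q"
  by (rule Cr_at_bounded_linear[OF CF bounded_linear_fst])

lemma cU: "q \<in> U \<Longrightarrow> cinv c (snd c q) = q"
  using cinv_chart[OF pre_manifold_open_atlas[OF M] c] Uc by blast

lemma C\<theta>_slice: assumes t: "t \<in> I" shows "Cr_on r B (\<lambda>b. snd c (\<theta> (t, b)))"
  by (rule Cr_on_compose[OF oB oIB _ Cr_on_Pair[OF oB Cr_on_const Cr_on_id] C\<theta>]) (use t in blast)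

lemma Cr_at_slice:
  fixes u :: "'a \<Rightarrow> 'v::banach"
  assumes u: "\<And>q. q \<in> U \<Longrightarrow> Cr_at r M u q" and q: "q \<in> A"
  shows "Cr_at r s.S u q"
proof (rule s.Cr_at_S[OF _ q], unfold \<kappa>A)
  have oU: "open (snd c ` U)" using openin_chart_subset[OF M c Uc] U by blast
  have 1: "Cr_on r B (\<lambda>b. u (cinv c (snd c (\<theta> (t\<^sub>0, b)))))"
    by (rule Cr_on_compose[OF oB oU _ C\<theta>_slice[OF t0] Cr_on_chart[OF M c U Uc u]]) (use patch'(1)[OF t0] in blast)
  show "Cr_on r B (\<lambda>x. u (inv_into A \<kappa> x))"
    by (rule Cr_on_cong[OF oB 1]) (use cU[OF patch'(1)[OF t0]] inv_\<kappa> in simp)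
qed

lemma Cr_at_slice_chart: "q \<in> A \<Longrightarrow> Cr_at r s.S (snd c) q"
  by (rule Cr_at_slice) (use Cr_at_chart[OF M c] Uc in blast)

text \<open>The chain rule for the inclusion of the slice, which is read in the ambient chart
  through \<open>snd c\<close>.\<close>

lemma vd_slice:
  fixes u :: "'a \<Rightarrow> 'v::banach"
  assumes u: "\<And>q. q \<in> U \<Longrightarrow> Cr_at r M u q" and q: "q \<in> A"
  shows "vd (A, \<kappa>) u q v = vd c u q (vd (A, \<kappa>) (snd c) q v)"
proof -
  have qU: "q \<in> U" using q AU by blast
  have e: "(A, \<kappa>) \<in> s.S" "q \<in> fst (A, \<kappa>)" using q by simp_all
  have d: "((\<lambda>x. u (cinv c x)) has_derivative vd c u q) (at (snd c q))"
    by (rule vd_has_derivative[OF M u[OF qU] c]) (use qU Uc in blast)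
  have "vd (A, \<kappa>) (\<lambda>q. u (cinv c (snd c q))) q = (\<lambda>v. vd c u q (vd (A, \<kappa>) (snd c) q v))"
    by (rule vd_compose[OF s.S_pre Cr_at_slice_chart[OF q] e d])
  moreover have "vd (A, \<kappa>) (\<lambda>q. u (cinv c (snd c q))) q = vd (A, \<kappa>) u q"
    by (rule vd_cong[OF s.S_pre Cr_at_slice[OF u q] e openin_carrier_self[OF s.S_pre]])
       (use q AU cU in \<open>auto simp: s.carrier_S\<close>)
  ultimately show ?thesis by simp
qed

lemma Cf_slice: "q \<in> A \<Longrightarrow> Cr_at r s.S f q" and C\<nu>_slice: "q \<in> A \<Longrightarrow> Cr_at r s.S \<nu> q"
  by (rule Cr_at_slice; use Cf C\<nu> U_carrier in blast)+

lemma vd_\<kappa>: assumes q: "q \<in> A" shows "vd (A, \<kappa>) \<kappa> q = (\<lambda>v. v)"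
proof -
  have e: "(A, \<kappa>) \<in> s.S" "q \<in> fst (A, \<kappa>)" using q by simp_all
  show ?thesis using vd_chart[OF s.S_pre e] by simp
qed

lemma C\<kappa>_slice: "q \<in> A \<Longrightarrow> Cr_at r s.S \<kappa> q"
  by (rule Cr_at_slice) (use C\<kappa> U_carrier in blast)

text \<open>Orthogonality is inherited from the whole front; (f, \<nu>) is an immersion of the slice
  because its chart \<kappa> is \<open>P\<close> applied to (f, \<nu>).\<close>

lemma slice_front: "euclidean_front r s.S f \<nu>"
proof
  show "pre_manifold r s.S" by (rule s.S_pre)
  show "CARD('k) = CARD('n) - 1" by (rule dim)
  show "Cr_at r s.S f p" "Cr_at r s.S \<nu> p" if "p \<in> carrier s.S" for p
    using that Cf_slice C\<nu>_slice by (simp_all add: s.carrier_S)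
  show "norm (\<nu> p) = 1" if "p \<in> carrier s.S" for p
    using that unit U_carrier AU by (auto simp: s.carrier_S)
  fix e p assume e: "e \<in> s.S" "p \<in> fst e"
  then have e': "e = (A, \<kappa>)" and p: "p \<in> A" by simp_all
  have pc: "p \<in> fst c" "p \<in> U" using p AU Uc by blast+
  show "\<nu> p \<bullet> vd e f p v = 0" for v
  proof -
    have "vd (A, \<kappa>) f p v = vd c f p (vd (A, \<kappa>) (snd c) p v)"
      by (rule vd_slice[OF _ p]) (use Cf U_carrier in blast)
    then show ?thesis unfolding e' using f_orth[OF c pc(1)] by simp
  qed
  show "inj (vd e (\<lambda>q. (f q, \<nu> q)) p)"
  proof (rule inj_vd_factor[OF s.S_pre Cr_at_Pair[OF s.S_pre Cf_slice[OF p] C\<nu>_slice[OF p]] e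
        bounded_linear.has_derivative[OF P has_derivative_ident] C\<kappa>_slice[OF p]])
    show "inj (vd e \<kappa> p)" unfolding e' vd_\<kappa>[OF p] by (simp add: inj_def)
    show "openin (mtop s.S) (fst e)" by (rule openin_chart[OF s.S_pre e(1)])
  qed (use e in \<open>auto simp: \<kappa>_def\<close>)
qed

sublocale e: euclidean_front r s.S f \<nu> by (rule slice_front)

abbreviation R where "R \<equiv> restr M U"

lemma R: "pre_manifold r R" by (rule pre_manifold_restr[OF M U])
lemma carrier_R: "carrier R = U" by (rule openin_restr(2)[OF pre_manifold_open_atlas[OF M] U])
lemma Cr_at_R: "q \<in> U \<Longrightarrow> Cr_at r R u q \<longleftrightarrow> Cr_at r M u q" by (rule Cr_at_restr[OF M U])
lemma U_R: "openin (mtop R) U" using openin_carrier_self[OF R] carrier_R by simp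

abbreviation cR where "cR \<equiv> (U \<inter> fst c, snd c)"

lemma cR: "cR \<in> R" "q \<in> U \<Longrightarrow> q \<in> fst cR" using c Uc by (auto simp: restr_def)

lemma \<rho>_map: "Cr_map r R s.S \<rho>"
proof (rule Cr_mapI_pre[OF R s.S_pre])
  fix p assume "p \<in> carrier R"
  then have p: "p \<in> U" by (simp add: carrier_R)
  have "Cr_at r R (\<lambda>q. \<kappa> (\<rho> q)) p"
    by (rule Cr_at_cong[OF R _ U_R p, where f = \<kappa>]) (use p C\<kappa>[OF U_carrier[OF p]] Cr_at_R \<rho>(2) in auto)
  then show "\<exists>d\<in>s.S. \<rho> p \<in> fst d \<and> Cr_at r R (\<lambda>q. snd d (\<rho> q)) p \<and> (\<exists>V. openin (mtop R) V \<and> p \<in> V \<and> \<rho> ` V \<subseteq> fst d)"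
    using U_R p \<rho>(1) by auto
qed

text \<open>In coordinates \<rho> is the projection to b. The map b \<mapsto> \<theta> (t, b), with
  t the time of the point, is a regular section, and its derivative is a right inverse of the
  differential.\<close>

lemma \<rho>_submersion: "Cr_submersion r R s.S \<rho>"
  unfolding Cr_submersion_def
proof (rule conjI[OF \<rho>_map], intro ballI impI)
  fix p e d assume "p \<in> carrier R" and e': "e \<in> R" and d: "d \<in> s.S" and "p \<in> fst e \<and> \<rho> p \<in> fst d"
  then have p: "p \<in> U" and e: "e \<in> R" "p \<in> fst e" by (simp_all add: carrier_R)
  have d': "snd d = \<kappa>" using d by simp
  have C: "Cr_at r R \<kappa> p" using C\<kappa>[OF U_carrier[OF p]] Cr_at_R[OF p] by blast
  have eq: "vd e (\<lambda>q. \<kappa> (\<rho> q)) p = vd e \<kappa> p"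
    by (rule vd_cong[OF R C e U_R p]) (simp add: \<rho>(2))
  let ?t = "fst (F p)" and ?b = "\<kappa> p"
  let ?D = "frechet_derivative (\<lambda>b. snd c (\<theta> (?t, b))) (at ?b)"
  have t: "?t \<in> I" and b: "?b \<in> B" using patch p by blast+
  have 1: "((\<lambda>b. snd c (\<theta> (?t, b))) has_derivative ?D) (at ?b)"
    by (rule Cr_on_has_derivative[OF C\<theta>_slice[OF t] b])
  have 2: "((\<lambda>x. \<kappa> (cinv cR x)) has_derivative vd cR \<kappa> p) (at (snd c (\<theta> (?t, ?b))))"
    using vd_has_derivative[OF R C cR(1) cR(2)[OF p]] patch(3)[OF p] by simp
  have "((\<lambda>b. \<kappa> (cinv cR (snd c (\<theta> (?t, b))))) has_derivative (\<lambda>v. vd cR \<kappa> p (?D v))) (at ?b)"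
    by (rule has_derivative_compose[OF 1 2])
  moreover have "((\<lambda>b. \<kappa> (cinv cR (snd c (\<theta> (?t, b))))) has_derivative (\<lambda>v. v)) (at ?b)"
  proof (rule has_derivative_transform_within_open[OF has_derivative_ident oB b])
    fix x assume x: "x \<in> B"
    have "cinv cR (snd cR (\<theta> (?t, x))) = \<theta> (?t, x)"
      by (rule cinv_chart[OF pre_manifold_open_atlas[OF R] cR(1) cR(2)[OF patch'(1)[OF t x]]])
    then show "x = \<kappa> (cinv cR (snd c (\<theta> (?t, x))))" using patch'(3)[OF t x] by simp
  qed
  ultimately have inv: "(\<lambda>v. vd cR \<kappa> p (?D v)) = (\<lambda>v. v)" by (rule has_derivative_unique)
  have "surj (vd cR \<kappa> p)" by (rule surjI[of _ ?D]) (rule fun_cong[OF inv])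
  then show "surj (mderiv e d \<rho> p)"
    unfolding mderiv_vd d' eq by (rule surj_vd_change_chart[OF R C cR(1) cR(2)[OF p] e])
qed

lemma inclusion_map: "Cr_map r s.S R (\<lambda>x. x)"
proof (rule Cr_mapI_pre[OF s.S_pre R])
  fix p assume "p \<in> carrier s.S"
  then have p: "p \<in> A" by (simp add: s.carrier_S)
  show "\<exists>d\<in>R. p \<in> fst d \<and> Cr_at r s.S (snd d) p \<and> (\<exists>V. openin (mtop s.S) V \<and> p \<in> V \<and> (\<lambda>x. x) ` V \<subseteq> fst d)"
  proof (intro bexI[of _ cR] conjI exI[of _ A])
    show "openin (mtop s.S) A" using openin_carrier_self[OF s.S_pre] by (simp add: s.carrier_S)
  qed (use p AU Uc cR Cr_at_slice_chart in auto)
qed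

text \<open>\<rho> is a continuous retraction of the patch onto the slice, which gives the
  topological part; the differential is injective because the chart \<kappa> of the slice is regular
  on the whole patch.\<close>

lemma inclusion_embedding: "Cr_embedding r s.S R (\<lambda>x. x)"
  unfolding Cr_embedding_def
proof
  show "Cr_immersion r s.S R (\<lambda>x. x)"
  proof (rule Cr_immersionI[OF s.S_pre inclusion_map])
    fix p d assume pS: "p \<in> carrier s.S" and d: "d \<in> R" "p \<in> fst d"
    then have p: "p \<in> A" by (simp add: s.carrier_S)
    have pU: "p \<in> U" using p AU by blast
    have C: "Cr_at r s.S (snd d) p" by (rule Cr_mapD_pre[OF s.S_pre R inclusion_map pS d])
    have CR: "Cr_at r R \<kappa> p" using C\<kappa>[OF U_carrier[OF pU]] Cr_at_R[OF pU] by blast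
    obtain V where V: "openin (mtop s.S) V" "p \<in> V" "V \<subseteq> fst d"
      using Cr_mapD(2)[OF s.S_pre openin_chart[OF R d(1)] inclusion_map pS d] by auto
    have e: "(A, \<kappa>) \<in> s.S" "p \<in> fst (A, \<kappa>)" using p by simp_all
    have "inj (vd (A, \<kappa>) (snd d) p)"
    proof (rule inj_vd_factor[OF s.S_pre C e vd_has_derivative[OF R CR d] C\<kappa>_slice[OF p] _ V(1,2)])
      show "inj (vd (A, \<kappa>) \<kappa> p)" unfolding vd_\<kappa>[OF p] by (simp add: inj_def)
      show "\<kappa> q = \<kappa> (cinv d (snd d q))" if "q \<in> V" for q
        using cinv_chart[OF pre_manifold_open_atlas[OF R] d(1)] V(3) that by (metis subsetD)
    qed
    then show "Cr_at r s.S (snd d) p \<and> (\<exists>e\<in>s.S. p \<in> fst e \<and> inj (vd e (snd d) p))"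
      using C e by blast
  qed
  have "continuous_map (mtop R) (mtop s.S) \<rho>" using \<rho>_map by (simp add: Cr_map_def)
  then show "embedding_map (mtop s.S) (mtop R) (\<lambda>x. x)"
    by (intro embedding_mapI[where g = \<rho>])
       (use inclusion_map \<rho>_A in \<open>auto simp: Cr_map_def s.topspace_S intro: continuous_map_from_subtopology\<close>)
qed

definition D :: "('a, 'n, 'k) fdata" where
  "D = \<lparr>U_of = U, Sigma_of = s.S, tau_of = \<lambda>q. fst (F q), rho_of = \<rho>, g_of = \<lambda>q. (0, f q),
        xi_of = \<lambda>q. (1, \<nu> q), I_of = I\<rparr>"

lemma l_embedding: "Cr_embedding r s.S euclid (l_of D)"
proof (rule s.S_embedding)
  show "Cr_at r s.S (l_of D) q" if "q \<in> A" for q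
  proof -
    have q: "q \<in> carrier s.S" using that by (simp add: s.carrier_S)
    have "Cr_at r s.S (\<lambda>q. ((0::real, f q), (1::real, \<nu> q))) q"
      by (intro Cr_at_Pair[OF s.S_pre] Cr_at_const[OF s.S_pre q] Cf_slice C\<nu>_slice that)
    then show ?thesis by (simp add: l_of_def[abs_def] D_def)
  qed
  let ?T = "\<lambda>z :: 'n mink \<times> 'n mink. (snd (fst z), snd (snd z))"
  have "((\<lambda>z. P (?T z)) has_derivative (\<lambda>v. P (?T v))) (at z)" for z
    by (rule bounded_linear.has_derivative[OF P]) (auto intro!: derivative_eq_intros)
  then show "((\<lambda>z. P (?T z)) has_derivative (\<lambda>v. P (?T v))) (at z)" for z .
  show "\<kappa> q = P (?T (l_of D q))" for q by (simp add: l_of_def D_def \<kappa>_def)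
qed

lemma product_slice: assumes oJ: "open J"
  shows "single_chart (J \<times> A) (map_prod (\<lambda>t::real. t) \<kappa>)"
    "prod_atlas {(J, \<lambda>t. t)} s.S = {(J \<times> A, map_prod (\<lambda>t. t) \<kappa>)}" "map_prod (\<lambda>t. t) \<kappa> ` (J \<times> A) = J \<times> B"
proof -
  show im: "map_prod (\<lambda>t. t) \<kappa> ` (J \<times> A) = J \<times> B" by (rule map_prod_surj_on) (simp_all add: \<kappa>A)
  show "single_chart (J \<times> A) (map_prod (\<lambda>t. t) \<kappa>)"
  proof
    show "inj_on (map_prod (\<lambda>t. t) \<kappa>) (J \<times> A)" by (rule map_prod_inj_on) (simp_all add: \<kappa>_inj)
    show "open (map_prod (\<lambda>t. t) \<kappa> ` (J \<times> A))" unfolding im by (rule open_Times[OF oJ oB])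
  qed
  show "prod_atlas {(J, \<lambda>t. t)} s.S = {(J \<times> A, map_prod (\<lambda>t. t) \<kappa>)}" by (auto simp: prod_atlas_def)
qed

lemma L_embedding: "Cr_embedding r (prod_atlas euclid s.S) euclid (L_of D)"
proof -
  interpret p: single_chart "UNIV \<times> A" "map_prod (\<lambda>t::real. t) \<kappa>" by (rule product_slice(1)[OF open_UNIV])
  have pe: "prod_atlas euclid s.S = p.S" unfolding euclid_def by (rule product_slice(2)[OF open_UNIV])
  show ?thesis
    unfolding pe
  proof (rule p.S_embedding)
    show "Cr_at r p.S (L_of D) q" if "q \<in> UNIV \<times> A" for q
    proof -
      have q: "q \<in> carrier (prod_atlas euclid s.S)" unfolding pe p.carrier_S by (rule that)
      have "Cr_at r (prod_atlas euclid s.S) (\<lambda>q. (normal_F f \<nu> q, (1::real, \<nu> (snd q)))) q"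
        by (intro Cr_at_Pair[OF e.P] e.P_regular[OF q] Cr_at_const[OF e.P q])
      moreover have "(\<lambda>q. (normal_F f \<nu> q, (1::real, \<nu> (snd q)))) = L_of D"
        by (auto simp: L_of_def G_of_def D_def normal_F_def)
      ultimately show ?thesis unfolding pe by simp
    qed
    \<comment> \<open>Recovers (f, \<nu>) from the lift at time t by subtracting t \<nu> from the
      position. This is quadratic in the lift, so its derivative \<open>?T'\<close> depends on the
      point.\<close>
    let ?T = "\<lambda>z :: 'n mink \<times> 'n mink. (snd (fst z) - fst (fst z) *\<^sub>R snd (snd z), snd (snd z))"
    let ?T' = "\<lambda>z v :: 'n mink \<times> 'n mink. (snd (fst v) - (fst (fst z) *\<^sub>R snd (snd v) + fst (fst v) *\<^sub>R snd (snd z)), snd (snd v))"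
    show "((\<lambda>z. (fst (fst z), P (?T z))) has_derivative (\<lambda>v. (fst (fst v), P (?T' z v)))) (at z)" for z
    proof (rule has_derivative_Pair)
      show "((\<lambda>z :: 'n mink \<times> 'n mink. fst (fst z)) has_derivative (\<lambda>v. fst (fst v))) (at z)"
        by (auto intro!: derivative_eq_intros)
      show "((\<lambda>z. P (?T z)) has_derivative (\<lambda>v. P (?T' z v))) (at z)"
        by (rule bounded_linear.has_derivative[OF P]) (auto intro!: derivative_eq_intros)
    qed
    show "map_prod (\<lambda>t. t) \<kappa> q = (fst (fst (L_of D q)), P (?T (L_of D q)))" for q
      by (cases q) (simp add: L_of_def G_of_def D_def \<kappa>_def)
  qed
qed

lemma Phi_diffeo: "Cr_diffeo r R (prod_atlas (restr euclid I) s.S) (Phi_of D)"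
proof -
  interpret p: single_chart "I \<times> A" "map_prod (\<lambda>t::real. t) \<kappa>" by (rule product_slice(1)[OF oI])
  have "restr (euclid :: (real, real) atlas) I = {(I, \<lambda>t. t)}" by (simp add: restr_def euclid_def)
  then have pe: "prod_atlas (restr euclid I) s.S = p.S" using product_slice(2)[OF oI] by simp
  \<comment> \<open>\<open>?\<Psi>\<close> takes a time and a point of the slice to the point at
    that time on the same line.\<close>
  let ?\<Phi> = "\<lambda>q. (fst (F q), \<rho> q)" and ?\<Psi> = "\<lambda>z. \<theta> (fst z, \<kappa> (snd z))"
  have \<Phi>: "Phi_of D = ?\<Phi>" by (auto simp: Phi_of_def D_def)
  have in1: "?\<Phi> q \<in> I \<times> A" "?\<Psi> (?\<Phi> q) = q" if "q \<in> U" for q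
    using that patch \<rho> by auto
  have in2: "?\<Psi> z \<in> U" "?\<Phi> (?\<Psi> z) = z" if z: "z \<in> I \<times> A" for z
  proof -
    have *: "fst z \<in> I" "snd z \<in> A" "\<kappa> (snd z) \<in> B" using z \<kappa>A by auto
    show "?\<Psi> z \<in> U" by (rule patch'(1)[OF *(1,3)])
    show "?\<Phi> (?\<Psi> z) = z" using patch'(2,3)[OF *(1,3)] \<theta>_A[OF *(2)] by (simp add: \<rho>_def prod_eq_iff)
  qed
  have bij: "bij_betw ?\<Phi> U (I \<times> A)"
    by (rule bij_betw_byWitness[where f' = ?\<Psi>]) (use in1 in2 in blast)+
  have inv: "inv_into U ?\<Phi> z = ?\<Psi> z" if "z \<in> I \<times> A" for z
    by (rule inv_into_f_eq[OF bij_betw_imp_inj_on[OF bij] in2[OF that]])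
  have map1: "Cr_map r R p.S ?\<Phi>"
  proof (rule Cr_mapI_pre[OF R p.S_pre])
    fix q assume "q \<in> carrier R"
    then have q: "q \<in> U" by (simp add: carrier_R)
    have "Cr_at r M (\<lambda>q. (fst (F q), \<kappa> q)) q"
      by (rule Cr_at_Pair[OF M C\<tau>[OF U_carrier[OF q]] C\<kappa>[OF U_carrier[OF q]]])
    then have 1: "Cr_at r R (\<lambda>q. (fst (F q), \<kappa> q)) q" using Cr_at_R[OF q] by blast
    have "Cr_at r R (\<lambda>q. map_prod (\<lambda>t. t) \<kappa> (?\<Phi> q)) q"
      by (rule Cr_at_cong[OF R 1 U_R q]) (simp add: \<rho>(2))
    then show "\<exists>d\<in>p.S. ?\<Phi> q \<in> fst d \<and> Cr_at r R (\<lambda>q. snd d (?\<Phi> q)) q \<and>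
        (\<exists>V. openin (mtop R) V \<and> q \<in> V \<and> ?\<Phi> ` V \<subseteq> fst d)"
      using in1(1) q U_R by (intro bexI[of _ "(I \<times> A, map_prod (\<lambda>t. t) \<kappa>)"] conjI exI[of _ U]) auto
  qed
  have map2: "Cr_map r p.S R (inv_into U ?\<Phi>)"
  proof (rule Cr_mapI_pre[OF p.S_pre R])
    fix z assume "z \<in> carrier p.S"
    then have z: "z \<in> I \<times> A" unfolding p.carrier_S .
    have "Cr_at r p.S (\<lambda>z. snd c (inv_into U ?\<Phi> z)) z"
    proof (rule p.Cr_at_S[OF _ z], unfold product_slice(3)[OF oI])
      show "Cr_on r (I \<times> B) (\<lambda>x. snd c (inv_into U ?\<Phi> (inv_into (I \<times> A) (map_prod (\<lambda>t. t) \<kappa>) x)))"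
      proof (rule Cr_on_cong[OF oIB C\<theta>])
        fix x assume x: "x \<in> I \<times> B"
        have x': "(fst x, \<theta> (t\<^sub>0, snd x)) \<in> I \<times> A" using x slice by auto
        have "inv_into (I \<times> A) (map_prod (\<lambda>t. t) \<kappa>) x = (fst x, \<theta> (t\<^sub>0, snd x))"
          by (rule inv_into_f_eq[OF p.inj x']) (use x patch'(3)[OF t0] in auto)
        then show "snd c (\<theta> x) = snd c (inv_into U ?\<Phi> (inv_into (I \<times> A) (map_prod (\<lambda>t. t) \<kappa>) x))"
          using inv[OF x'] patch'(3)[OF t0] x by auto
      qed
    qed
    moreover have "openin (mtop p.S) (I \<times> A)" using openin_carrier_self[OF p.S_pre] unfolding p.carrier_S .
    moreover have "inv_into U ?\<Phi> ` (I \<times> A) \<subseteq> fst cR" using inv in2(1) Uc by auto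
    ultimately show "\<exists>d\<in>R. inv_into U ?\<Phi> z \<in> fst d \<and> Cr_at r p.S (\<lambda>z. snd d (inv_into U ?\<Phi> z)) z \<and>
        (\<exists>V. openin (mtop p.S) V \<and> z \<in> V \<and> inv_into U ?\<Phi> ` V \<subseteq> fst d)"
      using z cR(1) by (intro bexI[of _ cR] conjI exI[of _ "I \<times> A"]) auto
  qed
  show ?thesis
    unfolding Cr_diffeo_def pe \<Phi> carrier_R p.carrier_S using bij map1 map2 by blast
qed

lemma fundamental: assumes p: "p \<in> U" shows "fundamental_data r M F \<alpha> p D"
proof -
  have [simp]: "U_of D = U" "Sigma_of D = s.S" "tau_of D = (\<lambda>q. fst (F q))" "rho_of D = \<rho>" "g_of D = (\<lambda>q. (0, f q))"
    "xi_of D = (\<lambda>q. (1, \<nu> q))" "I_of D = I" by (simp_all add: D_def)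
  have o: "snd \<circ> g_of D = f" "snd \<circ> xi_of D = \<nu>" by (auto simp: o_def)
  have "connected B" by (simp add: B_def)
  then have conn: "connected_space (mtop s.S)" using s.connected_S \<kappa>A by simp
  have \<rho>U: "\<rho> ` U = A"
  proof
    show "\<rho> ` U \<subseteq> A" using \<rho>(1) by blast
    show "A \<subseteq> \<rho> ` U"
    proof
      fix x assume x: "x \<in> A"
      show "x \<in> \<rho> ` U" using imageI[OF subsetD[OF AU x], of \<rho>] \<rho>_A[OF x] by simp
    qed
  qed
  have FG: "F q = G_of D (Phi_of D q)" if "q \<in> U" for q
    using F_eq[of q] \<rho>(3,4)[OF that] by (simp add: G_of_def Phi_of_def)
  show ?thesis
    unfolding fundamental_data_def o
  proof (intro conjI ballI)
    show "canonical_lift F \<alpha> q = L_of D (Phi_of D q)" if "q \<in> U_of D" for q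
      using FG[of q] xihat[OF U_carrier[of q]] \<rho>(4)[of q] that by (simp add: canonical_lift_def L_of_def Phi_of_def)
    show "F q = G_of D (Phi_of D q)" if "q \<in> U_of D" for q using FG that by simp
    show "\<exists>\<nu>. euclidean_front_with r (Sigma_of D) f \<nu>" using e.euclidean_front_with by auto
    show "unit_normal_field r (Sigma_of D) f \<nu>" using e.unit_normal_field by simp
    show "(\<exists>t e. e > 0 \<and> I_of D = {t - e<..<t + e}) \<or> I_of D = UNIV"
      by (rule disjI1, rule exI[of _ t\<^sub>0], rule exI[of _ \<epsilon>]) (use \<epsilon> in \<open>simp flip: I_def\<close>)
    show "xi_of D x = xihat_E \<alpha> x" if "x \<in> carrier (Sigma_of D)" for x
      using that xihat[OF U_carrier[of x]] AU by (auto simp: s.carrier_S)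
    show "carrier (Sigma_of D) \<subseteq> U_of D" using AU by (simp add: s.carrier_S)
    show "rho_of D ` U_of D = carrier (Sigma_of D)" using \<rho>U by (simp add: s.carrier_S)
    show "Cr_embedding r (Sigma_of D) euclid (l_of D)" using l_embedding by simp
    show "Cr_embedding r (prod_atlas euclid (Sigma_of D)) euclid (L_of D)" using L_embedding by simp
    show "Cr_diffeo r (restr M (U_of D)) (prod_atlas (restr euclid (I_of D)) (Sigma_of D)) (Phi_of D)"
      using Phi_diffeo by simp
    show "Cr_submersion r (restr M (U_of D)) (Sigma_of D) (rho_of D)" using \<rho>_submersion by simp
    show "Cr_embedding r (Sigma_of D) (restr M (U_of D)) (\<lambda>x. x)" using inclusion_embedding by simp
  qed (use U p conn s.S_manifold in auto)
qed

end

lemma (in null_front) fundamental_data_exists: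
  assumes dim: "CARD('k::finite) = CARD('n) - 1" and p: "p \<in> carrier M"
  shows "\<exists>D :: ('a, 'n, 'k) fdata. fundamental_data r M F \<alpha> p D"
proof -
  obtain c U t\<^sub>0 \<epsilon> b\<^sub>0 \<theta> and P :: "(real^'n) \<times> (real^'n) \<Rightarrow> real^'k" and I B
    where sp: "straight_patch r M F \<alpha> c U t\<^sub>0 \<epsilon> b\<^sub>0 \<theta> P I B" and pU: "p \<in> U"
    by (rule straightening[OF dim p])
  interpret straight_patch r M F \<alpha> c U t\<^sub>0 \<epsilon> b\<^sub>0 \<theta> P I B by (rule sp)
  show ?thesis using fundamental[OF pU] by blast
qed

lemma analytic_front_admissible:
  fixes M :: "('a, real^'n::finite) atlas" and F :: "'a \<Rightarrow> 'n mink" and \<alpha> :: "'a \<Rightarrow> 'n dual"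
  assumes dim: "CARD('k::finite) = CARD('n) - 1" and mf: "Cr_manifold Analytic M" and front: "null_wave_front Analytic M F \<alpha>"
  shows "admissible_front TYPE('k) Analytic M F \<alpha>"
proof -
  interpret null_front Analytic M F \<alpha>
    by unfold_locales (use front Cr_manifold_pre[OF mf] in auto)
  have tM: "topspace (mtop M) = carrier M" by (rule topspace_mtop[OF pre_manifold_open_atlas[OF Cr_manifold_pre[OF mf]]])
  define D where "D p = (SOME D :: ('a, 'n, 'k) fdata. fundamental_data Analytic M F \<alpha> p D)" for p
  have D: "fundamental_data Analytic M F \<alpha> p (D p)" if "p \<in> carrier M" for p
    unfolding D_def by (rule someI_ex[OF fundamental_data_exists[OF dim that]])
  have DU: "openin (mtop M) (U_of (D p)) \<and> p \<in> U_of (D p)" if "p \<in> topspace (mtop M)" for p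
    using D[of p] that unfolding tM fundamental_data_def by blast
  have "second_countable (mtop M)" using mf by (simp add: Cr_manifold_iff)
  then obtain X where X: "countable X" "X \<subseteq> topspace (mtop M)" "(\<Union>p\<in>X. U_of (D p)) = topspace (mtop M)"
    using DU by (rule countable_subcover)
  have XD: "fundamental_data Analytic M F \<alpha> p (D p)" if "p \<in> X" for p using D X(2) that unfolding tM by blast
  have parts: "Cr_manifold Analytic (Sigma_of (D p))" "connected_space (mtop (Sigma_of (D p)))"
    "Cr_embedding Analytic (Sigma_of (D p)) euclid (l_of (D p))" if "p \<in> X" for p
    using XD[OF that] unfolding fundamental_data_def by simp_all
  have adm: "admissible_family Analytic (D ` X) Sigma_of l_of"
    unfolding admissible_family_def
  proof (intro conjI ballI)
    show "countable (D ` X)" using X(1) by simp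
    show "DIM(real^'k) < DIM('n mink \<times> 'n mink)" using dim by simp
    fix E assume E: "E \<in> D ` X"
    then show "Cr_manifold Analytic (Sigma_of E)" "connected_space (mtop (Sigma_of E))" "Cr_embedding Analytic (Sigma_of E) euclid (l_of E)"
      using parts by auto
    fix E' assume E': "E' \<in> D ` X"
    show "admissible_pair (Sigma_of E) (Sigma_of E') (l_of E) (l_of E')"
      using E E' parts(3) Cr_manifold_pre[OF parts(1)] by (auto intro!: analytic_admissible_pair)
  qed
  show ?thesis
    unfolding admissible_front_def
    by (rule exI[of _ "D ` X"]) (use adm X(2,3) XD tM in auto)
qed

theorem theorem3p4:
  fixes r :: regularity
    and M :: "('a, real^'n::finite) atlas"
    and F :: "'a \<Rightarrow> 'n mink"
    and \<alpha> :: "'a \<Rightarrow> 'n dual"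
  assumes "CARD('n) \<ge> 2" and "CARD('k::finite) = CARD('n) - 1"
    and "Cr_manifold r M"
    and "null_wave_front r M F \<alpha>"
  shows "(r = Analytic \<longrightarrow> admissible_front TYPE('k) r M F \<alpha>) \<and>
    (admissible_front TYPE('k) r M F \<alpha> \<longrightarrow>
      (\<exists>(S :: ('a set, real^'k) atlas) (\<I> :: 'a \<Rightarrow> real \<times> 'a set)
         (F' :: real \<times> 'a set \<Rightarrow> 'n mink) (\<alpha>' :: real \<times> 'a set \<Rightarrow> 'n dual).
         Cr_manifold r S \<and>
         Cr_immersion r M (prod_atlas euclid S) \<I> \<and>
         null_wave_front r (prod_atlas euclid S) F' \<alpha>' \<and>
         L_complete r (prod_atlas euclid S) F' \<alpha>' \<and>
         normal_form r S F' \<alpha>' \<and>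
         (\<forall>q\<in>carrier M. F' (\<I> q) = F q \<and>
                         canonical_lift F' \<alpha>' (\<I> q) = canonical_lift F \<alpha> q) \<and>
         (Cr_embedding r M euclid (canonical_lift F \<alpha>) \<longrightarrow>
            openin (mtop (prod_atlas euclid S)) (\<I> ` carrier M) \<and>
            Cr_diffeo r M (restr (prod_atlas euclid S) (\<I> ` carrier M)) \<I>) \<and>
         (L_complete r M F \<alpha> \<longrightarrow> \<I> ` carrier M = carrier (prod_atlas euclid S))))"
  using admissible_front_quotient[OF assms(2-4)] analytic_front_admissible[OF assms(2)] assms(3,4) by blast

end
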